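(* Let $a_*,A_*,q_*$ be positive definite symmetric $d\times d$ matrices. For $\mathbf M=(\delta_0,a_*,A_*,q_* )$, $$\mathfrak Q(\mathbf M)=\lambda_{\max}(A_*^{-1/2}q_*A_*^{-1/2}).$$ For a heat-phase tuple $\mathbf M=(\lambda,a_*,A_*,q_* )$, $$\mathfrak Q(\mathbf M)=\max\Bigl\{\lambda_{\max}(A_*^{-1/2}q_*A_*^{-1/2}),\ \sup_{\zeta\in\operatorname{supp}\lambda}\Phi\bigl(\mathsf R(a_*,A_*,q_*;\zeta)\bigr)\Bigr\}.$$ In both cases, for $J=(c,B)$, $$k_\alpha(J;W_{\mathbf M},A_*,q_* )\le\mathfrak Q(\mathbf M)\qquad\text{for all }\alpha\ge0\text{ and all }0\le c<B<\infty,$$ and for $\alpha=0$ this bound also holds for every $-\infty<c<B<\infty$. Equality holds in this bound when $\lambda=\delta_0$. Moreover, for every $B\in\mathbb R$, $$\mathfrak Q(\mathbf M)=\sup_{v\in C_c^\infty((-\infty,B)\times\mathbb R^d)}\frac{\|\mathcal H_{q_*}v\|_{L^2(W_{\mathbf M})}}{\|P_{A_*}v\|_{L^2(W_{\mathbf M})}}.$$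
   Context: Conventions: vector norms are Euclidean, matrix norms Frobenius, $C:D=\operatorname{tr}(C^{\mathsf T}D)$, $0/0=0$, positive$/0=+\infty$; values lie in $[0,\infty]$. For constant symmetric positive definite $A,q$: $P_Au=-u_s-A:D^2u$, $\mathcal H_qu=q^{1/2}D^2u\,q^{1/2}$. Tuples. For a compactly supported probability measure $\lambda$ on $\mathbb R^d$ and $\mathbf M=(\lambda,a_*,A_*,q_* )$, set $W_{\mathbf M}(s,z)=\int_{\mathbb R^d}e^{2(s\zeta^{\mathsf T}a_*\zeta-\zeta\cdot z)}\,\lambda(d\zeta)$ for $(s,z)\in\mathbb R\times\mathbb R^d$. The tuple is flat if $\lambda=\delta_0$ (then $W_{\mathbf M}=1$), and a heat-phase tuple if $\operatorname{supp}\lambda\subset\{\zeta:m\le|\zeta|\le M\}$ for some $0<m\le M<\infty$. Define $$\mathfrak Q(\mathbf M)=\sup_{v\in C_c^\infty(\mathbb R\times\mathbb R^d)}\frac{\|\mathcal H_{q_*}v\|_{L^2(W_{\mathbf M})}}{\|P_{A_*}v\|_{L^2(W_{\mathbf M})}},$$ where $L^2(W_{\mathbf M})=L^2(\mathbb R\times\mathbb R^d,W_{\mathbf M}\,ds\,dz)$. Directional ratio: $\mathsf R(a,A,q;v)=\dfrac{v^{\mathsf T}(a-A)v}{v^{\mathsf T}qv}$ for $v\ne0$; $\Phi(c)=c^{-1}$ if $c>0$, $\Phi(c)=+\infty$ if $c\le0$. Interval constants. For a finite interval $J=(c,B)$ (with $c\ge0$ if $\alpha>0$) and a positive continuous weight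 $F$ on $(c,B]\times\mathbb R^d$: $\|f\|_{\alpha,J;F}^2=\int_J\int s^\alpha F|f|^2\,dz\,ds$ (for $\alpha=0$ the time factor is $1$), $\mathcal W_\alpha(J;F)$ is the space of $u$ with $u,u_s,Du,D^2u$ (distributional derivatives) of finite $\|\cdot\|_{\alpha,J;F}$ norm; such $u$ have an $H^1_{\mathrm{loc}}(\mathbb R^d)$ trace at $s=B$, and $\mathcal W_{\alpha,0}(J;F)$ is the subspace with zero trace at $B$ (no condition at $c$). $k_\alpha(J;F,A,q)=\sup_{u\in\mathcal W_{\alpha,0}(J;F)}\|\mathcal H_qu\|_{\alpha,J;F}/\|P_Au\|_{\alpha,J;F}$. *)

theory Defs
  imports "HOL-Probability.Probability"
begin

section \<open>Symmetric positive definite matrices\<close>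

definition sym_posdef :: "real^'n^'n \<Rightarrow> bool" where
  "sym_posdef M \<longleftrightarrow> transpose M = M \<and> (\<forall>x. x \<noteq> 0 \<longrightarrow> x \<bullet> (M *v x) > 0)"

text \<open>Only meaningful for positive definite \<open>M\<close>, where the square root exists and is unique.\<close>

definition mat_sqrt :: "real^'n^'n \<Rightarrow> real^'n^'n" where
  "mat_sqrt M = (THE R. sym_posdef R \<and> R ** R = M)"

text \<open>Applied to symmetric matrices only, where the set of real eigenvalues is finite and
  nonempty, so that the supremum is a maximum.\<close>

definition lambda_max :: "real^'n^'n \<Rightarrow> real" where
  "lambda_max M = Sup {l. \<exists>v. v \<noteq> 0 \<and> M *v v = l *\<^sub>R v}"

definition frob_inner :: "real^'n^'n \<Rightarrow> real^'n^'n \<Rightarrow> real" where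
  "frob_inner C D = trace (transpose C ** D)"

section \<open>Test functions\<close>

definition pd :: "'a::real_normed_vector \<Rightarrow> ('a \<Rightarrow> real) \<Rightarrow> 'a \<Rightarrow> real" where
  "pd b f x = frechet_derivative f (at x) b"

text \<open>\<open>C_diff k f\<close>: all iterated partial derivatives of \<open>f\<close> of order at most \<open>k\<close> exist and are
  continuous.\<close>

fun C_diff :: "nat \<Rightarrow> ('a::euclidean_space \<Rightarrow> real) \<Rightarrow> bool" where
  "C_diff 0 f \<longleftrightarrow> continuous_on UNIV f"
| "C_diff (Suc k) f \<longleftrightarrow> f differentiable_on UNIV \<and> (\<forall>b\<in>Basis. C_diff k (pd b f))"

definition Cc_infty :: "'a::euclidean_space set \<Rightarrow> ('a \<Rightarrow> real) set" where
  "Cc_infty U = {f. (\<forall>k. C_diff k f) \<and> compact (closure {x. f x \<noteq> 0}) \<and> closure {x. f x \<noteq> 0} \<subseteq> U}"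

section \<open>The operators, in terms of given derivatives\<close>

text \<open>Points of space-time are pairs \<open>(s, z)\<close>. The operators take the derivatives \<open>us\<close> (in time) and
  \<open>D2u\<close> (spatial Hessian) as arguments, so that they serve classical and distributional
  derivatives alike.\<close>

definition dir_s :: "real \<times> (real^'n)" where
  "dir_s = (1, 0)"

definition dir_z :: "'n \<Rightarrow> real \<times> (real^'n)" where
  "dir_z i = (0, axis i 1)"

definition P_op :: "real^'n^'n \<Rightarrow> ('x \<Rightarrow> real) \<Rightarrow> ('x \<Rightarrow> real^'n^'n) \<Rightarrow> 'x \<Rightarrow> real" where
  "P_op A us D2u x = - us x - frob_inner A (D2u x)"

definition H_op :: "real^'n^'n \<Rightarrow> ('x \<Rightarrow> real^'n^'n) \<Rightarrow> 'x \<Rightarrow> real^'n^'n" where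
  "H_op q D2u x = mat_sqrt q ** D2u x ** mat_sqrt q"

definition hess_z :: "(real \<times> (real^'n) \<Rightarrow> real) \<Rightarrow> real \<times> (real^'n) \<Rightarrow> real^'n^'n" where
  "hess_z v x = (\<chi> i j. pd (dir_z j) (pd (dir_z i) v) x)"

section \<open>Weighted norms\<close>

definition esqrt :: "ennreal \<Rightarrow> ennreal" where
  "esqrt x = (if x = \<top> then \<top> else ennreal (sqrt (enn2real x)))"

text \<open>The norm on \<open>real^'n\<close> is Euclidean and the one on \<open>real^'n^'n\<close> is the Frobenius norm.\<close>

definition wnorm :: "'a::euclidean_space set \<Rightarrow> ('a \<Rightarrow> real) \<Rightarrow> ('a \<Rightarrow> 'b::real_normed_vector) \<Rightarrow> ennreal"
  where "wnorm S F f = esqrt (\<integral>\<^sup>+x\<in>S. ennreal (F x * (norm (f x))\<^sup>2) \<partial>lborel)"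

section \<open>Tuples\<close>

definition msupp :: "'a::topological_space measure \<Rightarrow> 'a set" where
  "msupp lam = {x. \<forall>U. open U \<and> x \<in> U \<longrightarrow> emeasure lam U > 0}"

definition compactly_supported_prob :: "(real^'n) measure \<Rightarrow> bool" where
  "compactly_supported_prob lam \<longleftrightarrow> prob_space lam \<and> sets lam = sets borel \<and> compact (msupp lam)"

abbreviation dirac0 :: "(real^'n) measure" where
  "dirac0 \<equiv> return borel 0"

definition flat_measure :: "(real^'n) measure \<Rightarrow> bool" where
  "flat_measure lam \<longleftrightarrow> lam = dirac0"

definition heat_phase :: "(real^'n) measure \<Rightarrow> bool" where
  "heat_phase lam \<longleftrightarrow> compactly_supported_prob lam \<and>
     (\<exists>m M. 0 < m \<and> m \<le> M \<and> msupp lam \<subseteq> {\<zeta>. m \<le> norm \<zeta> \<and> norm \<zeta> \<le> M})"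

definition W_wt :: "(real^'n) measure \<Rightarrow> real^'n^'n \<Rightarrow> real \<times> (real^'n) \<Rightarrow> real" where
  "W_wt lam a = (\<lambda>(s, z). LINT \<zeta>|lam. exp (2 * (s * (\<zeta> \<bullet> (a *v \<zeta>)) - \<zeta> \<bullet> z)))"

text \<open>Division on \<open>ennreal\<close> satisfies \<open>0 / 0 = 0\<close> and \<open>x / 0 = \<top>\<close> for \<open>x > 0\<close>.\<close>

definition Q_on :: "(real \<times> (real^'n)) set \<Rightarrow> (real^'n) measure \<Rightarrow> real^'n^'n \<Rightarrow> real^'n^'n \<Rightarrow> real^'n^'n \<Rightarrow> ennreal"
  where "Q_on U lam a A q =
    (SUP v\<in>Cc_infty U. wnorm UNIV (W_wt lam a) (H_op q (hess_z v)) /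
                        wnorm UNIV (W_wt lam a) (P_op A (pd dir_s v) (hess_z v)))"

definition Q_const :: "(real^'n) measure \<Rightarrow> real^'n^'n \<Rightarrow> real^'n^'n \<Rightarrow> real^'n^'n \<Rightarrow> ennreal" where
  "Q_const lam a A q = Q_on UNIV lam a A q"

definition dir_ratio :: "real^'n^'n \<Rightarrow> real^'n^'n \<Rightarrow> real^'n^'n \<Rightarrow> real^'n \<Rightarrow> real" where
  "dir_ratio a A q v = (v \<bullet> ((a - A) *v v)) / (v \<bullet> (q *v v))"

definition Phi :: "real \<Rightarrow> ennreal" where
  "Phi c = (if c > 0 then ennreal (inverse c) else \<top>)"

section \<open>Distributional derivatives and interval constants\<close>

definition locally_integrable :: "'a::euclidean_space set \<Rightarrow> ('a \<Rightarrow> real) \<Rightarrow> bool" where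
  "locally_integrable U f \<longleftrightarrow> (\<forall>K. compact K \<and> K \<subseteq> U \<longrightarrow> set_integrable lborel K f)"

definition has_weak_deriv ::
  "'a::euclidean_space set \<Rightarrow> ('a \<Rightarrow> real) \<Rightarrow> 'a \<Rightarrow> ('a \<Rightarrow> real) \<Rightarrow> bool" where
  "has_weak_deriv U u b w \<longleftrightarrow> locally_integrable U u \<and> locally_integrable U w \<and>
     (\<forall>\<phi>\<in>Cc_infty U. (LINT x:U|lborel. u x * pd b \<phi> x) = - (LINT x:U|lborel. w x * \<phi> x))"

definition slab :: "real \<Rightarrow> real \<Rightarrow> (real \<times> (real^'n)) set" where
  "slab c B = {c<..<B} \<times> UNIV"

text \<open>Functions stand for Borel representatives of their classes modulo null sets; the
  distributional derivatives are determined by \<open>u\<close> almost everywhere.\<close>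

definition weak_derivs :: "real \<Rightarrow> real \<Rightarrow> (real \<times> (real^'n) \<Rightarrow> real) \<Rightarrow> (real \<times> (real^'n) \<Rightarrow> real) \<Rightarrow>
    (real \<times> (real^'n) \<Rightarrow> real^'n) \<Rightarrow> (real \<times> (real^'n) \<Rightarrow> real^'n^'n) \<Rightarrow> bool" where
  "weak_derivs c B u us Du D2u \<longleftrightarrow>
     has_weak_deriv (slab c B) u dir_s us \<and>
     (\<forall>i. has_weak_deriv (slab c B) u (dir_z i) (\<lambda>x. Du x $ i)) \<and>
     (\<forall>i j. has_weak_deriv (slab c B) (\<lambda>x. Du x $ i) (dir_z j) (\<lambda>x. D2u x $ i $ j))"

text \<open>The case distinction is needed since \<open>0 powr 0 = 0\<close>; moreover \<open>s\<close> may be negative when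
  \<open>\<alpha> = 0\<close>.\<close>

definition time_factor :: "real \<Rightarrow> real \<Rightarrow> real" where
  "time_factor \<alpha> s = (if \<alpha> = 0 then 1 else s powr \<alpha>)"

definition inorm :: "real \<Rightarrow> real \<Rightarrow> real \<Rightarrow> (real \<times> (real^'n) \<Rightarrow> real) \<Rightarrow>
    (real \<times> (real^'n) \<Rightarrow> 'b::real_normed_vector) \<Rightarrow> ennreal" where
  "inorm \<alpha> c B F f = wnorm (slab c B) (\<lambda>(s, z). time_factor \<alpha> s * F (s, z)) f"

definition W_space :: "real \<Rightarrow> real \<Rightarrow> real \<Rightarrow> (real \<times> (real^'n) \<Rightarrow> real) \<Rightarrow> (real \<times> (real^'n) \<Rightarrow> real) set" where
  "W_space \<alpha> c B F = {u. \<exists>us Du D2u. weak_derivs c B u us Du D2u \<and>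
     inorm \<alpha> c B F u < \<top> \<and> inorm \<alpha> c B F us < \<top> \<and>
     inorm \<alpha> c B F Du < \<top> \<and> inorm \<alpha> c B F D2u < \<top>}"

text \<open>The trace at \<open>s = B\<close> is the limit of the time slices \<open>u(s, \<sqdot>)\<close> in \<open>H\<^sup>1\<^sub>l\<^sub>o\<^sub>c\<close> as \<open>s\<close> increases to
  \<open>B\<close>. Since \<open>u\<close> and \<open>Du\<close> are only determined almost everywhere, a null set \<open>N\<close> of times is
  disregarded. \<open>Dg\<close> is the gradient of the trace \<open>g\<close>.\<close>

definition has_trace_at :: "real \<Rightarrow> real \<Rightarrow> (real \<times> (real^'n) \<Rightarrow> real) \<Rightarrow> (real \<times> (real^'n) \<Rightarrow> real^'n) \<Rightarrow>
    (real^'n \<Rightarrow> real) \<Rightarrow> (real^'n \<Rightarrow> real^'n) \<Rightarrow> bool" where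
  "has_trace_at c B u Du g Dg \<longleftrightarrow>
     (\<forall>i. has_weak_deriv UNIV g (axis i 1) (\<lambda>z. Dg z $ i)) \<and>
     (\<forall>K. compact K \<longrightarrow> wnorm K (\<lambda>_. 1) g < \<top> \<and> wnorm K (\<lambda>_. 1) Dg < \<top>) \<and>
     (\<exists>N\<in>null_sets lborel. \<forall>K. compact K \<longrightarrow>
        ((\<lambda>s. wnorm K (\<lambda>_. 1) (\<lambda>z. u (s, z) - g z) + wnorm K (\<lambda>_. 1) (\<lambda>z. Du (s, z) - Dg z))
           \<longlongrightarrow> 0) (at B within ({c<..<B} - N)))"

definition W0_space :: "real \<Rightarrow> real \<Rightarrow> real \<Rightarrow> (real \<times> (real^'n) \<Rightarrow> real) \<Rightarrow> (real \<times> (real^'n) \<Rightarrow> real) set" where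
  "W0_space \<alpha> c B F = {u \<in> W_space \<alpha> c B F.
     \<exists>us Du D2u. weak_derivs c B u us Du D2u \<and> has_trace_at c B u Du (\<lambda>_. 0) (\<lambda>_. 0)}"

definition k_const :: "real \<Rightarrow> real \<Rightarrow> real \<Rightarrow> (real \<times> (real^'n) \<Rightarrow> real) \<Rightarrow> real^'n^'n \<Rightarrow> real^'n^'n \<Rightarrow> ennreal" where
  "k_const \<alpha> c B F A q =
     Sup {inorm \<alpha> c B F (H_op q D2u) / inorm \<alpha> c B F (P_op A us D2u) | u us Du D2u.
            u \<in> W0_space \<alpha> c B F \<and> weak_derivs c B u us Du D2u}"

end

theory Submission
  imports Defs "HOL-Computational_Algebra.Polynomial"
begin

text \<open>
  The weight \<open>W\<close> is a mixture of the exponentials \<open>exp (2 (s k - \<zeta> \<sqdot> z))\<close> with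
  \<open>k = \<zeta>\<^sup>T a \<zeta>\<close>. All constants are at most \<open>K\<close> if and only if \<open>q \<le> K A\<close> and
  \<open>\<zeta>\<^sup>T q \<zeta> \<le> K \<zeta>\<^sup>T (a - A) \<zeta>\<close> on the support.

  Sufficiency is proved for one exponential at a time. Conjugation by \<open>exp (s k - \<zeta> \<sqdot> z)\<close> turns
  the operators into polynomials in the commuting skew-adjoint spatial derivatives and the time
  derivative, whose symmetric part has a favourable sign because the weight in time is nondecreasing
  and the final trace vanishes. The energy identity then reduces the estimate to the nonnegativity
  of tensor products of positive semidefinite forms. Functions of finite norm are first extended by
  zero past the final time and mollified with a kernel looking only at later times.

  For necessity, translating test functions by \<open>(-T, -2 T a \<zeta>)\<close> with \<open>T\<close> large concentrates \<open>W\<close>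
  at the frequency \<open>\<zeta>\<close> of the support, by Laplace's method, and keeps the tests in the past. Wide
  wave packets of frequency \<open>\<xi>\<close> then yield
  \<open>\<zeta>\<^sup>T q \<zeta> + \<xi>\<^sup>T q \<xi> \<le> K |\<zeta>\<^sup>T (a - A) \<zeta> + \<xi>\<^sup>T A \<xi>|\<close> for all \<open>\<xi>\<close>. In the flat case the
  packets have high frequency instead, so that they fit into any time interval.
\<close>

section \<open>Linear algebra: quadratic forms, square roots and Frobenius norms\<close>

section \<open>Symmetric matrices\<close>

text \<open>Every equality is obtained by comparing upper bounds: y bounds the constant in question
  iff the algebraic condition \<open>freq_bound\<close> holds for y. Its two clauses have different
  origins. Letting the packet frequency \<xi> tend to infinity isolates q \<le> K A. If \<zeta> . (a
  - A) \<zeta> were \<le> 0, some multiple \<xi> of \<zeta> would annihilate the right-hand symbol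
  while the left one stays positive; this is where \<open>Phi\<close> becomes infinite. Otherwise
  \<xi> = 0 gives the quotient. In the upper bound the clauses say that K times the conjugated
  elliptic operator exceeds the conjugated q-operator by a nonnegative operator commuting with it,
  so that norms can be compared.

  Two obstacles shape the upper bound. Nothing is known at the initial time c, so the time weight is
  cut off there by a nondecreasing factor, which Fatou's lemma removes at the end. And functions of
  finite norm are too rough for the repeated integrations by parts; the algebra is therefore run on
  mollification kernels, to which all derivatives are transferred, and is stated for an abstract
  bilinear form.\<close>

lemma inner_matrix_vector:
  fixes M :: "real^'n^'m"
  shows "x \<bullet> (M *v y) = (\<Sum>i\<in>UNIV. \<Sum>j\<in>UNIV. x $ i * M $ i $ j * y $ j)"
  by (simp add: inner_vec_def matrix_vector_mult_def sum_distrib_left mult.assoc)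

lemma symmetric_inner_swap:
  fixes M :: "real^'n^'n"
  assumes "transpose M = M"
  shows "x \<bullet> (M *v y) = (M *v x) \<bullet> y"
  by (metis assms dot_lmul_matrix transpose_matrix_vector)

text \<open>First variation: the residual \<open>y\<close> of the eigenvalue equation lies in
  \<open>S\<close> by invariance, and along \<open>v + t y\<close> the quadratic form exceeds l
  times the squared norm by 2 t |y|^2 to first order. Maximality forbids this for small t > 0 unless
  y = 0.\<close>

lemma maximizer_is_eigenvector:
  fixes M :: "real^'n^'n"
  assumes sym: "transpose M = M" and S: "subspace S" and inv: "\<And>x. x \<in> S \<Longrightarrow> M *v x \<in> S"
    and v: "v \<in> S" "norm v = 1"
    and max: "\<And>x. x \<in> S \<Longrightarrow> norm x = 1 \<Longrightarrow> x \<bullet> (M *v x) \<le> v \<bullet> (M *v v)"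
  shows "M *v v = (v \<bullet> (M *v v)) *\<^sub>R v"
proof -
  define l where "l = v \<bullet> (M *v v)"
  have ray: "x \<bullet> (M *v x) \<le> l * (x \<bullet> x)" if "x \<in> S" for x
  proof (cases "x = 0")
    case False
    let ?y = "(1 / norm x) *\<^sub>R x"
    have "?y \<in> S" using S that by (simp add: subspace_mul)
    moreover have "norm ?y = 1" using False by simp
    ultimately have "?y \<bullet> (M *v ?y) \<le> l" unfolding l_def by (rule max)
    moreover have "?y \<bullet> (M *v ?y) = (x \<bullet> (M *v x)) / (norm x)^2"
      by (simp add: matrix_vector_mult_scaleR power2_eq_square)
    ultimately have "(x \<bullet> (M *v x)) / (norm x)^2 \<le> l" by metis
    then show ?thesis using False by (simp add: pos_divide_le_eq power2_norm_eq_inner)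
  qed simp
  define y where "y = M *v v - l *\<^sub>R v"
  have yS: "y \<in> S" unfolding y_def using S v inv by (simp add: subspace_diff subspace_mul)
  have vv: "v \<bullet> v = 1" using v by (simp add: norm_eq_1)
  have yv: "y \<bullet> v = 0" unfolding y_def l_def
    by (simp add: inner_diff_left vv) (simp add: inner_commute)
  have yy: "y \<bullet> y = y \<bullet> (M *v v)"
    using yv unfolding y_def by (simp add: inner_diff_right)
  have key: "2 * t * (y \<bullet> y) \<le> t^2 * (l * (y \<bullet> y) - y \<bullet> (M *v y))" for t :: real
  proof -
    have "v + t *\<^sub>R y \<in> S" using S v yS by (simp add: subspace_add subspace_mul)
    from ray[OF this]
    have "v \<bullet> (M *v v) + t * (v \<bullet> (M *v y)) + t * (y \<bullet> (M *v v)) + t^2 * (y \<bullet> (M *v y))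
        \<le> l * (1 + t^2 * (y \<bullet> y))"
      using yv vv
      by (simp add: matrix_vector_right_distrib matrix_vector_mult_scaleR inner_add_left inner_add_right
          inner_commute power2_eq_square algebra_simps)
    moreover have "v \<bullet> (M *v y) = y \<bullet> y"
      using symmetric_inner_swap[OF sym, of v y] yy by (simp add: inner_commute)
    ultimately show ?thesis using yy by (simp add: l_def[symmetric] algebra_simps)
  qed
  define C where "C = \<bar>l * (y \<bullet> y) - y \<bullet> (M *v y)\<bar>"
  have "y \<bullet> y \<le> 0"
  proof (rule ccontr)
    assume "\<not> y \<bullet> y \<le> 0"
    then have pos: "y \<bullet> y > 0" by linarith
    \<comment> \<open>Small enough that t C \<le> y . y, against the inequality 2 (y . y) \<le> t C;
      the 1 avoids a division by zero.\<close>
    define t where "t = (y \<bullet> y) / (C + 1)"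
    have C: "C \<ge> 0" by (simp add: C_def)
    have t: "t > 0" using pos C by (simp add: t_def)
    have "2 * t * (y \<bullet> y) \<le> t^2 * C"
      using key[of t] by (smt (verit) C_def mult_left_mono zero_le_power2)
    then have "2 * (y \<bullet> y) \<le> t * C" using t by (simp add: power2_eq_square)
    also have "\<dots> \<le> t * (C + 1)" using t by simp
    also have "\<dots> = y \<bullet> y" using C by (simp add: t_def)
    finally show False using pos by simp
  qed
  then have "y = 0" by (metis inner_gt_zero_iff not_le)
  then show ?thesis by (simp add: y_def l_def)
qed

definition orthonormal_eigenvectors :: "real^'n^'n \<Rightarrow> (real^'n) set \<Rightarrow> (real^'n \<Rightarrow> real) \<Rightarrow> bool" where
  "orthonormal_eigenvectors M E l \<longleftrightarrow>
     pairwise orthogonal E \<and> (\<forall>b\<in>E. norm b = 1 \<and> M *v b = l b *\<^sub>R b)"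

lemma orthonormal_eigenvectors_finite:
  fixes M :: "real^'n^'n"
  assumes "orthonormal_eigenvectors M E l"
  shows "finite E" "card E \<le> DIM(real^'n)"
proof -
  have "independent E"
    by (rule pairwise_orthogonal_independent)
       (use assms in \<open>auto simp: orthonormal_eigenvectors_def\<close>)
  then show "finite E" "card E \<le> DIM(real^'n)" using independent_bound by blast+
qed

text \<open>An orthonormal set of eigenvectors has at most as many elements as the dimension, so one
  of maximal size exists. Its orthogonal complement is invariant by symmetry; if it were not zero, a
  maximizer of the quadratic form on its unit sphere would be one more eigenvector.\<close>

lemma spectral_theorem:
  fixes M :: "real^'n^'n"
  assumes sym: "transpose M = M"
  obtains E l where "finite E" "orthonormal_eigenvectors M E l" "span E = UNIV"
proof -
  define \<C> where "\<C> = {E. \<exists>l. orthonormal_eigenvectors M E l}"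
  have "{} \<in> \<C>" by (auto simp: \<C>_def orthonormal_eigenvectors_def)
  moreover have "\<forall>E. E \<in> \<C> \<longrightarrow> card E < DIM(real^'n) + 1"
    using orthonormal_eigenvectors_finite(2) by (fastforce simp: \<C>_def)
  ultimately obtain E where E: "E \<in> \<C>" and Emax: "\<And>E'. E' \<in> \<C> \<Longrightarrow> card E' \<le> card E"
    using ex_has_greatest_nat[of "\<lambda>E. E \<in> \<C>" "{}" card "DIM(real^'n) + 1"] by auto
  then obtain l where l: "orthonormal_eigenvectors M E l" by (auto simp: \<C>_def)
  have fin: "finite E" using l by (rule orthonormal_eigenvectors_finite)
  define S where "S = {x. \<forall>b\<in>E. b \<bullet> x = 0}"
  have S: "subspace S" unfolding S_def subspace_def by (auto simp: inner_add_right)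
  have inv: "M *v x \<in> S" if "x \<in> S" for x
  proof -
    have "b \<bullet> (M *v x) = 0" if "b \<in> E" for b
      using symmetric_inner_swap[OF sym, of b x] l that \<open>x \<in> S\<close>
      by (auto simp: orthonormal_eigenvectors_def S_def)
    then show ?thesis by (auto simp: S_def)
  qed
  have "S \<subseteq> {0}"
  proof (rule ccontr)
    assume "\<not> S \<subseteq> {0}"
    then obtain x where x: "x \<in> S" "x \<noteq> 0" by auto
    let ?K = "S \<inter> sphere 0 1"
    have K: "compact ?K" using closed_subspace[OF S] by (simp add: closed_Int_compact)
    have "(1 / norm x) *\<^sub>R x \<in> ?K" using x S by (simp add: subspace_mul)
    then have ne: "?K \<noteq> {}" by blast
    have cont: "continuous_on ?K (\<lambda>x. x \<bullet> (M *v x))"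
      by (intro continuous_intros linear_continuous_on) (simp add: matrix_vector_mul_bounded_linear)
    obtain v where v: "v \<in> ?K" "\<And>y. y \<in> ?K \<Longrightarrow> y \<bullet> (M *v y) \<le> v \<bullet> (M *v v)"
      using continuous_attains_sup[OF K ne cont] by blast
    have ev: "M *v v = (v \<bullet> (M *v v)) *\<^sub>R v"
      by (rule maximizer_is_eigenvector[OF sym S inv]) (use v in auto)
    have notin: "v \<notin> E" using v by (auto simp: S_def norm_eq_1)
    let ?l = "l(v := v \<bullet> (M *v v))"
    have "orthonormal_eigenvectors M (insert v E) ?l"
      using l v ev notin
      by (auto simp: orthonormal_eigenvectors_def pairwise_insert S_def orthogonal_def inner_commute)
    then have "insert v E \<in> \<C>" by (auto simp: \<C>_def)
    from Emax[OF this] show False using notin fin by simp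
  qed
  moreover have "\<exists>y \<in> span E. \<forall>b\<in>E. b \<bullet> (x - y) = 0" for x
  proof (intro bexI ballI)
    let ?y = "\<Sum>b\<in>E. (b \<bullet> x) *\<^sub>R b"
    show "?y \<in> span E" by (simp add: span_base span_mul span_sum)
    fix b assume b: "b \<in> E"
    have "b \<bullet> ?y = (\<Sum>b'\<in>E. if b' = b then b \<bullet> x else 0)"
      unfolding inner_sum_right
    proof (rule sum.cong[OF refl])
      fix b' assume "b' \<in> E"
      then show "b \<bullet> (b' \<bullet> x) *\<^sub>R b' = (if b' = b then b \<bullet> x else 0)"
        using l b by (auto simp: orthonormal_eigenvectors_def norm_eq_1 pairwise_def orthogonal_def)
    qed
    then show "b \<bullet> (x - ?y) = 0" using b fin by (simp add: inner_diff_right)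
  qed
  ultimately have "span E = UNIV" by (fastforce simp: S_def)
  with l fin that show thesis by blast
qed

lemma orthonormal_eigenvectors_expand:
  fixes M :: "real^'n^'n"
  assumes "finite E" "orthonormal_eigenvectors M E l" "span E = UNIV"
  shows "x = (\<Sum>b\<in>E. (x \<bullet> b) *\<^sub>R b)"
    and "M *v x = (\<Sum>b\<in>E. (l b * (x \<bullet> b)) *\<^sub>R b)"
    and "x \<bullet> x = (\<Sum>b\<in>E. (x \<bullet> b)\<^sup>2)"
    and "x \<bullet> (M *v x) = (\<Sum>b\<in>E. l b * (x \<bullet> b)\<^sup>2)"
    and "M $ i $ j = (\<Sum>b\<in>E. l b * b $ i * b $ j)"
proof -
  have e: "x = (\<Sum>b\<in>E. (x \<bullet> b) *\<^sub>R b)" for x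
    by (rule orthonormal_basis_expand[symmetric])
       (use assms in \<open>auto simp: orthonormal_eigenvectors_def\<close>)
  have m: "M *v x = (\<Sum>b\<in>E. (l b * (x \<bullet> b)) *\<^sub>R b)" for x
  proof -
    have "M *v x = M *v (\<Sum>b\<in>E. (x \<bullet> b) *\<^sub>R b)" using e by simp
    also have "\<dots> = (\<Sum>b\<in>E. (x \<bullet> b) *\<^sub>R (M *v b))"
      by (simp add: matrix_vector_mult_scaleR linear_sum[OF matrix_vector_mul_linear])
    also have "\<dots> = (\<Sum>b\<in>E. (l b * (x \<bullet> b)) *\<^sub>R b)"
      by (rule sum.cong) (use assms in \<open>auto simp: orthonormal_eigenvectors_def\<close>)
    finally show ?thesis .
  qed
  show "x = (\<Sum>b\<in>E. (x \<bullet> b) *\<^sub>R b)" by (rule e)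
  show "M *v x = (\<Sum>b\<in>E. (l b * (x \<bullet> b)) *\<^sub>R b)" by (rule m)
  have "x \<bullet> x = x \<bullet> (\<Sum>b\<in>E. (x \<bullet> b) *\<^sub>R b)" using e[of x] by simp
  then show "x \<bullet> x = (\<Sum>b\<in>E. (x \<bullet> b)\<^sup>2)" by (simp add: inner_sum_right power2_eq_square)
  show "x \<bullet> (M *v x) = (\<Sum>b\<in>E. l b * (x \<bullet> b)\<^sup>2)"
    by (simp add: m inner_sum_right power2_eq_square mult.assoc)
  have "M $ i $ j = (M *v axis j 1) $ i"
    by (simp add: matrix_vector_mult_basis column_def)
  also have "\<dots> = (\<Sum>b\<in>E. l b * b $ i * b $ j)"
    by (subst m) (simp add: inner_axis' mult_ac)
  finally show "M $ i $ j = (\<Sum>b\<in>E. l b * b $ i * b $ j)" .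
qed

lemma orthonormal_basis_matrix_eqI:
  fixes M N :: "real^'n^'n"
  assumes "span E = UNIV" "\<And>b. b \<in> E \<Longrightarrow> M *v b = N *v b"
  shows "M = N"
proof -
  have "(\<lambda>x. M *v x) x = (\<lambda>x. N *v x) x" for x
    by (rule linear_eq_on[of _ _ _ E]) (use assms in auto)
  then show ?thesis by (simp add: matrix_eq)
qed

section \<open>The square root of a positive definite matrix\<close>

text \<open>On an eigenvector b of \<open>M\<close> with eigenvalue m^2, m > 0, the vector (R + m)(R
  - m) b vanishes, and R + m is injective by positivity. So every positive definite root acts on b
  as m, and the eigenvectors span.\<close>

lemma sym_posdef_sqrt_unique:
  fixes M :: "real^'n^'n"
  assumes M: "sym_posdef M" and R: "sym_posdef R" "R ** R = M" and S: "sym_posdef S" "S ** S = M"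
  shows "R = S"
proof -
  obtain E l where E: "finite E" "orthonormal_eigenvectors M E l" "span E = UNIV"
    using M spectral_theorem[of M] by (auto simp: sym_posdef_def)
  have eig: "R *v b = sqrt (l b) *\<^sub>R b" if "b \<in> E" "sym_posdef R" "R ** R = M" for b R
  proof -
    have b: "b \<noteq> 0" "b \<bullet> b = 1" "M *v b = l b *\<^sub>R b"
      using E that by (auto simp: orthonormal_eigenvectors_def norm_eq_1)
    have "b \<bullet> (M *v b) > 0" using M b by (auto simp: sym_posdef_def)
    then have lpos: "l b > 0" using b by simp
    define m where "m = sqrt (l b)"
    have m: "m > 0" "m * m = l b" using lpos by (auto simp: m_def)
    define y where "y = R *v b - m *\<^sub>R b"
    have "R *v y + m *\<^sub>R y = R *v (R *v b) - (m * m) *\<^sub>R b"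
      by (simp add: y_def matrix_vector_mult_diff_distrib matrix_vector_mult_scaleR algebra_simps)
    also have "R *v (R *v b) = M *v b" using that by (simp add: matrix_vector_mul_assoc)
    finally have 0: "R *v y + m *\<^sub>R y = 0" using m b by simp
    have "y = 0"
    proof (rule ccontr)
      assume y: "y \<noteq> 0"
      then have "y \<bullet> (R *v y) + m * (y \<bullet> y) > 0"
        using that m by (simp add: sym_posdef_def add_pos_pos)
      moreover have "y \<bullet> (R *v y) + m * (y \<bullet> y) = y \<bullet> (R *v y + m *\<^sub>R y)"
        by (simp add: inner_add_right)
      ultimately show False using 0 by simp
    qed
    then show ?thesis by (simp add: y_def m_def)
  qed
  show ?thesis
    by (rule orthonormal_basis_matrix_eqI[OF E(3)]) (use eig R S in auto)
qed

lemma sym_posdef_sqrt_exists: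
  fixes M :: "real^'n^'n"
  assumes M: "sym_posdef M"
  shows "\<exists>R. sym_posdef R \<and> R ** R = M"
proof -
  obtain E l where E: "finite E" "orthonormal_eigenvectors M E l" "span E = UNIV"
    using M spectral_theorem[of M] by (auto simp: sym_posdef_def)
  have lpos: "l b > 0" if "b \<in> E" for b
  proof -
    have b: "b \<noteq> 0" "b \<bullet> b = 1" "M *v b = l b *\<^sub>R b"
      using E that by (auto simp: orthonormal_eigenvectors_def norm_eq_1)
    have "b \<bullet> (M *v b) > 0" using M b by (auto simp: sym_posdef_def)
    then show ?thesis using b by simp
  qed
  define R :: "real^'n^'n" where "R = (\<chi> i j. \<Sum>b\<in>E. sqrt (l b) * b $ i * b $ j)"
  have Rx: "R *v x = (\<Sum>b\<in>E. (sqrt (l b) * (x \<bullet> b)) *\<^sub>R b)" for x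
  proof (rule vec_eq_iff[THEN iffD2], rule allI)
    fix i
    have "(R *v x) $ i = (\<Sum>j\<in>UNIV. \<Sum>b\<in>E. sqrt (l b) * b $ i * b $ j * x $ j)"
      by (simp add: R_def matrix_vector_mult_def sum_distrib_right)
    also have "\<dots> = (\<Sum>b\<in>E. \<Sum>j\<in>UNIV. sqrt (l b) * b $ i * b $ j * x $ j)" by (rule sum.swap)
    also have "\<dots> = (\<Sum>b\<in>E. (sqrt (l b) * (x \<bullet> b)) *\<^sub>R b) $ i"
      by (simp add: inner_vec_def sum_distrib_left sum_distrib_right mult_ac)
    finally show "(R *v x) $ i = (\<Sum>b\<in>E. (sqrt (l b) * (x \<bullet> b)) *\<^sub>R b) $ i" .
  qed
  have Rb: "R *v b = sqrt (l b) *\<^sub>R b" if "b \<in> E" for b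
  proof -
    have "R *v b = (\<Sum>c\<in>E. if c = b then sqrt (l b) *\<^sub>R b else 0)"
      unfolding Rx
      by (rule sum.cong) (use E that in
          \<open>auto simp: orthonormal_eigenvectors_def norm_eq_1 pairwise_def orthogonal_def\<close>)
    then show ?thesis using that E by simp
  qed
  have "R ** R = M"
  proof (rule orthonormal_basis_matrix_eqI[OF E(3)])
    fix b assume b: "b \<in> E"
    have "(R ** R) *v b = R *v (R *v b)" by (simp add: matrix_vector_mul_assoc)
    also have "\<dots> = (sqrt (l b) * sqrt (l b)) *\<^sub>R b"
      by (simp add: Rb[OF b] matrix_vector_mult_scaleR)
    also have "\<dots> = M *v b"
      using E b lpos[OF b] by (simp add: orthonormal_eigenvectors_def)
    finally show "(R ** R) *v b = M *v b" .
  qed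
  moreover have "transpose R = R" by (simp add: R_def transpose_def vec_eq_iff mult_ac)
  moreover have "x \<bullet> (R *v x) > 0" if "x \<noteq> 0" for x
  proof -
    have xR: "x \<bullet> (R *v x) = (\<Sum>b\<in>E. sqrt (l b) * (x \<bullet> b)\<^sup>2)"
      by (simp add: Rx inner_sum_right power2_eq_square mult.assoc)
    have nn: "0 \<le> sqrt (l b) * (x \<bullet> b)\<^sup>2" if "b \<in> E" for b using lpos[OF that] by simp
    have "x \<bullet> (R *v x) \<noteq> 0"
    proof
      assume "x \<bullet> (R *v x) = 0"
      then have "\<forall>b\<in>E. sqrt (l b) * (x \<bullet> b)\<^sup>2 = 0"
        using sum_nonneg_eq_0_iff[OF E(1) nn] xR by auto
      then have "\<forall>b\<in>E. x \<bullet> b = 0" using lpos by (metis less_irrefl mult_eq_0_iff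
            power_eq_0_iff real_sqrt_eq_zero_cancel_iff)
      then show False using orthonormal_eigenvectors_expand(1)[OF E, of x] that by simp
    qed
    moreover have "x \<bullet> (R *v x) \<ge> 0" unfolding xR by (rule sum_nonneg) (use nn in auto)
    ultimately show ?thesis by simp
  qed
  ultimately show ?thesis by (auto simp: sym_posdef_def)
qed

lemma mat_sqrt:
  fixes M :: "real^'n^'n"
  assumes "sym_posdef M"
  shows "sym_posdef (mat_sqrt M)" "mat_sqrt M ** mat_sqrt M = M"
proof -
  have "\<exists>!R. sym_posdef R \<and> R ** R = M"
    using sym_posdef_sqrt_exists[OF assms] sym_posdef_sqrt_unique[OF assms] by blast
  from theI'[OF this] show "sym_posdef (mat_sqrt M)" "mat_sqrt M ** mat_sqrt M = M"
    by (auto simp: mat_sqrt_def)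
qed

lemma sym_posdef_inverse:
  fixes M :: "real^'n^'n"
  assumes "sym_posdef M"
  shows "M ** matrix_inv M = mat 1" "matrix_inv M ** M = mat 1"
    "transpose (matrix_inv M) = matrix_inv M"
proof -
  have "M *v x = 0 \<longrightarrow> x = 0" for x
    using assms by (metis inner_zero_right less_irrefl sym_posdef_def)
  then have "invertible M"
    using matrix_left_invertible_ker[of M] invertible_left_inverse[of M] by auto
  then show 1: "M ** matrix_inv M = mat 1" and 2: "matrix_inv M ** M = mat 1"
    unfolding invertible_def matrix_inv_def by (metis (mono_tags, lifting) someI_ex)+
  have "transpose (matrix_inv M) ** M = mat 1"
    using 1 assms by (metis matrix_transpose_mul sym_posdef_def transpose_mat)
  then show "transpose (matrix_inv M) = matrix_inv M"
    by (metis 1 matrix_mul_assoc matrix_mul_lid matrix_mul_rid)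
qed

text \<open>The substitution y = A^(1/2) x turns the Rayleigh quotient of the sandwiched matrix into
  the quotient of the forms of \<open>q\<close> and \<open>A\<close>. This removes square roots and
  inverses from everything that follows.\<close>

lemma lambda_max_le_iff:
  fixes A q :: "real^'n^'n"
  assumes A: "sym_posdef A" and q: "sym_posdef q"
  shows "lambda_max (matrix_inv (mat_sqrt A) ** q ** matrix_inv (mat_sqrt A)) \<le> K \<longleftrightarrow>
    (\<forall>x. x \<bullet> (q *v x) \<le> K * (x \<bullet> (A *v x)))"
proof -
  define R where "R = mat_sqrt A"
  define I where "I = matrix_inv R"
  define N where "N = I ** q ** I"
  have R: "sym_posdef R" "R ** R = A" using mat_sqrt[OF A] by (auto simp: R_def)
  have I: "R ** I = mat 1" "I ** R = mat 1" "transpose I = I"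
    using sym_posdef_inverse[OF R(1)] by (auto simp: I_def)
  have Rs: "transpose R = R" using R by (simp add: sym_posdef_def)
  have symN: "transpose N = N"
    using q I by (simp add: N_def matrix_transpose_mul sym_posdef_def matrix_mul_assoc)
  obtain E l where E: "finite E" "orthonormal_eigenvectors N E l" "span E = UNIV"
    using symN spectral_theorem[of N] by auto
  have eigs: "{m. \<exists>v. v \<noteq> 0 \<and> N *v v = m *\<^sub>R v} = l ` E"
  proof safe
    fix m and v :: "real^'n" assume v: "v \<noteq> 0" "N *v v = m *\<^sub>R v"
    obtain b where b: "b \<in> E" "v \<bullet> b \<noteq> 0"
      using orthonormal_eigenvectors_expand(1)[OF E, of v] v
      by (metis (no_types, lifting) scale_eq_0_iff sum.neutral)
    have "m * (v \<bullet> b) = (N *v v) \<bullet> b" using v by simp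
    also have "\<dots> = v \<bullet> (N *v b)" using symmetric_inner_swap[OF symN] by simp
    also have "\<dots> = l b * (v \<bullet> b)" using E b by (simp add: orthonormal_eigenvectors_def)
    finally show "m \<in> l ` E" using b by auto
  next
    fix b assume "b \<in> E"
    then show "\<exists>v. v \<noteq> 0 \<and> N *v v = l b *\<^sub>R v"
      using E by (intro exI[of _ b]) (auto simp: orthonormal_eigenvectors_def)
  qed
  \<comment> \<open>Makes the supremum in \<open>lambda_max\<close> a maximum; it holds because the
    index type is nonempty, so the space is not {0}.\<close>
  have "E \<noteq> {}"
  proof
    assume "E = {}"
    then have "(UNIV :: (real^'n) set) = {0}" using E by simp
    then show False by (metis UNIV_I singletonD axis_eq_0_iff zero_neq_one)
  qed
  then have 1: "lambda_max N \<le> K \<longleftrightarrow> (\<forall>b\<in>E. l b \<le> K)"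
    unfolding lambda_max_def eigs using E(1) by (simp add: cSup_eq_Max)
  have 2: "(\<forall>b\<in>E. l b \<le> K) \<longleftrightarrow> (\<forall>y. y \<bullet> (N *v y) \<le> K * (y \<bullet> y))"
  proof safe
    fix y assume "\<forall>b\<in>E. l b \<le> K"
    then show "y \<bullet> (N *v y) \<le> K * (y \<bullet> y)"
      unfolding orthonormal_eigenvectors_expand(3,4)[OF E, of y] sum_distrib_left
      by (intro sum_mono mult_right_mono) auto
  next
    fix b assume "\<forall>y. y \<bullet> (N *v y) \<le> K * (y \<bullet> y)" and "b \<in> E"
    then have "b \<bullet> (N *v b) \<le> K * (b \<bullet> b)" by blast
    then show "l b \<le> K" using E \<open>b \<in> E\<close>
      by (auto simp: orthonormal_eigenvectors_def norm_eq_1)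
  qed
  have 3: "(R *v x) \<bullet> (N *v (R *v x)) = x \<bullet> (q *v x)" "(R *v x) \<bullet> (R *v x) = x \<bullet> (A *v x)" for x
  proof -
    have "(R *v x) \<bullet> (N *v (R *v x)) = x \<bullet> (R *v (N *v (R *v x)))"
      using symmetric_inner_swap[OF Rs] by simp
    also have "R *v (N *v (R *v x)) = (R ** N ** R) *v x"
      by (simp add: matrix_vector_mul_assoc matrix_mul_assoc)
    also have "R ** N ** R = (R ** I) ** q ** (I ** R)"
      by (simp add: N_def matrix_mul_assoc)
    finally show "(R *v x) \<bullet> (N *v (R *v x)) = x \<bullet> (q *v x)"
      by (simp add: I)
    show "(R *v x) \<bullet> (R *v x) = x \<bullet> (A *v x)"
      using symmetric_inner_swap[OF Rs, of x "R *v x"] R(2) by (simp add: matrix_vector_mul_assoc)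
  qed
  have "(\<forall>y. y \<bullet> (N *v y) \<le> K * (y \<bullet> y)) \<longleftrightarrow>
      (\<forall>x. (R *v x) \<bullet> (N *v (R *v x)) \<le> K * ((R *v x) \<bullet> (R *v x)))"
  proof safe
    fix y
    assume *: "\<forall>x. (R *v x) \<bullet> (N *v (R *v x)) \<le> K * ((R *v x) \<bullet> (R *v x))"
    have "y = R *v (I *v y)" by (simp add: matrix_vector_mul_assoc I)
    then show "y \<bullet> (N *v y) \<le> K * (y \<bullet> y)" using * by metis
  qed auto
  with 1 2 3 show ?thesis unfolding N_def I_def R_def by simp
qed

section \<open>Sums over positive semidefinite matrices\<close>


lemma sum_rotate3:
  "(\<Sum>k\<in>A. \<Sum>l\<in>B. \<Sum>j\<in>C. f k l j) = (\<Sum>j\<in>C. \<Sum>k\<in>A. \<Sum>l\<in>B. f k l j)"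
proof -
  have "(\<Sum>k\<in>A. \<Sum>l\<in>B. \<Sum>j\<in>C. f k l j) = (\<Sum>k\<in>A. \<Sum>j\<in>C. \<Sum>l\<in>B. f k l j)"
    by (intro sum.cong refl sum.swap)
  also have "\<dots> = (\<Sum>j\<in>C. \<Sum>k\<in>A. \<Sum>l\<in>B. f k l j)" by (rule sum.swap)
  finally show ?thesis .
qed

lemma matrix_mul_nth: "(M ** N) $ i $ j = (\<Sum>k\<in>UNIV. M $ i $ k * N $ k $ j)"
  by (simp add: matrix_matrix_mult_def)

lemma norm_matrix_power2: "(norm (M :: real^'n^'m))\<^sup>2 = (\<Sum>i\<in>UNIV. \<Sum>j\<in>UNIV. (M $ i $ j)\<^sup>2)"
  by (simp add: norm_vec_def L2_set_def sum_nonneg)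

lemma frob_inner_eq_sum: "frob_inner C D = (\<Sum>i\<in>UNIV. \<Sum>j\<in>UNIV. C $ i $ j * D $ i $ j)"
  unfolding frob_inner_def trace_def
  by (simp add: matrix_mul_nth transpose_def) (rule sum.swap)

text \<open>By cyclicity of the trace only the square of \<open>R\<close> survives. With
  \<open>R\<close> the root of q, the weighted Hessian norm becomes the contraction of two Hessians
  with q twice, which is the shape the energy identity works with.\<close>

lemma norm_sandwich_power2:
  fixes R G :: "real^'n^'n"
  assumes sym: "transpose R = R"
  shows "(norm (R ** G ** R))\<^sup>2 =
    (\<Sum>i\<in>UNIV. \<Sum>j\<in>UNIV. \<Sum>k\<in>UNIV. \<Sum>l\<in>UNIV.
      (R ** R) $ i $ j * (R ** R) $ k $ l * G $ i $ k * G $ j $ l)"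
proof -
  have "(norm (R ** G ** R))\<^sup>2 = frob_inner (R ** G ** R) (R ** G ** R)"
    by (simp add: norm_matrix_power2 frob_inner_eq_sum) (simp add: power2_eq_square)
  also have "\<dots> = trace (R ** (transpose G ** (R ** R) ** G ** R))"
    unfolding frob_inner_def by (simp add: matrix_transpose_mul sym matrix_mul_assoc)
  also have "\<dots> = trace (transpose G ** (R ** R) ** G ** R ** R)" by (rule trace_mul_sym)
  also have "\<dots> = trace (transpose G ** ((R ** R) ** G ** (R ** R)))" by (simp add: matrix_mul_assoc)
  also have "\<dots> = frob_inner G ((R ** R) ** G ** (R ** R))" by (simp add: frob_inner_def)
  also have "\<dots> = (\<Sum>i\<in>UNIV. \<Sum>k\<in>UNIV. \<Sum>l\<in>UNIV. \<Sum>j\<in>UNIV.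
      (R ** R) $ i $ j * (R ** R) $ l $ k * G $ i $ k * G $ j $ l)"
    unfolding frob_inner_eq_sum
    by (simp add: matrix_mul_nth[of "R ** R ** G"] matrix_mul_nth[of "R ** R"]
        sum_distrib_left sum_distrib_right mult_ac)
  also have "\<dots> = (\<Sum>i\<in>UNIV. \<Sum>j\<in>UNIV. \<Sum>k\<in>UNIV. \<Sum>l\<in>UNIV.
      (R ** R) $ i $ j * (R ** R) $ l $ k * G $ i $ k * G $ j $ l)"
    by (intro sum.cong refl sum_rotate3)
  also have "\<dots> = (\<Sum>i\<in>UNIV. \<Sum>j\<in>UNIV. \<Sum>k\<in>UNIV. \<Sum>l\<in>UNIV.
      (R ** R) $ i $ j * (R ** R) $ k $ l * G $ i $ k * G $ j $ l)"
  proof -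
    have sym': "transpose (R ** R) = R ** R" by (simp add: matrix_transpose_mul sym)
    have "(R ** R) $ l $ k = (R ** R) $ k $ l" for k l
      by (subst sym'[symmetric]) (simp add: transpose_def)
    then show ?thesis by (intro sum.cong refl arg_cong2[of _ _ _ _ "(*)"])
  qed
  finally show ?thesis .
qed

section \<open>Test functions: smoothness, bumps, commuting derivatives, integration by
  parts\<close>

section \<open>Smooth functions\<close>

abbreviation smooth :: "('a::euclidean_space \<Rightarrow> real) \<Rightarrow> bool" where
  "smooth f \<equiv> \<forall>k. C_diff k f"

lemma pd_eqI: "(f has_derivative f') (at x) \<Longrightarrow> pd b f x = f' b"
  unfolding pd_def by (metis frechet_derivative_at)

lemma C_diff_SucD: "C_diff (Suc k) f \<Longrightarrow> C_diff k f"
proof (induction k arbitrary: f)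
  case 0
  then show ?case by (simp add: differentiable_imp_continuous_on)
next
  case (Suc k)
  then show ?case by (metis C_diff.simps(2))
qed

lemma smooth_differentiable: "smooth f \<Longrightarrow> f differentiable (at x)"
  using C_diff.simps(2)[of 0 f] by (auto simp: differentiable_on_def)

lemma smooth_has_derivative:
  assumes "smooth f"
  shows "(f has_derivative (\<lambda>b. pd b f x)) (at x)"
  using smooth_differentiable[OF assms, of x] unfolding pd_def
  by (metis eta_contract_eq frechet_derivative_works)

lemma smooth_continuous: "smooth f \<Longrightarrow> continuous_on S f"
  by (meson C_diff.simps(1) continuous_on_subset subset_UNIV)

lemma smooth_pd: "smooth f \<Longrightarrow> b \<in> Basis \<Longrightarrow> smooth (pd b f)"
  by (metis C_diff.simps(2))

lemma C_diff_const: "C_diff k (\<lambda>_. c)"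
proof (induction k arbitrary: c)
  case (Suc k)
  have "pd b (\<lambda>_::'a. c) = (\<lambda>_. 0)" for b
    by (rule ext, rule pd_eqI) (rule has_derivative_const)
  then show ?case using Suc by simp
qed simp

lemma pd_add:
  assumes "f differentiable (at x)" "g differentiable (at x)"
  shows "pd b (\<lambda>x. f x + g x) x = pd b f x + pd b g x"
proof -
  have "((\<lambda>x. f x + g x) has_derivative
      (\<lambda>h. frechet_derivative f (at x) h + frechet_derivative g (at x) h)) (at x)"
    by (intro has_derivative_add) (use assms frechet_derivative_works in auto)
  from pd_eqI[OF this] show ?thesis by (simp add: pd_def)
qed

lemma pd_mult:
  assumes "f differentiable (at x)" "g differentiable (at x)"
  shows "pd b (\<lambda>x. f x * g x) x = pd b f x * g x + f x * pd b g x"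
proof -
  have "((\<lambda>x. f x * g x) has_derivative
      (\<lambda>h. f x * frechet_derivative g (at x) h + frechet_derivative f (at x) h * g x)) (at x)"
    by (intro has_derivative_mult) (use assms frechet_derivative_works in auto)
  from pd_eqI[OF this] show ?thesis by (simp add: pd_def)
qed

lemma C_diff_add: "C_diff k f \<Longrightarrow> C_diff k g \<Longrightarrow> C_diff k (\<lambda>x. f x + g x)"
proof (induction k arbitrary: f g)
  case 0
  then show ?case by (auto intro: continuous_on_add)
next
  case (Suc k)
  then have d: "f differentiable (at x)" "g differentiable (at x)" for x
    by (auto simp: differentiable_on_def)
  have "pd b (\<lambda>x. f x + g x) = (\<lambda>x. pd b f x + pd b g x)" for b
    using pd_add[OF d] by blast
  with Suc show ?case by (auto intro: differentiable_on_add)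
qed

lemma C_diff_mult: "C_diff k f \<Longrightarrow> C_diff k g \<Longrightarrow> C_diff k (\<lambda>x. f x * g x)"
proof (induction k arbitrary: f g)
  case 0
  then show ?case by (auto intro: continuous_on_mult)
next
  case (Suc k)
  then have d: "f differentiable (at x)" "g differentiable (at x)" for x
    by (auto simp: differentiable_on_def)
  have *: "pd b (\<lambda>x. f x * g x) = (\<lambda>x. pd b f x * g x + f x * pd b g x)" for b
    using pd_mult[OF d] by blast
  have "C_diff k f" "C_diff k g" using Suc.prems C_diff_SucD by auto
  with Suc show ?case unfolding C_diff.simps *
    by (auto intro!: C_diff_add differentiable_on_mult)
qed

lemma C_diff_prod: "(\<And>i. i \<in> I \<Longrightarrow> C_diff k (f i)) \<Longrightarrow> C_diff k (\<lambda>x. \<Prod>i\<in>I. f i x)"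
  by (induction I rule: infinite_finite_induct) (auto intro: C_diff_mult C_diff_const)

lemma C_diff_minus: "C_diff k f \<Longrightarrow> C_diff k (\<lambda>x. - f x)"
  using C_diff_mult[OF C_diff_const[of k "-1"], of f] by simp

lemma pd_affine:
  assumes "f differentiable (at (x + r *\<^sub>R y))"
  shows "pd b (\<lambda>y. f (x + r *\<^sub>R y)) y = r * pd b f (x + r *\<^sub>R y)"
proof -
  let ?D = "frechet_derivative f (at (x + r *\<^sub>R y))"
  have D: "(f has_derivative ?D) (at (x + r *\<^sub>R y))"
    using assms frechet_derivative_works by blast
  have "((\<lambda>y. x + r *\<^sub>R y) has_derivative (\<lambda>h. r *\<^sub>R h)) (at y)"
    by (auto intro!: derivative_eq_intros)
  from has_derivative_compose[OF this D]
  have "pd b (\<lambda>y. f (x + r *\<^sub>R y)) y = ?D (r *\<^sub>R b)" by (rule pd_eqI)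
  also have "\<dots> = r * ?D b"
    using D by (simp add: has_derivative_def bounded_linear.linear linear_cmul)
  finally show ?thesis by (simp add: pd_def)
qed

lemma C_diff_affine: "C_diff k f \<Longrightarrow> C_diff k (\<lambda>y. f (x + r *\<^sub>R y))"
proof (induction k arbitrary: f)
  case 0
  then show ?case
    by (auto intro!: continuous_on_compose2[of UNIV f] continuous_intros)
next
  case (Suc k)
  then have d: "f differentiable (at x)" for x by (auto simp: differentiable_on_def)
  have "pd b (\<lambda>y. f (x + r *\<^sub>R y)) = (\<lambda>y. r * pd b f (x + r *\<^sub>R y))" for b
    using pd_affine[OF d] by blast
  moreover have "(\<lambda>y. f (x + r *\<^sub>R y)) differentiable (at y)" for y
    by (rule differentiable_compose[of f "\<lambda>y. x + r *\<^sub>R y", OF d]) simp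
  moreover have "C_diff k (\<lambda>y. r * pd b f (x + r *\<^sub>R y))" if "b \<in> Basis" for b
    using Suc that by (intro C_diff_mult C_diff_const) simp
  ultimately show ?case by (simp add: differentiable_on_def)
qed

text \<open>The hypothesis packages a function of one variable with all its derivatives into one
  sequence \<open>G\<close>, so that the induction on \<open>k\<close> can pass from
  \<open>G n\<close> to \<open>G (Suc n)\<close>. Flat functions, exponentials, sine, cosine and the
  smooth step all enter in this form.\<close>

lemma C_diff_ridge:
  fixes e :: "'a::euclidean_space"
  assumes G: "\<And>n t. (G n has_real_derivative G (Suc n) t) (at t)"
  shows "C_diff k (\<lambda>x. G n (x \<bullet> e + d))"
    and pd_ridge: "pd b (\<lambda>x. G n (x \<bullet> e + d)) x = (b \<bullet> e) * G (Suc n) (x \<bullet> e + d)"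
proof -
  have D: "((\<lambda>x. G n (x \<bullet> e + d)) has_derivative (\<lambda>h. (h \<bullet> e) * G (Suc n) (x \<bullet> e + d))) (at x)"
    for n and x :: 'a
  proof -
    have "((\<lambda>x. x \<bullet> e + d) has_derivative (\<lambda>h. h \<bullet> e)) (at x)"
      by (auto intro!: derivative_eq_intros)
    from has_derivative_compose[OF this G[of n, unfolded has_field_derivative_def]]
    show ?thesis by (simp add: mult.commute)
  qed
  show pd: "pd b (\<lambda>x. G n (x \<bullet> e + d)) x = (b \<bullet> e) * G (Suc n) (x \<bullet> e + d)" for b n x
    by (rule pd_eqI[OF D])
  show "C_diff k (\<lambda>x. G n (x \<bullet> e + d))"
  proof (induction k arbitrary: n)
    case 0
    have "isCont (\<lambda>x. G n (x \<bullet> e + d)) x" for x using has_derivative_continuous[OF D] .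
    then show ?case by (simp add: continuous_on_eq_continuous_at)
  next
    case (Suc k)
    have "pd b (\<lambda>x. G n (x \<bullet> e + d)) = (\<lambda>x. (b \<bullet> e) * G (Suc n) (x \<bullet> e + d))" for b
      using pd by blast
    moreover have "(\<lambda>x. G n (x \<bullet> e + d)) differentiable at x" for x
      using D differentiable_def by blast
    ultimately show ?case using Suc
      by (auto simp: differentiable_on_def intro!: C_diff_mult C_diff_const)
  qed
qed

section \<open>A flat function and bump functions\<close>

text \<open>The polynomial is a parameter because the functions p(1/t) exp(-1/t), extended by 0, are
  closed under differentiation: p is replaced by X^2 (p - p').\<close>

definition flat_exp :: "real poly \<Rightarrow> real \<Rightarrow> real" where
  "flat_exp p t = (if t > 0 then poly p (1 / t) * exp (- (1 / t)) else 0)"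

lemma poly_times_exp_minus_tendsto_0:
  "((\<lambda>x::real. poly p x * exp (- x)) \<longlongrightarrow> 0) at_top"
proof -
  have "((\<lambda>x. \<Sum>i\<le>degree p. coeff p i * (x ^ i / exp x)) \<longlongrightarrow> (\<Sum>i\<le>degree p. coeff p i * 0)) at_top"
    by (intro tendsto_intros tendsto_power_div_exp_0)
  then show ?thesis
    by (simp add: poly_altdef sum_distrib_right exp_minus divide_inverse mult.assoc)
qed

lemma flat_exp_tendsto_0: "(flat_exp p \<longlongrightarrow> 0) (at 0)"
proof -
  have "((\<lambda>t. poly p (inverse t) * exp (- inverse t)) \<longlongrightarrow> 0) (at_right (0::real))"
    using filterlim_compose[OF poly_times_exp_minus_tendsto_0 filterlim_inverse_at_top_right] .
  then have "(flat_exp p \<longlongrightarrow> 0) (at_right 0)"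
    by (rule Lim_transform_eventually)
       (auto simp: flat_exp_def eventually_at_filter inverse_eq_divide)
  moreover have "(flat_exp p \<longlongrightarrow> 0) (at_left 0)"
    by (rule tendsto_eventually) (auto simp: flat_exp_def eventually_at_filter)
  ultimately show ?thesis by (simp add: filterlim_at_split)
qed

lemma flat_exp_deriv:
  "(flat_exp p has_real_derivative flat_exp ([:0, 0, 1:] * (p - pderiv p)) t) (at t)"
proof -
  consider "t < 0" | "t = 0" | "t > 0" by linarith
  then show ?thesis
  proof cases
    case 1
    have "((\<lambda>_. 0) has_real_derivative 0) (at t)" by simp
    then have "(flat_exp p has_real_derivative 0) (at t)"
      by (rule has_field_derivative_transform_within_open[of _ _ _ "{..<0}"])
         (use 1 in \<open>auto simp: flat_exp_def\<close>)
    then show ?thesis using 1 by (simp add: flat_exp_def)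
  next
    case 2
    \<comment> \<open>At 0 the difference quotient is again such a function, with X p in place of p,
      so it tends to 0.\<close>
    have "((\<lambda>h. flat_exp ([:0, 1:] * p) h) \<longlongrightarrow> 0) (at 0)" by (rule flat_exp_tendsto_0)
    moreover have "flat_exp ([:0, 1:] * p) h = (flat_exp p (0 + h) - flat_exp p 0) / h" for h
      by (simp add: flat_exp_def)
    ultimately have "(flat_exp p has_real_derivative 0) (at 0)"
      by (simp add: DERIV_def)
    then show ?thesis using 2 by (simp add: flat_exp_def)
  next
    case 3
    have "((\<lambda>t. poly p (1 / t) * exp (- (1 / t))) has_real_derivative
        poly p (1 / t) * (exp (- (1 / t)) * (1 / t^2)) + poly (pderiv p) (1 / t) * (- (1 / t^2)) * exp (- (1 / t)))
        (at t)"
      using 3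
      by (auto intro!: derivative_eq_intros DERIV_chain2[OF poly_DERIV] simp: power2_eq_square field_simps)
    then have "((\<lambda>t. poly p (1 / t) * exp (- (1 / t))) has_real_derivative
        flat_exp ([:0, 0, 1:] * (p - pderiv p)) t) (at t)"
      using 3 by (simp add: flat_exp_def power2_eq_square algebra_simps)
    then show ?thesis
      by (rule has_field_derivative_transform_within_open[of _ _ _ "{0<..}"])
         (use 3 in \<open>auto simp: flat_exp_def\<close>)
  qed
qed

definition flat_poly :: "nat \<Rightarrow> real poly" where
  "flat_poly n = ((\<lambda>p. [:0, 0, 1:] * (p - pderiv p)) ^^ n) 1"

definition flat :: "nat \<Rightarrow> real \<Rightarrow> real" where
  "flat n = flat_exp (flat_poly n)"

lemma flat_deriv: "(flat n has_real_derivative flat (Suc n) t) (at t)"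
  unfolding flat_def flat_poly_def using flat_exp_deriv by simp

lemma flat_0: "flat 0 t = (if t > 0 then exp (- (1 / t)) else 0)"
  by (simp add: flat_def flat_poly_def flat_exp_def)

lemma flat_1: "flat (Suc 0) t = (if t > 0 then exp (- (1 / t)) / t\<^sup>2 else 0)"
  by (simp add: flat_def flat_poly_def flat_exp_def power2_eq_square)

lemma flat_0_bounds: "0 \<le> flat 0 t" "flat 0 t \<le> 1" "flat 0 t > 0 \<longleftrightarrow> t > 0"
  by (auto simp: flat_0)

lemma flat_1_nonneg: "0 \<le> flat (Suc 0) t"
  by (auto simp: flat_1)

lemma flat_0_tendsto_1: "(flat 0 \<longlongrightarrow> 1) at_top"
proof -
  have "((\<lambda>t::real. exp (- (1 / t))) \<longlongrightarrow> exp (- 0)) at_top"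
    by (intro tendsto_intros tendsto_divide_0[OF tendsto_const] filterlim_at_top_imp_at_infinity
        filterlim_ident)
  then show ?thesis
    by (simp add: filterlim_cong[OF refl refl, of "flat 0" "\<lambda>t. exp (- (1 / t))"] flat_0
        eventually_mono[OF eventually_gt_at_top[of 0]])
qed

lemma continuous_flat: "continuous_on S (flat n)"
  by (meson DERIV_continuous_on flat_deriv has_field_derivative_at_within)

text \<open>Both factors are written as ridge functions x . e + d to fit
  \<open>C_diff_ridge\<close>.\<close>

definition box_bump :: "'a::euclidean_space \<Rightarrow> 'a \<Rightarrow> 'a \<Rightarrow> real" where
  "box_bump l u x = (\<Prod>b\<in>Basis. flat 0 (x \<bullet> b + - (l \<bullet> b)) * flat 0 (x \<bullet> (- b) + u \<bullet> b))"

lemma smooth_box_bump: "C_diff k (box_bump l u)"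
  unfolding box_bump_def[abs_def]
  by (intro C_diff_prod C_diff_mult C_diff_ridge flat_deriv)

lemma box_bump_nonneg: "0 \<le> box_bump l u x"
  unfolding box_bump_def by (intro prod_nonneg mult_nonneg_nonneg flat_0_bounds)

lemma box_bump_le_1: "box_bump l u x \<le> 1"
  unfolding box_bump_def by (intro prod_le_1) (auto simp: flat_0_bounds mult_le_one)

lemma box_bump_pos_iff: "box_bump l u x > 0 \<longleftrightarrow> x \<in> box l u"
proof -
  have "box_bump l u x > 0 \<longleftrightarrow> box_bump l u x \<noteq> 0"
    using box_bump_nonneg[of l u x] by linarith
  also have "\<dots> \<longleftrightarrow> (\<forall>b\<in>Basis. flat 0 (x \<bullet> b + - (l \<bullet> b)) > 0 \<and> flat 0 (x \<bullet> (- b) + u \<bullet> b) > 0)"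
    unfolding box_bump_def using flat_0_bounds(1) by (auto simp: less_le)
  also have "\<dots> \<longleftrightarrow> x \<in> box l u"
    by (simp only: flat_0_bounds(3)) (auto simp: mem_box)
  finally show ?thesis .
qed

lemma box_bump_eq_0: "x \<notin> box l u \<Longrightarrow> box_bump l u x = 0"
  using box_bump_pos_iff[of l u x] box_bump_nonneg[of l u x] by linarith

section \<open>Test functions\<close>

lemma Cc_inftyI:
  assumes "smooth f" "compact K" "K \<subseteq> U" "\<And>x. x \<notin> K \<Longrightarrow> f x = 0"
  shows "f \<in> Cc_infty U"
proof -
  have "closure {x. f x \<noteq> 0} \<subseteq> K"
    using assms by (intro closure_minimal) (auto simp: compact_imp_closed)
  moreover from this have "compact (closure {x. f x \<noteq> 0})"
    using assms by (metis closed_closure compact_Int_closed inf.absorb_iff2)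
  ultimately show ?thesis using assms by (auto simp: Cc_infty_def)
qed

lemma Cc_inftyD:
  assumes "f \<in> Cc_infty U"
  shows "smooth f"
    and "\<exists>K. compact K \<and> K \<subseteq> U \<and> (\<forall>x. x \<notin> K \<longrightarrow> f x = 0)"
proof -
  show "smooth f" using assms by (simp add: Cc_infty_def)
  show "\<exists>K. compact K \<and> K \<subseteq> U \<and> (\<forall>x. x \<notin> K \<longrightarrow> f x = 0)"
    using assms closure_subset[of "{x. f x \<noteq> 0}"]
    by (intro exI[of _ "closure {x. f x \<noteq> 0}"]) (auto simp: Cc_infty_def)
qed

lemma Cc_infty_mono: "U \<subseteq> V \<Longrightarrow> f \<in> Cc_infty U \<Longrightarrow> f \<in> Cc_infty V"
  by (auto simp: Cc_infty_def)

lemma pd_vanish: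
  assumes "open S" "x \<in> S" "\<And>y. y \<in> S \<Longrightarrow> f y = 0"
  shows "pd b f x = 0"
proof -
  have "(f has_derivative (\<lambda>_. 0)) (at x)"
    by (rule has_derivative_transform_within_open[of "\<lambda>_. 0"]) (use assms in auto)
  then show ?thesis by (rule pd_eqI)
qed

lemma Cc_infty_pd:
  assumes "f \<in> Cc_infty U" "b \<in> Basis"
  shows "pd b f \<in> Cc_infty U"
proof -
  obtain K where K: "compact K" "K \<subseteq> U" "\<And>x. x \<notin> K \<Longrightarrow> f x = 0"
    using Cc_inftyD(2)[OF assms(1)] by blast
  show ?thesis
  proof (rule Cc_inftyI[OF _ K(1,2)])
    show "smooth (pd b f)" using Cc_inftyD(1)[OF assms(1)] assms(2) smooth_pd by blast
    show "pd b f x = 0" if "x \<notin> K" for x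
      by (rule pd_vanish[of "- K"]) (use K that compact_imp_closed in auto)
  qed
qed

lemma Cc_infty_mult:
  assumes "f \<in> Cc_infty U" "smooth g"
  shows "(\<lambda>x. g x * f x) \<in> Cc_infty U"
proof -
  obtain K where K: "compact K" "K \<subseteq> U" "\<And>x. x \<notin> K \<Longrightarrow> f x = 0"
    using Cc_inftyD(2)[OF assms(1)] by blast
  show ?thesis
    using Cc_inftyD(1)[OF assms(1)] assms(2) K
    by (intro Cc_inftyI[OF _ K(1,2)] allI C_diff_mult) auto
qed

text \<open>Compactness comes from the affine preimage of the support of \<open>f\<close>; the
  closed set \<open>L\<close>, often a half space of times, places that support inside
  \<open>U\<close>.\<close>

lemma Cc_infty_affine:
  assumes "f \<in> Cc_infty UNIV" "r \<noteq> 0" "\<And>y. f (x + r *\<^sub>R y) \<noteq> 0 \<Longrightarrow> y \<in> L" "closed L" "L \<subseteq> U"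
  shows "(\<lambda>y. f (x + r *\<^sub>R y)) \<in> Cc_infty U"
proof -
  obtain K where K: "compact K" "\<And>x. x \<notin> K \<Longrightarrow> f x = 0"
    using Cc_inftyD(2)[OF assms(1)] by blast
  let ?K = "(\<lambda>z. (1 / r) *\<^sub>R (z - x)) ` K"
  have "compact (?K \<inter> L)"
    by (intro compact_Int_closed compact_continuous_image continuous_intros K assms)
  moreover have "f (x + r *\<^sub>R y) = 0" if "y \<notin> ?K \<inter> L" for y
  proof (rule ccontr)
    assume *: "f (x + r *\<^sub>R y) \<noteq> 0"
    then have "x + r *\<^sub>R y \<in> K" using K(2) by blast
    moreover have "y = (1 / r) *\<^sub>R ((x + r *\<^sub>R y) - x)" using assms(2) by simp
    ultimately have "y \<in> ?K" by blast
    then show False using assms(3)[OF *] that by blast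
  qed
  ultimately show ?thesis
    using Cc_inftyD(1)[OF assms(1)] assms(5)
    by (intro Cc_inftyI[of _ "?K \<inter> L"] allI C_diff_affine) auto
qed

lemma box_bump_Cc_infty: "cbox l u \<subseteq> U \<Longrightarrow> box_bump l u \<in> Cc_infty U"
  by (rule Cc_inftyI[of _ "cbox l u"])
     (auto intro: smooth_box_bump box_bump_eq_0 dest: box_subset_cbox[THEN subsetD])

lemma Cc_infty_add:
  assumes "f \<in> Cc_infty U" "g \<in> Cc_infty U"
  shows "(\<lambda>x. f x + g x) \<in> Cc_infty U"
proof -
  obtain K L where K: "compact K" "K \<subseteq> U" "\<And>x. x \<notin> K \<Longrightarrow> f x = 0"
    and L: "compact L" "L \<subseteq> U" "\<And>x. x \<notin> L \<Longrightarrow> g x = 0"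
    using Cc_inftyD(2)[OF assms(1)] Cc_inftyD(2)[OF assms(2)] by metis
  show ?thesis
    using Cc_inftyD(1)[OF assms(1)] Cc_inftyD(1)[OF assms(2)] K L
    by (intro Cc_inftyI[of _ "K \<union> L"] allI C_diff_add) auto
qed

lemma Cc_infty_cmult: "f \<in> Cc_infty U \<Longrightarrow> (\<lambda>x. c * f x) \<in> Cc_infty U"
  using Cc_infty_mult[of f U "\<lambda>_. c"] C_diff_const by blast

lemma Cc_infty_continuous: "f \<in> Cc_infty U \<Longrightarrow> continuous_on S f"
  using Cc_inftyD(1) smooth_continuous by blast

lemma Cc_infty_bounded:
  assumes "f \<in> Cc_infty U"
  obtains C where "C \<ge> 0" "\<And>x. \<bar>f x\<bar> \<le> C"
proof -
  obtain K where K: "compact K" "\<And>x. x \<notin> K \<Longrightarrow> f x = 0"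
    using Cc_inftyD(2)[OF assms] by blast
  have "bounded (f ` K)"
    by (intro compact_imp_bounded compact_continuous_image Cc_infty_continuous[OF assms] K)
  then obtain C where C: "\<And>x. x \<in> K \<Longrightarrow> \<bar>f x\<bar> \<le> C" by (auto simp: bounded_iff)
  have "\<bar>f x\<bar> \<le> max C 0" for x using C[of x] K(2)[of x] by (cases "x \<in> K") auto
  then show thesis using that[of "max C 0"] by simp
qed

lemma smooth_line_deriv:
  assumes "smooth f"
  shows "((\<lambda>t. f (x + t *\<^sub>R b)) has_real_derivative pd b f (x + t *\<^sub>R b)) (at t)"
proof -
  let ?D = "\<lambda>h. pd h f (x + t *\<^sub>R b)"
  have D: "(f has_derivative ?D) (at (x + t *\<^sub>R b))" by (rule smooth_has_derivative[OF assms])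
  have "((\<lambda>t. x + t *\<^sub>R b) has_derivative (\<lambda>h. h *\<^sub>R b)) (at t)"
    by (auto intro!: derivative_eq_intros)
  from has_derivative_compose[OF this D]
  have "((\<lambda>t. f (x + t *\<^sub>R b)) has_derivative (\<lambda>h. ?D (h *\<^sub>R b))) (at t)" .
  moreover have "?D (h *\<^sub>R b) = ?D b * h" for h
    using linear_cmul[OF has_derivative_linear[OF D], of h b] by simp
  ultimately show ?thesis by (simp add: has_field_derivative_def)
qed

text \<open>The mean value theorem is applied once in each direction. The second difference on the
  left is symmetric in \<open>b\<close> and \<open>c\<close>, which yields the commutation of
  derivatives.\<close>

lemma second_difference_mvt:
  assumes f: "smooth f" and b: "b \<in> Basis" and h: "h > 0"
  shows "\<exists>t u. 0 < t \<and> t < h \<and> 0 < u \<and> u < h \<and>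
    f (x + h *\<^sub>R b + h *\<^sub>R c) - f (x + h *\<^sub>R b) - f (x + h *\<^sub>R c) + f x
      = h\<^sup>2 * pd c (pd b f) (x + t *\<^sub>R b + u *\<^sub>R c)"
proof -
  let ?g = "\<lambda>t. f ((x + h *\<^sub>R c) + t *\<^sub>R b) - f (x + t *\<^sub>R b)"
  have "\<exists>t. 0 < t \<and> t < h \<and> ?g h - ?g 0 =
      (h - 0) * (pd b f ((x + h *\<^sub>R c) + t *\<^sub>R b) - pd b f (x + t *\<^sub>R b))"
    by (rule MVT2[OF h]) (intro derivative_intros smooth_line_deriv f)
  then obtain t where t: "0 < t" "t < h"
    "?g h - ?g 0 = h * (pd b f ((x + h *\<^sub>R c) + t *\<^sub>R b) - pd b f (x + t *\<^sub>R b))" by auto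
  let ?k = "\<lambda>u. pd b f ((x + t *\<^sub>R b) + u *\<^sub>R c)"
  have "\<exists>u. 0 < u \<and> u < h \<and> ?k h - ?k 0 = (h - 0) * pd c (pd b f) ((x + t *\<^sub>R b) + u *\<^sub>R c)"
    by (rule MVT2[OF h]) (intro smooth_line_deriv smooth_pd[OF f b])
  then obtain u where u: "0 < u" "u < h"
    "?k h - ?k 0 = h * pd c (pd b f) ((x + t *\<^sub>R b) + u *\<^sub>R c)" by auto
  have "?g h - ?g 0 = h\<^sup>2 * pd c (pd b f) (x + t *\<^sub>R b + u *\<^sub>R c)"
    unfolding t(3) using u(3) by (simp add: power2_eq_square add_ac)
  then show ?thesis using t u
    by (intro exI[of _ t] exI[of _ u]) (simp add: algebra_simps)
qed

text \<open>Schwarz's theorem: the same second difference is h^2 times either mixed derivative at a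
  point near \<open>x\<close>, and both mixed derivatives are continuous.\<close>

lemma pd_commute:
  assumes f: "smooth f" and b: "b \<in> Basis" and c: "c \<in> Basis"
  shows "pd b (pd c f) x = pd c (pd b f) x"
proof (rule ccontr)
  let ?p = "pd b (pd c f)" and ?q = "pd c (pd b f)"
  assume "?p x \<noteq> ?q x"
  then have e: "\<bar>?p x - ?q x\<bar> / 2 > 0" (is "?e > 0") by simp
  have "isCont ?p x" "isCont ?q x"
    using smooth_continuous[OF smooth_pd[OF smooth_pd[OF f c] b], of UNIV]
      smooth_continuous[OF smooth_pd[OF smooth_pd[OF f b] c], of UNIV]
    by (auto simp: continuous_on_eq_continuous_at)
  then obtain d1 d2 where d: "d1 > 0" "\<And>y. dist y x < d1 \<Longrightarrow> dist (?p y) (?p x) < ?e"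
    "d2 > 0" "\<And>y. dist y x < d2 \<Longrightarrow> dist (?q y) (?q x) < ?e"
    using e unfolding continuous_at_eps_delta by metis
  define h where "h = min d1 d2 / 3"
  have h: "h > 0" using d by (simp add: h_def)
  obtain t u where tu: "0 < t" "t < h" "0 < u" "u < h"
    "f (x + h *\<^sub>R b + h *\<^sub>R c) - f (x + h *\<^sub>R b) - f (x + h *\<^sub>R c) + f x
      = h\<^sup>2 * ?q (x + t *\<^sub>R b + u *\<^sub>R c)"
    using second_difference_mvt[OF f b h] by blast
  obtain t' u' where tu': "0 < t'" "t' < h" "0 < u'" "u' < h"
    "f (x + h *\<^sub>R c + h *\<^sub>R b) - f (x + h *\<^sub>R c) - f (x + h *\<^sub>R b) + f x
      = h\<^sup>2 * ?p (x + t' *\<^sub>R c + u' *\<^sub>R b)"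
    using second_difference_mvt[OF f c h] by blast
  have eq: "?p (x + t' *\<^sub>R c + u' *\<^sub>R b) = ?q (x + t *\<^sub>R b + u *\<^sub>R c)"
  proof -
    have "f (x + h *\<^sub>R c + h *\<^sub>R b) = f (x + h *\<^sub>R b + h *\<^sub>R c)"
      by (rule arg_cong[of _ _ f]) simp
    then have "h\<^sup>2 * ?p (x + t' *\<^sub>R c + u' *\<^sub>R b) = h\<^sup>2 * ?q (x + t *\<^sub>R b + u *\<^sub>R c)"
      using tu(5) tu'(5) by linarith
    then show ?thesis using h by simp
  qed
  have close: "dist (x + s *\<^sub>R v + r *\<^sub>R w) x < min d1 d2"
    if "0 < s" "s < h" "0 < r" "r < h" "v \<in> Basis" "w \<in> Basis" for s r and v w :: 'a
  proof -
    have "norm (s *\<^sub>R v + r *\<^sub>R w) \<le> s + r"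
      using norm_triangle_ineq[of "s *\<^sub>R v" "r *\<^sub>R w"] that by simp
    then show ?thesis using that d by (simp add: dist_norm h_def add.assoc)
  qed
  have "dist (?p (x + t' *\<^sub>R c + u' *\<^sub>R b)) (?p x) < ?e"
    using close[OF tu'(1-4) c b] by (intro d) simp
  moreover have "dist (?q (x + t *\<^sub>R b + u *\<^sub>R c)) (?q x) < ?e"
    using close[OF tu(1-4) b c] by (intro d) simp
  moreover have "dist (?p x) (?q x) \<le> dist r (?p x) + dist r (?q x)" for r
    by (rule dist_triangle3)
  ultimately show False
    unfolding eq by (smt (verit, best) dist_real_def field_sum_of_halves)
qed

section \<open>Translations and integration by parts\<close>

lemma nn_integral_shift:
  fixes f :: "'a::euclidean_space \<Rightarrow> ennreal"
  assumes [measurable]: "f \<in> borel_measurable borel"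
  shows "(\<integral>\<^sup>+x. f (x + c) \<partial>lborel) = (\<integral>\<^sup>+x. f x \<partial>lborel)"
proof -
  have "(\<integral>\<^sup>+x. f x \<partial>lborel) = (\<integral>\<^sup>+x. f x \<partial>distr lborel borel ((+) c))"
    by (simp add: lborel_distr_plus)
  also have "\<dots> = (\<integral>\<^sup>+x. f (c + x) \<partial>lborel)" by (rule nn_integral_distr) auto
  finally show ?thesis by (simp add: add.commute)
qed

lemma integral_shift:
  fixes f :: "'a::euclidean_space \<Rightarrow> real"
  assumes [measurable]: "f \<in> borel_measurable borel"
  shows "(LINT x|lborel. f (x + c)) = (LINT x|lborel. f x)"
proof -
  have "(LINT x|lborel. f x) = (LINT x|distr lborel borel ((+) c). f x)"
    by (simp add: lborel_distr_plus)
  also have "\<dots> = (LINT x|lborel. f (c + x))" by (rule integral_distr) auto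
  finally show ?thesis by (simp add: add.commute)
qed

lemma integrable_shift:
  fixes f :: "'a::euclidean_space \<Rightarrow> real"
  assumes "integrable lborel f"
  shows "integrable lborel (\<lambda>x. f (x + c))"
proof -
  have "integrable (distr lborel borel ((+) c)) f" using assms by (simp add: lborel_distr_plus)
  then have "integrable lborel (\<lambda>x. f (c + x))"
    using assms by (subst (asm) integrable_distr_eq) auto
  then show ?thesis by (simp add: add.commute)
qed

text \<open>Integrating \<open>h (x + b) - h x = (\<integral>t\<in>{0..1}. k (x + t b))\<close> over \<open>x\<close> gives 0 on the left by
  translation invariance and \<open>\<integral>k\<close> on the right by Fubini.\<close>

lemma integral_directional_derivative:
  fixes h k :: "'a::euclidean_space \<Rightarrow> real"
  assumes h: "integrable lborel h" and k: "integrable lborel k"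
    and D: "\<And>x t. ((\<lambda>t. h (x + t *\<^sub>R b)) has_real_derivative k (x + t *\<^sub>R b)) (at t)"
    and cont: "\<And>x. continuous_on UNIV (\<lambda>t. k (x + t *\<^sub>R b))"
  shows "(LINT x|lborel. k x) = 0"
proof -
  have [measurable]: "h \<in> borel_measurable borel" "k \<in> borel_measurable borel"
    using h k by auto
  let ?f = "\<lambda>x t. indicator {0..1::real} t * k (x + t *\<^sub>R b)"
  have ftc: "(LINT t|lborel. ?f x t) = h (x + b) - h x" for x
  proof -
    have "(LINT t|lborel. indicator {0..1::real} t *\<^sub>R k (x + t *\<^sub>R b))
        = h (x + 1 *\<^sub>R b) - h (x + 0 *\<^sub>R b)"
    proof (rule integral_FTC_atLeastAtMost)
      show "((\<lambda>t. h (x + t *\<^sub>R b)) has_vector_derivative k (x + t *\<^sub>R b)) (at t within {0..1})" for t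
        using D by (simp add: has_real_derivative_iff_has_vector_derivative[symmetric]
            has_field_derivative_at_within)
      show "continuous_on {0..1} (\<lambda>t. k (x + t *\<^sub>R b))"
        using cont continuous_on_subset by blast
    qed simp
    then show ?thesis by simp
  qed
  have int: "integrable (lborel \<Otimes>\<^sub>M lborel) (\<lambda>(x, t). ?f x t)"
  proof (rule integrableI_bounded)
    have "(\<integral>\<^sup>+xt. ennreal (norm (case xt of (x, t) \<Rightarrow> ?f x t)) \<partial>(lborel \<Otimes>\<^sub>M lborel))
        = (\<integral>\<^sup>+t. (\<integral>\<^sup>+x. ennreal (norm (?f x t)) \<partial>lborel) \<partial>lborel)"
      by (subst lborel_pair.nn_integral_snd[symmetric]) auto
    also have "\<dots> = (\<integral>\<^sup>+t. indicator {0..1::real} t * (\<integral>\<^sup>+x. ennreal (norm (k x)) \<partial>lborel) \<partial>lborel)"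
    proof (rule nn_integral_cong)
      fix t :: real
      have "(\<integral>\<^sup>+x. ennreal (norm (?f x t)) \<partial>lborel)
          = (\<integral>\<^sup>+x. indicator {0..1} t * ennreal (norm (k (x + t *\<^sub>R b))) \<partial>lborel)"
        by (intro nn_integral_cong) (auto split: split_indicator)
      also have "\<dots> = indicator {0..1} t * (\<integral>\<^sup>+x. ennreal (norm (k x)) \<partial>lborel)"
        using nn_integral_shift[of "\<lambda>x. ennreal (norm (k x))" "t *\<^sub>R b"]
        by (subst nn_integral_cmult) auto
      finally show "(\<integral>\<^sup>+x. ennreal (norm (?f x t)) \<partial>lborel)
          = indicator {0..1} t * (\<integral>\<^sup>+x. ennreal (norm (k x)) \<partial>lborel)" .
    qed
    also have "\<dots> = (\<integral>\<^sup>+x. ennreal (norm (k x)) \<partial>lborel)"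
      by (subst nn_integral_multc) auto
    also have "\<dots> < \<infinity>" using k by (simp add: integrable_iff_bounded)
    finally show "(\<integral>\<^sup>+xt. ennreal (norm (case xt of (x, t) \<Rightarrow> ?f x t)) \<partial>(lborel \<Otimes>\<^sub>M lborel)) < \<infinity>" .
  qed measurable
  have "(LINT x|lborel. k x) = (LINT t|lborel. indicator {0..1::real} t * (LINT x|lborel. k x))"
    by simp
  also have "\<dots> = (LINT t|lborel. (LINT x|lborel. ?f x t))"
    by (simp add: integral_shift)
  also have "\<dots> = (LINT x|lborel. (LINT t|lborel. ?f x t))"
    by (rule lborel_pair.Fubini_integral[OF int])
  also have "\<dots> = (LINT x|lborel. h (x + b)) - (LINT x|lborel. h x)"
    unfolding ftc by (intro Bochner_Integration.integral_diff integrable_shift h)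
  also have "\<dots> = 0" by (simp add: integral_shift)
  finally show ?thesis .
qed

lemma Cc_infty_integrable:
  assumes "f \<in> Cc_infty U"
  shows "integrable lborel f"
proof -
  obtain K where K: "compact K" "\<And>x. x \<notin> K \<Longrightarrow> f x = 0"
    using Cc_inftyD(2)[OF assms] by blast
  have "integrable lborel (\<lambda>x. indicator K x *\<^sub>R f x)"
    using K Cc_infty_continuous[OF assms] by (intro borel_integrable_compact)
  moreover have "(\<lambda>x. indicator K x *\<^sub>R f x) = f"
    using K(2) by (auto simp: fun_eq_iff indicator_def)
  ultimately show ?thesis by simp
qed

lemma integral_pd_eq_0:
  assumes "f \<in> Cc_infty U" "b \<in> Basis"
  shows "(LINT x|lborel. pd b f x) = 0"
proof (rule integral_directional_derivative[of f _ b])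
  show "integrable lborel f" "integrable lborel (pd b f)"
    using assms Cc_infty_integrable Cc_infty_pd by blast+
  show "((\<lambda>t. f (x + t *\<^sub>R b)) has_real_derivative pd b f (x + t *\<^sub>R b)) (at t)" for x t
    using assms Cc_inftyD(1) smooth_line_deriv by blast
  show "continuous_on UNIV (\<lambda>t. pd b f (x + t *\<^sub>R b))" for x
    by (rule continuous_on_compose2[of UNIV "pd b f"])
       (auto intro!: continuous_intros Cc_infty_continuous[OF Cc_infty_pd[OF assms]])
qed

lemma continuous_locally_integrable:
  "continuous_on UNIV f \<Longrightarrow> locally_integrable U f"
  unfolding locally_integrable_def set_integrable_def
  by (intro allI impI borel_integrable_compact) (auto intro: continuous_on_subset)

lemma set_integral_Cc:
  assumes "\<phi> \<in> Cc_infty U"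
  shows "(LINT x:U|lborel. g x * \<phi> x) = (LINT x|lborel. g x * \<phi> x)"
  unfolding set_lebesgue_integral_def
  using Cc_inftyD(2)[OF assms] by (intro Bochner_Integration.integral_cong) (auto simp: indicator_def)

lemma smooth_has_weak_deriv:
  assumes v: "smooth v" and b: "b \<in> Basis"
  shows "has_weak_deriv U v b (pd b v)"
  unfolding has_weak_deriv_def
proof (intro conjI ballI)
  show "locally_integrable U v" "locally_integrable U (pd b v)"
    using v b smooth_continuous smooth_pd continuous_locally_integrable by blast+
  fix \<phi> assume \<phi>: "\<phi> \<in> Cc_infty U"
  have sm: "smooth \<phi>" using Cc_inftyD(1)[OF \<phi>] .
  have i1: "integrable lborel (\<lambda>x. pd b v x * \<phi> x)"
    by (rule Cc_infty_integrable[OF Cc_infty_mult[OF \<phi> smooth_pd[OF v b]]])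
  have i2: "integrable lborel (\<lambda>x. v x * pd b \<phi> x)"
    by (rule Cc_infty_integrable[OF Cc_infty_mult[OF Cc_infty_pd[OF \<phi> b] v]])
  have "0 = (LINT x|lborel. pd b (\<lambda>x. v x * \<phi> x) x)"
    by (rule integral_pd_eq_0[OF Cc_infty_mult[OF \<phi> v] b, symmetric])
  also have "\<dots> = (LINT x|lborel. pd b v x * \<phi> x + v x * pd b \<phi> x)"
    using v sm by (simp add: pd_mult smooth_differentiable)
  also have "\<dots> = (LINT x|lborel. pd b v x * \<phi> x) + (LINT x|lborel. v x * pd b \<phi> x)"
    by (rule Bochner_Integration.integral_add[OF i1 i2])
  finally show "(LINT x:U|lborel. v x * pd b \<phi> x) = - (LINT x:U|lborel. pd b v x * \<phi> x)"
    unfolding set_integral_Cc[OF \<phi>] set_integral_Cc[OF Cc_infty_pd[OF \<phi> b]] by simp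
qed

section \<open>Mollification in L1 and uniqueness of distributional derivatives\<close>

section \<open>Density of continuous functions and continuity of translations in \<open>L\<^sup>1\<close>\<close>

lemma tendsto_nn_integral_truncation:
  fixes f :: "'a::euclidean_space \<Rightarrow> real"
  assumes "integrable lborel f"
  shows "(\<lambda>n. LINT x|lborel. \<bar>f x - indicator (cball 0 (real n)) x * max (- real n) (min (real n) (f x))\<bar>)
    \<longlonglongrightarrow> 0"
proof -
  have [measurable]: "f \<in> borel_measurable borel" using assms by auto
  have "(\<lambda>n. LINT x|lborel. \<bar>f x - indicator (cball 0 (real n)) x * max (- real n) (min (real n) (f x))\<bar>)
    \<longlonglongrightarrow> (LINT x|lborel. (0::real) * f x)"
  proof (rule integral_dominated_convergence[where w="\<lambda>x. 2 * \<bar>f x\<bar>"])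
    show "AE x in lborel. (\<lambda>n. \<bar>f x - indicator (cball 0 (real n)) x * max (- real n) (min (real n) (f x))\<bar>)
      \<longlonglongrightarrow> 0 * f x"
    proof (rule AE_I2)
      fix x
      obtain N where N: "norm x + \<bar>f x\<bar> \<le> real N" using real_arch_simple by blast
      have "\<bar>f x - indicator (cball 0 (real n)) x * max (- real n) (min (real n) (f x))\<bar> = 0"
        if "n \<ge> N" for n
      proof -
        have "norm x + \<bar>f x\<bar> \<le> real n" using N that by linarith
        then have "norm x \<le> real n" "max (- real n) (min (real n) (f x)) = f x"
          using norm_ge_zero[of x] by linarith+
        then show ?thesis by simp
      qed
      then show "(\<lambda>n. \<bar>f x - indicator (cball 0 (real n)) x * max (- real n) (min (real n) (f x))\<bar>)
        \<longlonglongrightarrow> 0 * f x"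
        by (intro tendsto_eventually) (auto simp: eventually_sequentially)
    qed
  qed (use assms in \<open>auto simp: indicator_def\<close>)
  then show ?thesis by simp
qed

text \<open>After truncation to a bounded function on a ball, continuous functions converge to it
  almost everywhere, because Lebesgue measurable functions are such limits; dominated convergence
  turns this into convergence in L1.\<close>

lemma L1_dense_compact_support:
  fixes f :: "'a::euclidean_space \<Rightarrow> real"
  assumes f: "integrable lborel f" and e: "e > 0"
  obtains g R where "continuous_on UNIV g" "\<And>x. norm x \<ge> R \<Longrightarrow> g x = 0" "integrable lborel g"
    "(LINT x|lborel. \<bar>f x - g x\<bar>) < e"
proof -
  obtain n where n: "(LINT x|lborel. \<bar>f x - indicator (cball 0 (real n)) x * max (- real n) (min (real n) (f x))\<bar>) < e / 2"
    using order_tendstoD(2)[OF tendsto_nn_integral_truncation[OF f], of "e / 2"] e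
    by (auto simp: eventually_sequentially)
  define F where "F x = indicator (cball 0 (real n)) x * max (- real n) (min (real n) (f x))" for x
  have [measurable]: "f \<in> borel_measurable borel" using f by auto
  have Fm[measurable]: "F \<in> borel_measurable borel" unfolding F_def
    by (intro borel_measurable_times borel_measurable_indicator borel_measurable_max
        borel_measurable_min borel_measurable_const) auto
  have Fb: "\<bar>F x\<bar> \<le> n" "norm x > n \<Longrightarrow> F x = 0" for x by (auto simp: F_def indicator_def)
  have "F \<in> borel_measurable lborel" using Fm by simp
  then have "F \<in> borel_measurable lebesgue" by (rule measurable_completion)
  then have "F measurable_on UNIV" by (rule lebesgue_measurable_imp_measurable_on) auto
  then obtain N g where N: "negligible N" and g: "\<And>k. continuous_on UNIV (g k)"
    "\<And>x. x \<notin> N \<Longrightarrow> (\<lambda>k. g k x) \<longlonglongrightarrow> F x"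
    unfolding measurable_on_def by auto
  \<comment> \<open>Clipping at height n and the radial cutoff provide a common integrable majorant.
    They leave the limit \<open>F\<close> unchanged, since |F| \<le> n and F vanishes where the
    cutoff differs from 1.\<close>
  define G where "G k x = max (- n) (min n (g k x)) * max 0 (min 1 (n + 1 - norm x))" for k x
  have Gc: "continuous_on UNIV (G k)" for k
    unfolding G_def by (intro continuous_intros g)
  have Gm[measurable]: "G k \<in> borel_measurable borel" for k
    using Gc borel_measurable_continuous_onI by blast
  have G0: "G k x = 0" if "norm x \<ge> n + 1" for k x using that by (simp add: G_def)
  have Gb: "\<bar>G k x\<bar> \<le> n" for k x
  proof -
    have "\<bar>max (- n) (min n (g k x))\<bar> * \<bar>max 0 (min 1 (n + 1 - norm x))\<bar> \<le> real n * 1"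
      by (intro mult_mono) auto
    then show ?thesis by (simp add: G_def abs_mult)
  qed
  have GF: "(\<lambda>k. G k x) \<longlonglongrightarrow> F x" if "x \<notin> N" for x
  proof -
    have "(\<lambda>k. G k x) \<longlonglongrightarrow> max (- n) (min n (F x)) * max 0 (min 1 (n + 1 - norm x))"
      unfolding G_def using g(2)[OF that] by (intro tendsto_intros)
    moreover have "max (- n) (min n (F x)) * max 0 (min 1 (n + 1 - norm x)) = F x"
    proof (cases "norm x > n")
      case True
      then show ?thesis using Fb(2)[of x] by simp
    next
      case False
      then have "max 0 (min 1 (n + 1 - norm x)) = 1" by auto
      moreover have "max (- n) (min n (F x)) = F x" using Fb(1)[of x] by auto
      ultimately show ?thesis by simp
    qed
    ultimately show ?thesis by simp
  qed
  have AEN: "AE x in lborel. x \<notin> N"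
    using N unfolding negligible_iff_null_sets
    by (metis AE_completion_iff AE_not_in null_sets_completion_iff2 AE_iff_null_sets)
  have w: "integrable lborel (\<lambda>x. 2 * real n * indicator (cball 0 (n + 1 :: real)) (x::'a))"
    by (intro integrable_mult_right integrable_real_indicator) (simp_all add: emeasure_lborel_cball_finite[unfolded infinity_ennreal_def])
  have Gint: "integrable lborel (G k)" for k
    by (rule Bochner_Integration.integrable_bound[OF w])
       (use Gb[of k] G0[of _ k] in \<open>auto simp: indicator_def intro!: AE_I2\<close>, 
        smt (verit) of_nat_0_le_iff)
  have "(\<lambda>k. LINT x|lborel. \<bar>F x - G k x\<bar>) \<longlonglongrightarrow> (LINT x|(lborel::'a measure). 0::real)"
  proof (rule integral_dominated_convergence[OF _ _ w])
    show "AE x in lborel. (\<lambda>k. \<bar>F x - G k x\<bar>) \<longlonglongrightarrow> 0"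
      using AEN
    proof eventually_elim
      case (elim x)
      from tendsto_rabs_zero[OF LIM_zero[OF GF[OF elim]]]
      show ?case by (simp add: abs_minus_commute)
    qed
    show "AE x in lborel. norm \<bar>F x - G k x\<bar> \<le> 2 * real n * indicator (cball 0 (n + 1)) x" for k
    proof (rule AE_I2)
      fix x :: 'a
      show "norm \<bar>F x - G k x\<bar> \<le> 2 * real n * indicator (cball 0 (n + 1)) x"
        using Fb[of x] Gb[of k x] G0[of x k] by (auto simp: indicator_def)
    qed
  qed measurable
  then have "\<exists>k. (LINT x|lborel. \<bar>F x - G k x\<bar>) < e / 2"
    using order_tendstoD(2)[of _ 0 _ "e / 2"] e by (fastforce simp: eventually_sequentially)
  then obtain k where k: "(LINT x|lborel. \<bar>F x - G k x\<bar>) < e / 2" by blast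
  have Fint: "integrable lborel F"
    by (rule Bochner_Integration.integrable_bound[OF f]) (auto simp: F_def indicator_def)
  have "(LINT x|lborel. \<bar>f x - G k x\<bar>) \<le> (LINT x|lborel. \<bar>f x - F x\<bar> + \<bar>F x - G k x\<bar>)"
    by (intro integral_mono Bochner_Integration.integrable_add integrable_abs Bochner_Integration.integrable_diff f Fint Gint) linarith
  also have "\<dots> = (LINT x|lborel. \<bar>f x - F x\<bar>) + (LINT x|lborel. \<bar>F x - G k x\<bar>)"
    by (intro Bochner_Integration.integral_add integrable_abs Bochner_Integration.integrable_diff f Fint Gint)
  also have "\<dots> < e" using n k unfolding F_def by linarith
  finally show thesis using that[of "G k" "n + 1"] Gc G0 Gint by blast
qed

text \<open>Uniform continuity settles the case of a continuous compactly supported function;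
  density and translation invariance of the integral carry it to \<open>f\<close>, with e split into
  three parts.\<close>

lemma L1_translation_continuous:
  fixes f :: "'a::euclidean_space \<Rightarrow> real"
  assumes f: "integrable lborel f" and e: "e > 0"
  obtains d where "d > 0" "\<And>y. norm y < d \<Longrightarrow> (LINT x|lborel. \<bar>f (x + y) - f x\<bar>) < e"
proof -
  obtain g R where g: "continuous_on UNIV g" "\<And>x. norm x \<ge> R \<Longrightarrow> g x = 0" "integrable lborel g"
    "(LINT x|lborel. \<bar>f x - g x\<bar>) < e / 3"
    using L1_dense_compact_support[OF f, of "e / 3"] e by auto
  define V where "V = measure lborel (cball (0::'a) (\<bar>R\<bar> + 1))"
  have V: "V \<ge> 0" by (simp add: V_def)
  \<comment> \<open>For shifts shorter than 1, the difference vanishes off the ball of radius |R| +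
    1, whose volume is \<open>V\<close>; the larger radius contains both \<open>x\<close> and
    \<open>x + y\<close>.\<close>
  have "uniformly_continuous_on (cball 0 (\<bar>R\<bar> + 3)) g"
    using g(1) by (intro compact_uniformly_continuous) (auto intro: continuous_on_subset)
  then obtain d where d: "d > 0"
    "\<And>x y. x \<in> cball 0 (\<bar>R\<bar> + 3) \<Longrightarrow> y \<in> cball 0 (\<bar>R\<bar> + 3) \<Longrightarrow> dist y x < d \<Longrightarrow> dist (g y) (g x) < e / (3 * (V + 1))"
    unfolding uniformly_continuous_on_def using e V
    by (metis add_nonneg_pos divide_pos_pos mult_pos_pos zero_less_numeral zero_less_one)
  show thesis
  proof (rule that[of "min d 1"])
    show "min d 1 > 0" using d by simp
    fix y :: 'a assume y: "norm y < min d 1"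
    have [measurable]: "g \<in> borel_measurable borel" "f \<in> borel_measurable borel" using g f by auto
    have bd: "\<bar>g (x + y) - g x\<bar> \<le> e / (3 * (V + 1)) * indicator (cball 0 (\<bar>R\<bar> + 1)) x" for x
    proof (cases "x \<in> cball 0 (\<bar>R\<bar> + 1)")
      case True
      have "norm (x + y) \<le> \<bar>R\<bar> + 3" using True y norm_triangle_ineq[of x y] by auto
      then have "x + y \<in> cball 0 (\<bar>R\<bar> + 3)" by (simp only: mem_cball_0)
      then have "dist (g (x + y)) (g x) < e / (3 * (V + 1))"
        using True y by (intro d(2)) (auto simp: dist_norm)
      then show ?thesis using True by (simp add: dist_real_def)
    next
      case False
      have "norm x \<le> norm (x + y) + norm y" using norm_triangle_ineq4[of "x + y" y] by simp
      then have "norm (x + y) \<ge> R" "norm x \<ge> R" using False y by auto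
      then show ?thesis using g(2) False by simp
    qed
    have gs: "integrable lborel (\<lambda>x. g (x + y))" "integrable lborel (\<lambda>x. f (x + y))"
      using integrable_shift g(3) f by auto
    have "(LINT x|lborel. \<bar>g (x + y) - g x\<bar>) \<le> (LINT x|lborel. e / (3 * (V + 1)) * indicator (cball 0 (\<bar>R\<bar> + 1)) (x::'a))"
      using bd by (intro integral_mono integrable_abs Bochner_Integration.integrable_diff gs g
          integrable_mult_right integrable_real_indicator) (simp_all add: emeasure_lborel_cball_finite[unfolded infinity_ennreal_def])
    also have "\<dots> = e / (3 * (V + 1)) * V"
      by (simp add: V_def)
    also have "\<dots> \<le> e / 3" using e V by (simp add: field_simps)
    finally have 1: "(LINT x|lborel. \<bar>g (x + y) - g x\<bar>) \<le> e / 3" .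
    have 2: "(LINT x|lborel. \<bar>f (x + y) - g (x + y)\<bar>) < e / 3"
      using g(4) integral_shift[of "\<lambda>x. \<bar>f x - g x\<bar>" y] by simp
    have "(LINT x|lborel. \<bar>f (x + y) - f x\<bar>)
        \<le> (LINT x|lborel. \<bar>f (x + y) - g (x + y)\<bar> + \<bar>g (x + y) - g x\<bar> + \<bar>f x - g x\<bar>)"
      by (intro integral_mono integrable_abs Bochner_Integration.integrable_add Bochner_Integration.integrable_diff gs g f) linarith
    also have "\<dots> = (LINT x|lborel. \<bar>f (x + y) - g (x + y)\<bar>) + (LINT x|lborel. \<bar>g (x + y) - g x\<bar>)
        + (LINT x|lborel. \<bar>f x - g x\<bar>)"
      by (subst Bochner_Integration.integral_add; (subst Bochner_Integration.integral_add)?;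
          (intro integrable_abs Bochner_Integration.integrable_add Bochner_Integration.integrable_diff gs g f refl)?)
    also have "\<dots> < e" using 1 2 g(4) by linarith
    finally show "(LINT x|lborel. \<bar>f (x + y) - f x\<bar>) < e" .
  qed
qed


section \<open>Mollification\<close>

text \<open>The kernel is evaluated at \<open>y - x\<close>: a kernel supported in the positive orthant then only uses
  values of \<open>W\<close> at later times.\<close>

definition cor :: "('a::euclidean_space \<Rightarrow> real) \<Rightarrow> ('a \<Rightarrow> real) \<Rightarrow> 'a \<Rightarrow> real" where
  "cor W \<psi> x = (LINT y|lborel. W y * \<psi> (y - x))"

definition mollifiers :: "(nat \<Rightarrow> 'a::euclidean_space \<Rightarrow> real) \<Rightarrow> bool" where
  "mollifiers \<rho> \<longleftrightarrow> (\<forall>k. \<rho> k \<in> Cc_infty UNIV \<and> (\<forall>y. 0 \<le> \<rho> k y) \<and> (LINT y|lborel. \<rho> k y) = 1 \<and>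
     (\<forall>y. \<rho> k y \<noteq> 0 \<longrightarrow> (\<forall>b\<in>Basis. 0 < y \<bullet> b) \<and> norm y < 1 / real (Suc k)))"

lemma mollifiers_exist: "\<exists>\<rho>::nat \<Rightarrow> 'a::euclidean_space \<Rightarrow> real. mollifiers \<rho>"
proof -
  \<comment> \<open>Dividing by the dimension keeps the l1 norm, hence the norm, below 1 / (k + 1)
    on the box.\<close>
  define u :: "nat \<Rightarrow> 'a" where "u k = (1 / (real (Suc k) * real (DIM('a)))) *\<^sub>R One" for k
  define c where "c k = (LINT y|lborel. box_bump 0 (u k) y)" for k
  have bb: "box_bump 0 (u k) \<in> Cc_infty UNIV" for k by (rule box_bump_Cc_infty) simp
  have upos: "u k \<bullet> b = 1 / (real (Suc k) * real (DIM('a)))" if "b \<in> Basis" for k b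
    using that by (simp add: u_def)
  have cpos: "c k > 0" for k
  proof -
    have "c k \<noteq> 0"
    proof
      assume "c k = 0"
      then have "AE y in lborel. box_bump 0 (u k) y = 0"
        unfolding c_def
        by (subst (asm) integral_nonneg_eq_0_iff_AE) (auto intro!: Cc_infty_integrable[OF bb] box_bump_nonneg)
      then have "AE y in lborel. y \<notin> box 0 (u k)"
        by eventually_elim (metis box_bump_pos_iff less_irrefl)
      then have "emeasure lborel (box 0 (u k)) = 0"
        by (subst (asm) AE_iff_measurable[OF _ refl]) auto
      then have "box 0 (u k) \<in> null_sets lborel" by auto
      then have "box 0 (u k) = {}"
        using open_box negligible_iff_null_sets open_not_negligible null_sets_completionI by metis
      moreover have "(1 / 2) *\<^sub>R u k \<in> box 0 (u k)" by (auto simp: mem_box upos divide_strict_left_mono)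
      ultimately show False by blast
    qed
    moreover have "c k \<ge> 0" unfolding c_def by (rule Bochner_Integration.integral_nonneg[OF box_bump_nonneg])
    ultimately show ?thesis by simp
  qed
  have nrm: "norm y < 1 / real (Suc k)" if y: "y \<in> box 0 (u k)" for y k
  proof -
    have "norm y \<le> (\<Sum>b\<in>Basis. \<bar>y \<bullet> b\<bar>)" by (rule norm_le_l1)
    also have "\<dots> < (\<Sum>b\<in>(Basis::'a set). 1 / (real (Suc k) * real (DIM('a))))"
      using y upos by (intro sum_strict_mono) (auto simp: mem_box)
    also have "\<dots> = 1 / real (Suc k)" by simp
    finally show ?thesis .
  qed
  have "mollifiers (\<lambda>k y. (1 / c k) * box_bump 0 (u k) y)"
    unfolding mollifiers_def
  proof (intro allI conjI impI)
    fix k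
    show "(\<lambda>y. (1 / c k) * box_bump 0 (u k) y) \<in> Cc_infty UNIV" by (rule Cc_infty_cmult[OF bb])
    show "0 \<le> (1 / c k) * box_bump 0 (u k) y" for y
      using cpos[of k] box_bump_nonneg[of 0 "u k" y] by simp
    show "(LINT y|lborel. (1 / c k) * box_bump 0 (u k) y) = 1"
      using cpos[of k] by (simp add: c_def)
    fix y assume "(1 / c k) * box_bump 0 (u k) y \<noteq> 0"
    then have "y \<in> box 0 (u k)" using box_bump_eq_0 by fastforce
    then show "\<forall>b\<in>Basis. 0 < y \<bullet> b" "norm y < 1 / real (Suc k)"
      using nrm by (auto simp: mem_box)
  qed
  then show ?thesis by blast
qed

lemma mollifiersD:
  assumes "mollifiers \<rho>"
  shows "\<rho> k \<in> Cc_infty UNIV" "0 \<le> \<rho> k y" "(LINT y|lborel. \<rho> k y) = 1"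
    "\<rho> k y \<noteq> 0 \<Longrightarrow> b \<in> Basis \<Longrightarrow> 0 < y \<bullet> b" "\<rho> k y \<noteq> 0 \<Longrightarrow> norm y < 1 / real (Suc k)"
  using assms by (auto simp: mollifiers_def)

lemma cor_shift:
  assumes [measurable]: "W \<in> borel_measurable borel" "\<psi> \<in> borel_measurable borel"
  shows "cor W \<psi> x = (LINT y|lborel. W (x + y) * \<psi> y)"
  unfolding cor_def using integral_shift[of "\<lambda>y. W y * \<psi> (y - x)" x] by (simp add: add.commute)

lemma Cc_infty_borel: "f \<in> Cc_infty U \<Longrightarrow> f \<in> borel_measurable borel"
  using Cc_infty_continuous borel_measurable_continuous_onI by blast

lemma cor_measurable:
  assumes [measurable]: "W \<in> borel_measurable borel" "\<psi> \<in> borel_measurable borel"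
  shows "cor W \<psi> \<in> borel_measurable borel"
  unfolding cor_def[abs_def] by measurable

text \<open>The L1 distance between \<open>f\<close> and its mollification is at most the average,
  against the kernel, of the L1 distances between \<open>f\<close> and its translates; for a
  concentrated kernel only short translations count.\<close>

lemma mollification_L1:
  fixes f :: "'a::euclidean_space \<Rightarrow> real"
  assumes f: "integrable lborel f" and \<rho>: "mollifiers \<rho>"
  shows "(\<lambda>k. LINT x|lborel. \<bar>cor f (\<rho> k) x - f x\<bar>) \<longlonglongrightarrow> 0"
    and "integrable lborel (cor f (\<rho> k))"
proof -
  have fm[measurable]: "f \<in> borel_measurable borel" using f by auto
  have \<rho>m[measurable]: "\<rho> k \<in> borel_measurable borel" for k
    using mollifiersD(1)[OF \<rho>] Cc_infty_borel by blast
  have \<rho>i: "integrable lborel (\<rho> k)" for k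
    using mollifiersD(1)[OF \<rho>] Cc_infty_integrable by blast
  have cm[measurable]: "cor f (\<rho> k) \<in> borel_measurable borel" for k by (rule cor_measurable) auto
  have \<rho>1: "(\<integral>\<^sup>+y. ennreal (\<rho> k y) \<partial>lborel) = 1" for k
    using nn_integral_eq_integral[OF \<rho>i[of k]] mollifiersD(2,3)[OF \<rho>] by simp
  \<comment> \<open>For an individual \<open>x\<close> the product may fail to be integrable, and
    the integral would then be 0 by default. Tonelli excludes this for almost every
    \<open>x\<close>, which is all the L1 estimate needs.\<close>
  have int2: "AE x in lborel. integrable lborel (\<lambda>y. f (x + y) * \<rho> k y)" for k
  proof -
    have "integrable (lborel \<Otimes>\<^sub>M lborel) (\<lambda>(x, y). f (x + y) * \<rho> k y)"
    proof (rule integrableI_bounded)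
      have "(\<integral>\<^sup>+xy. ennreal (norm (case xy of (x, y) \<Rightarrow> f (x + y) * \<rho> k y)) \<partial>(lborel \<Otimes>\<^sub>M lborel))
        = (\<integral>\<^sup>+y. (\<integral>\<^sup>+x. ennreal \<bar>f (x + y)\<bar> * ennreal (\<rho> k y) \<partial>lborel) \<partial>lborel)"
        by (subst lborel_pair.nn_integral_snd[symmetric])
           (auto simp: abs_mult ennreal_mult mollifiersD(2)[OF \<rho>])
      also have "\<dots> = (\<integral>\<^sup>+y. (\<integral>\<^sup>+x. ennreal \<bar>f x\<bar> \<partial>lborel) * ennreal (\<rho> k y) \<partial>lborel)"
        using nn_integral_shift[of "\<lambda>x. ennreal \<bar>f x\<bar>"]
        by (intro nn_integral_cong) (simp add: nn_integral_multc)
      also have "\<dots> = (\<integral>\<^sup>+x. ennreal \<bar>f x\<bar> \<partial>lborel)"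
        by (simp add: nn_integral_cmult \<rho>1)
      also have "\<dots> < \<infinity>" using f by (simp add: integrable_iff_bounded)
      finally show "(\<integral>\<^sup>+xy. ennreal (norm (case xy of (x, y) \<Rightarrow> f (x + y) * \<rho> k y)) \<partial>(lborel \<Otimes>\<^sub>M lborel)) < \<infinity>" .
    qed measurable
    from lborel_pair.AE_integrable_fst'[OF this] show ?thesis by simp
  qed
  have key: "(\<integral>\<^sup>+x. ennreal \<bar>cor f (\<rho> k) x - f x\<bar> \<partial>lborel)
      \<le> (\<integral>\<^sup>+y. ennreal (LINT x|lborel. \<bar>f (x + y) - f x\<bar>) * ennreal (\<rho> k y) \<partial>lborel)" for k
  proof -
    have "(\<integral>\<^sup>+x. ennreal \<bar>cor f (\<rho> k) x - f x\<bar> \<partial>lborel)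
        \<le> (\<integral>\<^sup>+x. (\<integral>\<^sup>+y. ennreal (\<bar>f (x + y) - f x\<bar> * \<rho> k y) \<partial>lborel) \<partial>lborel)"
    proof (rule nn_integral_mono_AE)
      show "AE x in lborel. ennreal \<bar>cor f (\<rho> k) x - f x\<bar>
          \<le> (\<integral>\<^sup>+y. ennreal (\<bar>f (x + y) - f x\<bar> * \<rho> k y) \<partial>lborel)"
        using int2[of k]
      proof eventually_elim
        case (elim x)
        have i: "integrable lborel (\<lambda>y. (f (x + y) - f x) * \<rho> k y)"
          unfolding left_diff_distrib
          using elim \<rho>i by (intro Bochner_Integration.integrable_diff) auto
        have "cor f (\<rho> k) x - f x = (LINT y|lborel. (f (x + y) - f x) * \<rho> k y)"
          unfolding left_diff_distrib cor_shift[OF fm \<rho>m]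
          using elim \<rho>i[of k] by (subst Bochner_Integration.integral_diff) (auto simp: mollifiersD(3)[OF \<rho>])
        then have "ennreal \<bar>cor f (\<rho> k) x - f x\<bar> \<le> (\<integral>\<^sup>+y. ennreal (norm ((f (x + y) - f x) * \<rho> k y)) \<partial>lborel)"
          using integral_norm_bound_ennreal[OF i] by simp
        then show ?case by (simp add: abs_mult mollifiersD(2)[OF \<rho>])
      qed
    qed
    also have "\<dots> = (\<integral>\<^sup>+y. (\<integral>\<^sup>+x. ennreal (\<bar>f (x + y) - f x\<bar> * \<rho> k y) \<partial>lborel) \<partial>lborel)"
      by (rule lborel_pair.Fubini'[symmetric]) measurable
    also have "\<dots> = (\<integral>\<^sup>+y. ennreal (LINT x|lborel. \<bar>f (x + y) - f x\<bar>) * ennreal (\<rho> k y) \<partial>lborel)"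
    proof (rule nn_integral_cong)
      fix y
      have "integrable lborel (\<lambda>x. \<bar>f (x + y) - f x\<bar>)"
        by (intro integrable_abs Bochner_Integration.integrable_diff integrable_shift f)
      from nn_integral_eq_integral[OF this]
      show "(\<integral>\<^sup>+x. ennreal (\<bar>f (x + y) - f x\<bar> * \<rho> k y) \<partial>lborel)
          = ennreal (LINT x|lborel. \<bar>f (x + y) - f x\<bar>) * ennreal (\<rho> k y)"
        by (simp add: ennreal_mult mollifiersD(2)[OF \<rho>] nn_integral_multc)
    qed
    finally show ?thesis .
  qed
  have bound: "(LINT x|lborel. \<bar>f (x + y) - f x\<bar>) \<le> 2 * (LINT x|lborel. \<bar>f x\<bar>)" for y
  proof -
    have "(LINT x|lborel. \<bar>f (x + y) - f x\<bar>) \<le> (LINT x|lborel. \<bar>f (x + y)\<bar> + \<bar>f x\<bar>)"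
      by (intro integral_mono integrable_abs Bochner_Integration.integrable_diff
          Bochner_Integration.integrable_add integrable_shift f) linarith
    also have "\<dots> = (LINT x|lborel. \<bar>f (x + y)\<bar>) + (LINT x|lborel. \<bar>f x\<bar>)"
      by (intro Bochner_Integration.integral_add integrable_abs integrable_shift f)
    also have "(LINT x|lborel. \<bar>f (x + y)\<bar>) = (LINT x|lborel. \<bar>f x\<bar>)"
      using integral_shift[of "\<lambda>x. \<bar>f x\<bar>" y] by simp
    finally show ?thesis by simp
  qed
  have le: "(\<integral>\<^sup>+x. ennreal \<bar>cor f (\<rho> k) x - f x\<bar> \<partial>lborel) \<le> ennreal e"
    if *: "\<And>y. \<rho> k y \<noteq> 0 \<Longrightarrow> (LINT x|lborel. \<bar>f (x + y) - f x\<bar>) \<le> e" for e k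
  proof -
    have "(\<integral>\<^sup>+y. ennreal (LINT x|lborel. \<bar>f (x + y) - f x\<bar>) * ennreal (\<rho> k y) \<partial>lborel)
        \<le> (\<integral>\<^sup>+y. ennreal e * ennreal (\<rho> k y) \<partial>lborel)"
    proof (rule nn_integral_mono)
      fix y
      show "ennreal (LINT x|lborel. \<bar>f (x + y) - f x\<bar>) * ennreal (\<rho> k y) \<le> ennreal e * ennreal (\<rho> k y)"
        using *[of y] by (cases "\<rho> k y = 0") (auto intro!: mult_right_mono ennreal_leI)
    qed
    also have "\<dots> = ennreal e" by (simp add: nn_integral_cmult \<rho>1)
    finally show ?thesis using key order_trans by blast
  qed
  have di: "integrable lborel (\<lambda>x. cor f (\<rho> k) x - f x)" for k
  proof (rule integrableI_bounded)
    have "(\<integral>\<^sup>+x. ennreal (norm (cor f (\<rho> k) x - f x)) \<partial>lborel) \<le> ennreal (2 * (LINT x|lborel. \<bar>f x\<bar>))"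
      using le[OF bound] by simp
    then show "(\<integral>\<^sup>+x. ennreal (norm (cor f (\<rho> k) x - f x)) \<partial>lborel) < \<infinity>"
      using ennreal_less_top le_less_trans by (metis infinity_ennreal_def)
  qed measurable
  from Bochner_Integration.integrable_add[OF di f] show "integrable lborel (cor f (\<rho> k))" by simp
  show "(\<lambda>k. LINT x|lborel. \<bar>cor f (\<rho> k) x - f x\<bar>) \<longlonglongrightarrow> 0"
  proof (rule LIMSEQ_I)
    fix e :: real assume e: "e > 0"
    obtain d where d: "d > 0" "\<And>y. norm y < d \<Longrightarrow> (LINT x|lborel. \<bar>f (x + y) - f x\<bar>) < e / 2"
      using L1_translation_continuous[OF f, of "e / 2"] e by auto
    obtain N where N: "1 / real (Suc N) < d" using nat_approx_posE[OF d(1)] by blast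
    show "\<exists>no. \<forall>n\<ge>no. norm ((LINT x|lborel. \<bar>cor f (\<rho> n) x - f x\<bar>) - 0) < e"
    proof (intro exI allI impI)
      fix n assume n: "n \<ge> N"
      have "1 / real (Suc n) \<le> 1 / real (Suc N)" using n by (simp add: frac_le)
      then have "(LINT x|lborel. \<bar>f (x + y) - f x\<bar>) \<le> e / 2" if "\<rho> n y \<noteq> 0" for y
        using d(2)[of y] mollifiersD(5)[OF \<rho> that] N by linarith
      from le[OF this] have "(\<integral>\<^sup>+x. ennreal \<bar>cor f (\<rho> n) x - f x\<bar> \<partial>lborel) \<le> ennreal (e / 2)" .
      then have "(LINT x|lborel. \<bar>cor f (\<rho> n) x - f x\<bar>) \<le> e / 2"
        using e di by (subst (asm) nn_integral_eq_integral) (auto simp: ennreal_le_iff)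
      moreover have "(LINT x|lborel. \<bar>cor f (\<rho> n) x - f x\<bar>) \<ge> 0" by simp
      ultimately show "norm ((LINT x|lborel. \<bar>cor f (\<rho> n) x - f x\<bar>) - 0) < e" using e by simp
    qed
  qed
qed

section \<open>Uniqueness of distributional derivatives\<close>

lemma locally_integrable_diff:
  "locally_integrable U f \<Longrightarrow> locally_integrable U g \<Longrightarrow> locally_integrable U (\<lambda>x. f x - g x)"
  unfolding locally_integrable_def by auto

lemma integrable_times_Cc:
  assumes f: "locally_integrable U f" and \<phi>: "\<phi> \<in> Cc_infty U"
  shows "integrable lborel (\<lambda>x. f x * \<phi> x)"
proof -
  obtain K where K: "compact K" "K \<subseteq> U" "\<And>x. x \<notin> K \<Longrightarrow> \<phi> x = 0"
    using Cc_inftyD(2)[OF \<phi>] by blast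
  obtain C where C: "C \<ge> 0" "\<And>x. \<bar>\<phi> x\<bar> \<le> C" using Cc_infty_bounded[OF \<phi>] by blast
  have i: "integrable lborel (\<lambda>x. indicator K x * f x)"
    using f K by (auto simp: locally_integrable_def set_integrable_def)
  have [measurable]: "(\<lambda>x. indicator K x * f x) \<in> borel_measurable borel" "\<phi> \<in> borel_measurable borel"
    using i Cc_infty_borel[OF \<phi>] by auto
  have "integrable lborel (\<lambda>x. (indicator K x * f x) * \<phi> x)"
  proof (rule Bochner_Integration.integrable_bound[OF integrable_mult_right[OF i, of C]])
    show "AE x in lborel. norm ((indicator K x * f x) * \<phi> x) \<le> norm (C * (indicator K x * f x))"
    proof (rule AE_I2)
      fix x
      have "\<bar>indicator K x * f x\<bar> * \<bar>\<phi> x\<bar> \<le> \<bar>indicator K x * f x\<bar> * C"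
        using C by (intro mult_left_mono) auto
      then show "norm ((indicator K x * f x) * \<phi> x) \<le> norm (C * (indicator K x * f x))"
        using C(1) by (simp add: abs_mult mult_ac)
    qed
  qed measurable
  moreover have "(\<lambda>x. (indicator K x * f x) * \<phi> x) = (\<lambda>x. f x * \<phi> x)"
    using K(3) by (auto simp: fun_eq_iff indicator_def)
  ultimately show ?thesis by simp
qed

text \<open>On a compact \<open>C n\<close> and for concentrated kernels, the mollification at x
  only tests \<open>f\<close> against a translated kernel supported in the next compact set, hence
  is 0; yet it converges in L1 to \<open>f\<close> cut off to that set.\<close>

lemma test_integrals_zero_imp_AE_zero:
  fixes f :: "'a::euclidean_space \<Rightarrow> real"
  assumes U: "open U" and f: "locally_integrable U f"
    and 0: "\<And>\<phi>. \<phi> \<in> Cc_infty U \<Longrightarrow> (LINT x|lborel. f x * \<phi> x) = 0"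
  shows "AE x in lborel. x \<in> U \<longrightarrow> f x = 0"
proof -
  obtain \<rho> :: "nat \<Rightarrow> 'a \<Rightarrow> real" where \<rho>: "mollifiers \<rho>" using mollifiers_exist by blast
  obtain C where C: "\<And>n. compact (C n)" "\<And>n. C n \<subseteq> U" "\<And>n. C n \<subseteq> interior (C (Suc n))"
    "\<Union>(range C) = U" using open_Union_compact_subsets[OF U] by metis
  have "AE x in lborel. x \<in> C n \<longrightarrow> f x = 0" for n
  proof -
    let ?g = "\<lambda>x. indicator (C (Suc n)) x * f x"
    have gi: "integrable lborel ?g"
      using f C by (auto simp: locally_integrable_def set_integrable_def)
    then have [measurable]: "?g \<in> borel_measurable borel" by auto
    obtain d where d: "d > 0" "(\<Union>x\<in>C n. ball x d) \<subseteq> interior (C (Suc n))"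
      using compact_subset_open_imp_ball_epsilon_subset[OF C(1) open_interior C(3)] by blast
    obtain N where N: "1 / real (Suc N) < d" using nat_approx_posE[OF d(1)] by blast
    have [measurable]: "C n \<in> sets borel" using C(1) by (simp add: borel_compact)
    have z: "cor ?g (\<rho> k) x = 0" if k: "k \<ge> N" and x: "x \<in> C n" for k x
    proof -
      have sm: "1 / real (Suc k) < d"
        using N k by (smt (verit) frac_le of_nat_0_less_iff of_nat_mono Suc_le_mono zero_less_Suc)
      have in1: "y \<in> C (Suc n)" if "\<rho> k (y - x) \<noteq> 0" for y
      proof -
        have "y \<in> ball x d" using mollifiersD(5)[OF \<rho> that] sm by (auto simp: dist_norm norm_minus_commute)
        then show ?thesis using d(2) x interior_subset by blast
      qed
      have "(\<lambda>y. \<rho> k (- x + 1 *\<^sub>R y)) \<in> Cc_infty U"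
        by (rule Cc_infty_affine[where L="C (Suc n)"])
           (use mollifiersD(1)[OF \<rho>] in1 C(2) compact_imp_closed[OF C(1)] in \<open>auto simp: algebra_simps\<close>)
      then have "(\<lambda>y. \<rho> k (y - x)) \<in> Cc_infty U" by simp
      from 0[OF this] have "(LINT y|lborel. f y * \<rho> k (y - x)) = 0" .
      moreover have "(\<lambda>y. ?g y * \<rho> k (y - x)) = (\<lambda>y. f y * \<rho> k (y - x))"
        using in1 by (auto simp: fun_eq_iff indicator_def)
      ultimately show ?thesis unfolding cor_def by simp
    qed
    have gn: "integrable lborel (\<lambda>x. indicator (C n) x * \<bar>?g x\<bar>)"
      using integrable_mult_indicator[OF _ integrable_abs[OF gi], of "C n"]
      by (simp only: real_scaleR_def) (simp add: borel_compact C(1))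
    have "(LINT x|lborel. indicator (C n) x * \<bar>?g x\<bar>) \<le> (LINT x|lborel. \<bar>cor ?g (\<rho> k) x - ?g x\<bar>)"
      if "k \<ge> N" for k
    proof (rule integral_mono)
      show "integrable lborel (\<lambda>x. indicator (C n) x * \<bar>?g x\<bar>)" by (rule gn)
      show "integrable lborel (\<lambda>x. \<bar>cor ?g (\<rho> k) x - ?g x\<bar>)"
        by (intro integrable_abs Bochner_Integration.integrable_diff gi mollification_L1(2)[OF gi \<rho>])
      show "indicator (C n) x * \<bar>?g x\<bar> \<le> \<bar>cor ?g (\<rho> k) x - ?g x\<bar>" for x
        using z[OF that, of x] by (cases "x \<in> C n") auto
    qed
    then have "(LINT x|lborel. indicator (C n) x * \<bar>?g x\<bar>) \<le> 0"
      using mollification_L1(1)[OF gi \<rho>] by (intro LIMSEQ_le_const) auto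
    moreover have "(LINT x|lborel. indicator (C n) x * \<bar>?g x\<bar>) \<ge> 0"
      by (intro Bochner_Integration.integral_nonneg) auto
    ultimately have "(LINT x|lborel. indicator (C n) x * \<bar>?g x\<bar>) = 0" by simp
    then have "AE x in lborel. indicator (C n) x * \<bar>?g x\<bar> = 0"
      using integral_nonneg_eq_0_iff_AE[OF gn] by simp
    then show ?thesis
    proof eventually_elim
      case (elim x)
      then show ?case using C(3)[of n] interior_subset[of "C (Suc n)"] by (auto simp: indicator_def)
    qed
  qed
  then have "AE x in lborel. \<forall>n. x \<in> C n \<longrightarrow> f x = 0" by (subst AE_all_countable) blast
  then show ?thesis by eventually_elim (use C(4) in blast)
qed

lemma has_weak_deriv_unique:
  assumes U: "open U" and b: "b \<in> Basis"
    and v: "has_weak_deriv U u b v" and w: "has_weak_deriv U u' b w"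
    and u: "AE x in lborel. x \<in> U \<longrightarrow> u x = u' x"
  shows "AE x in lborel. x \<in> U \<longrightarrow> v x = w x"
proof -
  have lv: "locally_integrable U v" and lw: "locally_integrable U w"
    using v w by (auto simp: has_weak_deriv_def)
  have "AE x in lborel. x \<in> U \<longrightarrow> v x - w x = 0"
  proof (rule test_integrals_zero_imp_AE_zero[OF U locally_integrable_diff[OF lv lw]])
    fix \<phi> assume \<phi>: "\<phi> \<in> Cc_infty U"
    have "(LINT x:U|lborel. v x * \<phi> x) = - (LINT x:U|lborel. u x * pd b \<phi> x)"
      using v \<phi> by (simp add: has_weak_deriv_def)
    also have "(LINT x:U|lborel. u x * pd b \<phi> x) = (LINT x:U|lborel. u' x * pd b \<phi> x)"
    proof -
      have "integrable lborel (\<lambda>x. u x * pd b \<phi> x)" "integrable lborel (\<lambda>x. u' x * pd b \<phi> x)"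
        using v w integrable_times_Cc[OF _ Cc_infty_pd[OF \<phi> b]] by (auto simp: has_weak_deriv_def)
      moreover have "AE x in lborel. u x * pd b \<phi> x = u' x * pd b \<phi> x"
        using u Cc_inftyD(2)[OF Cc_infty_pd[OF \<phi> b]] by (auto elim!: eventually_mono)
      ultimately show ?thesis unfolding set_integral_Cc[OF Cc_infty_pd[OF \<phi> b]]
        by (intro integral_cong_AE) auto
    qed
    also have "- \<dots> = (LINT x:U|lborel. w x * \<phi> x)"
      using w \<phi> by (simp add: has_weak_deriv_def)
    finally have "(LINT x|lborel. v x * \<phi> x) = (LINT x|lborel. w x * \<phi> x)"
      by (simp add: set_integral_Cc[OF \<phi>])
    then show "(LINT x|lborel. (v x - w x) * \<phi> x) = 0"
      using integrable_times_Cc[OF lv \<phi>] integrable_times_Cc[OF lw \<phi>]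
      by (simp add: left_diff_distrib)
  qed
  then show ?thesis by simp
qed

section \<open>The abstract energy inequality\<close>

section \<open>The energy inequality for skew-adjoint derivations\<close>

definition lin_closed :: "('x \<Rightarrow> real) set \<Rightarrow> bool" where
  "lin_closed V \<longleftrightarrow> (\<lambda>_. 0) \<in> V \<and> (\<forall>f\<in>V. \<forall>g\<in>V. (\<lambda>x. f x + g x) \<in> V) \<and> (\<forall>f\<in>V. \<forall>c. (\<lambda>x. c * f x) \<in> V)"

definition bilin :: "('x \<Rightarrow> real) set \<Rightarrow> (('x \<Rightarrow> real) \<Rightarrow> ('x \<Rightarrow> real) \<Rightarrow> real) \<Rightarrow> bool" where
  "bilin V C \<longleftrightarrow> (\<forall>f\<in>V. \<forall>g\<in>V. \<forall>h\<in>V. C (\<lambda>x. f x + g x) h = C f h + C g h \<and> C h (\<lambda>x. f x + g x) = C h f + C h g) \<and>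
     (\<forall>f\<in>V. \<forall>h\<in>V. \<forall>c. C (\<lambda>x. c * f x) h = c * C f h \<and> C h (\<lambda>x. c * f x) = c * C h f)"

context
  fixes V :: "('x \<Rightarrow> real) set"
  assumes V: "lin_closed V"
begin

lemma lin_closed_sum: "(\<And>i. i \<in> I \<Longrightarrow> f i \<in> V) \<Longrightarrow> (\<lambda>x. \<Sum>i\<in>I. f i x) \<in> V"
  by (induction I rule: infinite_finite_induct) (use V in \<open>auto simp: lin_closed_def\<close>)

context
  fixes C :: "('x \<Rightarrow> real) \<Rightarrow> ('x \<Rightarrow> real) \<Rightarrow> real"
  assumes C: "bilin V C"
begin

lemma bilinD:
  "f \<in> V \<Longrightarrow> g \<in> V \<Longrightarrow> h \<in> V \<Longrightarrow> C (\<lambda>x. f x + g x) h = C f h + C g h"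
  "f \<in> V \<Longrightarrow> g \<in> V \<Longrightarrow> h \<in> V \<Longrightarrow> C h (\<lambda>x. f x + g x) = C h f + C h g"
  "f \<in> V \<Longrightarrow> h \<in> V \<Longrightarrow> C (\<lambda>x. c * f x) h = c * C f h"
  "f \<in> V \<Longrightarrow> h \<in> V \<Longrightarrow> C h (\<lambda>x. c * f x) = c * C h f"
  using C by (simp_all add: bilin_def)

lemma bilin_zero: "h \<in> V \<Longrightarrow> C (\<lambda>_. 0) h = 0" "h \<in> V \<Longrightarrow> C h (\<lambda>_. 0) = 0"
proof -
  assume h: "h \<in> V"
  have "C (\<lambda>x. 0 * h x) h = 0 * C h h" "C h (\<lambda>x. 0 * h x) = 0 * C h h"
    by (intro bilinD h)+
  then show "C (\<lambda>_. 0) h = 0" "C h (\<lambda>_. 0) = 0" by simp_all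
qed

lemma bilin_sum_left:
  "(\<And>i. i \<in> I \<Longrightarrow> f i \<in> V) \<Longrightarrow> h \<in> V \<Longrightarrow> C (\<lambda>x. \<Sum>i\<in>I. f i x) h = (\<Sum>i\<in>I. C (f i) h)"
proof (induction I rule: infinite_finite_induct)
  case (insert i F)
  then have "(\<lambda>x. \<Sum>i\<in>F. f i x) \<in> V" by (intro lin_closed_sum) auto
  then have "C (\<lambda>x. f i x + (\<Sum>i\<in>F. f i x)) h = C (f i) h + C (\<lambda>x. \<Sum>i\<in>F. f i x) h"
    using insert.prems by (intro bilinD) auto
  then show ?case using insert by simp
qed (simp_all add: bilin_zero)

lemma bilin_sum_right:
  "(\<And>i. i \<in> I \<Longrightarrow> f i \<in> V) \<Longrightarrow> h \<in> V \<Longrightarrow> C h (\<lambda>x. \<Sum>i\<in>I. f i x) = (\<Sum>i\<in>I. C h (f i))"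
proof (induction I rule: infinite_finite_induct)
  case (insert i F)
  then have "(\<lambda>x. \<Sum>i\<in>F. f i x) \<in> V" by (intro lin_closed_sum) auto
  then have "C h (\<lambda>x. f i x + (\<Sum>i\<in>F. f i x)) = C h (f i) + C h (\<lambda>x. \<Sum>i\<in>F. f i x)"
    using insert.prems by (intro bilinD) auto
  then show ?case using insert by simp
qed (simp_all add: bilin_zero)

lemma bilin_lincomb:
  assumes "\<And>i. f i \<in> V" "\<And>i. g i \<in> V"
  shows "C (\<lambda>x. \<Sum>i\<in>I. a i * f i x) (\<lambda>x. \<Sum>j\<in>J. b j * g j x)
    = (\<Sum>i\<in>I. \<Sum>j\<in>J. a i * b j * C (f i) (g j))"
proof -
  have cV: "(\<lambda>x. c * f i x) \<in> V" "(\<lambda>x. c * g j x) \<in> V" for c i j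
    using V assms by (auto simp: lin_closed_def)
  have sV: "(\<lambda>x. \<Sum>j\<in>J. b j * g j x) \<in> V" by (intro lin_closed_sum cV)
  have c: "C (\<lambda>x. a i * f i x) h = a i * C (f i) h" "C (f i) (\<lambda>x. b j * g j x) = b j * C (f i) (g j)"
    if "h \<in> V" for i j h by (intro bilinD assms that)+
  have "C (\<lambda>x. \<Sum>i\<in>I. a i * f i x) (\<lambda>x. \<Sum>j\<in>J. b j * g j x)
      = (\<Sum>i\<in>I. a i * C (f i) (\<lambda>x. \<Sum>j\<in>J. b j * g j x))"
    using sV by (subst bilin_sum_left) (auto simp: cV c)
  also have "\<dots> = (\<Sum>i\<in>I. \<Sum>j\<in>J. a i * b j * C (f i) (g j))"
    using cV assms by (intro sum.cong refl, subst bilin_sum_right)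
      (auto simp: c(2)[OF sV] sum_distrib_left mult_ac)
  finally show ?thesis .
qed

text \<open>Inserting the spectral sum of \<open>r\<close> and using bilinearity collects the double
  sum into one term per eigenvector, in which the functions are combined with the eigenvector's
  coordinates.\<close>

lemma psd_sum_diagonalize:
  fixes r :: "real^'n^'n"
  assumes r: "transpose r = r" "\<And>x. 0 \<le> x \<bullet> (r *v x)"
  obtains E :: "(real^'n) set" and l where "finite E" "\<And>b. b \<in> E \<Longrightarrow> l b \<ge> 0"
    "\<And>f g. (\<And>i. f i \<in> V) \<Longrightarrow> (\<And>i. g i \<in> V) \<Longrightarrow> (\<Sum>i\<in>UNIV. \<Sum>j\<in>UNIV. r $ i $ j * C (f i) (g j))
      = (\<Sum>b\<in>E. l b * C (\<lambda>x. \<Sum>i\<in>UNIV. b $ i * f i x) (\<lambda>x. \<Sum>i\<in>UNIV. b $ i * g i x))"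
proof -
  obtain E l where E: "finite E" "orthonormal_eigenvectors r E l" "span E = UNIV"
    using spectral_theorem[OF r(1)] by blast
  have l: "l b \<ge> 0" if "b \<in> E" for b
    using r(2)[of b] E that by (auto simp: orthonormal_eigenvectors_def norm_eq_1)
  have "(\<Sum>i\<in>UNIV. \<Sum>j\<in>UNIV. r $ i $ j * C (f i) (g j))
      = (\<Sum>b\<in>E. l b * C (\<lambda>x. \<Sum>i\<in>UNIV. b $ i * f i x) (\<lambda>x. \<Sum>i\<in>UNIV. b $ i * g i x))"
    if "\<And>i. f i \<in> V" "\<And>i. g i \<in> V" for f g
  proof -
    have "(\<Sum>i\<in>UNIV. \<Sum>j\<in>UNIV. r $ i $ j * C (f i) (g j))
        = (\<Sum>i\<in>UNIV. \<Sum>j\<in>UNIV. \<Sum>b\<in>E. l b * b $ i * b $ j * C (f i) (g j))"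
      unfolding orthonormal_eigenvectors_expand(5)[OF E] by (simp add: sum_distrib_right)
    also have "\<dots> = (\<Sum>b\<in>E. \<Sum>i\<in>UNIV. \<Sum>j\<in>UNIV. l b * b $ i * b $ j * C (f i) (g j))"
      by (rule sum_rotate3)
    also have "\<dots> = (\<Sum>b\<in>E. l b * C (\<lambda>x. \<Sum>i\<in>UNIV. b $ i * f i x) (\<lambda>x. \<Sum>i\<in>UNIV. b $ i * g i x))"
      using that by (simp add: bilin_lincomb sum_distrib_left mult.assoc)
    finally show ?thesis .
  qed
  with E(1) l that show thesis by blast
qed

text \<open>After diagonalization only diagonal values of \<open>C\<close> with nonnegative
  coefficients remain. The form may be unsymmetric: a later application takes - B f (T g), which has
  a sign only on the diagonal.\<close>

lemma psd_form_nonneg: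
  fixes r :: "real^'n^'n"
  assumes r: "transpose r = r" "\<And>x. 0 \<le> x \<bullet> (r *v x)"
    and C0: "\<And>f. f \<in> V \<Longrightarrow> 0 \<le> C f f" and f: "\<And>i. f i \<in> V"
  shows "0 \<le> (\<Sum>i\<in>UNIV. \<Sum>j\<in>UNIV. r $ i $ j * C (f i) (f j))"
proof (rule psd_sum_diagonalize[OF r])
  fix E l assume E: "finite E" "\<And>b. b \<in> E \<Longrightarrow> l b \<ge> 0"
    "\<And>f g. (\<And>i. f i \<in> V) \<Longrightarrow> (\<And>i. g i \<in> V) \<Longrightarrow> (\<Sum>i\<in>UNIV. \<Sum>j\<in>UNIV. r $ i $ j * C (f i) (g j))
      = (\<Sum>b\<in>E. l b * C (\<lambda>x. \<Sum>i\<in>UNIV. b $ i * f i x) (\<lambda>x. \<Sum>i\<in>UNIV. b $ i * g i x))"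
  have "(\<lambda>x. \<Sum>i\<in>UNIV. b $ i * f i x) \<in> V" for b :: "real^'n"
    using V f by (intro lin_closed_sum) (auto simp: lin_closed_def)
  then show ?thesis unfolding E(3)[OF f f] by (intro sum_nonneg mult_nonneg_nonneg E(2) C0)
qed

text \<open>Tensor products of positive semidefinite forms are positive semidefinite: diagonalizing
  \<open>q\<close> in the indices i, j leaves, for each eigenvector, an instance of
  \<open>psd_form_nonneg\<close> in k, l.\<close>

lemma psd_form_tensor_nonneg:
  fixes r q :: "real^'n^'n"
  assumes r: "transpose r = r" "\<And>x. 0 \<le> x \<bullet> (r *v x)"
    and q: "transpose q = q" "\<And>x. 0 \<le> x \<bullet> (q *v x)"
    and C0: "\<And>f. f \<in> V \<Longrightarrow> 0 \<le> C f f" and f: "\<And>i k. f i k \<in> V"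
  shows "0 \<le> (\<Sum>i\<in>UNIV. \<Sum>j\<in>UNIV. \<Sum>k\<in>UNIV. \<Sum>l\<in>UNIV. q $ i $ j * r $ k $ l * C (f i k) (f j l))"
proof (rule psd_sum_diagonalize[OF q])
  fix E l assume E: "finite E" "\<And>b. b \<in> E \<Longrightarrow> l b \<ge> 0"
    "\<And>f g. (\<And>i. f i \<in> V) \<Longrightarrow> (\<And>i. g i \<in> V) \<Longrightarrow> (\<Sum>i\<in>UNIV. \<Sum>j\<in>UNIV. q $ i $ j * C (f i) (g j))
      = (\<Sum>b\<in>E. l b * C (\<lambda>x. \<Sum>i\<in>UNIV. b $ i * f i x) (\<lambda>x. \<Sum>i\<in>UNIV. b $ i * g i x))"
  define F where "F b k = (\<lambda>x. \<Sum>i\<in>UNIV. b $ i * f i k x)" for b :: "real^'n" and k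
  have F: "F b k \<in> V" for b k
    unfolding F_def using V f by (intro lin_closed_sum) (auto simp: lin_closed_def)
  have "(\<Sum>i\<in>UNIV. \<Sum>j\<in>UNIV. \<Sum>k\<in>UNIV. \<Sum>l\<in>UNIV. q $ i $ j * r $ k $ l * C (f i k) (f j l))
      = (\<Sum>k\<in>UNIV. \<Sum>l\<in>UNIV. \<Sum>i\<in>UNIV. \<Sum>j\<in>UNIV. q $ i $ j * r $ k $ l * C (f i k) (f j l))"
    by (subst sum_rotate3) (intro sum.cong refl sum_rotate3)
  also have "\<dots> = (\<Sum>k\<in>UNIV. \<Sum>m\<in>UNIV. r $ k $ m * (\<Sum>b\<in>E. l b * C (F b k) (F b m)))"
    unfolding F_def E(3)[OF f f, symmetric] by (simp add: sum_distrib_left mult_ac)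
  also have "\<dots> = (\<Sum>k\<in>UNIV. \<Sum>m\<in>UNIV. \<Sum>b\<in>E. l b * (r $ k $ m * C (F b k) (F b m)))"
    by (simp add: sum_distrib_left mult_ac)
  also have "\<dots> = (\<Sum>b\<in>E. \<Sum>k\<in>UNIV. \<Sum>m\<in>UNIV. l b * (r $ k $ m * C (F b k) (F b m)))"
    by (rule sum_rotate3)
  also have "\<dots> = (\<Sum>b\<in>E. l b * (\<Sum>k\<in>UNIV. \<Sum>m\<in>UNIV. r $ k $ m * C (F b k) (F b m)))"
    by (simp add: sum_distrib_left)
  finally show ?thesis
    using psd_form_nonneg[OF r C0 F] E(2) by (simp add: sum_nonneg)
qed

end

end

text \<open>Models a weighted L2 product whose weight depends on time only, which makes the spatial
  derivatives \<open>D\<close> skew, and is nondecreasing in time, which gives the sign for the time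
  derivative \<open>T\<close>. The setting is abstract because in the application the elements of
  \<open>V\<close> are mollification kernels rather than the functions being integrated.\<close>

locale energy_form =
  fixes V :: "('x \<Rightarrow> real) set" and B :: "('x \<Rightarrow> real) \<Rightarrow> ('x \<Rightarrow> real) \<Rightarrow> real"
    and D :: "'n::finite \<Rightarrow> ('x \<Rightarrow> real) \<Rightarrow> 'x \<Rightarrow> real" and T :: "('x \<Rightarrow> real) \<Rightarrow> 'x \<Rightarrow> real"
  assumes V: "lin_closed V" and B: "bilin V B"
    and sym: "\<And>f g. B f g = B g f" and pos: "\<And>f. f \<in> V \<Longrightarrow> 0 \<le> B f f"
    and D_closed: "\<And>f i. f \<in> V \<Longrightarrow> D i f \<in> V" and T_closed: "\<And>f. f \<in> V \<Longrightarrow> T f \<in> V"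
    and D_add: "\<And>f g i. f \<in> V \<Longrightarrow> g \<in> V \<Longrightarrow> D i (\<lambda>x. f x + g x) = (\<lambda>x. D i f x + D i g x)"
    and D_cmult: "\<And>f c i. f \<in> V \<Longrightarrow> D i (\<lambda>x. c * f x) = (\<lambda>x. c * D i f x)"
    and T_add: "\<And>f g. f \<in> V \<Longrightarrow> g \<in> V \<Longrightarrow> T (\<lambda>x. f x + g x) = (\<lambda>x. T f x + T g x)"
    and T_cmult: "\<And>f c. f \<in> V \<Longrightarrow> T (\<lambda>x. c * f x) = (\<lambda>x. c * T f x)"
    and D_commute: "\<And>f i j. f \<in> V \<Longrightarrow> D i (D j f) = D j (D i f)"
    and DT_commute: "\<And>f i. f \<in> V \<Longrightarrow> D i (T f) = T (D i f)"
    and skew: "\<And>f g i. f \<in> V \<Longrightarrow> g \<in> V \<Longrightarrow> B (D i f) g = - B f (D i g)"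
    and dissipative: "\<And>f. f \<in> V \<Longrightarrow> B f (T f) \<le> 0"
begin

lemma add_closed: "f \<in> V \<Longrightarrow> g \<in> V \<Longrightarrow> (\<lambda>x. f x + g x) \<in> V"
  and cmult_closed: "f \<in> V \<Longrightarrow> (\<lambda>x. c * f x) \<in> V"
  using V by (auto simp: lin_closed_def)

lemmas closed = add_closed cmult_closed D_closed T_closed lin_closed_sum[OF V]

lemma B_add_left: "f \<in> V \<Longrightarrow> g \<in> V \<Longrightarrow> h \<in> V \<Longrightarrow> B (\<lambda>x. f x + g x) h = B f h + B g h"
  and B_add_right: "f \<in> V \<Longrightarrow> g \<in> V \<Longrightarrow> h \<in> V \<Longrightarrow> B h (\<lambda>x. f x + g x) = B h f + B h g"
  and B_cmult_left: "f \<in> V \<Longrightarrow> h \<in> V \<Longrightarrow> B (\<lambda>x. c * f x) h = c * B f h"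
  and B_cmult_right: "f \<in> V \<Longrightarrow> h \<in> V \<Longrightarrow> B h (\<lambda>x. c * f x) = c * B h f"
  using B by (auto simp: bilin_def)

lemmas B_sum_left = bilin_sum_left[OF V B] and B_sum_right = bilin_sum_right[OF V B]

text \<open>This is the spatial derivative conjugated by an exponential, exp(p) d_i exp(-p) with p =
  s k - \<zeta> . z. The next operator \<open>Ls\<close> is its adjoint for \<open>B\<close>,
  because \<open>D i\<close> is skew.\<close>

definition L :: "(real^'n) \<Rightarrow> 'n \<Rightarrow> ('x \<Rightarrow> real) \<Rightarrow> 'x \<Rightarrow> real" where
  "L \<zeta> i f = (\<lambda>x. D i f x + \<zeta> $ i * f x)"

definition Ls :: "(real^'n) \<Rightarrow> 'n \<Rightarrow> ('x \<Rightarrow> real) \<Rightarrow> 'x \<Rightarrow> real" where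
  "Ls \<zeta> i f = (\<lambda>x. (- 1) * D i f x + \<zeta> $ i * f x)"

lemma L_closed: "f \<in> V \<Longrightarrow> L \<zeta> i f \<in> V" and Ls_closed: "f \<in> V \<Longrightarrow> Ls \<zeta> i f \<in> V"
  unfolding L_def Ls_def by (intro closed; assumption)+

lemma D_L: "f \<in> V \<Longrightarrow> D i (L \<zeta> j f) = L \<zeta> j (D i f)"
  and D_Ls: "f \<in> V \<Longrightarrow> D i (Ls \<zeta> j f) = Ls \<zeta> j (D i f)"
  unfolding L_def Ls_def by (simp_all only: D_add D_cmult closed D_commute[of f i j])

lemma L_Ls: "f \<in> V \<Longrightarrow> L \<zeta> i (Ls \<zeta> j f) = Ls \<zeta> j (L \<zeta> i f)"
  unfolding L_def Ls_def
  by (simp only: D_add D_cmult closed D_commute[of f i j]) (simp add: algebra_simps)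

lemma B_L: "f \<in> V \<Longrightarrow> g \<in> V \<Longrightarrow> B (L \<zeta> i f) g = B f (Ls \<zeta> i g)"
  unfolding L_def Ls_def
  by (simp only: B_add_left B_add_right B_cmult_left B_cmult_right closed skew)

text \<open>Two adjunctions exchange one derivative between the factors, as in the classical passage
  from the L2 norm of the Hessian to that of the Laplacian.\<close>

lemma hessian_form_eq:
  assumes f: "f \<in> V"
  shows "B (L \<zeta> i (L \<zeta> k f)) (L \<zeta> j (L \<zeta> l f)) = B (Ls \<zeta> j (L \<zeta> i f)) (Ls \<zeta> k (L \<zeta> l f))"
proof -
  note cl = L_closed Ls_closed f
  have "B (L \<zeta> i (L \<zeta> k f)) (L \<zeta> j (L \<zeta> l f)) = B (L \<zeta> j (L \<zeta> l f)) (L \<zeta> i (L \<zeta> k f))" by (rule sym)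
  also have "\<dots> = B (L \<zeta> l f) (Ls \<zeta> j (L \<zeta> i (L \<zeta> k f)))" by (intro B_L cl)
  also have "Ls \<zeta> j (L \<zeta> i (L \<zeta> k f)) = L \<zeta> k (Ls \<zeta> j (L \<zeta> i f))"
  proof -
    have "L \<zeta> i (L \<zeta> k f) = L \<zeta> k (L \<zeta> i f)"
      unfolding L_def by (simp only: D_add D_cmult closed f D_commute[of f i k]) (simp add: algebra_simps)
    then show ?thesis by (simp add: L_Ls cl)
  qed
  also have "B (L \<zeta> l f) (L \<zeta> k (Ls \<zeta> j (L \<zeta> i f))) = B (L \<zeta> k (Ls \<zeta> j (L \<zeta> i f))) (L \<zeta> l f)" by (rule sym)
  also have "\<dots> = B (Ls \<zeta> j (L \<zeta> i f)) (Ls \<zeta> k (L \<zeta> l f))" by (intro B_L cl)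
  finally show ?thesis .
qed

definition Lq :: "(real^'n) \<Rightarrow> (real^'n^'n) \<Rightarrow> ('x \<Rightarrow> real) \<Rightarrow> 'x \<Rightarrow> real" where
  "Lq \<zeta> q f = (\<lambda>x. \<Sum>i\<in>UNIV. \<Sum>j\<in>UNIV. q $ i $ j * Ls \<zeta> i (L \<zeta> j f) x)"

definition DD :: "(real^'n^'n) \<Rightarrow> ('x \<Rightarrow> real) \<Rightarrow> 'x \<Rightarrow> real" where
  "DD q f = (\<lambda>x. \<Sum>i\<in>UNIV. \<Sum>j\<in>UNIV. q $ i $ j * D i (D j f) x)"

lemma Lq_closed: "f \<in> V \<Longrightarrow> Lq \<zeta> q f \<in> V" and DD_closed: "f \<in> V \<Longrightarrow> DD q f \<in> V"
  unfolding Lq_def DD_def by (intro closed L_closed Ls_closed; assumption)+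

lemma B_Lq_left: "f \<in> V \<Longrightarrow> h \<in> V \<Longrightarrow>
    B (Lq \<zeta> q f) h = (\<Sum>i\<in>UNIV. \<Sum>j\<in>UNIV. q $ i $ j * B (Ls \<zeta> i (L \<zeta> j f)) h)"
  unfolding Lq_def by (simp add: B_sum_left B_cmult_left closed L_closed Ls_closed)

lemma B_DD_right: "f \<in> V \<Longrightarrow> h \<in> V \<Longrightarrow>
    B h (DD q f) = (\<Sum>i\<in>UNIV. \<Sum>j\<in>UNIV. q $ i $ j * B h (D i (D j f)))"
  unfolding DD_def by (simp add: B_sum_right B_cmult_right closed)

lemma symmetric_nth: "transpose q = q \<Longrightarrow> q $ i $ j = q $ j $ (i::'n)"
  by (drule arg_cong[of _ _ "\<lambda>M. M $ j $ i"]) (simp add: transpose_def)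

text \<open>After the exchange in \<open>hessian_form_eq\<close> the index pairs i, j and k, l sit
  in different factors, so the double contraction with \<open>q\<close> decouples into the norm of
  one scalar second-order operator.\<close>

lemma hessian_form_sum:
  assumes f: "f \<in> V" and q: "transpose q = q"
  shows "(\<Sum>i\<in>UNIV. \<Sum>j\<in>UNIV. \<Sum>k\<in>UNIV. \<Sum>l\<in>UNIV. q $ i $ j * q $ k $ l *
      B (L \<zeta> i (L \<zeta> k f)) (L \<zeta> j (L \<zeta> l f))) = B (Lq \<zeta> q f) (Lq \<zeta> q f)"
proof -
  have e: "B (L \<zeta> i (L \<zeta> k f)) (L \<zeta> j (L \<zeta> l f)) = B (Ls \<zeta> j (L \<zeta> i f)) (Ls \<zeta> k (L \<zeta> l f))" for i j k l
    by (rule hessian_form_eq[OF f])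
  have "(\<Sum>i\<in>UNIV. \<Sum>j\<in>UNIV. \<Sum>k\<in>UNIV. \<Sum>l\<in>UNIV. q $ i $ j * q $ k $ l *
      B (Ls \<zeta> j (L \<zeta> i f)) (Ls \<zeta> k (L \<zeta> l f)))
    = (\<Sum>i\<in>UNIV. \<Sum>j\<in>UNIV. q $ i $ j * B (Ls \<zeta> j (L \<zeta> i f)) (Lq \<zeta> q f))"
    using f by (simp add: sym[of _ "Lq \<zeta> q f"] B_Lq_left L_closed Ls_closed sum_distrib_left mult.assoc
        sym[of "Ls \<zeta> _ (L \<zeta> _ f)" "Ls \<zeta> _ (L \<zeta> _ f)"])
  also have "\<dots> = (\<Sum>i\<in>UNIV. \<Sum>j\<in>UNIV. q $ i $ j * B (Ls \<zeta> i (L \<zeta> j f)) (Lq \<zeta> q f))"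
    by (subst sum.swap) (intro sum.cong refl, subst symmetric_nth[OF q], rule refl)
  also have "\<dots> = B (Lq \<zeta> q f) (Lq \<zeta> q f)" by (rule B_Lq_left[symmetric, OF f Lq_closed[OF f]])
  finally show ?thesis by (simp only: e)
qed

text \<open>The first-order terms of \<open>Ls \<zeta> i (L \<zeta> j f)\<close> are antisymmetric
  in i and j and cancel against the symmetric \<open>q\<close>; only the second-order and
  zeroth-order terms remain.\<close>

lemma Lq_eq:
  assumes f: "f \<in> V" and q: "transpose q = q"
  shows "Lq \<zeta> q f = (\<lambda>x. (- 1) * DD q f x + (\<zeta> \<bullet> (q *v \<zeta>)) * f x)"
proof
  fix x
  have e: "Ls \<zeta> i (L \<zeta> j f) x = - D i (D j f) x - \<zeta> $ j * D i f x + \<zeta> $ i * D j f x + \<zeta> $ i * \<zeta> $ j * f x" for i j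
    unfolding L_def Ls_def by (simp only: D_add D_cmult closed f) (simp add: algebra_simps)
  have "(\<Sum>i\<in>UNIV. \<Sum>j\<in>UNIV. q $ i $ j * (\<zeta> $ j * D i f x)) = (\<Sum>j\<in>UNIV. \<Sum>i\<in>UNIV. q $ i $ j * (\<zeta> $ j * D i f x))"
    by (rule sum.swap)
  also have "\<dots> = (\<Sum>i\<in>UNIV. \<Sum>j\<in>UNIV. q $ i $ j * (\<zeta> $ i * D j f x))"
    by (intro sum.cong refl) (subst symmetric_nth[OF q], rule refl)
  finally have swap: "(\<Sum>i\<in>UNIV. \<Sum>j\<in>UNIV. q $ i $ j * (\<zeta> $ j * D i f x))
      = (\<Sum>i\<in>UNIV. \<Sum>j\<in>UNIV. q $ i $ j * (\<zeta> $ i * D j f x))" .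
  have "Lq \<zeta> q f x = - DD q f x - (\<Sum>i\<in>UNIV. \<Sum>j\<in>UNIV. q $ i $ j * (\<zeta> $ j * D i f x))
      + (\<Sum>i\<in>UNIV. \<Sum>j\<in>UNIV. q $ i $ j * (\<zeta> $ i * D j f x)) + (\<zeta> \<bullet> (q *v \<zeta>)) * f x"
    unfolding Lq_def DD_def e inner_matrix_vector
    by (simp add: sum.distrib sum_subtractf sum_negf sum_distrib_left algebra_simps)
  then show "Lq \<zeta> q f x = (- 1) * DD q f x + (\<zeta> \<bullet> (q *v \<zeta>)) * f x" using swap by simp
qed

lemma B_square_mono:
  assumes "f \<in> V" "g \<in> V" "0 \<le> B f g"
  shows "B f f \<le> B (\<lambda>x. f x + g x) (\<lambda>x. f x + g x)"
proof -
  have "B (\<lambda>x. f x + g x) (\<lambda>x. f x + g x) = B f f + 2 * B f g + B g g"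
    using assms(1,2) sym[of g f] by (simp add: B_add_left B_add_right closed)
  then show ?thesis using assms pos[of g] by simp
qed

text \<open>K S splits as \<open>Lq \<zeta> q f\<close> plus \<open>Z\<close>, where
  \<open>Z\<close> has the coefficient matrix K A - q and the constant K \<kappa> - \<zeta> . q
  \<zeta>. The two hypotheses with K make both nonnegative, so \<open>Z\<close> is a nonnegative
  operator commuting with the first one; the cross term is nonnegative and dropping \<open>Z\<close>
  only lowers the norm.\<close>

lemma elliptic_part:
  fixes A q :: "real^'n^'n"
  assumes f: "f \<in> V" and A: "transpose A = A"
    and q: "transpose q = q" "\<And>x. 0 \<le> x \<bullet> (q *v x)"
    and qA: "\<And>x. x \<bullet> (q *v x) \<le> K * (x \<bullet> (A *v x))"
    and \<kappa>: "\<zeta> \<bullet> (q *v \<zeta>) \<le> K * \<kappa>"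
  defines "S \<equiv> \<lambda>x. (- 1) * DD A f x + \<kappa> * f x"
  shows "B (Lq \<zeta> q f) (Lq \<zeta> q f) \<le> K\<^sup>2 * B S S"
proof -
  define r where "r = K *\<^sub>R A - q"
  define p where "p = K * \<kappa> - \<zeta> \<bullet> (q *v \<zeta>)"
  define Z where "Z = (\<lambda>x. (- 1) * DD r f x + p * f x)"
  have r: "transpose r = r"
    using symmetric_nth[OF A] symmetric_nth[OF q(1)] by (simp add: r_def transpose_def vec_eq_iff)
  have "x \<bullet> (r *v x) = K * (x \<bullet> (A *v x)) - x \<bullet> (q *v x)" for x
    by (simp add: r_def inner_matrix_vector algebra_simps sum_subtractf sum_distrib_left)
  then have r0: "0 \<le> x \<bullet> (r *v x)" for x using qA[of x] by simp
  have p: "p \<ge> 0" using \<kappa> by (simp add: p_def)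
  have SV: "S \<in> V" unfolding S_def by (intro closed DD_closed f)
  have ZV: "Z \<in> V" unfolding Z_def by (intro closed DD_closed f)
  have DDr: "DD r f x = K * DD A f x - DD q f x" for x
    unfolding DD_def r_def by (simp add: algebra_simps sum_subtractf sum_distrib_left)
  have KS: "(\<lambda>x. K * S x) = (\<lambda>x. Lq \<zeta> q f x + Z x)"
    unfolding Lq_eq[OF f q(1)] S_def Z_def DDr p_def by (auto simp: algebra_simps)
  \<comment> \<open>One derivative is moved by skewness and one \<open>Ls\<close> becomes
    \<open>L\<close> by adjunction. Every term is then a product of two expressions of the same
    kind, so the contraction with \<open>q\<close> and \<open>r\<close> has a sign.\<close>
  have "B (Lq \<zeta> q f) (DD r f) = - (\<Sum>i\<in>UNIV. \<Sum>j\<in>UNIV. \<Sum>k\<in>UNIV. \<Sum>l\<in>UNIV.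
      q $ i $ j * r $ k $ l * B (L \<zeta> j (D k f)) (L \<zeta> i (D l f)))"
  proof -
    have e: "B (Ls \<zeta> i (L \<zeta> j f)) (D k (D l f)) = - B (L \<zeta> j (D k f)) (L \<zeta> i (D l f))" for i j k l
    proof -
      have "B (Ls \<zeta> i (L \<zeta> j f)) (D k (D l f)) = - B (D k (Ls \<zeta> i (L \<zeta> j f))) (D l f)"
        by (simp add: skew f L_closed Ls_closed closed)
      also have "D k (Ls \<zeta> i (L \<zeta> j f)) = Ls \<zeta> i (L \<zeta> j (D k f))"
        by (simp add: D_L D_Ls f L_closed)
      also have "B \<dots> (D l f) = B (L \<zeta> i (D l f)) (L \<zeta> j (D k f))"
        by (subst B_L) (auto simp: f closed L_closed sym)
      finally show ?thesis by (simp add: sym)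
    qed
    show ?thesis
      using f by (simp add: B_Lq_left B_DD_right closed DD_closed L_closed Ls_closed e
          sum_distrib_left sum_negf mult.assoc)
  qed
  moreover have "0 \<le> (\<Sum>i\<in>UNIV. \<Sum>j\<in>UNIV. \<Sum>k\<in>UNIV. \<Sum>l\<in>UNIV.
      q $ i $ j * r $ k $ l * B (L \<zeta> i (D k f)) (L \<zeta> j (D l f)))"
    by (rule psd_form_tensor_nonneg[OF V B r r0 q pos]) (assumption, intro L_closed closed f)
  moreover have "(\<Sum>i\<in>UNIV. \<Sum>j\<in>UNIV. \<Sum>k\<in>UNIV. \<Sum>l\<in>UNIV.
      q $ i $ j * r $ k $ l * B (L \<zeta> j (D k f)) (L \<zeta> i (D l f)))
    = (\<Sum>i\<in>UNIV. \<Sum>j\<in>UNIV. \<Sum>k\<in>UNIV. \<Sum>l\<in>UNIV.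
      q $ i $ j * r $ k $ l * B (L \<zeta> i (D k f)) (L \<zeta> j (D l f)))"
    by (subst sum.swap) (intro sum.cong refl, subst symmetric_nth[OF q(1)], rule refl)
  ultimately have 1: "B (Lq \<zeta> q f) (DD r f) \<le> 0" by simp
  have "B (Lq \<zeta> q f) f = (\<Sum>i\<in>UNIV. \<Sum>j\<in>UNIV. q $ i $ j * B (L \<zeta> i f) (L \<zeta> j f))"
    using f by (simp add: B_Lq_left sym[of "Ls _ _ _" f] B_L[symmetric] L_closed)
  also have "\<dots> \<ge> 0" by (rule psd_form_nonneg[OF V B q pos]) (assumption, intro L_closed f)
  finally have 2: "0 \<le> B (Lq \<zeta> q f) f" .
  have "B (Lq \<zeta> q f) Z = - B (Lq \<zeta> q f) (DD r f) + p * B (Lq \<zeta> q f) f"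
    unfolding Z_def by (simp only: B_add_right B_cmult_right closed DD_closed Lq_closed f)
  also have "\<dots> \<ge> 0" using 1 mult_nonneg_nonneg[OF p 2] by linarith
  finally have "0 \<le> B (Lq \<zeta> q f) Z" .
  from B_square_mono[OF Lq_closed[OF f] ZV this]
  have "B (Lq \<zeta> q f) (Lq \<zeta> q f) \<le> B (\<lambda>x. K * S x) (\<lambda>x. K * S x)" unfolding KS .
  also have "\<dots> = K\<^sup>2 * B S S"
    using SV by (simp add: B_cmult_left B_cmult_right closed power2_eq_square)
  finally show ?thesis .
qed

lemma B_self_D: "f \<in> V \<Longrightarrow> B f (D i f) = 0"
  using skew[of f f i] sym[of "D i f" f] by simp

text \<open>The cross term of \<open>S\<close> and \<open>U\<close> has a sign. The drift is skew
  and commutes with the symmetric \<open>S\<close>, so it contributes 0 for any coefficients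
  \<open>v\<close>. The time derivative contributes dissipation terms of \<open>f\<close> (times
  \<kappa>) and of the gradient (contracted with \<open>A\<close>).\<close>

lemma parabolic_part:
  fixes A :: "real^'n^'n" and v :: "real^'n"
  assumes f: "f \<in> V" and A: "transpose A = A" "\<And>x. 0 \<le> x \<bullet> (A *v x)" and \<kappa>: "\<kappa> \<ge> 0"
  defines "S \<equiv> \<lambda>x. (- 1) * DD A f x + \<kappa> * f x"
    and "U \<equiv> \<lambda>x. (- 1) * T f x + (\<Sum>k\<in>UNIV. v $ k * D k f x)"
  shows "B S S \<le> B (\<lambda>x. S x + U x) (\<lambda>x. S x + U x)"
proof (rule B_square_mono)
  show SV: "S \<in> V" unfolding S_def by (intro closed DD_closed f)
  show "U \<in> V" unfolding U_def by (intro closed f)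
  have fU: "B f U = - B f (T f)"
    unfolding U_def by (simp only: B_add_right B_cmult_right B_sum_right B_self_D closed f) simp
  have "B (T f) (DD A f) = (\<Sum>i\<in>UNIV. \<Sum>j\<in>UNIV. A $ i $ j * - B (D j f) (T (D i f)))"
  proof -
    have "B (T f) (D i (D j f)) = - B (D j f) (T (D i f))" for i j
      using skew[of "T f" "D j f" i] f by (simp add: closed DT_commute sym)
    then show ?thesis using f by (simp add: B_DD_right closed)
  qed
  also have "\<dots> = (\<Sum>i\<in>UNIV. \<Sum>j\<in>UNIV. A $ i $ j * - B (D i f) (T (D j f)))"
    by (subst sum.swap) (intro sum.cong refl, subst symmetric_nth[OF A(1)], rule refl)
  also have "\<dots> \<ge> 0"
  proof (rule psd_form_nonneg[OF V _ A])
    show "bilin V (\<lambda>f g. - B f (T g))"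
      by (auto simp: bilin_def B_add_left B_add_right B_cmult_left B_cmult_right T_add T_cmult closed)
  qed (auto simp: dissipative closed f)
  finally have 1: "0 \<le> B (T f) (DD A f)" .
  \<comment> \<open>Three applications of skewness, an odd number, turn the expression into its own
    negative once the derivatives are commuted back.\<close>
  have 2: "B (D k f) (DD A f) = 0" for k
  proof -
    have e: "B (D k f) (D i (D j f)) = - B (D k f) (D j (D i f))" for i j
    proof -
      have "B (D k f) (D i (D j f)) = - B (D i (D k f)) (D j f)"
        using skew[of "D k f" "D j f" i] f by (simp add: closed)
      also have "D i (D k f) = D k (D i f)" by (rule D_commute[OF f])
      also have "B (D k (D i f)) (D j f) = - B (D i f) (D k (D j f))"
        by (simp add: skew closed f)
      also have "D k (D j f) = D j (D k f)" by (rule D_commute[OF f])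
      also have "B (D i f) (D j (D k f)) = - B (D j (D i f)) (D k f)"
        using skew[of "D i f" "D k f" j] f by (simp add: closed)
      finally show ?thesis by (simp add: sym)
    qed
    then have "B (D k f) (D i (D j f)) = 0" for i j
      using e[of i j] unfolding D_commute[OF f, of j i] by linarith
    then show ?thesis using f by (simp add: B_DD_right closed)
  qed
  have "B (DD A f) U = - B (T f) (DD A f)"
    unfolding U_def
    by (simp only: B_add_right B_cmult_right B_sum_right closed DD_closed f)
       (simp add: sym[of "DD A f"] 2)
  moreover have "B S U = - B (DD A f) U + \<kappa> * B f U"
    unfolding S_def by (simp only: B_add_left B_cmult_left closed DD_closed f \<open>U \<in> V\<close>)
  moreover have "\<kappa> * B f U \<ge> 0" using fU \<kappa> dissipative[OF f] by (intro mult_nonneg_nonneg) linarith+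
  ultimately show "0 \<le> B S U" using 1 by simp
qed

lemma energy_inequality:
  fixes A q :: "real^'n^'n" and v :: "real^'n"
  assumes f: "f \<in> V" and A: "transpose A = A" "\<And>x. 0 \<le> x \<bullet> (A *v x)"
    and q: "transpose q = q" "\<And>x. 0 \<le> x \<bullet> (q *v x)"
    and qA: "\<And>x. x \<bullet> (q *v x) \<le> K * (x \<bullet> (A *v x))"
    and \<kappa>: "\<kappa> \<ge> 0" "\<zeta> \<bullet> (q *v \<zeta>) \<le> K * \<kappa>"
  defines "P \<equiv> \<lambda>x. ((- 1) * DD A f x + \<kappa> * f x) + ((- 1) * T f x + (\<Sum>k\<in>UNIV. v $ k * D k f x))"
  shows "(\<Sum>i\<in>UNIV. \<Sum>j\<in>UNIV. \<Sum>k\<in>UNIV. \<Sum>l\<in>UNIV. q $ i $ j * q $ k $ l *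
      B (L \<zeta> i (L \<zeta> k f)) (L \<zeta> j (L \<zeta> l f))) \<le> K\<^sup>2 * B P P"
proof -
  have "B (Lq \<zeta> q f) (Lq \<zeta> q f) \<le> K\<^sup>2 * B (\<lambda>x. (- 1) * DD A f x + \<kappa> * f x) (\<lambda>x. (- 1) * DD A f x + \<kappa> * f x)"
    by (rule elliptic_part[OF f A(1) q qA \<kappa>(2)])
  also have "\<dots> \<le> K\<^sup>2 * B P P"
    unfolding P_def by (intro mult_left_mono parabolic_part[OF f A \<kappa>(1)]) simp
  finally show ?thesis unfolding hessian_form_sum[OF f q(1)] .
qed

end

section \<open>The energy inequality for square integrable functions, by mollification\<close>

section \<open>Square integrable functions and their mollifications\<close>

definition sqint :: "('a::euclidean_space \<Rightarrow> real) \<Rightarrow> bool" where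
  "sqint f \<longleftrightarrow> f \<in> borel_measurable borel \<and> integrable lborel (\<lambda>x. (f x)\<^sup>2)"

lemma sqint_measurable: "sqint f \<Longrightarrow> f \<in> borel_measurable borel"
  by (simp add: sqint_def)

lemma sqint_mult_integrable:
  assumes "sqint f" "sqint g"
  shows "integrable lborel (\<lambda>x. f x * g x)"
proof (rule Bochner_Integration.integrable_bound)
  show "integrable lborel (\<lambda>x. (f x)\<^sup>2 + (g x)\<^sup>2)" using assms by (auto simp: sqint_def)
  have [measurable]: "f \<in> borel_measurable borel" "g \<in> borel_measurable borel"
    using assms by (auto simp: sqint_def)
  show "(\<lambda>x. f x * g x) \<in> borel_measurable lborel" by simp
  have "\<bar>a * b\<bar> \<le> a\<^sup>2 + b\<^sup>2" for a b :: real
  proof -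
    have "0 \<le> (\<bar>a\<bar> - \<bar>b\<bar>)\<^sup>2" by simp
    then have "2 * (\<bar>a\<bar> * \<bar>b\<bar>) \<le> a\<^sup>2 + b\<^sup>2" by (simp add: power2_diff)
    moreover have "0 \<le> \<bar>a\<bar> * \<bar>b\<bar>" by simp
    ultimately have "\<bar>a\<bar> * \<bar>b\<bar> \<le> a\<^sup>2 + b\<^sup>2" by linarith
    then show ?thesis by (simp add: abs_mult)
  qed
  then show "AE x in lborel. norm (f x * g x) \<le> norm ((f x)\<^sup>2 + (g x)\<^sup>2)" by simp
qed

lemma sqint_add:
  assumes "sqint f" "sqint g"
  shows "sqint (\<lambda>x. f x + g x)"
proof -
  have [measurable]: "f \<in> borel_measurable borel" "g \<in> borel_measurable borel"
    using assms by (auto simp: sqint_def)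
  have "integrable lborel (\<lambda>x. (f x)\<^sup>2 + (g x)\<^sup>2 + 2 * (f x * g x))"
    using assms sqint_mult_integrable[OF assms]
    by (intro Bochner_Integration.integrable_add) (auto simp: sqint_def)
  then show ?thesis by (simp add: sqint_def power2_sum mult.assoc)
qed

lemma sqint_cmult: "sqint f \<Longrightarrow> sqint (\<lambda>x. c * f x)"
  by (auto simp: sqint_def power_mult_distrib)

lemma sqint_sum: "(\<And>i. i \<in> I \<Longrightarrow> sqint (f i)) \<Longrightarrow> sqint (\<lambda>x. \<Sum>i\<in>I. f i x)"
  by (induction I rule: infinite_finite_induct) (auto intro: sqint_add simp: sqint_def[of "\<lambda>x. 0"])

lemma sqint_Cc_shift:
  assumes "\<psi> \<in> Cc_infty UNIV"
  shows "sqint (\<lambda>y. \<psi> (y - x))"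
proof -
  have "integrable lborel (\<lambda>y. (\<psi> y)\<^sup>2)"
    using Cc_infty_integrable[OF Cc_infty_mult[OF assms Cc_inftyD(1)[OF assms]]]
    by (simp add: power2_eq_square)
  from integrable_shift[OF this, of "- x"] show ?thesis
    using Cc_infty_borel[OF assms] by (simp add: sqint_def)
qed

lemma cor_integrable: "sqint W \<Longrightarrow> \<psi> \<in> Cc_infty UNIV \<Longrightarrow> integrable lborel (\<lambda>y. W y * \<psi> (y - x))"
  by (intro sqint_mult_integrable sqint_Cc_shift)

lemma cor_add:
  "sqint W \<Longrightarrow> \<psi> \<in> Cc_infty UNIV \<Longrightarrow> \<eta> \<in> Cc_infty UNIV \<Longrightarrow>
    cor W (\<lambda>y. \<psi> y + \<eta> y) x = cor W \<psi> x + cor W \<eta> x"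
  unfolding cor_def using cor_integrable[of W \<psi> x] cor_integrable[of W \<eta> x]
  by (simp add: distrib_left)

lemma cor_cmult: "cor W (\<lambda>y. c * \<psi> y) x = c * cor W \<psi> x"
  unfolding cor_def by (simp add: mult.left_commute)

lemma cor_sum:
  "sqint W \<Longrightarrow> (\<And>i. i \<in> I \<Longrightarrow> \<psi> i \<in> Cc_infty UNIV) \<Longrightarrow>
    cor W (\<lambda>y. \<Sum>i\<in>I. \<psi> i y) x = (\<Sum>i\<in>I. cor W (\<psi> i) x)"
  unfolding cor_def using cor_integrable[of W _ x]
  by (simp add: sum_distrib_left Bochner_Integration.integral_sum)

lemma cor_add_left:
  "sqint f \<Longrightarrow> sqint g \<Longrightarrow> \<psi> \<in> Cc_infty UNIV \<Longrightarrow>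
    cor (\<lambda>y. f y + g y) \<psi> x = cor f \<psi> x + cor g \<psi> x"
  unfolding cor_def using cor_integrable[of f \<psi> x] cor_integrable[of g \<psi> x]
  by (simp add: distrib_right)

lemma cor_cmult_left: "cor (\<lambda>y. c * f y) \<psi> x = c * cor f \<psi> x"
  unfolding cor_def by (simp add: mult.assoc)

lemma cor_sum_left:
  "(\<And>i. i \<in> I \<Longrightarrow> sqint (f i)) \<Longrightarrow> \<psi> \<in> Cc_infty UNIV \<Longrightarrow>
    cor (\<lambda>y. \<Sum>i\<in>I. f i y) \<psi> x = (\<Sum>i\<in>I. cor (f i) \<psi> x)"
  unfolding cor_def using cor_integrable[of _ \<psi> x]
  by (simp add: sum_distrib_right Bochner_Integration.integral_sum)

text \<open>Differentiation under the integral falls on the kernel alone, so \<open>W\<close> may be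
  rough. The minus sign comes from the kernel's argument y - x, and is the reason for the signs in
  \<open>Dz\<close> and \<open>Ts\<close>.\<close>

lemma cor_has_derivative:
  assumes W: "sqint W" and \<psi>: "\<psi> \<in> Cc_infty UNIV" and b: "b \<in> Basis"
  shows "((\<lambda>t. cor W \<psi> (x + t *\<^sub>R b)) has_real_derivative cor W (\<lambda>y. - pd b \<psi> y) (x + t *\<^sub>R b)) (at t)"
proof -
  have [measurable]: "W \<in> borel_measurable borel" using W by (rule sqint_measurable)
  have [measurable]: "\<psi> \<in> borel_measurable borel" using Cc_infty_borel[OF \<psi>] .
  have pm[measurable]: "pd b \<psi> \<in> borel_measurable borel" using Cc_infty_borel[OF Cc_infty_pd[OF \<psi> b]] .
  obtain C where C: "C \<ge> 0" "\<And>x. \<bar>pd b \<psi> x\<bar> \<le> C"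
    using Cc_infty_bounded[OF Cc_infty_pd[OF \<psi> b]] by blast
  obtain K where K: "compact K" "\<And>x. x \<notin> K \<Longrightarrow> \<psi> x = 0" using Cc_inftyD(2)[OF \<psi>] by blast
  then obtain R where R: "\<And>x. x \<in> K \<Longrightarrow> norm x \<le> R"
    using compact_imp_bounded bounded_iff by metis
  define z where "z = x + t *\<^sub>R b"
  have line: "((\<lambda>h. \<psi> (w - h *\<^sub>R b)) has_real_derivative - pd b \<psi> (w - h *\<^sub>R b)) (at h)" for w h
  proof -
    have "((\<lambda>s. \<psi> (w + s *\<^sub>R b)) has_real_derivative pd b \<psi> (w + (- h) *\<^sub>R b)) (at (- h))"
      by (rule smooth_line_deriv[OF Cc_inftyD(1)[OF \<psi>]])
    moreover have "(uminus has_real_derivative - 1) (at h)"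
      by (auto intro!: derivative_eq_intros)
    ultimately have "((\<lambda>h. \<psi> (w + (- h) *\<^sub>R b)) has_real_derivative pd b \<psi> (w + (- h) *\<^sub>R b) * - 1) (at h)"
      by (rule DERIV_chain2)
    then show ?thesis by simp
  qed
  \<comment> \<open>Bounds the difference quotients of the kernel uniformly in h; together with the
    common ball containing their supports this gives the majorant for dominated convergence.\<close>
  have lip: "\<bar>\<psi> (w - h *\<^sub>R b) - \<psi> w\<bar> \<le> C * \<bar>h\<bar>" for w h
  proof -
    have "norm (\<psi> (w - h *\<^sub>R b) - \<psi> (w - 0 *\<^sub>R b)) \<le> C * norm (h - 0)"
      by (rule field_differentiable_bound[of UNIV "\<lambda>h. \<psi> (w - h *\<^sub>R b)" "\<lambda>h. - pd b \<psi> (w - h *\<^sub>R b)"])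
         (use line C in auto)
    then show ?thesis by simp
  qed
  have "((\<lambda>h. (cor W \<psi> (x + (t + h) *\<^sub>R b) - cor W \<psi> (x + t *\<^sub>R b)) / h)
      \<longlongrightarrow> cor W (\<lambda>y. - pd b \<psi> y) z) (at 0)"
    unfolding tendsto_at_iff_sequentially
  proof (intro allI impI)
    fix X :: "nat \<Rightarrow> real" assume X: "\<forall>i. X i \<in> UNIV - {0}" "X \<longlonglongrightarrow> 0"
    obtain r where r: "\<And>i. \<bar>X i\<bar> \<le> r"
      using convergent_imp_bounded[OF X(2)] by (auto simp: bounded_iff)
    let ?s = "\<lambda>i y. W y * ((\<psi> (y - z - X i *\<^sub>R b) - \<psi> (y - z)) / X i)"
    have "(\<lambda>i. LINT y|lborel. ?s i y) \<longlonglongrightarrow> (LINT y|lborel. W y * - pd b \<psi> (y - z))"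
    proof (rule integral_dominated_convergence[where w="\<lambda>y. \<bar>W y * (C * indicator (cball z (R + r)) y)\<bar>"])
      show "AE y in lborel. (\<lambda>i. ?s i y) \<longlonglongrightarrow> W y * - pd b \<psi> (y - z)"
      proof (intro AE_I2 tendsto_mult tendsto_const)
        fix y
        have "((\<lambda>h. (\<psi> (y - z - (0 + h) *\<^sub>R b) - \<psi> (y - z - 0 *\<^sub>R b)) / h)
            \<longlongrightarrow> - pd b \<psi> (y - z - 0 *\<^sub>R b)) (at 0)"
          using line[of "y - z" 0] unfolding DERIV_def .
        then have "((\<lambda>h. (\<psi> (y - z - h *\<^sub>R b) - \<psi> (y - z)) / h) \<longlongrightarrow> - pd b \<psi> (y - z)) (at 0)" by simp
        then show "(\<lambda>i. (\<psi> (y - z - X i *\<^sub>R b) - \<psi> (y - z)) / X i) \<longlonglongrightarrow> - pd b \<psi> (y - z)"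
          using X unfolding tendsto_at_iff_sequentially o_def by blast
      qed
      have "sqint (\<lambda>y. C * indicator (cball z (R + r)) y)"
      proof (rule sqint_cmult)
        have "(\<lambda>x. (indicator (cball z (R + r)) x)\<^sup>2) = (indicator (cball z (R + r)) :: 'a \<Rightarrow> real)"
          by (auto simp: indicator_def)
        then show "sqint (indicator (cball z (R + r)))"
          unfolding sqint_def by (auto intro!: borel_measurable_indicator simp: emeasure_lborel_cball_finite[unfolded infinity_ennreal_def])
      qed
      then show "integrable lborel (\<lambda>y. \<bar>W y * (C * indicator (cball z (R + r)) y)\<bar>)"
        by (intro integrable_abs sqint_mult_integrable W)
      show "AE y in lborel. norm (?s i y) \<le> \<bar>W y * (C * indicator (cball z (R + r)) y)\<bar>" for i
      proof (rule AE_I2)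
        fix y
        have "\<bar>(\<psi> (y - z - X i *\<^sub>R b) - \<psi> (y - z)) / X i\<bar> \<le> C * indicator (cball z (R + r)) y"
        proof (cases "y \<in> cball z (R + r)")
          case True
          then show ?thesis using lip[of "y - z" "X i"] X(1) by (auto simp: divide_le_eq)
        next
          case False
          then have n: "norm (y - z) > R + r" by (simp add: dist_norm norm_minus_commute)
          have "norm (y - z) \<le> norm (y - z - X i *\<^sub>R b) + \<bar>X i\<bar>"
            using norm_triangle_ineq[of "y - z - X i *\<^sub>R b" "X i *\<^sub>R b"] b by simp
          then have "norm (y - z - X i *\<^sub>R b) > R" using n r[of i] by linarith
          then have "\<psi> (y - z - X i *\<^sub>R b) = 0" using R K(2) by force
          moreover have "norm (y - z) > R" using n r[of i] by linarith
          then have "\<psi> (y - z) = 0" using R K(2) by force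
          ultimately show ?thesis using C(1) by simp
        qed
        from mult_left_mono[OF this, of "\<bar>W y\<bar>"]
        show "norm (?s i y) \<le> \<bar>W y * (C * indicator (cball z (R + r)) y)\<bar>"
          using C(1) by (simp add: abs_mult)
      qed
    qed measurable
    moreover have "(LINT y|lborel. ?s i y) = (cor W \<psi> (x + (t + X i) *\<^sub>R b) - cor W \<psi> (x + t *\<^sub>R b)) / X i" for i
    proof -
      have "cor W \<psi> (x + (t + X i) *\<^sub>R b) - cor W \<psi> (x + t *\<^sub>R b)
          = (LINT y|lborel. W y * \<psi> (y - (x + (t + X i) *\<^sub>R b)) - W y * \<psi> (y - (x + t *\<^sub>R b)))"
        unfolding cor_def by (intro Bochner_Integration.integral_diff[symmetric] cor_integrable W \<psi>)
      also have "\<dots> = (LINT y|lborel. ?s i y * X i)"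
        using X(1) by (intro Bochner_Integration.integral_cong)
          (auto simp: z_def right_diff_distrib scaleR_add_left diff_diff_eq add.assoc)
      finally show ?thesis using X(1) by simp
    qed
    ultimately show "((\<lambda>h. (cor W \<psi> (x + (t + h) *\<^sub>R b) - cor W \<psi> (x + t *\<^sub>R b)) / h) \<circ> X)
        \<longlonglongrightarrow> cor W (\<lambda>y. - pd b \<psi> y) z"
      unfolding o_def cor_def[of W "\<lambda>y. - pd b \<psi> y"] by (simp only:)
  qed
  then show ?thesis unfolding DERIV_def z_def .
qed

text \<open>Jensen's inequality for the kernel, followed by Tonelli.\<close>

lemma cor_weighted_bound:
  fixes W \<psi> :: "'a::euclidean_space \<Rightarrow> real"
  assumes W: "sqint W" and \<psi>: "\<psi> \<in> Cc_infty UNIV" and w[measurable]: "w \<in> borel_measurable borel"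
    and mono: "\<And>x y. \<psi> y \<noteq> 0 \<Longrightarrow> w x \<le> w (x + y)"
  shows "(\<integral>\<^sup>+x. w x * ennreal ((cor W \<psi> x)\<^sup>2) \<partial>lborel)
    \<le> (\<integral>\<^sup>+y. ennreal \<bar>\<psi> y\<bar> \<partial>lborel)\<^sup>2 * (\<integral>\<^sup>+x. w x * ennreal ((W x)\<^sup>2) \<partial>lborel)"
proof -
  have [measurable]: "W \<in> borel_measurable borel" using W by (rule sqint_measurable)
  have [measurable]: "\<psi> \<in> borel_measurable borel" using Cc_infty_borel[OF \<psi>] .
  let ?N = "\<integral>\<^sup>+y. ennreal \<bar>\<psi> y\<bar> \<partial>lborel"
  have cs: "ennreal ((cor W \<psi> x)\<^sup>2) \<le> ?N * (\<integral>\<^sup>+y. ennreal ((W (x + y))\<^sup>2) * ennreal \<bar>\<psi> y\<bar> \<partial>lborel)" for x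
  proof -
    have "ennreal \<bar>cor W \<psi> x\<bar> \<le> (\<integral>\<^sup>+y. ennreal (norm (W y * \<psi> (y - x))) \<partial>lborel)"
      unfolding cor_def using integral_norm_bound_ennreal[OF cor_integrable[OF W \<psi>, of x]] by simp
    also have "\<dots> = (\<integral>\<^sup>+y. ennreal (norm (W (y + x) * \<psi> (y + x - x))) \<partial>lborel)"
      by (rule nn_integral_shift[symmetric]) simp
    \<comment> \<open>The kernel is split into two square roots: Cauchy-Schwarz then leaves one full
      factor of the kernel beside the square of \<open>W\<close> and one for the mass.\<close>
    also have "\<dots> = (\<integral>\<^sup>+y. ennreal (\<bar>W (x + y)\<bar> * sqrt \<bar>\<psi> y\<bar>) * ennreal (sqrt \<bar>\<psi> y\<bar>) \<partial>lborel)"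
      by (intro nn_integral_cong) (simp add: ennreal_mult[symmetric] abs_mult add.commute mult.assoc)
    finally have "(ennreal \<bar>cor W \<psi> x\<bar>)\<^sup>2 \<le> (\<integral>\<^sup>+y. ennreal (\<bar>W (x + y)\<bar> * sqrt \<bar>\<psi> y\<bar>) * ennreal (sqrt \<bar>\<psi> y\<bar>) \<partial>lborel)\<^sup>2"
      by (intro power_mono) auto
    also have "\<dots> \<le> (\<integral>\<^sup>+y. (ennreal (\<bar>W (x + y)\<bar> * sqrt \<bar>\<psi> y\<bar>))\<^sup>2 \<partial>lborel) * (\<integral>\<^sup>+y. (ennreal (sqrt \<bar>\<psi> y\<bar>))\<^sup>2 \<partial>lborel)"
      by (rule Cauchy_Schwarz_nn_integral) measurable
    also have "\<dots> = (\<integral>\<^sup>+y. ennreal ((W (x + y))\<^sup>2) * ennreal \<bar>\<psi> y\<bar> \<partial>lborel) * ?N"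
      by (simp add: ennreal_power power_mult_distrib ennreal_mult)
    finally show ?thesis by (simp add: ennreal_power mult.commute)
  qed
  have "(\<integral>\<^sup>+x. w x * ennreal ((cor W \<psi> x)\<^sup>2) \<partial>lborel)
      \<le> (\<integral>\<^sup>+x. ?N * (\<integral>\<^sup>+y. w x * (ennreal ((W (x + y))\<^sup>2) * ennreal \<bar>\<psi> y\<bar>) \<partial>lborel) \<partial>lborel)"
    using mult_left_mono[OF cs]
    by (intro nn_integral_mono) (simp add: nn_integral_cmult mult.left_commute)
  also have "\<dots> = ?N * (\<integral>\<^sup>+x. (\<integral>\<^sup>+y. w x * (ennreal ((W (x + y))\<^sup>2) * ennreal \<bar>\<psi> y\<bar>) \<partial>lborel) \<partial>lborel)"
    by (rule nn_integral_cmult) measurable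
  also have "(\<integral>\<^sup>+x. (\<integral>\<^sup>+y. w x * (ennreal ((W (x + y))\<^sup>2) * ennreal \<bar>\<psi> y\<bar>) \<partial>lborel) \<partial>lborel)
      = (\<integral>\<^sup>+y. (\<integral>\<^sup>+x. w x * (ennreal ((W (x + y))\<^sup>2) * ennreal \<bar>\<psi> y\<bar>) \<partial>lborel) \<partial>lborel)"
    by (rule lborel_pair.Fubini'[symmetric]) measurable
  also have "\<dots> \<le> (\<integral>\<^sup>+y. ennreal \<bar>\<psi> y\<bar> * (\<integral>\<^sup>+x. w x * ennreal ((W x)\<^sup>2) \<partial>lborel) \<partial>lborel)"
  proof (rule nn_integral_mono)
    fix y
    have "(\<integral>\<^sup>+x. w x * (ennreal ((W (x + y))\<^sup>2) * ennreal \<bar>\<psi> y\<bar>) \<partial>lborel)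
        \<le> (\<integral>\<^sup>+x. ennreal \<bar>\<psi> y\<bar> * (w (x + y) * ennreal ((W (x + y))\<^sup>2)) \<partial>lborel)"
    proof (rule nn_integral_mono)
      fix x
      \<comment> \<open>Where the kernel lives, the weight at \<open>x\<close> may be replaced by
        the larger one at \<open>x + y\<close>; translation invariance then eliminates
        \<open>y\<close>.\<close>
      show "w x * (ennreal ((W (x + y))\<^sup>2) * ennreal \<bar>\<psi> y\<bar>) \<le> ennreal \<bar>\<psi> y\<bar> * (w (x + y) * ennreal ((W (x + y))\<^sup>2))"
        using mult_right_mono[OF mono[of y x], of "ennreal ((W (x + y))\<^sup>2) * ennreal \<bar>\<psi> y\<bar>"]
        by (cases "\<psi> y = 0") (auto simp: mult_ac)
    qed
    also have "\<dots> = ennreal \<bar>\<psi> y\<bar> * (\<integral>\<^sup>+x. w (x + y) * ennreal ((W (x + y))\<^sup>2) \<partial>lborel)"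
      by (rule nn_integral_cmult) measurable
    also have "(\<integral>\<^sup>+x. w (x + y) * ennreal ((W (x + y))\<^sup>2) \<partial>lborel) = (\<integral>\<^sup>+x. w x * ennreal ((W x)\<^sup>2) \<partial>lborel)"
      using nn_integral_shift[of "\<lambda>x. w x * ennreal ((W x)\<^sup>2)" y] by simp
    finally show "(\<integral>\<^sup>+x. w x * (ennreal ((W (x + y))\<^sup>2) * ennreal \<bar>\<psi> y\<bar>) \<partial>lborel)
        \<le> ennreal \<bar>\<psi> y\<bar> * (\<integral>\<^sup>+x. w x * ennreal ((W x)\<^sup>2) \<partial>lborel)" .
  qed
  also have "\<dots> = ?N * (\<integral>\<^sup>+x. w x * ennreal ((W x)\<^sup>2) \<partial>lborel)"
    by (rule nn_integral_multc) measurable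
  finally show ?thesis by (simp add: power2_eq_square mult.assoc mult_left_mono)
qed

lemma cor_sqint:
  assumes W: "sqint W" and \<psi>: "\<psi> \<in> Cc_infty UNIV"
  shows "sqint (cor W \<psi>)"
proof -
  have [measurable]: "W \<in> borel_measurable borel" using W by (rule sqint_measurable)
  have [measurable]: "\<psi> \<in> borel_measurable borel" using Cc_infty_borel[OF \<psi>] .
  have m[measurable]: "cor W \<psi> \<in> borel_measurable borel" by (rule cor_measurable) auto
  have "(\<integral>\<^sup>+x. ennreal ((cor W \<psi> x)\<^sup>2) \<partial>lborel)
      \<le> (\<integral>\<^sup>+y. ennreal \<bar>\<psi> y\<bar> \<partial>lborel)\<^sup>2 * (\<integral>\<^sup>+x. ennreal ((W x)\<^sup>2) \<partial>lborel)"
    using cor_weighted_bound[OF W \<psi>, of "\<lambda>_. 1"] by simp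
  also have "\<dots> < \<infinity>"
  proof -
    have "(\<integral>\<^sup>+y. ennreal \<bar>\<psi> y\<bar> \<partial>lborel) < \<infinity>" "(\<integral>\<^sup>+x. ennreal ((W x)\<^sup>2) \<partial>lborel) < \<infinity>"
      using Cc_infty_integrable[OF \<psi>] W by (auto simp: integrable_iff_bounded sqint_def)
    then show ?thesis by (simp add: ennreal_mult_less_top power2_eq_square)
  qed
  finally show ?thesis using m by (auto simp: sqint_def integrable_iff_bounded)
qed


section \<open>The energy inequality for mollified functions\<close>

lemma Basis_space_time:
  "dir_s \<in> (Basis :: (real \<times> (real^'n)) set)" "dir_z i \<in> (Basis :: (real \<times> (real^'n)) set)"
  by (auto simp: dir_s_def dir_z_def Basis_prod_def Basis_vec_def)

text \<open>Kernels vanishing at negative times let \<open>cor W \<psi> x\<close> see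
  \<open>W\<close> only at times not before that of \<open>x\<close>, and they form a linear space
  closed under differentiation: this is the space \<open>V\<close> of the energy form.\<close>

definition later_tests :: "(real \<times> (real^'n) \<Rightarrow> real) set" where
  "later_tests = {\<psi> \<in> Cc_infty UNIV. \<forall>y. fst y < 0 \<longrightarrow> \<psi> y = 0}"

lemma later_testsD: "\<psi> \<in> later_tests \<Longrightarrow> \<psi> \<in> Cc_infty UNIV" "\<psi> \<in> later_tests \<Longrightarrow> smooth \<psi>"
  using Cc_inftyD(1) by (auto simp: later_tests_def)

lemma later_tests_pd:
  assumes "\<psi> \<in> later_tests" "b \<in> Basis"
  shows "pd b \<psi> \<in> later_tests"
proof -
  have "open {y::real \<times> (real^'n). fst y < 0}" by (intro open_Collect_less continuous_intros)
  then have "pd b \<psi> y = 0" if "fst y < 0" for y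
    by (rule pd_vanish) (use assms that in \<open>auto simp: later_tests_def\<close>)
  then show ?thesis using assms Cc_infty_pd by (auto simp: later_tests_def)
qed

lemma pd_cmult: "f differentiable (at x) \<Longrightarrow> pd b (\<lambda>x. c * f x) x = c * pd b f x"
proof -
  assume "f differentiable (at x)"
  then have "pd b (\<lambda>x. c * f x) x = pd b (\<lambda>_. c) x * f x + c * pd b f x"
    by (intro pd_mult) auto
  also have "pd b (\<lambda>_. c) x = 0" by (rule pd_eqI) (rule has_derivative_const)
  finally show ?thesis by simp
qed

text \<open>A zero final trace appears here as extension by 0 past \<open>Bnd\<close>. Bounds on the
  time weight are asked only up to \<open>Bnd\<close>, since all correlations with later kernels
  vanish beyond it.\<close>

locale later_energy =
  fixes W :: "real \<times> (real^'n) \<Rightarrow> real" and \<theta> \<theta>' :: "real \<Rightarrow> real" and Bnd M :: real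
  assumes W: "sqint W" and W0: "\<And>y. fst y \<ge> Bnd \<Longrightarrow> W y = 0"
    and \<theta>_deriv: "\<And>s. (\<theta> has_real_derivative \<theta>' s) (at s)" and \<theta>'_cont: "continuous_on UNIV \<theta>'"
    and \<theta>_bound: "\<And>s. s \<le> Bnd \<Longrightarrow> 0 \<le> \<theta> s \<and> \<theta> s \<le> M \<and> 0 \<le> \<theta>' s \<and> \<theta>' s \<le> M"
begin

lemma \<theta>_cont: "continuous_on UNIV \<theta>"
  using \<theta>_deriv DERIV_continuous_on by blast

lemma cor_eq_0:
  assumes "\<psi> \<in> later_tests" "fst x \<ge> Bnd"
  shows "cor W \<psi> x = 0"
proof -
  have "W y * \<psi> (y - x) = 0" for y
  proof (cases "fst y < fst x")
    case True
    then have "fst (y - x) < 0" by simp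
    then have "\<psi> (y - x) = 0" using assms(1) unfolding later_tests_def by blast
    then show ?thesis by simp
  next
    case False
    then show ?thesis using W0[of y] assms(2) by simp
  qed
  then show ?thesis unfolding cor_def by (simp only: Bochner_Integration.integral_zero)
qed

lemma weighted_integrable:
  assumes \<psi>: "\<psi> \<in> later_tests" "\<eta> \<in> later_tests"
    and e: "continuous_on UNIV e" "\<And>s. s \<le> Bnd \<Longrightarrow> \<bar>e s\<bar> \<le> M"
  shows "integrable lborel (\<lambda>x. e (fst x) * cor W \<psi> x * cor W \<eta> x)"
proof -
  have sq: "sqint (cor W \<psi>)" "sqint (cor W \<eta>)" using \<psi> cor_sqint W later_testsD by auto
  have [measurable]: "cor W \<psi> \<in> borel_measurable borel" "cor W \<eta> \<in> borel_measurable borel"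
    using sq by (auto simp: sqint_def)
  have [measurable]: "e \<in> borel_measurable borel"
    using e(1) by (rule borel_measurable_continuous_onI)
  have fm: "fst \<in> borel_measurable (borel :: (real \<times> (real^'n)) measure)"
    by (intro borel_measurable_continuous_onI continuous_intros)
  show ?thesis
  proof (rule Bochner_Integration.integrable_bound)
    show "integrable lborel (\<lambda>x. M * (cor W \<psi> x * cor W \<eta> x))"
      using sqint_mult_integrable[OF sq] by simp
    show "(\<lambda>x. e (fst x) * cor W \<psi> x * cor W \<eta> x) \<in> borel_measurable lborel"
      using measurable_compose[OF fm, of e borel] by simp
    show "AE x in lborel. norm (e (fst x) * cor W \<psi> x * cor W \<eta> x) \<le> norm (M * (cor W \<psi> x * cor W \<eta> x))"
    proof (rule AE_I2)
      fix x
      show "norm (e (fst x) * cor W \<psi> x * cor W \<eta> x) \<le> norm (M * (cor W \<psi> x * cor W \<eta> x))"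
      proof (cases "fst x \<ge> Bnd")
        case True
        then show ?thesis using cor_eq_0[OF \<psi>(1)] by simp
      next
        case False
        then have "\<bar>e (fst x)\<bar> \<le> \<bar>M\<bar>" using e(2)[of "fst x"] by linarith
        then show ?thesis by (auto simp: abs_mult mult.assoc intro!: mult_right_mono)
      qed
    qed
  qed
qed

definition form :: "(real \<times> (real^'n) \<Rightarrow> real) \<Rightarrow> (real \<times> (real^'n) \<Rightarrow> real) \<Rightarrow> real" where
  "form \<psi> \<eta> = (LINT x|lborel. \<theta> (fst x) * cor W \<psi> x * cor W \<eta> x)"

lemma form_integrable: "\<psi> \<in> later_tests \<Longrightarrow> \<eta> \<in> later_tests \<Longrightarrow>
    integrable lborel (\<lambda>x. \<theta> (fst x) * cor W \<psi> x * cor W \<eta> x)"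
  using \<theta>_bound \<theta>_cont by (intro weighted_integrable) auto

definition Dz :: "'n \<Rightarrow> (real \<times> (real^'n) \<Rightarrow> real) \<Rightarrow> real \<times> (real^'n) \<Rightarrow> real" where
  "Dz i \<psi> = (\<lambda>y. - pd (dir_z i) \<psi> y)"

definition Ts :: "(real \<times> (real^'n) \<Rightarrow> real) \<Rightarrow> real \<times> (real^'n) \<Rightarrow> real" where
  "Ts \<psi> = (\<lambda>y. - pd dir_s \<psi> y)"

lemma later_tests_lin_closed: "lin_closed later_tests"
proof -
  have "(\<lambda>_. 0) \<in> Cc_infty UNIV" by (rule Cc_inftyI[of _ "{}"]) (auto simp: C_diff_const)
  then show ?thesis
    by (auto simp: lin_closed_def later_tests_def Cc_infty_add Cc_infty_cmult)
qed

lemma later_tests_neg_pd: "\<psi> \<in> later_tests \<Longrightarrow> b \<in> Basis \<Longrightarrow> (\<lambda>y. - pd b \<psi> y) \<in> later_tests"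
proof -
  assume "\<psi> \<in> later_tests" "b \<in> Basis"
  then have "(\<lambda>y. (- 1) * pd b \<psi> y) \<in> later_tests"
    using later_tests_pd later_tests_lin_closed unfolding lin_closed_def by blast
  then show ?thesis by simp
qed

lemma product_line_deriv:
  assumes \<psi>: "\<psi> \<in> later_tests" "\<eta> \<in> later_tests" and b: "b \<in> Basis"
  shows "((\<lambda>t. cor W \<psi> (x + t *\<^sub>R b) * cor W \<eta> (x + t *\<^sub>R b)) has_real_derivative
      cor W (\<lambda>y. - pd b \<psi> y) (x + t *\<^sub>R b) * cor W \<eta> (x + t *\<^sub>R b)
      + cor W (\<lambda>y. - pd b \<eta> y) (x + t *\<^sub>R b) * cor W \<psi> (x + t *\<^sub>R b)) (at t)"
  using DERIV_mult[OF cor_has_derivative[OF W later_testsD(1)[OF \<psi>(1)] b, of x t]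
      cor_has_derivative[OF W later_testsD(1)[OF \<psi>(2)] b, of x t]] by (simp add: mult_ac)

lemma cor_line_continuous:
  assumes "\<psi> \<in> later_tests" "b \<in> Basis"
  shows "continuous_on UNIV (\<lambda>t. cor W \<psi> (x + t *\<^sub>R b))"
  using cor_has_derivative[OF W later_testsD(1)[OF assms(1)] assms(2)]
  by (meson DERIV_continuous_on has_field_derivative_at_within)

text \<open>The weight is constant along spatial directions, so the directional derivative of the
  whole integrand, which integrates to 0, consists of just the two terms of the product
  rule.\<close>

lemma form_skew:
  assumes \<psi>: "\<psi> \<in> later_tests" "\<eta> \<in> later_tests"
  shows "form (Dz i \<psi>) \<eta> = - form \<psi> (Dz i \<eta>)"
proof -
  have b: "dir_z i \<in> (Basis :: (real \<times> (real^'n)) set)" by (rule Basis_space_time)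
  note pds = later_tests_neg_pd[OF \<psi>(1) b] later_tests_neg_pd[OF \<psi>(2) b]
  have f0: "fst (x + t *\<^sub>R dir_z i) = fst x" for x :: "real \<times> (real^'n)" and t
    by (simp add: dir_z_def)
  let ?k = "\<lambda>x. \<theta> (fst x) * cor W (\<lambda>y. - pd (dir_z i) \<psi> y) x * cor W \<eta> x
      + \<theta> (fst x) * cor W \<psi> x * cor W (\<lambda>y. - pd (dir_z i) \<eta> y) x"
  have "(LINT x|lborel. ?k x) = 0"
  proof (rule integral_directional_derivative)
    show "integrable lborel (\<lambda>x. \<theta> (fst x) * cor W \<psi> x * cor W \<eta> x)" by (rule form_integrable[OF \<psi>])
    show "integrable lborel ?k" by (intro Bochner_Integration.integrable_add form_integrable pds \<psi>)
    show "((\<lambda>t. \<theta> (fst (x + t *\<^sub>R dir_z i)) * cor W \<psi> (x + t *\<^sub>R dir_z i) * cor W \<eta> (x + t *\<^sub>R dir_z i))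
        has_real_derivative ?k (x + t *\<^sub>R dir_z i)) (at t)" for x t
      using DERIV_cmult[OF product_line_deriv[OF \<psi> b, of x t], of "\<theta> (fst x)"]
      unfolding f0 by (simp add: algebra_simps)
    show "continuous_on UNIV (\<lambda>t. ?k (x + t *\<^sub>R dir_z i))" for x
      unfolding f0 by (intro continuous_intros cor_line_continuous pds \<psi> b)
  qed
  then show ?thesis
    unfolding form_def Dz_def
    using form_integrable[OF pds(1) \<psi>(2)] form_integrable[OF \<psi>(1) pds(2)] by simp
qed

text \<open>Put w = \<open>cor W \<psi>\<close>. The time derivative of \<theta> w^2 integrates to
  0, hence twice the form is minus the integral of \<theta>' w^2. The sign is that of a
  nondecreasing weight, and the extension by zero leaves no contribution from the final
  time.\<close>

lemma form_dissipative:
  assumes \<psi>: "\<psi> \<in> later_tests"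
  shows "form \<psi> (Ts \<psi>) \<le> 0"
proof -
  have b: "dir_s \<in> (Basis :: (real \<times> (real^'n)) set)" by (rule Basis_space_time)
  note pds = later_tests_neg_pd[OF \<psi> b]
  have f0: "fst (x + t *\<^sub>R dir_s) = fst x + t" for x :: "real \<times> (real^'n)" and t
    by (simp add: dir_s_def)
  let ?g = "\<lambda>x. \<theta>' (fst x) * cor W \<psi> x * cor W \<psi> x"
  let ?h = "\<lambda>x. \<theta> (fst x) * cor W \<psi> x * cor W (\<lambda>y. - pd dir_s \<psi> y) x"
  have gi: "integrable lborel ?g"
    using \<theta>_bound \<theta>'_cont by (intro weighted_integrable \<psi>) auto
  have hi: "integrable lborel ?h" by (rule form_integrable[OF \<psi> pds])
  have "(LINT x|lborel. ?g x + 2 * ?h x) = 0"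
  proof (rule integral_directional_derivative)
    show "integrable lborel (\<lambda>x. \<theta> (fst x) * cor W \<psi> x * cor W \<psi> x)" by (rule form_integrable[OF \<psi> \<psi>])
    show "integrable lborel (\<lambda>x. ?g x + 2 * ?h x)" using gi hi by simp
    show "((\<lambda>t. \<theta> (fst (x + t *\<^sub>R dir_s)) * cor W \<psi> (x + t *\<^sub>R dir_s) * cor W \<psi> (x + t *\<^sub>R dir_s))
        has_real_derivative ?g (x + t *\<^sub>R dir_s) + 2 * ?h (x + t *\<^sub>R dir_s)) (at t)" for x t
    proof -
      have "((\<lambda>t. \<theta> (fst x + t)) has_real_derivative \<theta>' (fst x + t)) (at t)"
        using DERIV_shift[of \<theta> "\<theta>' (fst x + t)" t "fst x"] \<theta>_deriv[of "fst x + t"] by (simp add: add.commute)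
      from DERIV_mult[OF this product_line_deriv[OF \<psi> \<psi> b, of x t]]
      show ?thesis unfolding f0 by (simp add: algebra_simps)
    qed
    have "continuous_on UNIV (\<lambda>t. \<theta> (fst x + t))" "continuous_on UNIV (\<lambda>t. \<theta>' (fst x + t))" for x :: "real \<times> (real^'n)"
      by (auto intro!: continuous_on_compose2[OF \<theta>_cont] continuous_on_compose2[OF \<theta>'_cont] continuous_intros)
    then show "continuous_on UNIV (\<lambda>t. ?g (x + t *\<^sub>R dir_s) + 2 * ?h (x + t *\<^sub>R dir_s))" for x
      unfolding f0 by (intro continuous_intros cor_line_continuous pds \<psi> b)
  qed
  then have "(LINT x|lborel. ?g x) + 2 * (LINT x|lborel. ?h x) = 0" using gi hi by simp
  moreover have "(LINT x|lborel. ?g x) \<ge> 0"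
  proof (rule Bochner_Integration.integral_nonneg)
    fix x
    show "0 \<le> ?g x"
    proof (cases "fst x \<ge> Bnd")
      case True
      then show ?thesis using cor_eq_0[OF \<psi>] by simp
    next
      case False
      then have "0 \<le> \<theta>' (fst x) * (cor W \<psi> x * cor W \<psi> x)" using \<theta>_bound[of "fst x"] by simp
      then show ?thesis by (simp add: mult.assoc)
    qed
  qed
  ultimately show ?thesis by (simp add: form_def Ts_def)
qed

lemma energy_form: "energy_form later_tests form Dz Ts"
proof
  show "lin_closed (later_tests :: (real \<times> (real^'n) \<Rightarrow> real) set)" by (rule later_tests_lin_closed)
  note lt = later_testsD(1)
  show "bilin later_tests form"
    unfolding bilin_def
  proof (intro conjI ballI allI)
    fix f g h :: "real \<times> (real^'n) \<Rightarrow> real"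
    assume V: "f \<in> later_tests" "g \<in> later_tests" "h \<in> later_tests"
    note i = form_integrable[OF V(1) V(3)] form_integrable[OF V(2) V(3)]
      form_integrable[OF V(3) V(1)] form_integrable[OF V(3) V(2)]
    show "form (\<lambda>x. f x + g x) h = form f h + form g h"
      unfolding form_def cor_add[OF W lt[OF V(1)] lt[OF V(2)]]
      using i by (simp add: algebra_simps)
    show "form h (\<lambda>x. f x + g x) = form h f + form h g"
      unfolding form_def cor_add[OF W lt[OF V(1)] lt[OF V(2)]]
      using i by (simp add: algebra_simps)
  next
    fix f h :: "real \<times> (real^'n) \<Rightarrow> real" and c
    show "form (\<lambda>x. c * f x) h = c * form f h" "form h (\<lambda>x. c * f x) = c * form h f"
      unfolding form_def cor_cmult by (simp_all add: mult_ac flip: Bochner_Integration.integral_mult_right_zero)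
  qed
  show "form f g = form g f" for f g unfolding form_def by (simp add: mult_ac)
  show "0 \<le> form f f" if f: "f \<in> later_tests" for f
    unfolding form_def
  proof (rule Bochner_Integration.integral_nonneg)
    fix x
    show "0 \<le> \<theta> (fst x) * cor W f x * cor W f x"
    proof (cases "fst x \<ge> Bnd")
      case True
      then show ?thesis using cor_eq_0[OF f] by simp
    next
      case False
      then have "0 \<le> \<theta> (fst x) * (cor W f x * cor W f x)" using \<theta>_bound[of "fst x"] by simp
      then show ?thesis by (simp add: mult.assoc)
    qed
  qed
  note dd = smooth_differentiable[OF later_testsD(2)]
  fix f g :: "real \<times> (real^'n) \<Rightarrow> real" and i j c
  assume f: "f \<in> later_tests"
  show "Dz i f \<in> later_tests" "Ts f \<in> later_tests"
    unfolding Dz_def Ts_def by (intro later_tests_neg_pd f Basis_space_time)+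
  show "Dz i (\<lambda>x. c * f x) = (\<lambda>x. c * Dz i f x)" "Ts (\<lambda>x. c * f x) = (\<lambda>x. c * Ts f x)"
    unfolding Dz_def Ts_def by (simp_all add: pd_cmult dd[OF f])
  have neg: "pd b (\<lambda>y. - pd e f y) y = - pd b (pd e f) y" if "e \<in> Basis" for b e y
    using pd_cmult[OF smooth_differentiable[OF smooth_pd[OF later_testsD(2)[OF f] that]], of b "-1"] by simp
  show "Dz i (Dz j f) = Dz j (Dz i f)" "Dz i (Ts f) = Ts (Dz i f)"
    unfolding Dz_def Ts_def using pd_commute[OF later_testsD(2)[OF f]]
    by (auto simp: fun_eq_iff neg Basis_space_time)
  show "form f (Ts f) \<le> 0" by (rule form_dissipative[OF f])
  assume g: "g \<in> later_tests"
  show "Dz i (\<lambda>x. f x + g x) = (\<lambda>x. Dz i f x + Dz i g x)" "Ts (\<lambda>x. f x + g x) = (\<lambda>x. Ts f x + Ts g x)"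
    unfolding Dz_def Ts_def by (simp_all add: pd_add dd[OF f] dd[OF g])
  show "form (Dz i f) g = - form f (Dz i g)" by (rule form_skew[OF f g])
qed

end

section \<open>Passing to the limit in the mollification\<close>

lemma nn_integral_Fatou_le:
  assumes m: "\<And>n. f n \<in> borel_measurable M" and le: "\<And>n::nat. (\<integral>\<^sup>+x. f n x \<partial>M) \<le> C"
    and lim: "AE x in M. (\<lambda>n. f n x) \<longlonglongrightarrow> g x"
  shows "(\<integral>\<^sup>+x. g x \<partial>M) \<le> C"
proof -
  have "(\<integral>\<^sup>+x. g x \<partial>M) = (\<integral>\<^sup>+x. liminf (\<lambda>n. f n x) \<partial>M)"
    by (rule nn_integral_cong_AE) (use lim in \<open>eventually_elim, simp add: lim_imp_Liminf\<close>)
  also have "\<dots> \<le> liminf (\<lambda>n. \<integral>\<^sup>+x. f n x \<partial>M)" by (rule nn_integral_liminf[OF m])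
  also have "\<dots> \<le> liminf (\<lambda>n::nat. C)" by (intro Liminf_mono) (simp add: le)
  also have "\<dots> = C" by (simp add: Liminf_const)
  finally show ?thesis .
qed

text \<open>For x later than \<open>c\<close>, the translated kernel is supported at times not
  before x, so it is a test function for the half space; nothing about \<open>f\<close> near or
  before \<open>c\<close> enters.\<close>

lemma cor_weak_deriv:
  assumes f: "has_weak_deriv {x. c < fst x} f b g" and b: "b \<in> Basis" and \<psi>: "\<psi> \<in> later_tests"
    and x: "c < fst x"
  shows "cor f (\<lambda>y. - pd b \<psi> y) x = cor g \<psi> x"
proof -
  have Cc: "(\<lambda>y. \<psi> (- x + 1 *\<^sub>R y)) \<in> Cc_infty {x. c < fst x}"
  proof (rule Cc_infty_affine[where L="{y. fst x \<le> fst y}"])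
    show "\<psi> \<in> Cc_infty UNIV" using \<psi> by (rule later_testsD)
    show "y \<in> {y. fst x \<le> fst y}" if "\<psi> (- x + 1 *\<^sub>R y) \<noteq> 0" for y
    proof (rule ccontr)
      assume "y \<notin> {y. fst x \<le> fst y}"
      then have "fst (- x + 1 *\<^sub>R y) < 0" by simp
      then show False using \<psi> that unfolding later_tests_def by blast
    qed
    show "closed {y. fst x \<le> fst y}" by (intro closed_Collect_le continuous_intros)
  qed (use x in auto)
  have pd: "pd b (\<lambda>y. \<psi> (- x + 1 *\<^sub>R y)) y = pd b \<psi> (y - x)" for y
    using pd_affine[OF smooth_differentiable[OF later_testsD(2)[OF \<psi>]], of b "- x" 1 y] by simp
  have "(LINT y:{x. c < fst x}|lborel. f y * pd b (\<lambda>y. \<psi> (- x + 1 *\<^sub>R y)) y)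
      = - (LINT y:{x. c < fst x}|lborel. g y * \<psi> (- x + 1 *\<^sub>R y))"
    using f Cc unfolding has_weak_deriv_def by blast
  then have "(LINT y|lborel. f y * pd b \<psi> (y - x)) = - (LINT y|lborel. g y * \<psi> (y - x))"
    unfolding set_integral_Cc[OF Cc] set_integral_Cc[OF Cc_infty_pd[OF Cc b]] unfolding pd by simp
  then show ?thesis by (simp add: cor_def)
qed

lemma frob_sandwich_tendsto:
  fixes R :: "real^'n^'n"
  assumes R: "transpose R = R" and G: "\<And>i j. (\<lambda>n. G n $ i $ j) \<longlonglongrightarrow> H $ i $ j"
  shows "(\<lambda>n. (norm (R ** G n ** R))\<^sup>2) \<longlonglongrightarrow> (norm (R ** H ** R))\<^sup>2"
  unfolding norm_sandwich_power2[OF R] by (intro tendsto_intros G)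

lemma mollifiers_later: "mollifiers \<rho> \<Longrightarrow> \<rho> k \<in> later_tests"
proof -
  assume \<rho>: "mollifiers \<rho>"
  have "\<rho> k y = 0" if "fst y < 0" for y :: "real \<times> (real^'a)"
  proof (rule ccontr)
    assume "\<rho> k y \<noteq> 0"
    from mollifiersD(4)[OF \<rho> this Basis_space_time(1)] show False
      using that by (simp add: dir_s_def inner_prod_def)
  qed
  then show ?thesis using mollifiersD(1)[OF \<rho>] by (auto simp: later_tests_def)
qed

text \<open>On a ball, square integrability gives integrability, so the L1 result applies to the
  functions cut off to radius r + 1; the kernels have radius at most 1, so the cutoff is invisible
  inside radius r. Summing the errors over the finite index type gives one subsequence for all
  components.\<close>

lemma mollification_AE_subsequence:
  fixes G :: "'i::finite \<Rightarrow> 'a::euclidean_space \<Rightarrow> real"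
  assumes G: "\<And>i. sqint (G i)" and \<rho>: "mollifiers \<rho>"
  shows "\<exists>s::nat \<Rightarrow> nat. AE x in lborel. x \<in> cball 0 r \<longrightarrow> (\<forall>i. (\<lambda>n. cor (G i) (\<rho> (s n)) x) \<longlonglongrightarrow> G i x)"
proof -
  define X where "X i x = indicator (cball 0 (r + 1)) x * G i x" for i x
  have ind: "sqint (indicator (cball 0 (r + 1)) :: 'a \<Rightarrow> real)"
  proof -
    have "(\<lambda>x. (indicator (cball 0 (r + 1)) x)\<^sup>2) = (indicator (cball 0 (r + 1)) :: 'a \<Rightarrow> real)"
      by (auto simp: indicator_def)
    then show ?thesis
      unfolding sqint_def by (auto intro!: borel_measurable_indicator simp: emeasure_lborel_cball_finite[unfolded infinity_ennreal_def])
  qed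
  have X: "integrable lborel (X i)" for i
    unfolding X_def by (rule sqint_mult_integrable[OF ind G])
  let ?d = "\<lambda>n x. \<Sum>i\<in>UNIV. \<bar>cor (X i) (\<rho> n) x - X i x\<bar>"
  have di: "integrable lborel (\<lambda>x. \<bar>cor (X i) (\<rho> n) x - X i x\<bar>)" for i n
    by (intro integrable_abs Bochner_Integration.integrable_diff X mollification_L1(2)[OF X \<rho>])
  have "(\<lambda>n. \<Sum>i\<in>UNIV. LINT x|lborel. \<bar>cor (X i) (\<rho> n) x - X i x\<bar>) \<longlonglongrightarrow> (\<Sum>i\<in>(UNIV::'i set). 0)"
    by (intro tendsto_sum mollification_L1(1)[OF X \<rho>])
  then have "(\<lambda>n. LINT x|lborel. norm (?d n x)) \<longlonglongrightarrow> 0"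
    using di by (simp add: sum_nonneg Bochner_Integration.integral_sum)
  then obtain s where s: "AE x in lborel. (\<lambda>n. ?d (s n) x) \<longlonglongrightarrow> 0"
    using tendsto_L1_AE_subseq[of lborel ?d] di by auto
  have "AE x in lborel. x \<in> cball 0 r \<longrightarrow> (\<forall>i. (\<lambda>n. cor (G i) (\<rho> (s n)) x) \<longlonglongrightarrow> G i x)"
    using s
  proof (eventually_elim, intro impI allI)
    fix x i assume lim: "(\<lambda>n. ?d (s n) x) \<longlonglongrightarrow> 0" and x: "x \<in> cball 0 r"
    have "(\<lambda>n. cor (X i) (\<rho> (s n)) x - X i x) \<longlonglongrightarrow> 0"
      by (rule Lim_null_comparison[OF _ lim]) (auto intro!: always_eventually member_le_sum)
    then have "(\<lambda>n. cor (X i) (\<rho> (s n)) x) \<longlonglongrightarrow> X i x" using LIM_zero_iff by blast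
    moreover have "X i x = G i x" using x by (simp add: X_def)
    moreover have "cor (X i) (\<rho> n) x = cor (G i) (\<rho> n) x" for n
    proof -
      have "X i y * \<rho> n (y - x) = G i y * \<rho> n (y - x)" for y
      proof (cases "\<rho> n (y - x) = 0")
        case False
        have "1 / real (Suc n) \<le> 1" by simp
        then have "norm (y - x) < 1" using mollifiersD(5)[OF \<rho> False] by linarith
        then have "norm y \<le> r + 1" using x norm_triangle_ineq[of "y - x" x] by simp
        then show ?thesis by (simp add: X_def)
      qed simp
      then show ?thesis unfolding cor_def by (intro Bochner_Integration.integral_cong) auto
    qed
    ultimately show "(\<lambda>n. cor (G i) (\<rho> (s n)) x) \<longlonglongrightarrow> G i x" by simp
  qed
  then show ?thesis by blast
qed

text \<open>Since \<theta> vanishes up to \<open>c0\<close>, the distributional derivatives are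
  needed only later than \<open>c0\<close>. The numbers \<kappa> and \<open>v\<close> are the
  zeroth-order and first-order coefficients of the conjugated parabolic operator.\<close>

locale weak_energy = later_energy W \<theta> \<theta>' Bnd M
  for W :: "real \<times> (real^'n) \<Rightarrow> real" and \<theta> \<theta>' Bnd M +
  fixes c0 :: real and Ws :: "real \<times> (real^'n) \<Rightarrow> real" and Wz :: "'n \<Rightarrow> real \<times> (real^'n) \<Rightarrow> real"
    and Wzz :: "'n \<Rightarrow> 'n \<Rightarrow> real \<times> (real^'n) \<Rightarrow> real"
    and A q R :: "real^'n^'n" and K \<kappa> :: real and \<zeta> v :: "real^'n"
  assumes \<theta>0: "\<And>s. s \<le> c0 \<Longrightarrow> \<theta> s = 0"
    and sq: "sqint Ws" "\<And>i. sqint (Wz i)" "\<And>i j. sqint (Wzz i j)"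
    and weak: "has_weak_deriv {x. c0 < fst x} W dir_s Ws"
      "\<And>i. has_weak_deriv {x. c0 < fst x} W (dir_z i) (Wz i)"
      "\<And>i j. has_weak_deriv {x. c0 < fst x} (Wz i) (dir_z j) (Wzz i j)"
    and A: "transpose A = A" "\<And>x. 0 \<le> x \<bullet> (A *v x)"
    and q: "transpose q = q" "\<And>x. 0 \<le> x \<bullet> (q *v x)"
    and R: "transpose R = R" "R ** R = q"
    and qA: "\<And>x. x \<bullet> (q *v x) \<le> K * (x \<bullet> (A *v x))"
    and \<kappa>: "\<kappa> \<ge> 0" "\<zeta> \<bullet> (q *v \<zeta>) \<le> K * \<kappa>"
begin

text \<open>\<open>G\<close> collects the entries of (D + \<zeta>)(D + \<zeta>) W and
  \<open>Y\<close>, defined next, is - W_s - A : D^2 W + v . D W + \<kappa> W. They are the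
  conjugated Hessian and parabolic operator, written with the given distributional
  derivatives.\<close>

definition G where "G i k = (\<lambda>x. Wzz i k x + (\<zeta> $ i * Wz k x + (\<zeta> $ k * Wz i x + \<zeta> $ i * \<zeta> $ k * W x)))"

definition Y where "Y = (\<lambda>x. ((- 1) * (\<Sum>i\<in>UNIV. \<Sum>j\<in>UNIV. A $ i $ j * Wzz i j x) + \<kappa> * W x)
    + ((- 1) * Ws x + (\<Sum>k\<in>UNIV. v $ k * Wz k x)))"

lemma G_sqint: "sqint (G i k)" and Y_sqint: "sqint Y"
  unfolding G_def Y_def by (intro sqint_add sqint_cmult sqint_sum sq W)+

interpretation E: energy_form later_tests form Dz Ts by (rule energy_form)

lemma D2_cor:
  assumes "\<psi> \<in> later_tests" "c0 < fst x"
  shows "cor W (Dz i \<psi>) x = cor (Wz i) \<psi> x" "cor W (Dz i (Dz j \<psi>)) x = cor (Wzz i j) \<psi> x"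
    "cor W (Ts \<psi>) x = cor Ws \<psi> x"
proof -
  have 1: "cor W (Dz i \<psi>) x = cor (Wz i) \<psi> x" if "\<psi> \<in> later_tests" for i \<psi>
    unfolding Dz_def by (rule cor_weak_deriv[OF weak(2) Basis_space_time(2) that assms(2)])
  show "cor W (Dz i \<psi>) x = cor (Wz i) \<psi> x" by (rule 1[OF assms(1)])
  have "cor W (Dz i (Dz j \<psi>)) x = cor (Wz i) (Dz j \<psi>) x" by (intro 1 E.D_closed assms)
  also have "\<dots> = cor (Wzz i j) \<psi> x"
    unfolding Dz_def by (rule cor_weak_deriv[OF weak(3) Basis_space_time(2) assms])
  finally show "cor W (Dz i (Dz j \<psi>)) x = cor (Wzz i j) \<psi> x" .
  show "cor W (Ts \<psi>) x = cor Ws \<psi> x"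
    unfolding Ts_def by (rule cor_weak_deriv[OF weak(1) Basis_space_time(1) assms])
qed

lemma cor_G:
  assumes \<psi>: "\<psi> \<in> later_tests" and x: "c0 < fst x"
  shows "cor W (E.L \<zeta> i (E.L \<zeta> k \<psi>)) x = cor (G i k) \<psi> x"
proof -
  note C = later_testsD(1)
  note cl = E.closed \<psi>
  have e: "E.L \<zeta> i (E.L \<zeta> k \<psi>) = (\<lambda>x. Dz i (Dz k \<psi>) x + (\<zeta> $ k * Dz i \<psi> x + (\<zeta> $ i * Dz k \<psi> x + \<zeta> $ i * \<zeta> $ k * \<psi> x)))"
    unfolding E.L_def by (simp only: E.D_add E.D_cmult cl) (simp add: algebra_simps)
  have "cor W (E.L \<zeta> i (E.L \<zeta> k \<psi>)) x
      = cor W (Dz i (Dz k \<psi>)) x + (\<zeta> $ k * cor W (Dz i \<psi>) x + (\<zeta> $ i * cor W (Dz k \<psi>) x + \<zeta> $ i * \<zeta> $ k * cor W \<psi> x))"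
    unfolding e by (simp only: cor_add cor_cmult W C cl)
  also have "\<dots> = cor (G i k) \<psi> x"
    unfolding G_def
    by (simp only: cor_add_left cor_cmult_left sqint_add sqint_cmult sq W C[OF \<psi>] D2_cor[OF \<psi> x])
  finally show ?thesis .
qed

lemma cor_Y:
  assumes \<psi>: "\<psi> \<in> later_tests" and x: "c0 < fst x"
  shows "cor W (\<lambda>x. ((- 1) * E.DD A \<psi> x + \<kappa> * \<psi> x) + ((- 1) * Ts \<psi> x + (\<Sum>k\<in>UNIV. v $ k * Dz k \<psi> x))) x
    = cor Y \<psi> x"
proof -
  note C = later_testsD(1)
  note cl = E.closed E.DD_closed \<psi>
  have "cor W (E.DD A \<psi>) x = (\<Sum>i\<in>UNIV. \<Sum>j\<in>UNIV. A $ i $ j * cor (Wzz i j) \<psi> x)"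
    unfolding E.DD_def by (simp only: cor_sum cor_cmult W C cl D2_cor[OF \<psi> x])
  then show ?thesis
    unfolding Y_def
    by (simp only: cor_add cor_sum cor_cmult W C cl cor_add_left cor_cmult_left cor_sum_left sqint_add
        sqint_cmult sqint_sum sq D2_cor[OF \<psi> x])
qed

text \<open>The abstract inequality for the kernel, with derivatives shifted onto \<open>W\<close>.
  Past \<open>Bnd\<close> the sign of \<theta> is unknown but the mollified quantities vanish;
  freezing its argument at \<open>Bnd\<close> therefore changes no value and makes the weight
  nonnegative and nondecreasing on the whole line.\<close>

lemma mollified_energy:
  assumes \<psi>: "\<psi> \<in> later_tests"
  shows "(\<integral>\<^sup>+x. ennreal (\<theta> (min (fst x) Bnd) * (norm (R ** (\<chi> i k. cor (G i k) \<psi> x) ** R))\<^sup>2) \<partial>lborel)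
    \<le> ennreal (K\<^sup>2) * (\<integral>\<^sup>+x. ennreal (\<theta> (min (fst x) Bnd) * (cor Y \<psi> x)\<^sup>2) \<partial>lborel)"
proof -
  let ?P = "\<lambda>x. ((- 1) * E.DD A \<psi> x + \<kappa> * \<psi> x) + ((- 1) * Ts \<psi> x + (\<Sum>k\<in>UNIV. v $ k * Dz k \<psi> x))"
  let ?LL = "\<lambda>i k. E.L \<zeta> i (E.L \<zeta> k \<psi>)"
  have LV: "?LL i k \<in> later_tests" for i k by (intro E.L_closed \<psi>)
  have PV: "?P \<in> later_tests" by (intro E.closed E.DD_closed \<psi>)
  let ?N = "\<lambda>x. \<theta> (fst x) * (norm (R ** (\<chi> i k. cor W (?LL i k) x) ** R))\<^sup>2"
  have N: "?N x = (\<Sum>i\<in>UNIV. \<Sum>j\<in>UNIV. \<Sum>k\<in>UNIV. \<Sum>l\<in>UNIV. q $ i $ j * q $ k $ l *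
      (\<theta> (fst x) * cor W (?LL i k) x * cor W (?LL j l) x))" for x
    unfolding norm_sandwich_power2[OF R(1)] R(2) by (simp add: sum_distrib_left mult_ac)
  have Ni: "integrable lborel ?N" unfolding N
    by (intro Bochner_Integration.integrable_sum integrable_mult_right form_integrable LV)
  have Nint: "(LINT x|lborel. ?N x) = (\<Sum>i\<in>UNIV. \<Sum>j\<in>UNIV. \<Sum>k\<in>UNIV. \<Sum>l\<in>UNIV. q $ i $ j * q $ k $ l *
      form (?LL i k) (?LL j l))"
    unfolding N form_def using form_integrable[OF LV LV]
    by (simp add: Bochner_Integration.integral_sum)
  have Pi: "integrable lborel (\<lambda>x. \<theta> (fst x) * cor W ?P x * cor W ?P x)" by (rule form_integrable[OF PV PV])
  have en: "(LINT x|lborel. ?N x) \<le> K\<^sup>2 * (LINT x|lborel. \<theta> (fst x) * cor W ?P x * cor W ?P x)"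
    unfolding Nint using E.energy_inequality[OF \<psi> A q qA \<kappa>, of v] unfolding form_def .
  have pos: "0 \<le> \<theta> (min s Bnd)" for s using \<theta>_bound[of "min s Bnd"] by simp
  have eqN: "\<theta> (min (fst x) Bnd) * (norm (R ** (\<chi> i k. cor (G i k) \<psi> x) ** R))\<^sup>2 = ?N x" for x
  proof -
    consider "fst x \<le> c0" | "c0 < fst x" "Bnd \<le> fst x" | "c0 < fst x" "fst x < Bnd" by linarith
    then show ?thesis
    proof cases
      case 1
      then have "\<theta> (min (fst x) Bnd) = 0" "\<theta> (fst x) = 0" by (auto intro!: \<theta>0)
      then show ?thesis by simp
    next
      case 2
      then have "(\<chi> i k. cor (G i k) \<psi> x) = 0" "(\<chi> i k. cor W (?LL i k) x) = 0"
        using cor_eq_0[OF LV, of x] cor_G[OF \<psi>, of x] by (simp_all add: vec_eq_iff)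
      then show ?thesis by simp
    next
      case 3
      then show ?thesis by (simp add: cor_G[OF \<psi>])
    qed
  qed
  have eqP: "\<theta> (min (fst x) Bnd) * (cor Y \<psi> x)\<^sup>2 = \<theta> (fst x) * cor W ?P x * cor W ?P x" for x
  proof -
    consider "fst x \<le> c0" | "c0 < fst x" "Bnd \<le> fst x" | "c0 < fst x" "fst x < Bnd" by linarith
    then show ?thesis
    proof cases
      case 1
      then have "\<theta> (min (fst x) Bnd) = 0" "\<theta> (fst x) = 0" by (auto intro!: \<theta>0)
      then show ?thesis by simp
    next
      case 2
      then show ?thesis
        using cor_eq_0[OF PV, of x] cor_Y[OF \<psi>, of x] by simp
    next
      case 3
      then show ?thesis by (simp only: cor_Y[OF \<psi>]) (simp add: power2_eq_square mult.assoc)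
    qed
  qed
  have "(\<integral>\<^sup>+x. ennreal (\<theta> (min (fst x) Bnd) * (norm (R ** (\<chi> i k. cor (G i k) \<psi> x) ** R))\<^sup>2) \<partial>lborel)
      = ennreal (LINT x|lborel. ?N x)"
    unfolding eqN[symmetric]
    by (rule nn_integral_eq_integral)
       (use Ni in \<open>simp only: eqN\<close>, intro AE_I2 mult_nonneg_nonneg pos, simp)
  also have "\<dots> \<le> ennreal (K\<^sup>2 * (LINT x|lborel. \<theta> (fst x) * cor W ?P x * cor W ?P x))"
    by (rule ennreal_leI[OF en])
  also have "\<dots> = ennreal (K\<^sup>2) * ennreal (LINT x|lborel. \<theta> (fst x) * cor W ?P x * cor W ?P x)"
    by (rule ennreal_mult') simp
  also have "ennreal (LINT x|lborel. \<theta> (fst x) * cor W ?P x * cor W ?P x)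
      = (\<integral>\<^sup>+x. ennreal (\<theta> (min (fst x) Bnd) * (cor Y \<psi> x)\<^sup>2) \<partial>lborel)"
    unfolding eqP[symmetric]
    by (rule nn_integral_eq_integral[symmetric])
       (use Pi in \<open>simp only: eqP\<close>, intro AE_I2 mult_nonneg_nonneg pos, simp)
  finally show ?thesis .
qed

lemma \<theta>_mono:
  assumes "s \<le> t"
  shows "\<theta> (min s Bnd) \<le> \<theta> (min t Bnd)"
proof (rule DERIV_nonneg_imp_nondecreasing[where f=\<theta>])
  fix x assume "min s Bnd \<le> x" "x \<le> min t Bnd"
  then show "\<exists>y. (\<theta> has_real_derivative y) (at x) \<and> 0 \<le> y"
    using \<theta>_deriv[of x] \<theta>_bound[of x] by auto
qed (use assms in auto)

text \<open>On the right, mollifying does not increase the norm: the kernels have mass 1 and look to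
  later times, where the weight is not smaller. On the left, Fatou's lemma is used along an almost
  everywhere convergent subsequence on each ball, and again as the balls exhaust space.\<close>

lemma weak_energy_inequality:
  "(\<integral>\<^sup>+x. ennreal (\<theta> (min (fst x) Bnd) * (norm (R ** (\<chi> i k. G i k x) ** R))\<^sup>2) \<partial>lborel)
    \<le> ennreal (K\<^sup>2) * (\<integral>\<^sup>+x. ennreal (\<theta> (min (fst x) Bnd) * (Y x)\<^sup>2) \<partial>lborel)" (is "_ \<le> ?C")
proof -
  obtain \<rho> :: "nat \<Rightarrow> real \<times> (real^'n) \<Rightarrow> real" where \<rho>: "mollifiers \<rho>" using mollifiers_exist by blast
  have pos: "0 \<le> \<theta> (min s Bnd)" for s using \<theta>_bound[of "min s Bnd"] by simp
  have \<theta>m: "(\<lambda>x::real \<times> (real^'n). \<theta> (min (fst x) Bnd)) \<in> borel_measurable borel"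
    by (intro borel_measurable_continuous_onI continuous_on_compose2[OF \<theta>_cont] continuous_intros) auto
  have Gm[measurable]: "G i k \<in> borel_measurable borel" for i k using G_sqint sqint_measurable by blast
  have \<rho>m[measurable]: "\<rho> n \<in> borel_measurable borel" for n
    using mollifiersD(1)[OF \<rho>] Cc_infty_borel by blast
  have cm[measurable]: "cor (G i k) (\<rho> n) \<in> borel_measurable borel" for i k n by (rule cor_measurable) auto
  have bound: "(\<integral>\<^sup>+x. ennreal (\<theta> (min (fst x) Bnd) * (norm (R ** (\<chi> i k. cor (G i k) (\<rho> n) x) ** R))\<^sup>2) \<partial>lborel) \<le> ?C" for n
  proof -
    have "(\<integral>\<^sup>+x. ennreal (\<theta> (min (fst x) Bnd) * (cor Y (\<rho> n) x)\<^sup>2) \<partial>lborel)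
        = (\<integral>\<^sup>+x. ennreal (\<theta> (min (fst x) Bnd)) * ennreal ((cor Y (\<rho> n) x)\<^sup>2) \<partial>lborel)"
      by (intro nn_integral_cong ennreal_mult pos) simp
    also have "\<dots> \<le> (\<integral>\<^sup>+y. ennreal \<bar>\<rho> n y\<bar> \<partial>lborel)\<^sup>2 * (\<integral>\<^sup>+x. ennreal (\<theta> (min (fst x) Bnd)) * ennreal ((Y x)\<^sup>2) \<partial>lborel)"
    proof (rule cor_weighted_bound[OF Y_sqint mollifiersD(1)[OF \<rho>]])
      show "(\<lambda>x::real \<times> (real^'n). ennreal (\<theta> (min (fst x) Bnd))) \<in> borel_measurable borel" using \<theta>m by simp
      fix x y :: "real \<times> (real^'n)" assume "\<rho> n y \<noteq> 0"
      then have "0 < fst y"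
        using mollifiersD(4)[OF \<rho> _ Basis_space_time(1)] by (fastforce simp: dir_s_def inner_prod_def)
      then show "ennreal (\<theta> (min (fst x) Bnd)) \<le> ennreal (\<theta> (min (fst (x + y)) Bnd))"
        by (intro ennreal_leI \<theta>_mono) simp
    qed
    also have "(\<integral>\<^sup>+y. ennreal \<bar>\<rho> n y\<bar> \<partial>lborel) = 1"
      using nn_integral_eq_integral[OF Cc_infty_integrable[OF mollifiersD(1)[OF \<rho>]], of n] mollifiersD(2,3)[OF \<rho>] by simp
    also have "(\<integral>\<^sup>+x. ennreal (\<theta> (min (fst x) Bnd)) * ennreal ((Y x)\<^sup>2) \<partial>lborel)
        = (\<integral>\<^sup>+x. ennreal (\<theta> (min (fst x) Bnd) * (Y x)\<^sup>2) \<partial>lborel)"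
      by (intro nn_integral_cong ennreal_mult[symmetric] pos) simp
    finally have "(\<integral>\<^sup>+x. ennreal (\<theta> (min (fst x) Bnd) * (cor Y (\<rho> n) x)\<^sup>2) \<partial>lborel)
        \<le> (\<integral>\<^sup>+x. ennreal (\<theta> (min (fst x) Bnd) * (Y x)\<^sup>2) \<partial>lborel)" by simp
    from order_trans[OF mollified_energy[OF mollifiers_later[OF \<rho>]] mult_left_mono[OF this]]
    show ?thesis by simp
  qed
  let ?F = "\<lambda>x. \<theta> (min (fst x) Bnd) * (norm (R ** (\<chi> i k. G i k x) ** R))\<^sup>2"
  have Fm[measurable]: "?F \<in> borel_measurable borel"
    unfolding norm_sandwich_power2[OF R(1)] using \<theta>m by simp
  have ball: "(\<integral>\<^sup>+x. ennreal (indicator (cball 0 (real r)) x * ?F x) \<partial>lborel) \<le> ?C" for r :: nat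
  proof -
    obtain s where s: "AE x in lborel. x \<in> cball 0 (real r) \<longrightarrow>
        (\<forall>p. (\<lambda>n. cor (case p of (i, k) \<Rightarrow> G i k) (\<rho> (s n)) x) \<longlonglongrightarrow> (case p of (i, k) \<Rightarrow> G i k) x)"
      using mollification_AE_subsequence[of "\<lambda>p. case p of (i, k) \<Rightarrow> G i k", OF _ \<rho>] G_sqint by force
    show ?thesis
    proof (rule nn_integral_Fatou_le)
      let ?f = "\<lambda>n x. indicator (cball 0 (real r)) x * (\<theta> (min (fst x) Bnd) * (norm (R ** (\<chi> i k. cor (G i k) (\<rho> (s n)) x) ** R))\<^sup>2)"
      show "(\<lambda>x. ennreal (?f n x)) \<in> borel_measurable lborel" for n
        unfolding norm_sandwich_power2[OF R(1)] measurable_lborel1 vec_lambda_beta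
        by (intro measurable_compose[OF _ measurable_ennreal] borel_measurable_times
            borel_measurable_indicator borel_measurable_sum borel_measurable_const cm \<theta>m)
           (use \<theta>m in auto)
      show "(\<integral>\<^sup>+x. ennreal (?f n x) \<partial>lborel) \<le> ?C" for n
      proof (rule order_trans[OF nn_integral_mono bound[of "s n"]])
        show "ennreal (?f n x) \<le> ennreal (\<theta> (min (fst x) Bnd) * (norm (R ** (\<chi> i k. cor (G i k) (\<rho> (s n)) x) ** R))\<^sup>2)" for x
          using pos[of "fst x"] by (intro ennreal_leI) (auto simp: indicator_def)
      qed
      show "AE x in lborel. (\<lambda>n. ennreal (?f n x)) \<longlonglongrightarrow> ennreal (indicator (cball 0 (real r)) x * ?F x)"
        using s
      proof eventually_elim
        case (elim x)
        show ?case
        proof (cases "x \<in> cball 0 (real r)")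
          case True
          then have "(\<lambda>n. cor (G i k) (\<rho> (s n)) x) \<longlonglongrightarrow> G i k x" for i k
            using elim[THEN mp, THEN spec, of "(i, k)"] by simp
          then show ?thesis
            by (intro tendsto_ennrealI tendsto_mult tendsto_const frob_sandwich_tendsto R) simp
        qed simp
      qed
    qed
  qed
  show ?thesis
  proof (rule nn_integral_Fatou_le)
    show "(\<lambda>x. ennreal (indicator (cball 0 (real r)) x * ?F x)) \<in> borel_measurable lborel" for r
    proof -
      have "(\<lambda>x. indicator (cball 0 (real r)) x * ?F x) \<in> borel_measurable borel"
        by (rule borel_measurable_times[OF borel_measurable_indicator Fm]) simp
      from measurable_compose[OF this measurable_ennreal] show ?thesis by simp
    qed
    show "(\<integral>\<^sup>+x. ennreal (indicator (cball 0 (real r)) x * ?F x) \<partial>lborel) \<le> ?C" for r by (rule ball)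
    show "AE x in lborel. (\<lambda>r. ennreal (indicator (cball 0 (real r)) x * ?F x)) \<longlonglongrightarrow> ennreal (?F x)"
    proof (rule AE_I2, rule tendsto_eventually)
      fix x :: "real \<times> (real^'n)"
      obtain N where "norm x \<le> real N" using real_arch_simple by blast
      then have "x \<in> cball 0 (real r)" if "r \<ge> N" for r using that by (simp add: order_trans)
      then show "\<forall>\<^sub>F r in sequentially. ennreal (indicator (cball 0 (real r)) x * ?F x) = ennreal (?F x)"
        unfolding eventually_sequentially by (intro exI[of _ N]) auto
    qed
  qed
qed

end

section \<open>Distributional derivatives and extension by zero past the final time\<close>

section \<open>Calculus of distributional derivatives\<close>

lemma has_weak_deriv_iff:
  assumes b: "b \<in> Basis"
  shows "has_weak_deriv U f b g \<longleftrightarrow> locally_integrable U f \<and> locally_integrable U g \<and>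
    (\<forall>\<phi>\<in>Cc_infty U. (LINT x|lborel. f x * pd b \<phi> x) = - (LINT x|lborel. g x * \<phi> x))"
  unfolding has_weak_deriv_def
  using set_integral_Cc[of _ U] set_integral_Cc[OF Cc_infty_pd[OF _ b], of _ U] by (metis (no_types, lifting))

lemma locally_integrable_cong_subset:
  assumes "locally_integrable U f" "V \<subseteq> U" "\<And>x. x \<in> V \<Longrightarrow> f' x = f x"
  shows "locally_integrable V f'"
  unfolding locally_integrable_def
proof (intro allI impI)
  fix K assume K: "compact K \<and> K \<subseteq> V"
  then have "set_integrable lborel K f" using assms(1,2) by (auto simp: locally_integrable_def)
  moreover have "(\<lambda>x. indicator K x *\<^sub>R f x) = (\<lambda>x. indicator K x *\<^sub>R f' x)"
    using K assms(3) by (auto simp: fun_eq_iff indicator_def)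
  ultimately show "set_integrable lborel K f'" by (simp add: set_integrable_def)
qed

lemma has_weak_deriv_cong_subset:
  assumes b: "b \<in> Basis" and w: "has_weak_deriv U f b g" and V: "V \<subseteq> U"
    and eq: "\<And>x. x \<in> V \<Longrightarrow> f' x = f x" "\<And>x. x \<in> V \<Longrightarrow> g' x = g x"
  shows "has_weak_deriv V f' b g'"
  unfolding has_weak_deriv_iff[OF b]
proof (intro conjI ballI)
  show "locally_integrable V f'" "locally_integrable V g'"
    using w V eq locally_integrable_cong_subset by (metis has_weak_deriv_def)+
  fix \<phi> assume \<phi>: "\<phi> \<in> Cc_infty V"
  have z: "\<phi> x = 0" "pd b \<phi> x = 0" if "x \<notin> V" for x
    using Cc_inftyD(2)[OF \<phi>] Cc_inftyD(2)[OF Cc_infty_pd[OF \<phi> b]] that by blast+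
  have "(\<lambda>x. f' x * pd b \<phi> x) = (\<lambda>x. f x * pd b \<phi> x)" "(\<lambda>x. g' x * \<phi> x) = (\<lambda>x. g x * \<phi> x)"
    using eq z by (metis mult_zero_right)+
  then show "(LINT x|lborel. f' x * pd b \<phi> x) = - (LINT x|lborel. g' x * \<phi> x)"
    using w Cc_infty_mono[OF V \<phi>] by (simp add: has_weak_deriv_iff[OF b])
qed

lemma locally_integrable_lincomb:
  "locally_integrable U f \<Longrightarrow> locally_integrable U g \<Longrightarrow> locally_integrable U (\<lambda>x. f x + c * g x)"
  unfolding locally_integrable_def by (auto intro!: set_integral_add set_integrable_mult_right)

lemma has_weak_deriv_lincomb:
  assumes b: "b \<in> Basis" and 1: "has_weak_deriv U f b g" and 2: "has_weak_deriv U f' b g'"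
  shows "has_weak_deriv U (\<lambda>x. f x + c * f' x) b (\<lambda>x. g x + c * g' x)"
proof -
  have l: "locally_integrable U f" "locally_integrable U g" "locally_integrable U f'" "locally_integrable U g'"
    using 1 2 by (auto simp: has_weak_deriv_def)
  show ?thesis unfolding has_weak_deriv_iff[OF b]
  proof (intro conjI ballI locally_integrable_lincomb l)
    fix \<phi> assume \<phi>: "\<phi> \<in> Cc_infty U"
    note i = integrable_times_Cc[OF l(1) Cc_infty_pd[OF \<phi> b]] integrable_times_Cc[OF l(3) Cc_infty_pd[OF \<phi> b]]
      integrable_times_Cc[OF l(2) \<phi>] integrable_times_Cc[OF l(4) \<phi>]
    show "(LINT x|lborel. (f x + c * f' x) * pd b \<phi> x) = - (LINT x|lborel. (g x + c * g' x) * \<phi> x)"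
      using i 1 2 \<phi> by (simp add: distrib_right mult.assoc has_weak_deriv_iff[OF b])
  qed
qed

lemma locally_integrable_mult_continuous:
  assumes f: "locally_integrable U f" and h: "continuous_on UNIV h"
  shows "locally_integrable U (\<lambda>x. h x * f x)"
  unfolding locally_integrable_def set_integrable_def
proof (intro allI impI)
  fix K :: "'a set" assume K: "compact K \<and> K \<subseteq> U"
  then have i: "integrable lborel (\<lambda>x. indicator K x *\<^sub>R f x)"
    using f by (auto simp: locally_integrable_def set_integrable_def)
  have "bounded (h ` K)" using K h continuous_on_subset compact_continuous_image compact_imp_bounded
    by (metis subset_UNIV)
  then obtain C where C: "\<And>x. x \<in> K \<Longrightarrow> \<bar>h x\<bar> \<le> C" by (auto simp: bounded_iff)
  have [measurable]: "h \<in> borel_measurable borel" using h by (rule borel_measurable_continuous_onI)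
  have [measurable]: "(\<lambda>x. indicator K x *\<^sub>R f x) \<in> borel_measurable borel" using i by auto
  have "integrable lborel (\<lambda>x. h x * (indicator K x *\<^sub>R f x))"
  proof (rule Bochner_Integration.integrable_bound[OF integrable_mult_right[OF i, of C]])
    show "AE x in lborel. norm (h x * (indicator K x *\<^sub>R f x)) \<le> norm (C * (indicator K x *\<^sub>R f x))"
    proof (rule AE_I2)
      fix x show "norm (h x * (indicator K x *\<^sub>R f x)) \<le> norm (C * (indicator K x *\<^sub>R f x))"
        using C[of x] by (cases "x \<in> K") (auto simp: abs_mult intro!: mult_right_mono)
    qed
  qed measurable
  then show "integrable lborel (\<lambda>x. indicator K x *\<^sub>R (h x * f x))" by (simp add: mult.left_commute)
qed

lemma has_weak_deriv_mult_smooth: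
  assumes b: "b \<in> Basis" and w: "has_weak_deriv U f b g" and h: "smooth h"
  shows "has_weak_deriv U (\<lambda>x. h x * f x) b (\<lambda>x. h x * g x + pd b h x * f x)"
proof -
  have l: "locally_integrable U f" "locally_integrable U g" using w by (auto simp: has_weak_deriv_def)
  note hc = smooth_continuous[OF h] smooth_continuous[OF smooth_pd[OF h b]]
  have lm: "locally_integrable U (\<lambda>x. h x * f x)" "locally_integrable U (\<lambda>x. h x * g x)"
    "locally_integrable U (\<lambda>x. pd b h x * f x)"
    using l hc by (auto intro: locally_integrable_mult_continuous)
  have lg: "locally_integrable U (\<lambda>x. h x * g x + pd b h x * f x)"
    using locally_integrable_lincomb[OF lm(2,3), of 1] by simp
  show ?thesis unfolding has_weak_deriv_iff[OF b]
  proof (intro conjI ballI lm(1) lg)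
    fix \<phi> assume \<phi>: "\<phi> \<in> Cc_infty U"
    have h\<phi>: "(\<lambda>x. h x * \<phi> x) \<in> Cc_infty U" by (rule Cc_infty_mult[OF \<phi> h])
    have "(LINT x|lborel. f x * pd b (\<lambda>x. h x * \<phi> x) x) = - (LINT x|lborel. g x * (h x * \<phi> x))"
      using w h\<phi> by (simp add: has_weak_deriv_iff[OF b])
    moreover have "f x * pd b (\<lambda>x. h x * \<phi> x) x = (pd b h x * f x) * \<phi> x + (h x * f x) * pd b \<phi> x" for x
      using pd_mult[OF smooth_differentiable[OF h] smooth_differentiable[OF Cc_inftyD(1)[OF \<phi>]]]
      by (simp add: algebra_simps)
    ultimately show "(LINT x|lborel. h x * f x * pd b \<phi> x) = - (LINT x|lborel. (h x * g x + pd b h x * f x) * \<phi> x)"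
      using integrable_times_Cc[OF lm(3) \<phi>] integrable_times_Cc[OF lm(1) Cc_infty_pd[OF \<phi> b]]
        integrable_times_Cc[OF lm(2) \<phi>]
      by (simp add: distrib_left mult_ac)
  qed
qed

text \<open>Measurability of the functions in \<open>weak_derivs\<close> has no other source than
  local integrability; an exhaustion by compact sets extracts it, on \<open>U\<close> only.\<close>

lemma locally_integrable_measurable:
  assumes U: "open U" and f: "locally_integrable U f"
  shows "(\<lambda>x. indicator U x * f x) \<in> borel_measurable borel"
proof -
  obtain C where C: "\<And>n. compact (C n)" "\<And>n. C n \<subseteq> U" "\<And>n. C n \<subseteq> interior (C (Suc n))"
    "\<And>K. \<lbrakk>compact K; K \<subseteq> U\<rbrakk> \<Longrightarrow> \<exists>N. \<forall>n\<ge>N. K \<subseteq> C n" using open_Union_compact_subsets[OF U] by metis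
  have m: "(\<lambda>x. indicator (C n) x * f x) \<in> borel_measurable borel" for n
  proof -
    have "set_integrable lborel (C n) f" using f C(1,2) by (simp add: locally_integrable_def)
    then have "integrable lborel (\<lambda>x. indicator (C n) x * f x)" by (simp add: set_integrable_def)
    then show ?thesis using borel_measurable_integrable by fastforce
  qed
  show ?thesis
  proof (rule borel_measurable_LIMSEQ_real[OF _ m])
    fix x show "(\<lambda>n. indicator (C n) x * f x) \<longlonglongrightarrow> indicator U x * f x"
    proof (cases "x \<in> U")
      case True
      then obtain N where "\<forall>n\<ge>N. {x} \<subseteq> C n" using C(4)[of "{x}"] by auto
      then show ?thesis using True
        by (intro tendsto_eventually) (auto simp: eventually_sequentially intro!: exI[of _ N])
    next
      case False
      then have "x \<notin> C n" for n using C(2) by blast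
      then show ?thesis using False by simp
    qed
  qed
qed

section \<open>A smooth step\<close>

text \<open>The normalized primitive of a bump on (1, 2), delivered with all its derivatives as a
  sequence for \<open>C_diff_ridge\<close>. Vanishing up to 1 leaves a gap that keeps the cut-off
  test functions away from the final time.\<close>

lemma smooth_step_exists:
  "\<exists>St :: nat \<Rightarrow> real \<Rightarrow> real. (\<forall>n t. (St n has_real_derivative St (Suc n) t) (at t)) \<and>
    (\<forall>t\<le>1. St 0 t = 0) \<and> (\<forall>t\<ge>2. St 0 t = 1) \<and> (\<forall>t. 0 \<le> St 0 t \<and> St 0 t \<le> 1) \<and>
    (\<forall>t. t \<notin> {1<..<2} \<longrightarrow> St 1 t = 0) \<and> (\<exists>C. \<forall>t. \<bar>St 1 t\<bar> \<le> C)"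
proof -
  define \<beta> :: "real \<Rightarrow> real" where "\<beta> = box_bump 1 2"
  have \<beta>C: "\<beta> \<in> Cc_infty UNIV" unfolding \<beta>_def by (rule box_bump_Cc_infty) simp
  have \<beta>c: "continuous_on S \<beta>" for S using Cc_infty_continuous[OF \<beta>C] .
  have \<beta>0: "\<beta> t \<ge> 0" "t \<notin> {1<..<2} \<Longrightarrow> \<beta> t = 0" "t \<in> {1<..<2} \<Longrightarrow> \<beta> t > 0" for t
    unfolding \<beta>_def using box_bump_nonneg box_bump_eq_0[of t 1 2] box_bump_pos_iff[of 1 2 t]
    by (auto simp: box_real)
  define I where "I t = (LINT s|lborel. indicator {0..t} s * \<beta> s)" for t
  have ii: "integrable lborel (\<lambda>s. indicator {a..t} s * \<beta> s)" for a t
    using borel_integrable_compact[of "{a..t}" \<beta>] \<beta>c by simp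
  have I_diff: "I t - I r = (LINT s|lborel. indicator {r..t} s * \<beta> s)" if "0 \<le> r" "r \<le> t" for r t
  proof -
    have "I t - I r = (LINT s|lborel. indicator {0..t} s * \<beta> s - indicator {0..r} s * \<beta> s)"
      unfolding I_def by (intro Bochner_Integration.integral_diff[symmetric] ii)
    also have "\<dots> = (LINT s|lborel. indicator {r..t} s * \<beta> s)"
    proof (rule integral_cong_AE)
      show "AE s in lborel. indicator {0..t} s * \<beta> s - indicator {0..r} s * \<beta> s = indicator {r..t} s * \<beta> s"
        using AE_lborel_singleton[of r]
        by eventually_elim (use that in \<open>auto simp: indicator_def\<close>)
    qed (use ii in auto)
    finally show ?thesis .
  qed
  have I_deriv: "(I has_real_derivative \<beta> t) (at t)" for t
  proof (cases "t < 1")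
    case True
    have z: "I s = 0" if "s < 1" for s
    proof -
      have "indicator {0..s} r * \<beta> r = 0" for r using \<beta>0(2)[of r] that by (auto simp: indicator_def)
      then show ?thesis unfolding I_def by (simp only: Bochner_Integration.integral_zero)
    qed
    have "((\<lambda>_. 0) has_real_derivative 0) (at t)" by simp
    then have "(I has_real_derivative 0) (at t)"
      by (rule has_field_derivative_transform_within_open[of _ _ _ "{..<1}"]) (use True z in auto)
    then show ?thesis using True \<beta>0(2)[of t] by simp
  next
    case False
    have "((\<lambda>u. integral {0..u} \<beta>) has_vector_derivative \<beta> t) (at t within {0..t + 1})"
      by (rule integral_has_vector_derivative[OF \<beta>c]) (use False in auto)
    then have "((\<lambda>u. integral {0..u} \<beta>) has_real_derivative \<beta> t) (at t)"
      using False by (subst (asm) at_within_interior) (auto simp: has_real_derivative_iff_has_vector_derivative)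
    moreover have "integral {0..u} \<beta> = I u" for u
      using set_borel_integral_eq_integral(2)[of "{0..u}" \<beta>] ii[of 0 u]
      by (simp add: set_integrable_def set_lebesgue_integral_def I_def)
    ultimately show ?thesis by simp
  qed
  have I_mono: "I r \<le> I t" if "r \<le> t" for r t
    by (rule DERIV_nonneg_imp_nondecreasing[OF that]) (use I_deriv \<beta>0 in blast)
  have I1: "I t = 0" if "t \<le> 1" for t
  proof -
    have "indicator {0..t} r * \<beta> r = 0" for r using \<beta>0(2)[of r] that by (auto simp: indicator_def)
    then show ?thesis unfolding I_def by (simp only: Bochner_Integration.integral_zero)
  qed
  have I2: "I t = I 2" if "t \<ge> 2" for t
  proof -
    have "I t - I 2 = (LINT s|lborel. indicator {2..t} s * \<beta> s)" using that by (intro I_diff) auto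
    also have "\<dots> = 0"
    proof -
      have "indicator {2..t} r * \<beta> r = 0" for r using \<beta>0(2)[of r] by (auto simp: indicator_def)
      then show ?thesis by (simp only: Bochner_Integration.integral_zero)
    qed
    finally show ?thesis by simp
  qed
  have pos: "I 2 > 0"
  proof -
    obtain z where z: "1 < z" "z < 2" "I 2 - I 1 = (2 - 1) * \<beta> z"
      using MVT2[of 1 2 I \<beta>] I_deriv by auto
    then show ?thesis using \<beta>0(3)[of z] I1[of 1] by simp
  qed
  define St where "St n = (case n of 0 \<Rightarrow> (\<lambda>t. I t / I 2) | Suc m \<Rightarrow> (\<lambda>t. ((pd 1 ^^ m) \<beta>) t / I 2))" for n
  have sm: "smooth ((pd (1::real) ^^ m) \<beta>)" for m
  proof (induction m)
    case (Suc m)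
    have "smooth (pd (1::real) ((pd 1 ^^ m) \<beta>))" by (rule smooth_pd[OF Suc]) simp
    then show ?case by simp
  qed (use Cc_inftyD(1)[OF \<beta>C] in simp)
  have 1: "(St n has_real_derivative St (Suc n) t) (at t)" for n t
  proof (cases n)
    case 0
    then show ?thesis using DERIV_cdivide[OF I_deriv[of t], of "I 2"] by (simp add: St_def)
  next
    case (Suc m)
    have "((pd 1 ^^ m) \<beta> has_real_derivative (pd 1 ^^ Suc m) \<beta> t) (at t)"
      using smooth_line_deriv[OF sm[of m], of 0 1 t] by simp
    from DERIV_cdivide[OF this, of "I 2"] show ?thesis by (simp add: St_def Suc)
  qed
  have 2: "0 \<le> St 0 t \<and> St 0 t \<le> 1" for t
  proof -
    have "I t \<ge> 0" using I_mono[of "min t 1" t] I1[of "min t 1"] by simp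
    moreover have "I t \<le> I 2" using I_mono[of t "max t 2"] I2[of "max t 2"] by simp
    ultimately show ?thesis using pos by (simp add: St_def)
  qed
  obtain C where "\<And>t. \<bar>\<beta> t\<bar> \<le> C" using Cc_infty_bounded[OF \<beta>C] by blast
  then have 3: "\<bar>St 1 t\<bar> \<le> C / I 2" for t using pos by (simp add: St_def divide_right_mono)
  have 4: "St 0 t = 0" if "t \<le> 1" for t using I1[OF that] by (simp add: St_def)
  have 5: "St 0 t = 1" if "t \<ge> 2" for t using I2[OF that] pos by (simp add: St_def)
  have 6: "St 1 t = 0" if "t \<notin> {1<..<2}" for t using \<beta>0(2)[OF that] by (simp add: St_def)
  show ?thesis using 1 2 3 4 5 6 by blast
qed

section \<open>Extension by zero past the final time\<close>

lemma esqrt_le_iff: "0 \<le> d \<Longrightarrow> esqrt x \<le> ennreal d \<longleftrightarrow> x \<le> ennreal (d\<^sup>2)"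
proof (cases x)
  case (real r)
  assume d: "0 \<le> d"
  have "sqrt r \<le> d \<longleftrightarrow> r \<le> d\<^sup>2"
    using d real_sqrt_le_iff[of r "d\<^sup>2"] by (simp only: real_sqrt_abs abs_of_nonneg)
  then show ?thesis using real d by (simp add: esqrt_def ennreal_le_iff)
qed (auto simp: esqrt_def top_unique)

lemma open_slab: "open (slab c B)"
  unfolding slab_def by (intro open_Times) auto

lemma in_slab: "x \<in> slab c B \<longleftrightarrow> c < fst x \<and> fst x < B"
  by (cases x) (auto simp: slab_def)

lemma ennreal_power2_le_imp_le:
  assumes "x\<^sup>2 \<le> ennreal (e\<^sup>2)" "0 \<le> e"
  shows "x \<le> ennreal e"
proof (cases x)
  case (real a)
  then have "a\<^sup>2 \<le> e\<^sup>2" using assms by (simp add: ennreal_power ennreal_le_iff)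
  then have "a \<le> e" using assms(2) by (rule power2_le_imp_le)
  then show ?thesis using real by (simp only: ennreal_leI)
next
  case top
  then show ?thesis using assms by (simp add: power2_eq_square top_unique)
qed

text \<open>Cauchy-Schwarz on the compact \<open>K\<close> converts the L2 trace condition into an
  L1 bound on slices. The threshold e / (V + 1), with V the volume of \<open>K\<close>, is chosen to
  make the product at most e.\<close>

lemma slice_L1_small:
  fixes u :: "real \<times> (real^'n) \<Rightarrow> real"
  assumes K: "compact K" and e: "e > 0"
    and lim: "((\<lambda>s. wnorm K (\<lambda>_. 1) (\<lambda>z. u (s, z))) \<longlongrightarrow> 0) (at B within S)"
    and m: "\<And>s. s \<in> S \<Longrightarrow> (\<lambda>z. u (s, z)) \<in> borel_measurable borel"
  obtains d where "d > 0"
    "\<And>s. s \<in> S \<Longrightarrow> s \<noteq> B \<Longrightarrow> \<bar>s - B\<bar> < d \<Longrightarrow> (\<integral>\<^sup>+z. indicator K z * ennreal \<bar>u (s, z)\<bar> \<partial>lborel) \<le> ennreal e"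
proof -
  have Km: "K \<in> sets borel" using K by (simp add: borel_compact)
  have Kf: "emeasure lborel K < \<infinity>" using K emeasure_bounded_finite compact_imp_bounded by blast
  define V where "V = measure lborel K"
  have V: "emeasure lborel K = ennreal V" "V \<ge> 0"
    using Kf by (auto simp: V_def emeasure_eq_ennreal_measure)
  define r where "r = e / (V + 1)"
  have r: "r > 0" using e V by (simp add: r_def)
  have "\<forall>\<^sub>F s in at B within S. wnorm K (\<lambda>_. 1) (\<lambda>z. u (s, z)) < ennreal r"
    using order_tendstoD(2)[OF lim] r by simp
  then obtain d where d: "d > 0" "\<And>s. s \<in> S \<Longrightarrow> s \<noteq> B \<Longrightarrow> dist s B < d \<Longrightarrow> wnorm K (\<lambda>_. 1) (\<lambda>z. u (s, z)) < ennreal r"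
    unfolding eventually_at by blast
  show thesis
  proof (rule that[OF d(1)])
    fix s assume s: "s \<in> S" "s \<noteq> B" "\<bar>s - B\<bar> < d"
    note [measurable] = m[OF s(1)] Km
    have "wnorm K (\<lambda>_. 1) (\<lambda>z. u (s, z)) \<le> ennreal r"
      using d(2)[OF s(1,2)] s(3) by (simp add: dist_real_def less_imp_le)
    then have "(\<integral>\<^sup>+z\<in>K. ennreal ((u (s, z))\<^sup>2) \<partial>lborel) \<le> ennreal (r\<^sup>2)"
      unfolding wnorm_def using r by (subst (asm) esqrt_le_iff) auto
    moreover have "(\<integral>\<^sup>+z. indicator K z * ennreal \<bar>u (s, z)\<bar> \<partial>lborel)\<^sup>2
      \<le> (\<integral>\<^sup>+z. (indicator K z)\<^sup>2 \<partial>lborel) * (\<integral>\<^sup>+z. (indicator K z * ennreal \<bar>u (s, z)\<bar>)\<^sup>2 \<partial>lborel)"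
    proof -
      have "indicator K z * ennreal \<bar>u (s, z)\<bar> = indicator K z * (indicator K z * ennreal \<bar>u (s, z)\<bar>)" for z
        by (auto simp: indicator_def)
      then show ?thesis using Cauchy_Schwarz_nn_integral[of "indicator K" lborel "\<lambda>z. indicator K z * ennreal \<bar>u (s, z)\<bar>"]
        by simp
    qed
    moreover have "(\<integral>\<^sup>+z. (indicator K z)\<^sup>2 \<partial>lborel) = ennreal V"
    proof -
      have "(\<integral>\<^sup>+z. (indicator K z)\<^sup>2 \<partial>lborel) = (\<integral>\<^sup>+z. indicator K z \<partial>lborel)"
        by (intro nn_integral_cong) (auto simp: indicator_def)
      then show ?thesis using V by simp
    qed
    moreover have "(\<integral>\<^sup>+z. (indicator K z * ennreal \<bar>u (s, z)\<bar>)\<^sup>2 \<partial>lborel) = (\<integral>\<^sup>+z\<in>K. ennreal ((u (s, z))\<^sup>2) \<partial>lborel)"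
      by (intro nn_integral_cong) (auto simp: indicator_def ennreal_power)
    ultimately have "(\<integral>\<^sup>+z. indicator K z * ennreal \<bar>u (s, z)\<bar> \<partial>lborel)\<^sup>2 \<le> ennreal V * ennreal (r\<^sup>2)"
      by (metis (no_types, lifting) mult_left_mono order_trans zero_le)
    also have "\<dots> = ennreal (V * r\<^sup>2)" using V by (simp add: ennreal_mult)
    also have "\<dots> \<le> ennreal (e\<^sup>2)"
    proof (rule ennreal_leI)
      have "V * r\<^sup>2 \<le> (V + 1)\<^sup>2 * r\<^sup>2"
        using V by (intro mult_right_mono) (auto simp: power2_eq_square algebra_simps)
      also have "\<dots> = e\<^sup>2" using V by (simp add: r_def power_divide)
      finally show "V * r\<^sup>2 \<le> e\<^sup>2" .
    qed
    finally show "(\<integral>\<^sup>+z. indicator K z * ennreal \<bar>u (s, z)\<bar> \<partial>lborel) \<le> ennreal e"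
      by (rule ennreal_power2_le_imp_le) (rule less_imp_le[OF e])
  qed
qed


text \<open>The integrand lives in the time layer between B - 2/(n+1) and B - 1/(n+1). The layer's
  width compensates the factor n + 1 from differentiating the cutoff, and the L1 norms of the slices
  tend to 0 by the trace condition.\<close>

lemma trace_term_tendsto_0:
  fixes u \<phi> :: "real \<times> (real^'n) \<Rightarrow> real"
  assumes cB: "c < B"
    and um: "(\<lambda>x. indicator (slab c B) x * u x) \<in> borel_measurable borel"
    and N: "N \<in> null_sets lborel" "\<And>K. compact K \<Longrightarrow> ((\<lambda>s. wnorm K (\<lambda>_. 1) (\<lambda>z. u (s, z))) \<longlongrightarrow> 0) (at B within ({c<..<B} - N))"
    and \<phi>: "compact K" "\<And>x. x \<notin> K \<Longrightarrow> \<phi> x = 0" "\<And>x. \<bar>\<phi> x\<bar> \<le> C2" "\<phi> \<in> borel_measurable borel"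
    and S1: "\<And>t. \<bar>S1 t\<bar> \<le> C1" "\<And>t. t \<notin> {1<..<2} \<Longrightarrow> S1 t = 0" "S1 \<in> borel_measurable borel"
  shows "(\<lambda>n. LINT x|lborel. indicator (slab c B) x * u x * (real (Suc n) * S1 (real (Suc n) * (B - fst x)) * \<phi> x)) \<longlonglongrightarrow> 0"
proof -
  define g where "g x = indicator (slab c B) x * u x" for x
  have [measurable]: "g \<in> borel_measurable borel" "\<phi> \<in> borel_measurable borel" "S1 \<in> borel_measurable borel"
    using um \<phi> S1 by (auto simp: g_def[abs_def])
  define K' where "K' = snd ` K"
  have K': "compact K'" unfolding K'_def using \<phi>(1) by (intro compact_continuous_image continuous_intros)
  have K'm[measurable]: "K' \<in> sets borel" using K' by (simp add: borel_compact)
  have C0: "C1 \<ge> 0" "C2 \<ge> 0" using S1(1)[of 0] \<phi>(3)[of 0] by linarith+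
  let ?J = "\<lambda>n x. g x * (real (Suc n) * S1 (real (Suc n) * (B - fst x)) * \<phi> x)"
  have gm: "(\<lambda>z. g (s, z)) \<in> borel_measurable borel" for s
  proof -
    have "(\<lambda>z::real^'n. (s, z)) \<in> borel_measurable borel"
      by (intro borel_measurable_continuous_onI continuous_intros)
    then show ?thesis by (rule measurable_compose) measurable
  qed
  have gu: "g (s, z) = u (s, z)" if "s \<in> {c<..<B}" for s z using that by (simp add: g_def in_slab)
  have "((\<lambda>s. wnorm K' (\<lambda>_. 1) (\<lambda>z. g (s, z))) \<longlongrightarrow> 0) (at B within ({c<..<B} - N))"
    by (rule Lim_transform_within[OF N(2)[OF K'], of 1]) (use gu in auto)
  note lim = this
  show ?thesis unfolding g_def[symmetric]
  proof (rule LIMSEQ_I)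
    fix e :: real assume e: "e > 0"
    define e' where "e' = e / (2 * (C1 * C2 + 1))"
    have e': "e' > 0" using e C0 by (simp add: e'_def add_nonneg_pos)
    obtain d where d: "d > 0" "\<And>s. s \<in> {c<..<B} - N \<Longrightarrow> s \<noteq> B \<Longrightarrow> \<bar>s - B\<bar> < d \<Longrightarrow>
        (\<integral>\<^sup>+z. indicator K' z * ennreal \<bar>g (s, z)\<bar> \<partial>lborel) \<le> ennreal e'"
      using slice_L1_small[OF K' e' lim gm] by blast
    obtain N0 where N0: "1 / real (Suc N0) < min d (B - c) / 2"
      using nat_approx_posE[of "min d (B - c) / 2"] d(1) cB by auto
    show "\<exists>no. \<forall>n\<ge>no. norm ((LINT x|lborel. ?J n x) - 0) < e"
    proof (intro exI allI impI)
      fix n assume n: "n \<ge> N0"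
      define m where "m = real (Suc n)"
      have m: "m > 0" by (simp add: m_def)
      have "1 / m \<le> 1 / real (Suc N0)" using n by (simp add: m_def frac_le)
      then have m2: "2 / m < min d (B - c)" using N0 by simp
      let ?I = "{B - 2 / m <..< B - 1 / m}"
      have pt: "ennreal (norm (?J n x)) \<le> ennreal (C1 * C2 * m) * (indicator ?I (fst x) * (indicator K' (snd x) * ennreal \<bar>g x\<bar>))" for x
      proof (cases "fst x \<in> ?I \<and> x \<in> K")
        case True
        have "norm (?J n x) = \<bar>g x\<bar> * (m * \<bar>S1 (m * (B - fst x))\<bar> * \<bar>\<phi> x\<bar>)"
          using m by (simp add: abs_mult m_def)
        also have "\<dots> \<le> \<bar>g x\<bar> * (m * C1 * C2)"
          using m S1(1) \<phi>(3) C0 by (intro mult_left_mono mult_mono) auto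
        also have "\<dots> = (C1 * C2 * m) * \<bar>g x\<bar>" by simp
        finally have "norm (?J n x) \<le> (C1 * C2 * m) * \<bar>g x\<bar>" .
        then have "ennreal (norm (?J n x)) \<le> ennreal (C1 * C2 * m) * ennreal \<bar>g x\<bar>"
          using C0 m by (subst ennreal_mult[symmetric]) (auto intro: ennreal_leI)
        then show ?thesis using True by (auto simp: K'_def)
      next
        case False
        then have "fst x \<notin> ?I \<or> x \<notin> K" by blast
        then have "S1 (m * (B - fst x)) = 0 \<or> \<phi> x = 0"
        proof
          assume "\<not> (fst x \<in> ?I)"
          then have "m * (B - fst x) \<notin> {1<..<2}" using m by (auto simp: field_simps)
          then show ?thesis using S1(2) by blast
        next
          assume "x \<notin> K" then show ?thesis using \<phi>(2) by blast
        qed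
        then show ?thesis by (auto simp: m_def)
      qed
      have Fm: "(\<lambda>x. indicator ?I (fst x) * (indicator K' (snd x) * ennreal \<bar>g x\<bar>)) \<in> borel_measurable borel"
      proof -
        have "(\<lambda>x. indicator ?I (fst x) * (indicator K' (snd x) * ennreal \<bar>g x\<bar>))
            = (\<lambda>x. indicator (?I \<times> K') x * ennreal \<bar>g x\<bar>)"
          by (auto simp: fun_eq_iff indicator_def)
        moreover have [measurable]: "?I \<times> K' \<in> sets borel" by (intro borel_Times K'm) auto
        ultimately show ?thesis by simp
      qed
      have "ennreal \<bar>LINT x|lborel. ?J n x\<bar> \<le> (\<integral>\<^sup>+x. ennreal (norm (?J n x)) \<partial>lborel)"
      proof (cases "integrable lborel (?J n)")
        case True
        then show ?thesis using integral_norm_bound_ennreal[OF True] by simp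
      next
        \<comment> \<open>A non-integrable integrand has integral 0 by convention, so the bound is
          trivial.\<close>
        case False
        then show ?thesis by (simp add: not_integrable_integral_eq)
      qed
      also have "\<dots> \<le> (\<integral>\<^sup>+x. ennreal (C1 * C2 * m) * (indicator ?I (fst x) * (indicator K' (snd x) * ennreal \<bar>g x\<bar>)) \<partial>lborel)"
        by (intro nn_integral_mono pt)
      also have "\<dots> = ennreal (C1 * C2 * m) * (\<integral>\<^sup>+x. (indicator ?I (fst x) * (indicator K' (snd x) * ennreal \<bar>g x\<bar>)) \<partial>(lborel \<Otimes>\<^sub>M lborel))"
        unfolding lborel_prod using Fm by (intro nn_integral_cmult) simp
      also have "(\<integral>\<^sup>+x. (indicator ?I (fst x) * (indicator K' (snd x) * ennreal \<bar>g x\<bar>)) \<partial>(lborel \<Otimes>\<^sub>M lborel))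
          = (\<integral>\<^sup>+s. (\<integral>\<^sup>+z. (indicator ?I s * (indicator K' z * ennreal \<bar>g (s, z)\<bar>)) \<partial>lborel) \<partial>lborel)"
      proof -
        have "(\<lambda>x. indicator ?I (fst x) * (indicator K' (snd x) * ennreal \<bar>g x\<bar>)) \<in> borel_measurable (lborel \<Otimes>\<^sub>M lborel)"
          unfolding lborel_prod using Fm by simp
        from lborel.nn_integral_fst[OF this] show ?thesis by simp
      qed
      also have "\<dots> \<le> (\<integral>\<^sup>+s. ennreal e' * indicator ?I s \<partial>lborel)"
      proof (rule nn_integral_mono_AE)
        show "AE s in lborel. (\<integral>\<^sup>+z. (indicator ?I s * (indicator K' z * ennreal \<bar>g (s, z)\<bar>)) \<partial>lborel) \<le> ennreal e' * indicator ?I s"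
          using AE_not_in[OF N(1)]
        proof eventually_elim
          case (elim s)
          show ?case
          proof (cases "s \<in> ?I")
            case True
            then have "s \<in> {c<..<B} - N" "s \<noteq> B" "\<bar>s - B\<bar> < d"
            proof -
              have "1 / m > 0" "B - 2 / m < s" "s < B - 1 / m" "2 / m < d" "2 / m < B - c"
                using True m m2 by auto
              then have "c < s" "s < B" "\<bar>s - B\<bar> < d" by linarith+
              then show "s \<in> {c<..<B} - N" "s \<noteq> B" "\<bar>s - B\<bar> < d" using elim by auto
            qed
            from d(2)[OF this] show ?thesis using True by simp
          qed simp
        qed
      qed
      also have "\<dots> = ennreal (e' * (1 / m))"
        using e' m by (simp add: nn_integral_cmult ennreal_mult[symmetric] field_simps)
      finally have "ennreal \<bar>LINT x|lborel. ?J n x\<bar> \<le> ennreal (C1 * C2 * m) * ennreal (e' * (1 / m))"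
        by (simp add: mult_left_mono)
      also have "\<dots> = ennreal (C1 * C2 * e')"
        using C0 m e' by (simp add: ennreal_mult[symmetric])
      finally have "\<bar>LINT x|lborel. ?J n x\<bar> \<le> C1 * C2 * e'"
        using C0 e' by (simp add: ennreal_le_iff)
      also have "\<dots> < e"
      proof -
        have "C1 * C2 * e' \<le> (C1 * C2 + 1) * e'" using e' by (intro mult_right_mono) auto
        also have "\<dots> = e / 2"
        proof -
          have "C1 * C2 + 1 > 0" using C0 by (simp add: add_nonneg_pos)
          moreover have "r * (e / (2 * r)) = e / 2" if "r > 0" for r :: real using that by simp
          ultimately show ?thesis unfolding e'_def by blast
        qed
        finally show ?thesis using e by simp
      qed
      finally show "norm ((LINT x|lborel. ?J n x) - 0) < e" by simp
    qed
  qed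
qed

text \<open>A test function reaching past \<open>B\<close> is made admissible for the slab by a time
  cutoff vanishing near \<open>B\<close>. The cutoff's own derivative appears only in the time
  direction, where the zero trace makes its contribution disappear; all other terms converge by
  domination.\<close>

lemma weak_deriv_extend:
  fixes u v :: "real \<times> (real^'n) \<Rightarrow> real"
  assumes cB: "c < B" and w: "has_weak_deriv (slab c B) u b v" and b: "b = dir_s \<or> b \<in> range dir_z"
    and iu: "locally_integrable {x. c < fst x} (\<lambda>x. indicator (slab c B) x * u x)"
    and iv: "locally_integrable {x. c < fst x} (\<lambda>x. indicator (slab c B) x * v x)"
    and tr: "b = dir_s \<Longrightarrow> \<exists>N\<in>null_sets lborel. \<forall>K. compact K \<longrightarrow>
      ((\<lambda>s. wnorm K (\<lambda>_. 1) (\<lambda>z. u (s, z))) \<longlongrightarrow> 0) (at B within ({c<..<B} - N))"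
  shows "has_weak_deriv {x. c < fst x} (\<lambda>x. indicator (slab c B) x * u x) b (\<lambda>x. indicator (slab c B) x * v x)"
proof -
  have bB: "b \<in> Basis" using b Basis_space_time by auto
  let ?g = "\<lambda>x. indicator (slab c B) x * u x" and ?h = "\<lambda>x. indicator (slab c B) x * v x"
  have um[measurable]: "?g \<in> borel_measurable borel" and vm[measurable]: "?h \<in> borel_measurable borel"
    using w locally_integrable_measurable[OF open_slab] by (auto simp: has_weak_deriv_def)
  obtain St :: "nat \<Rightarrow> real \<Rightarrow> real" and C1 where St: "\<And>n t. (St n has_real_derivative St (Suc n) t) (at t)"
    "\<And>t. t \<le> 1 \<Longrightarrow> St 0 t = 0" "\<And>t. t \<ge> 2 \<Longrightarrow> St 0 t = 1" "\<And>t. 0 \<le> St 0 t \<and> St 0 t \<le> 1"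
    "\<And>t. t \<notin> {1<..<2} \<Longrightarrow> St 1 t = 0" "\<And>t. \<bar>St 1 t\<bar> \<le> C1"
    using smooth_step_exists by blast
  have Stc: "continuous_on UNIV (St n)" for n using St(1) DERIV_continuous_on by blast
  show ?thesis unfolding has_weak_deriv_iff[OF bB]
  proof (intro conjI ballI iu iv)
    fix \<phi> assume \<phi>: "\<phi> \<in> Cc_infty {x::real \<times> (real^'n). c < fst x}"
    obtain K where K: "compact K" "K \<subseteq> {x. c < fst x}" "\<And>x. x \<notin> K \<Longrightarrow> \<phi> x = 0"
      using Cc_inftyD(2)[OF \<phi>] by blast
    obtain C2 where C2: "\<And>x. \<bar>\<phi> x\<bar> \<le> C2" using Cc_infty_bounded[OF \<phi>] by blast
    have [measurable]: "\<phi> \<in> borel_measurable borel" "pd b \<phi> \<in> borel_measurable borel"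
      using Cc_infty_borel[OF \<phi>] Cc_infty_borel[OF Cc_infty_pd[OF \<phi> bB]] by auto
    \<comment> \<open>This is the step evaluated at (n + 1)(B - s), written as a ridge function: it
      vanishes within 1/(n+1) of \<open>B\<close> and equals 1 earlier than 2/(n+1) before
      \<open>B\<close>.\<close>
    define X where "X n x = St 0 (x \<bullet> (- real (Suc n) *\<^sub>R dir_s) + real (Suc n) * B)" for n and x :: "real \<times> (real^'n)"
    have arg: "x \<bullet> (- real (Suc n) *\<^sub>R dir_s) + real (Suc n) * B = real (Suc n) * (B - fst x)" for n and x :: "real \<times> (real^'n)"
      by (simp add: dir_s_def inner_prod_def algebra_simps)
    have X_eq: "X n x = St 0 (real (Suc n) * (B - fst x))" for n x unfolding X_def arg ..
    have Xs: "smooth (X n)" for n unfolding X_def[abs_def] using C_diff_ridge[where G=St, OF St(1)] by blast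
    have Xm[measurable]: "X n \<in> borel_measurable borel" for n
      using smooth_continuous[OF Xs] by (rule borel_measurable_continuous_onI)
    have pX: "pd b (X n) x = (b \<bullet> (- real (Suc n) *\<^sub>R dir_s)) * St 1 (real (Suc n) * (B - fst x))" for n x
      unfolding X_def[abs_def] using pd_ridge[where G=St, OF St(1), of b 0 "- real (Suc n) *\<^sub>R dir_s" "real (Suc n) * B" x]
      unfolding arg by simp
    have X0: "X n x = 0" if "fst x \<ge> B - 1 / real (Suc n)" for n x
      unfolding X_eq using that by (intro St(2)) (simp add: field_simps)
    have Xlim: "(\<lambda>n. X n x) \<longlonglongrightarrow> 1" if "fst x < B" for x
    proof -
      obtain N where N: "2 / (B - fst x) \<le> real N" using real_arch_simple by blast
      have "X n x = 1" if "n \<ge> N" for n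
        unfolding X_eq
      proof (rule St(3))
        have "2 / (B - fst x) \<le> real (Suc n)" using N that by linarith
        then show "2 \<le> real (Suc n) * (B - fst x)" using \<open>fst x < B\<close> by (simp only: pos_divide_le_eq diff_gt_0_iff_gt)
      qed
      then show ?thesis by (intro tendsto_eventually) (auto simp: eventually_sequentially)
    qed
    have X\<phi>: "(\<lambda>x. X n x * \<phi> x) \<in> Cc_infty (slab c B)" for n
    proof (rule Cc_inftyI)
      show "smooth (\<lambda>x. X n x * \<phi> x)" using C_diff_mult Xs Cc_inftyD(1)[OF \<phi>] by blast
      have "closed {x::real \<times> (real^'n). fst x \<le> B - 1 / real (Suc n)}"
        by (intro closed_Collect_le continuous_intros)
      then show "compact (K \<inter> {x. fst x \<le> B - 1 / real (Suc n)})" using K(1) by (rule compact_Int_closed[rotated])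
      show "K \<inter> {x. fst x \<le> B - 1 / real (Suc n)} \<subseteq> slab c B"
      proof
        fix x assume x: "x \<in> K \<inter> {x. fst x \<le> B - 1 / real (Suc n)}"
        have "1 / real (Suc n) > 0" by simp
        moreover have "fst x \<le> B - 1 / real (Suc n)" "c < fst x" using x K(2) by auto
        ultimately show "x \<in> slab c B" unfolding in_slab by linarith
      qed
      show "X n x * \<phi> x = 0" if "x \<notin> K \<inter> {x. fst x \<le> B - 1 / real (Suc n)}" for x
        using that K(3)[of x] X0[of n x] by auto
    qed
    have ii: "integrable lborel (\<lambda>x. ?g x * pd b \<phi> x)" "integrable lborel (\<lambda>x. ?h x * \<phi> x)"
      by (rule integrable_times_Cc[OF iu Cc_infty_pd[OF \<phi> bB]], rule integrable_times_Cc[OF iv \<phi>])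
    have dom: "(\<lambda>n. LINT x|lborel. X n x * f x) \<longlonglongrightarrow> (LINT x|lborel. f x)" "\<And>n. integrable lborel (\<lambda>x. X n x * f x)"
      if f: "integrable lborel f" "\<And>x. fst x \<ge> B \<Longrightarrow> f x = 0" for f
    proof -
      have bd: "AE x in lborel. norm (X n x * f x) \<le> \<bar>f x\<bar>" for n
        using St(4) by (intro AE_I2) (auto simp: X_eq abs_mult intro: mult_left_le_one_le)
      have lim: "AE x in lborel. (\<lambda>n. X n x * f x) \<longlonglongrightarrow> f x"
      proof (rule AE_I2)
        fix x show "(\<lambda>n. X n x * f x) \<longlonglongrightarrow> f x"
        proof (cases "fst x < B")
          case True
          from tendsto_mult[OF Xlim[OF True] tendsto_const[of "f x"]] show ?thesis by simp
        qed (use f(2)[of x] in simp)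
      qed
      have fm: "f \<in> borel_measurable lborel" using f(1) by auto
      show "(\<lambda>n. LINT x|lborel. X n x * f x) \<longlonglongrightarrow> (LINT x|lborel. f x)"
        by (rule integral_dominated_convergence[OF fm _ integrable_abs[OF f(1)] lim bd]) (use fm in measurable)
      show "integrable lborel (\<lambda>x. X n x * f x)" for n
        by (rule Bochner_Integration.integrable_bound[OF f(1)]) (use fm bd in \<open>auto\<close>)
    qed
    let ?J = "\<lambda>n. LINT x|lborel. ?g x * (pd b (X n) x * \<phi> x)"
    have J: "?J \<longlonglongrightarrow> 0"
    proof (cases "b = dir_s")
      case True
      obtain N where N: "N \<in> null_sets lborel" "\<And>K. compact K \<Longrightarrow>
          ((\<lambda>s. wnorm K (\<lambda>_. 1) (\<lambda>z. u (s, z))) \<longlongrightarrow> 0) (at B within ({c<..<B} - N))"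
        using tr[OF True] by blast
      have "(\<lambda>n. LINT x|lborel. indicator (slab c B) x * u x * (real (Suc n) * (- St 1 (real (Suc n) * (B - fst x))) * \<phi> x)) \<longlonglongrightarrow> 0"
      proof (rule trace_term_tendsto_0[OF cB um N K(1) K(3) C2])
        show "\<bar>- St 1 t\<bar> \<le> C1" for t using St(6) by simp
        show "- St 1 t = 0" if "t \<notin> {1<..<2}" for t using St(5)[OF that] by simp
        show "(\<lambda>t. - St 1 t) \<in> borel_measurable borel"
          by (intro borel_measurable_continuous_onI continuous_intros Stc)
      qed auto
      moreover have "b \<bullet> (- real (Suc n) *\<^sub>R dir_s) = - real (Suc n)" for n
        using True by (simp add: dir_s_def inner_prod_def)
      ultimately show ?thesis unfolding pX by (simp only: mult_minus_left mult_minus_right)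
    next
      case False
      then have "b \<bullet> (- real (Suc n) *\<^sub>R dir_s) = 0" for n
        using b by (auto simp: dir_s_def dir_z_def inner_prod_def)
      then show ?thesis unfolding pX by simp
    qed
    have eq: "?J n = - (LINT x|lborel. X n x * (?h x * \<phi> x)) - (LINT x|lborel. X n x * (?g x * pd b \<phi> x))" for n
    proof -
      let ?f = "\<lambda>x. X n x * \<phi> x"
      have z: "?f x = 0" "pd b ?f x = 0" if "x \<notin> slab c B" for x
        using Cc_inftyD(2)[OF X\<phi>[of n]] Cc_inftyD(2)[OF Cc_infty_pd[OF X\<phi>[of n] bB]] that by blast+
      have pf: "pd b ?f x = pd b (X n) x * \<phi> x + X n x * pd b \<phi> x" for x
        by (rule pd_mult; rule smooth_differentiable) (use Xs Cc_inftyD(1)[OF \<phi>] in auto)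
      have "(LINT x|lborel. u x * pd b ?f x) = - (LINT x|lborel. v x * ?f x)"
        using w X\<phi>[of n] unfolding has_weak_deriv_iff[OF bB] by blast
      moreover have "(\<lambda>x. u x * pd b ?f x) = (\<lambda>x. ?g x * pd b ?f x)" "(\<lambda>x. v x * ?f x) = (\<lambda>x. X n x * (?h x * \<phi> x))"
        using z by (auto simp: fun_eq_iff indicator_def)
      ultimately have 1: "(LINT x|lborel. ?g x * pd b ?f x) = - (LINT x|lborel. X n x * (?h x * \<phi> x))" by simp
      have gi: "integrable lborel (\<lambda>x. ?g x * pd b ?f x)"
        by (rule integrable_times_Cc[OF iu Cc_infty_pd[OF Cc_infty_mult[OF \<phi> Xs] bB]])
      have gi2: "integrable lborel (\<lambda>x. X n x * (?g x * pd b \<phi> x))"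
        by (rule dom(2)[OF ii(1)]) (auto simp: in_slab)
      have "?J n = (LINT x|lborel. ?g x * pd b ?f x - X n x * (?g x * pd b \<phi> x))"
        unfolding pf by (simp add: algebra_simps)
      also have "\<dots> = (LINT x|lborel. ?g x * pd b ?f x) - (LINT x|lborel. X n x * (?g x * pd b \<phi> x))"
        by (rule Bochner_Integration.integral_diff[OF gi gi2])
      finally show ?thesis unfolding 1 .
    qed
    have "(\<lambda>n. - (LINT x|lborel. X n x * (?h x * \<phi> x)) - (LINT x|lborel. X n x * (?g x * pd b \<phi> x)))
        \<longlonglongrightarrow> - (LINT x|lborel. ?h x * \<phi> x) - (LINT x|lborel. ?g x * pd b \<phi> x)"
      by (intro tendsto_diff tendsto_minus dom(1) ii) (auto simp: in_slab)
    from LIMSEQ_unique[OF J[unfolded eq] this]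
    show "(LINT x|lborel. ?g x * pd b \<phi> x) = - (LINT x|lborel. ?h x * \<phi> x)" by simp
  qed
qed

section \<open>The upper bound: one frequency, then mixtures of frequencies\<close>

section \<open>The bound for a single frequency\<close>

text \<open>Half the exponent of one exponential in the weight:
  \<open>exp (phase k \<zeta> x)\<close> is the conjugating factor, and its square is the
  weight.\<close>

definition phase :: "real \<Rightarrow> real^'n \<Rightarrow> real \<times> (real^'n) \<Rightarrow> real" where
  "phase k \<zeta> x = fst x * k - \<zeta> \<bullet> snd x"

lemma smooth_exp_phase:
  "smooth (\<lambda>x. exp (phase k \<zeta> x))"
  "pd dir_s (\<lambda>x. exp (phase k \<zeta> x)) x = k * exp (phase k \<zeta> x)"
  "pd (dir_z i) (\<lambda>x. exp (phase k \<zeta> x)) x = - \<zeta> $ i * exp (phase k \<zeta> x)"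
proof -
  have e: "phase k \<zeta> x = x \<bullet> (k, - \<zeta>) + 0" for x
    by (simp add: phase_def inner_prod_def inner_commute)
  have D: "(exp has_real_derivative exp t) (at t)" for t :: real by (rule DERIV_exp)
  show "smooth (\<lambda>x. exp (phase k \<zeta> x))"
    unfolding e using C_diff_ridge[where G="\<lambda>_. exp", OF D] by blast
  have p: "pd b (\<lambda>x. exp (phase k \<zeta> x)) x = (b \<bullet> (k, - \<zeta>)) * exp (phase k \<zeta> x)" for b
    unfolding e using pd_ridge[where G="\<lambda>_. exp", OF D, of b] by blast
  show "pd dir_s (\<lambda>x. exp (phase k \<zeta> x)) x = k * exp (phase k \<zeta> x)"
    "pd (dir_z i) (\<lambda>x. exp (phase k \<zeta> x)) x = - \<zeta> $ i * exp (phase k \<zeta> x)"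
    unfolding p by (simp_all add: dir_s_def dir_z_def inner_prod_def inner_axis')
qed

lemma sqint_of_weight:
  assumes g: "g \<in> borel_measurable borel" and C: "C \<ge> 0"
    and fin: "(\<integral>\<^sup>+x\<in>S. ennreal (h x) \<partial>lborel) < \<top>"
    and h: "(\<lambda>x. indicator S x * h x) \<in> borel_measurable borel"
    and le: "\<And>x. (g x)\<^sup>2 \<le> C * (indicator S x * h x)"
  shows "sqint g"
proof -
  have "(\<integral>\<^sup>+x. ennreal ((g x)\<^sup>2) \<partial>lborel) \<le> (\<integral>\<^sup>+x. ennreal C * ennreal (indicator S x * h x) \<partial>lborel)"
    using C by (intro nn_integral_mono) (simp add: ennreal_mult'[symmetric] ennreal_leI le)
  also have "\<dots> = ennreal C * (\<integral>\<^sup>+x. ennreal (indicator S x * h x) \<partial>lborel)"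
    using h by (intro nn_integral_cmult) simp
  also have "(\<integral>\<^sup>+x. ennreal (indicator S x * h x) \<partial>lborel) = (\<integral>\<^sup>+x\<in>S. ennreal (h x) \<partial>lborel)"
    by (intro nn_integral_cong) (auto simp: indicator_def)
  also have "ennreal C * \<dots> < \<top>" using fin by (simp add: ennreal_mult_less_top)
  finally show ?thesis using g by (simp add: sqint_def integrable_iff_bounded)
qed

text \<open>\<open>tf\<close> stands for the time factor. Its regularity is required only strictly
  after \<open>c\<close>, because the derivative of s^\<alpha> is unbounded at c = 0 for 0 <
  \<alpha> < 1.\<close>

locale frequency_setup =
  fixes c B :: real and tf tf' :: "real \<Rightarrow> real" and k :: real and \<zeta> :: "real^'n"
  assumes cB: "c < B"
    and tf: "\<And>s. c < s \<Longrightarrow> (tf has_real_derivative tf' s) (at s)" "continuous_on {c<..} tf'"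
      "\<And>s. c < s \<Longrightarrow> 0 < tf s" "\<And>s. c < s \<Longrightarrow> 0 \<le> tf' s"
begin

abbreviation Ex where "Ex x \<equiv> exp (phase k \<zeta> x)"

abbreviation wt where "wt x \<equiv> tf (fst x) * exp (2 * phase k \<zeta> x)"

lemma Ex_square: "(Ex x)\<^sup>2 = exp (2 * phase k \<zeta> x)"
  by (simp add: exp_double)

lemma tf_mono:
  assumes "c < s" "s \<le> t"
  shows "tf s \<le> tf t"
proof (rule DERIV_nonneg_imp_nondecreasing[OF assms(2)])
  fix x assume "s \<le> x"
  then have "c < x" using assms(1) by simp
  then show "\<exists>y. (tf has_real_derivative y) (at x) \<and> 0 \<le> y" using tf(1,4) by blast
qed

lemma tf_cont: "continuous_on {c<..} tf"
  by (intro continuous_at_imp_continuous_on ballI) (use tf(1) DERIV_isCont in blast)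

lemma Ex_cont: "continuous_on S Ex"
  using smooth_continuous[OF smooth_exp_phase(1)] .

lemma slab_weight_measurable:
  assumes "(\<lambda>x. indicator (slab c B) x * f x) \<in> borel_measurable borel"
  shows "(\<lambda>x. indicator (slab c B) x * (wt x * (f x)\<^sup>2)) \<in> borel_measurable borel"
proof -
  have "(\<lambda>x::real \<times> (real^'n). indicator {c<..} (fst x) *\<^sub>R tf (fst x)) \<in> borel_measurable borel"
  proof (rule measurable_compose[of fst])
    show "fst \<in> borel_measurable (borel :: (real \<times> (real^'n)) measure)"
      by (intro borel_measurable_continuous_onI continuous_intros)
    show "(\<lambda>s. indicator {c<..} s *\<^sub>R tf s) \<in> borel_measurable borel"
      using borel_measurable_continuous_on_indicator[OF _ tf_cont] by simp
  qed
  moreover have "Ex \<in> borel_measurable borel" using Ex_cont by (rule borel_measurable_continuous_onI)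
  ultimately have "(\<lambda>x. (indicator {c<..} (fst x) *\<^sub>R tf (fst x)) * (Ex x)\<^sup>2 * (indicator (slab c B) x * f x)\<^sup>2) \<in> borel_measurable borel"
    by (rule borel_measurable_times[OF borel_measurable_times[OF _ borel_measurable_power] borel_measurable_power[OF assms]])
  moreover have "(indicator {c<..} (fst x) *\<^sub>R tf (fst x)) * (Ex x)\<^sup>2 * (indicator (slab c B) x * f x)\<^sup>2
      = indicator (slab c B) x * (wt x * (f x)\<^sup>2)" for x
    unfolding Ex_square by (auto simp: indicator_def in_slab)
  ultimately show ?thesis by (simp only:)
qed

definition fin_wt :: "(real \<times> (real^'n) \<Rightarrow> real) \<Rightarrow> bool" where
  "fin_wt f \<longleftrightarrow> (\<lambda>x. indicator (slab c B) x * f x) \<in> borel_measurable borel \<and>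
     (\<integral>\<^sup>+x\<in>slab c B. ennreal (wt x * (f x)\<^sup>2) \<partial>lborel) < \<top>"

text \<open>A compact set of times after \<open>c\<close>, possibly reaching past \<open>B\<close>,
  has a positive lower bound for the weight: \<open>tf\<close> is nondecreasing and the exponential
  is continuous. Finite weighted norm thus gives local square integrability.\<close>

lemma fin_wt_locally_integrable:
  assumes f: "fin_wt f"
  shows "locally_integrable {x. c < fst x} (\<lambda>x. indicator (slab c B) x * f x)"
  unfolding locally_integrable_def
proof (intro allI impI)
  fix K assume K: "compact K \<and> K \<subseteq> {x::real \<times> (real^'n). c < fst x}"
  show "set_integrable lborel K (\<lambda>x. indicator (slab c B) x * f x)"
  proof (cases "K = {}")
    case True
    then show ?thesis by (simp add: set_integrable_def)
  next
    case False
    obtain x0 where x0: "x0 \<in> K" "\<And>x. x \<in> K \<Longrightarrow> fst x0 \<le> fst x"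
    proof -
      have "continuous_on K fst" by (intro continuous_intros)
      then show thesis using continuous_attains_inf[of K fst] K False that by blast
    qed
    obtain x1 where x1: "x1 \<in> K" "\<And>x. x \<in> K \<Longrightarrow> Ex x1 \<le> Ex x"
      using continuous_attains_inf[of K Ex] K False Ex_cont by auto
    define m where "m = tf (fst x0) * (Ex x1)\<^sup>2"
    have t0: "tf (fst x0) > 0" using tf(3)[of "fst x0"] K x0(1) by auto
    have m: "m > 0" using t0 by (simp add: m_def)
    have Km: "K \<in> sets borel" using K by (simp add: borel_compact)
    have fm: "(\<lambda>x. indicator (slab c B) x * f x) \<in> borel_measurable borel" using f by (simp add: fin_wt_def)
    have "sqint (\<lambda>x. indicator K x * (indicator (slab c B) x * f x))"
    proof (rule sqint_of_weight[where C="1 / m" and S="slab c B" and h="\<lambda>x. wt x * (f x)\<^sup>2"])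
      show "(\<lambda>x. indicator K x * (indicator (slab c B) x * f x)) \<in> borel_measurable borel"
        by (intro borel_measurable_times borel_measurable_indicator fm Km)
      show "(\<integral>\<^sup>+x\<in>slab c B. ennreal (wt x * (f x)\<^sup>2) \<partial>lborel) < \<top>" using f by (simp add: fin_wt_def)
      show "(\<lambda>x. indicator (slab c B) x * (wt x * (f x)\<^sup>2)) \<in> borel_measurable borel"
        by (rule slab_weight_measurable[OF fm])
      show "(indicator K x * (indicator (slab c B) x * f x))\<^sup>2 \<le> 1 / m * (indicator (slab c B) x * (wt x * (f x)\<^sup>2))" for x
      proof (cases "x \<in> K \<and> x \<in> slab c B")
        case True
        have "m \<le> tf (fst x) * (Ex x)\<^sup>2"
          unfolding m_def
        proof (intro mult_mono tf_mono power_mono)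
          show "c < fst x0" using K x0(1) by auto
          show "0 \<le> tf (fst x)" using tf(3)[of "fst x"] True K by auto
        qed (use True x0 x1 in auto)
        then have "m * (f x)\<^sup>2 \<le> wt x * (f x)\<^sup>2" unfolding Ex_square by (intro mult_right_mono) auto
        then show ?thesis using True m by (simp add: field_simps)
      next
        case False
        have "0 \<le> indicator (slab c B) x * (wt x * (f x)\<^sup>2)"
          using tf(3)[of "fst x"] by (auto simp: indicator_def in_slab)
        then show ?thesis using False m by auto
      qed
    qed (use m in simp)
    moreover have "sqint (indicator K :: real \<times> (real^'n) \<Rightarrow> real)"
    proof -
      have "(\<lambda>x. (indicator K x)\<^sup>2) = (indicator K :: real \<times> (real^'n) \<Rightarrow> real)" by (auto simp: indicator_def)
      moreover have "emeasure lborel K < \<infinity>" using K emeasure_bounded_finite compact_imp_bounded by blast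
      ultimately show ?thesis using Km by (auto simp: sqint_def)
    qed
    ultimately have "integrable lborel (\<lambda>x. indicator K x * (indicator K x * (indicator (slab c B) x * f x)))"
      by (intro sqint_mult_integrable)
    moreover have "(\<lambda>x. indicator K x * (indicator K x * (indicator (slab c B) x * f x)))
        = (\<lambda>x. indicator K x *\<^sub>R (indicator (slab c B) x * f x))" by (auto simp: fun_eq_iff indicator_def)
    ultimately show ?thesis by (simp add: set_integrable_def)
  qed
qed

text \<open>The conjugated function, cut to times between \<open>c0\<close> and \<open>B\<close>.
  Starting strictly after \<open>c\<close> makes it square integrable without weight, since
  \<open>tf\<close> is at least \<open>tf c0\<close> there.\<close>

definition Z :: "real \<Rightarrow> (real \<times> (real^'n) \<Rightarrow> real) \<Rightarrow> real \<times> (real^'n) \<Rightarrow> real" where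
  "Z c0 f x = indicator (slab c0 B) x * (Ex x * f x)"

lemma Z_sqint:
  assumes f: "fin_wt f" and c0: "c < c0"
  shows "sqint (Z c0 f)"
proof (rule sqint_of_weight[where C="1 / tf c0" and S="slab c B" and h="\<lambda>x. wt x * (f x)\<^sup>2"])
  have fm: "(\<lambda>x. indicator (slab c B) x * f x) \<in> borel_measurable borel" using f by (simp add: fin_wt_def)
  have "(\<lambda>x. indicator (slab c0 B) x * (Ex x * (indicator (slab c B) x * f x))) \<in> borel_measurable borel"
    by (rule borel_measurable_times[OF borel_measurable_indicator
          borel_measurable_times[OF borel_measurable_continuous_onI[OF Ex_cont] fm]])
       (rule borel_open[OF open_slab])
  moreover have "Z c0 f = (\<lambda>x. indicator (slab c0 B) x * (Ex x * (indicator (slab c B) x * f x)))"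
    using c0 by (auto simp: fun_eq_iff Z_def indicator_def in_slab)
  ultimately show "Z c0 f \<in> borel_measurable borel" by simp
  show "(\<integral>\<^sup>+x\<in>slab c B. ennreal (wt x * (f x)\<^sup>2) \<partial>lborel) < \<top>" using f by (simp add: fin_wt_def)
  show "(\<lambda>x. indicator (slab c B) x * (wt x * (f x)\<^sup>2)) \<in> borel_measurable borel"
    by (rule slab_weight_measurable[OF fm])
  have t0: "tf c0 > 0" using tf(3)[OF c0] .
  then show "0 \<le> 1 / tf c0" by simp
  show "(Z c0 f x)\<^sup>2 \<le> 1 / tf c0 * (indicator (slab c B) x * (wt x * (f x)\<^sup>2))" for x
  proof (cases "x \<in> slab c0 B")
    case True
    then have "tf c0 \<le> tf (fst x)" using tf_mono[OF c0, of "fst x"] by (simp add: in_slab)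
    then have "tf c0 * ((Ex x)\<^sup>2 * (f x)\<^sup>2) \<le> tf (fst x) * ((Ex x)\<^sup>2 * (f x)\<^sup>2)"
      by (rule mult_right_mono) simp
    moreover have "x \<in> slab c B" using True c0 by (simp add: in_slab)
    ultimately show ?thesis using True t0
      by (simp add: Z_def Ex_square power_mult_distrib field_simps)
  next
    case False
    have "0 \<le> indicator (slab c B) x * (wt x * (f x)\<^sup>2)"
      using tf(3)[of "fst x"] by (auto simp: indicator_def in_slab)
    then show ?thesis using False t0 by (simp add: Z_def)
  qed
qed

lemma Z_weak_deriv:
  assumes b: "b \<in> Basis" and c0: "c < c0"
    and w: "has_weak_deriv {x. c < fst x} (\<lambda>x. indicator (slab c B) x * f x) b (\<lambda>x. indicator (slab c B) x * g x)"
    and e: "\<And>x. pd b Ex x = r * Ex x"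
  shows "has_weak_deriv {x. c0 < fst x} (Z c0 f) b (\<lambda>x. Z c0 g x + r * Z c0 f x)"
proof (rule has_weak_deriv_cong_subset[OF b has_weak_deriv_mult_smooth[OF b w smooth_exp_phase(1)]])
  show "{x. c0 < fst x} \<subseteq> {x. c < fst x}" using c0 by auto
  fix x :: "real \<times> (real^'n)" assume x: "x \<in> {x. c0 < fst x}"
  then have i: "indicator (slab c0 B) x = (indicator (slab c B) x :: real)"
    using c0 by (auto simp: indicator_def in_slab)
  show "Z c0 f x = Ex x * (indicator (slab c B) x * f x)" by (simp add: Z_def i)
  show "Z c0 g x + r * Z c0 f x = Ex x * (indicator (slab c B) x * g x) + pd b Ex x * (indicator (slab c B) x * f x)"
    unfolding e by (simp add: Z_def i algebra_simps)
qed

text \<open>No condition is imposed at \<open>c\<close>, so the weight is switched off near it. The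
  switching factor is nondecreasing, at most 1 and tends to 1 with n: monotonicity of the weight
  survives, and the cutoff can be removed in the limit.\<close>

definition \<theta> :: "nat \<Rightarrow> real \<Rightarrow> real" where
  "\<theta> n s = (if c < s then tf s * flat 0 (real (Suc n) * (s - c) - 1) else 0)"

definition \<theta>' :: "nat \<Rightarrow> real \<Rightarrow> real" where
  "\<theta>' n s = (if c < s then tf' s * flat 0 (real (Suc n) * (s - c) - 1)
     + (real (Suc n) * flat 1 (real (Suc n) * (s - c) - 1)) * tf s else 0)"

definition c0 :: "nat \<Rightarrow> real" where "c0 n = c + 1 / real (Suc n)"

lemma c0: "c < c0 n" by (simp add: c0_def)

lemma arg_nonpos: "s \<le> c0 n \<Longrightarrow> real (Suc n) * (s - c) - 1 \<le> 0"
proof -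
  assume "s \<le> c0 n"
  then have "s - c \<le> 1 / real (Suc n)" by (simp add: c0_def)
  then have "real (Suc n) * (s - c) \<le> real (Suc n) * (1 / real (Suc n))" by (intro mult_left_mono) auto
  then show ?thesis by simp
qed

lemma \<theta>_0: "s \<le> c0 n \<Longrightarrow> \<theta> n s = 0" "s \<le> c0 n \<Longrightarrow> \<theta>' n s = 0"
  using arg_nonpos[of s n] by (auto simp: \<theta>_def \<theta>'_def flat_0 flat_1)

lemma flat_arg_deriv: "((\<lambda>s. flat 0 (r * (s - c) - 1)) has_real_derivative r * flat 1 (r * (s - c) - 1)) (at s)"
proof -
  have "((\<lambda>s. r * (s - c) - 1) has_real_derivative r) (at s)" by (auto intro!: derivative_eq_intros)
  from DERIV_chain2[OF flat_deriv this] show ?thesis by (simp add: mult.commute)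
qed

lemma \<theta>_deriv: "(\<theta> n has_real_derivative \<theta>' n s) (at s)"
proof (cases "c < s")
  case True
  have "((\<lambda>s. tf s * flat 0 (real (Suc n) * (s - c) - 1)) has_real_derivative \<theta>' n s) (at s)"
    using DERIV_mult[OF tf(1)[OF True] flat_arg_deriv[of "real (Suc n)" s]] True by (simp add: \<theta>'_def)
  then show ?thesis
    by (rule has_field_derivative_transform_within_open[of _ _ _ "{c<..}"]) (use True in \<open>auto simp: \<theta>_def\<close>)
next
  case False
  have "((\<lambda>_. 0) has_real_derivative 0) (at s)" by simp
  then have "(\<theta> n has_real_derivative 0) (at s)"
    by (rule has_field_derivative_transform_within_open[of _ _ _ "{..<c0 n}"]) (use False c0[of n] \<theta>_0 in auto)
  then show ?thesis using False by (simp add: \<theta>'_def)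
qed

lemma \<theta>'_cont: "continuous_on UNIV (\<theta>' n)"
proof -
  have "continuous_on {c<..} (\<lambda>s. tf' s * flat 0 (real (Suc n) * (s - c) - 1)
     + (real (Suc n) * flat 1 (real (Suc n) * (s - c) - 1)) * tf s)"
    by (intro continuous_intros tf(2) tf_cont continuous_on_compose2[OF continuous_flat[of UNIV]]) auto
  then have "continuous_on {c<..} (\<theta>' n)" by (rule continuous_on_eq) (simp add: \<theta>'_def)
  moreover have "continuous_on {..<c0 n} (\<theta>' n)"
    by (rule continuous_on_eq[OF continuous_on_const[of _ 0]]) (simp add: \<theta>_0)
  ultimately have "continuous_on ({c<..} \<union> {..<c0 n}) (\<theta>' n)" by (intro continuous_on_open_Un) auto
  moreover have "{c<..} \<union> {..<c0 n} = UNIV" using c0[of n] by auto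
  ultimately show ?thesis by simp
qed

lemma \<theta>_nonneg: "0 \<le> \<theta> n s" "0 \<le> \<theta>' n s"
proof -
  show "0 \<le> \<theta> n s" using tf(3)[of s] flat_0_bounds(1) by (auto simp: \<theta>_def)
  show "0 \<le> \<theta>' n s" unfolding \<theta>'_def
    using tf(3)[of s] tf(4)[of s] flat_0_bounds(1) flat_1_nonneg
    by (auto intro!: add_nonneg_nonneg mult_nonneg_nonneg)
qed

lemma \<theta>_le: "c < s \<Longrightarrow> \<theta> n s \<le> tf s"
  using flat_0_bounds(1,2) tf(3)[of s] mult_left_mono[of "flat 0 (real (Suc n) * (s - c) - 1)" 1 "tf s"]
  by (simp add: \<theta>_def)

lemma \<theta>_bounded: "\<exists>M. \<forall>s\<le>B. \<theta> n s \<le> M \<and> \<theta>' n s \<le> M"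
proof -
  have "continuous_on UNIV (\<theta> n)" using \<theta>_deriv DERIV_continuous_on by blast
  then have "bounded (\<theta> n ` {c..B})" "bounded (\<theta>' n ` {c..B})"
    using \<theta>'_cont[of n] by (auto intro!: compact_imp_bounded compact_continuous_image elim: continuous_on_subset)
  then obtain M1 M2 where M: "\<And>s. s \<in> {c..B} \<Longrightarrow> \<bar>\<theta> n s\<bar> \<le> M1" "\<And>s. s \<in> {c..B} \<Longrightarrow> \<bar>\<theta>' n s\<bar> \<le> M2"
    unfolding bounded_iff by (metis image_eqI real_norm_def)
  show ?thesis
  proof (intro exI allI impI)
    fix s assume s: "s \<le> B"
    show "\<theta> n s \<le> max (max M1 M2) 0 \<and> \<theta>' n s \<le> max (max M1 M2) 0"
    proof (cases "c \<le> s")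
      case True
      then have "\<bar>\<theta> n s\<bar> \<le> M1" "\<bar>\<theta>' n s\<bar> \<le> M2" using M s by auto
      then show ?thesis by linarith
    next
      case False
      then show ?thesis using \<theta>_0[of s n] c0[of n] by auto
    qed
  qed
qed

lemma \<theta>_tendsto: "c < s \<Longrightarrow> (\<lambda>n. \<theta> n s) \<longlonglongrightarrow> tf s"
proof -
  assume s: "c < s"
  have "filterlim (\<lambda>n. real (Suc n) * (s - c) - 1) at_top sequentially"
  proof -
    have "filterlim (\<lambda>n. - 1 + (s - c) * real (Suc n)) at_top sequentially"
      using s by (intro filterlim_tendsto_add_at_top[OF tendsto_const]
          filterlim_tendsto_pos_mult_at_top[OF tendsto_const] filterlim_compose[OF filterlim_real_sequentially filterlim_Suc]) auto
    then show ?thesis by (simp add: algebra_simps)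
  qed
  from tendsto_mult[OF tendsto_const[of "tf s"] filterlim_compose[OF flat_0_tendsto_1 this]]
  show ?thesis using s by (simp add: \<theta>_def)
qed

text \<open>\<open>weak_energy_inequality\<close> is applied to the conjugated extension
  \<open>Z (c0 n) u\<close> with weight \<open>\<theta> n\<close>. The right side is bounded through
  \<theta> \<le> \<open>tf\<close>, and the left side passes to the limit n to infinity by Fatou's
  lemma.\<close>

lemma frequency_bound:
  fixes u us :: "real \<times> (real^'n) \<Rightarrow> real" and A q R :: "real^'n^'n"
  assumes wd: "weak_derivs c B u us Du D2u"
    and tr: "\<exists>N\<in>null_sets lborel. \<forall>K. compact K \<longrightarrow>
      ((\<lambda>s. wnorm K (\<lambda>_. 1) (\<lambda>z. u (s, z))) \<longlongrightarrow> 0) (at B within ({c<..<B} - N))"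
    and fin: "fin_wt u" "fin_wt us" "\<And>i. fin_wt (\<lambda>x. Du x $ i)" "\<And>i j. fin_wt (\<lambda>x. D2u x $ i $ j)"
    and A: "transpose A = A" "\<And>x. 0 \<le> x \<bullet> (A *v x)"
    and q: "transpose q = q" "\<And>x. 0 \<le> x \<bullet> (q *v x)"
    and R: "transpose R = R" "R ** R = q"
    and qA: "\<And>x. x \<bullet> (q *v x) \<le> K * (x \<bullet> (A *v x))"
    and \<kappa>: "0 \<le> k - \<zeta> \<bullet> (A *v \<zeta>)" "\<zeta> \<bullet> (q *v \<zeta>) \<le> K * (k - \<zeta> \<bullet> (A *v \<zeta>))"
  shows "(\<integral>\<^sup>+x\<in>slab c B. ennreal (wt x * (norm (R ** D2u x ** R))\<^sup>2) \<partial>lborel)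
    \<le> ennreal (K\<^sup>2) * (\<integral>\<^sup>+x\<in>slab c B. ennreal (wt x * (P_op A us D2u x)\<^sup>2) \<partial>lborel)" (is "_ \<le> ?C")
proof -
  \<comment> \<open>Expanding - d_s - A : D^2 after conjugation gives k - d_s - A : (D + \<zeta>)(D
    + \<zeta>). Its drift is - 2 A \<zeta> and its constant term is k - \<zeta> . A \<zeta>.\<close>
  define v :: "real^'n" where "v = - 2 *\<^sub>R (A *v \<zeta>)"
  define \<kappa> where "\<kappa> = k - \<zeta> \<bullet> (A *v \<zeta>)"
  let ?I = "\<lambda>f x. indicator (slab c B) x * f x"
  let ?U = "{x::real \<times> (real^'n). c < fst x}"
  have w: "has_weak_deriv (slab c B) u dir_s us" "\<And>i. has_weak_deriv (slab c B) u (dir_z i) (\<lambda>x. Du x $ i)"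
    "\<And>i j. has_weak_deriv (slab c B) (\<lambda>x. Du x $ i) (dir_z j) (\<lambda>x. D2u x $ i $ j)"
    using wd by (auto simp: weak_derivs_def)
  have w1: "has_weak_deriv ?U (?I u) dir_s (?I us)"
    by (rule weak_deriv_extend[OF cB w(1) _ fin_wt_locally_integrable[OF fin(1)] fin_wt_locally_integrable[OF fin(2)] tr]) simp_all
  have ns: "dir_z i \<noteq> (dir_s :: real \<times> (real^'n))" for i by (simp add: dir_s_def dir_z_def)
  have w2: "has_weak_deriv ?U (?I u) (dir_z i) (?I (\<lambda>x. Du x $ i))" for i
    by (rule weak_deriv_extend[OF cB w(2) _ fin_wt_locally_integrable[OF fin(1)] fin_wt_locally_integrable[OF fin(3)]])
       (use ns in auto)
  have w3: "has_weak_deriv ?U (?I (\<lambda>x. Du x $ i)) (dir_z j) (?I (\<lambda>x. D2u x $ i $ j))" for i j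
    by (rule weak_deriv_extend[OF cB w(3) _ fin_wt_locally_integrable[OF fin(3)] fin_wt_locally_integrable[OF fin(4)]])
       (use ns in auto)
  define Wz where "Wz c0 i = (\<lambda>x. Z c0 (\<lambda>x. Du x $ i) x + (- \<zeta> $ i) * Z c0 u x)" for c0 i
  define Ws where "Ws c0 = (\<lambda>x. Z c0 us x + k * Z c0 u x)" for c0
  define Wzz where "Wzz c0 i j = (\<lambda>x. (Z c0 (\<lambda>x. D2u x $ i $ j) x + (- \<zeta> $ j) * Z c0 (\<lambda>x. Du x $ i) x)
      + (- \<zeta> $ i) * (Z c0 (\<lambda>x. Du x $ j) x + (- \<zeta> $ j) * Z c0 u x))" for c0 i j
  have main: "(\<integral>\<^sup>+x. ennreal (\<theta> n (min (fst x) B) * (norm (R ** (\<chi> i k. Z (c0 n) (\<lambda>x. D2u x $ i $ k) x) ** R))\<^sup>2) \<partial>lborel)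
    \<le> ?C" for n
  proof -
    obtain M where M: "\<And>s. s \<le> B \<Longrightarrow> \<theta> n s \<le> M \<and> \<theta>' n s \<le> M" using \<theta>_bounded by blast
    note Zq = Z_sqint[OF fin(1) c0] Z_sqint[OF fin(2) c0] Z_sqint[OF fin(3) c0] Z_sqint[OF fin(4) c0]
    have "weak_energy (Z (c0 n) u) (\<theta> n) (\<theta>' n) B M (c0 n) (Ws (c0 n)) (Wz (c0 n)) (Wzz (c0 n)) A q R K \<kappa> \<zeta>"
    proof
      show "sqint (Z (c0 n) u)" by (rule Zq)
      show "Z (c0 n) u y = 0" if "B \<le> fst y" for y using that by (simp add: Z_def in_slab)
      show "(\<theta> n has_real_derivative \<theta>' n s) (at s)" for s by (rule \<theta>_deriv)
      show "continuous_on UNIV (\<theta>' n)" by (rule \<theta>'_cont)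
      show "0 \<le> \<theta> n s \<and> \<theta> n s \<le> M \<and> 0 \<le> \<theta>' n s \<and> \<theta>' n s \<le> M" if "s \<le> B" for s
        using M[OF that] \<theta>_nonneg by auto
      show "\<theta> n s = 0" if "s \<le> c0 n" for s using \<theta>_0(1)[OF that] .
      show "sqint (Ws (c0 n))" unfolding Ws_def by (intro sqint_add sqint_cmult Zq)
      show "sqint (Wz (c0 n) i)" for i unfolding Wz_def by (intro sqint_add sqint_cmult Zq)
      show "sqint (Wzz (c0 n) i j)" for i j unfolding Wzz_def by (intro sqint_add sqint_cmult Zq)
      note B = Basis_space_time
      show "has_weak_deriv {x. c0 n < fst x} (Z (c0 n) u) dir_s (Ws (c0 n))"
        unfolding Ws_def by (rule Z_weak_deriv[OF B(1) c0 w1 smooth_exp_phase(2)])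
      show "has_weak_deriv {x. c0 n < fst x} (Z (c0 n) u) (dir_z i) (Wz (c0 n) i)" for i
        unfolding Wz_def by (rule Z_weak_deriv[OF B(2) c0 w2 smooth_exp_phase(3)])
      show "has_weak_deriv {x. c0 n < fst x} (Wz (c0 n) i) (dir_z j) (Wzz (c0 n) i j)" for i j
        unfolding Wz_def Wzz_def
        by (intro has_weak_deriv_lincomb B(2) Z_weak_deriv[OF B(2) c0 w2 smooth_exp_phase(3)]
            Z_weak_deriv[OF B(2) c0 w3 smooth_exp_phase(3)])
      show "0 \<le> \<kappa>" "\<zeta> \<bullet> (q *v \<zeta>) \<le> K * \<kappa>" using \<kappa> by (simp_all add: \<kappa>_def)
    qed (fact A q R qA)+
    then interpret WE: weak_energy "Z (c0 n) u" "\<theta> n" "\<theta>' n" B M "c0 n" "Ws (c0 n)" "Wz (c0 n)" "Wzz (c0 n)" A q R K \<kappa> \<zeta> v .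
    \<comment> \<open>The derivatives of the exponential contained in \<open>Wz\<close> and
      \<open>Wzz\<close> cancel the \<zeta>-terms of \<open>G\<close> exactly, which undoes the
      conjugation; the same happens for \<open>Y\<close>.\<close>
    have G: "WE.G i k x = Z (c0 n) (\<lambda>x. D2u x $ i $ k) x" for i k x
      unfolding WE.G_def Wzz_def Wz_def by (simp add: algebra_simps)
    have Y: "WE.Y x = Z (c0 n) (P_op A us D2u) x" for x
    proof -
      let ?i = "indicator (slab (c0 n) B) x * Ex x"
      have Zf: "Z (c0 n) f x = ?i * f x" for f by (simp add: Z_def)
      have s1: "(\<Sum>i\<in>UNIV. \<Sum>j\<in>UNIV. A $ i $ j * Wzz (c0 n) i j x)
        = ?i * (frob_inner A (D2u x) - 2 * (\<Sum>i\<in>UNIV. (A *v \<zeta>) $ i * Du x $ i) + (\<zeta> \<bullet> (A *v \<zeta>)) * u x)"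
      proof -
        have a1: "(\<Sum>i\<in>UNIV. \<Sum>j\<in>UNIV. A $ i $ j * (\<zeta> $ j * Du x $ i)) = (\<Sum>i\<in>UNIV. (A *v \<zeta>) $ i * Du x $ i)"
          by (simp add: matrix_vector_mult_def sum_distrib_right mult.assoc)
        have "(\<Sum>i\<in>UNIV. \<Sum>j\<in>UNIV. A $ i $ j * (\<zeta> $ i * Du x $ j)) = (\<Sum>j\<in>UNIV. \<Sum>i\<in>UNIV. A $ i $ j * (\<zeta> $ i * Du x $ j))"
          by (rule sum.swap)
        also have "\<dots> = (\<Sum>j\<in>UNIV. \<Sum>i\<in>UNIV. A $ j $ i * (\<zeta> $ i * Du x $ j))"
          using arg_cong[OF A(1), of "\<lambda>M. M $ _ $ _"] by (simp add: transpose_def)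
        finally have a2: "(\<Sum>i\<in>UNIV. \<Sum>j\<in>UNIV. A $ i $ j * (\<zeta> $ i * Du x $ j)) = (\<Sum>i\<in>UNIV. (A *v \<zeta>) $ i * Du x $ i)"
          unfolding a1 .
        have a3: "(\<Sum>i\<in>UNIV. \<Sum>j\<in>UNIV. A $ i $ j * (\<zeta> $ i * \<zeta> $ j * u x)) = (\<zeta> \<bullet> (A *v \<zeta>)) * u x"
          by (simp add: inner_matrix_vector sum_distrib_left mult_ac)
        have "(\<Sum>i\<in>UNIV. \<Sum>j\<in>UNIV. A $ i $ j * Wzz (c0 n) i j x)
          = (\<Sum>i\<in>UNIV. \<Sum>j\<in>UNIV. ?i * (A $ i $ j * D2u x $ i $ j - A $ i $ j * (\<zeta> $ j * Du x $ i)
              - A $ i $ j * (\<zeta> $ i * Du x $ j) + A $ i $ j * (\<zeta> $ i * \<zeta> $ j * u x)))"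
          unfolding Wzz_def Zf by (intro sum.cong refl) (simp add: algebra_simps)
        also have "\<dots> = ?i * (frob_inner A (D2u x) - (\<Sum>i\<in>UNIV. (A *v \<zeta>) $ i * Du x $ i)
            - (\<Sum>i\<in>UNIV. (A *v \<zeta>) $ i * Du x $ i) + (\<zeta> \<bullet> (A *v \<zeta>)) * u x)"
          unfolding sum_distrib_left[symmetric] sum.distrib sum_subtractf a1 a2 a3 frob_inner_eq_sum ..
        finally show ?thesis by simp
      qed
      have s2: "(\<Sum>i\<in>UNIV. v $ i * Wz (c0 n) i x)
        = ?i * (- 2 * (\<Sum>i\<in>UNIV. (A *v \<zeta>) $ i * Du x $ i) + 2 * (\<zeta> \<bullet> (A *v \<zeta>)) * u x)"
      proof -
        have "(\<Sum>i\<in>UNIV. v $ i * Wz (c0 n) i x)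
          = (\<Sum>i\<in>UNIV. ?i * (- 2 * ((A *v \<zeta>) $ i * Du x $ i) + 2 * (\<zeta> $ i * (A *v \<zeta>) $ i * u x)))"
          unfolding Wz_def Zf v_def by (intro sum.cong refl) (simp add: algebra_simps)
        also have "\<dots> = ?i * (- 2 * (\<Sum>i\<in>UNIV. (A *v \<zeta>) $ i * Du x $ i) + 2 * (\<zeta> \<bullet> (A *v \<zeta>)) * u x)"
          unfolding sum_distrib_left[symmetric] sum.distrib inner_vec_def
          by (simp add: sum_distrib_right mult.assoc)
        finally show ?thesis .
      qed
      show ?thesis
        unfolding WE.Y_def unfolding s1 s2 Ws_def Zf P_op_def \<kappa>_def by (simp add: algebra_simps)
    qed
    have "(\<integral>\<^sup>+x. ennreal (\<theta> n (min (fst x) B) * (Z (c0 n) (P_op A us D2u) x)\<^sup>2) \<partial>lborel)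
        \<le> (\<integral>\<^sup>+x\<in>slab c B. ennreal (wt x * (P_op A us D2u x)\<^sup>2) \<partial>lborel)"
    proof (rule nn_integral_mono)
      fix x
      show "ennreal (\<theta> n (min (fst x) B) * (Z (c0 n) (P_op A us D2u) x)\<^sup>2)
          \<le> ennreal (wt x * (P_op A us D2u x)\<^sup>2) * indicator (slab c B) x"
      proof (cases "x \<in> slab (c0 n) B")
        case True
        then have x: "c < fst x" "fst x < B" using c0[of n] by (auto simp: in_slab)
        have "\<theta> n (fst x) * (Ex x * P_op A us D2u x)\<^sup>2 \<le> tf (fst x) * (Ex x * P_op A us D2u x)\<^sup>2"
          using \<theta>_le[OF x(1)] by (intro mult_right_mono) auto
        then show ?thesis using True x
          by (simp add: Z_def in_slab power_mult_distrib Ex_square mult.assoc ennreal_leI)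
      qed (simp add: Z_def)
    qed
    from order_trans[OF WE.weak_energy_inequality[unfolded G Y] mult_left_mono[OF this zero_le]]
    show ?thesis .
  qed
  show ?thesis
  proof (rule nn_integral_Fatou_le[OF _ main])
    have "Z (c0 n) (\<lambda>x. D2u x $ i $ j) \<in> borel_measurable borel" for n i j
      using Z_sqint[OF fin(4) c0] sqint_measurable by blast
    note Zm = this
    have \<theta>m: "(\<lambda>x::real \<times> (real^'n). \<theta> n (min (fst x) B)) \<in> borel_measurable borel" for n
    proof -
      have "continuous_on UNIV (\<theta> n)" using \<theta>_deriv DERIV_continuous_on by blast
      moreover have "continuous_on UNIV (\<lambda>x::real \<times> (real^'n). min (fst x) B)" by (intro continuous_intros)
      ultimately have "continuous_on UNIV (\<lambda>x::real \<times> (real^'n). \<theta> n (min (fst x) B))"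
        by (rule continuous_on_compose2) simp
      then show ?thesis by (rule borel_measurable_continuous_onI)
    qed
    show "(\<lambda>x. ennreal (\<theta> n (min (fst x) B) * (norm (R ** (\<chi> i k. Z (c0 n) (\<lambda>x. D2u x $ i $ k) x) ** R))\<^sup>2)) \<in> borel_measurable lborel" for n
    proof -
      have "(\<lambda>x. \<theta> n (min (fst x) B) * (norm (R ** (\<chi> i k. Z (c0 n) (\<lambda>x. D2u x $ i $ k) x) ** R))\<^sup>2) \<in> borel_measurable borel"
        unfolding norm_sandwich_power2[OF R(1)] vec_lambda_beta
        by (intro borel_measurable_times borel_measurable_sum borel_measurable_const Zm \<theta>m)
      then show ?thesis by simp
    qed
    show "AE x in lborel. (\<lambda>n. ennreal (\<theta> n (min (fst x) B) * (norm (R ** (\<chi> i k. Z (c0 n) (\<lambda>x. D2u x $ i $ k) x) ** R))\<^sup>2))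
        \<longlonglongrightarrow> ennreal (wt x * (norm (R ** D2u x ** R))\<^sup>2) * indicator (slab c B) x"
    proof (rule AE_I2)
      fix x
      show "(\<lambda>n. ennreal (\<theta> n (min (fst x) B) * (norm (R ** (\<chi> i k. Z (c0 n) (\<lambda>x. D2u x $ i $ k) x) ** R))\<^sup>2))
        \<longlonglongrightarrow> ennreal (wt x * (norm (R ** D2u x ** R))\<^sup>2) * indicator (slab c B) x"
      proof (cases "x \<in> slab c B")
        case True
        then have x: "c < fst x" "fst x < B" by (auto simp: in_slab)
        have il: "(\<lambda>n. indicator (slab (c0 n) B) x :: real) \<longlonglongrightarrow> 1"
        proof -
          obtain N where N: "1 / real (Suc N) < fst x - c" using nat_approx_posE[of "fst x - c"] x by auto
          have "indicator (slab (c0 n) B) x = (1::real)" if "n \<ge> N" for n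
          proof -
            have "1 / real (Suc n) \<le> 1 / real (Suc N)" using that by (simp add: frac_le)
            then show ?thesis using N x by (simp add: in_slab c0_def)
          qed
          then show ?thesis by (intro tendsto_eventually) (auto simp: eventually_sequentially)
        qed
        have "(\<lambda>n. Z (c0 n) (\<lambda>x. D2u x $ i $ j) x) \<longlonglongrightarrow> (Ex x *\<^sub>R D2u x) $ i $ j" for i j
          unfolding Z_def using tendsto_mult[OF il tendsto_const[of "Ex x * D2u x $ i $ j"]] by simp
        then have "(\<lambda>n. \<theta> n (fst x) * (norm (R ** (\<chi> i k. Z (c0 n) (\<lambda>x. D2u x $ i $ k) x) ** R))\<^sup>2)
            \<longlonglongrightarrow> tf (fst x) * (norm (R ** (Ex x *\<^sub>R D2u x) ** R))\<^sup>2"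
          by (intro tendsto_mult \<theta>_tendsto x frob_sandwich_tendsto R) simp
        moreover have "tf (fst x) * (norm (R ** (Ex x *\<^sub>R D2u x) ** R))\<^sup>2 = wt x * (norm (R ** D2u x ** R))\<^sup>2"
          unfolding norm_sandwich_power2[OF R(1)] Ex_square[symmetric]
          by (simp add: sum_distrib_left power2_eq_square mult_ac)
        moreover have "min (fst x) B = fst x" using x by simp
        ultimately show ?thesis using True by (simp add: tendsto_ennrealI)
      next
        case False
        have z: "\<theta> n (min (fst x) B) * (norm (R ** (\<chi> i k. Z (c0 n) (\<lambda>x. D2u x $ i $ k) x) ** R))\<^sup>2 = 0" for n
        proof -
          have "x \<notin> slab (c0 n) B" using False c0[of n] by (auto simp: in_slab)
          then have "(\<chi> i k. Z (c0 n) (\<lambda>x. D2u x $ i $ k) x) = 0" by (simp add: Z_def vec_eq_iff)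
          then show ?thesis by simp
        qed
        show ?thesis unfolding z using False by simp
      qed
    qed
  qed
qed

end

section \<open>Mixtures of exponential weights\<close>

text \<open>The complement of the support is a union of open null sets, and by the Lindelof property
  countably many of them suffice.\<close>

lemma AE_msupp:
  fixes lam :: "(real^'n) measure"
  assumes sets: "sets lam = sets borel"
  shows "AE \<zeta> in lam. \<zeta> \<in> msupp lam"
proof -
  define \<F> where "\<F> = {U::(real^'n) set. open U \<and> emeasure lam U = 0}"
  obtain \<G> where G: "\<G> \<subseteq> \<F>" "countable \<G>" "\<Union>\<G> = \<Union>\<F>"
    using Lindelof[of \<F>] by (auto simp: \<F>_def)
  have "\<Union>\<G> \<in> null_sets lam"
  proof -
    have "(\<Union>U\<in>\<G>. U) \<in> null_sets lam"
      by (rule null_sets_UN'[OF G(2)]) (use G(1) sets in \<open>auto simp: \<F>_def null_sets_def\<close>)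
    then show ?thesis by simp
  qed
  then have "AE \<zeta> in lam. \<zeta> \<notin> \<Union>\<F>" unfolding G(3) by (rule AE_not_in)
  then show ?thesis
  proof eventually_elim
    case (elim \<zeta>)
    then show ?case by (auto simp: msupp_def \<F>_def zero_less_iff_neq_zero)
  qed
qed

lemma phase_measurable:
  "(\<lambda>p. exp (2 * phase (fst p \<bullet> (a *v fst p)) (fst p) (snd p))) \<in> borel_measurable (borel :: ((real^'n) \<times> (real \<times> (real^'n))) measure)"
proof (rule borel_measurable_continuous_onI)
  have "continuous_on UNIV (\<lambda>p::(real^'n) \<times> (real \<times> (real^'n)). a *v fst p)"
    by (intro continuous_on_compose2[OF linear_continuous_on[OF matrix_vector_mul_bounded_linear[of a]]] continuous_intros) auto
  then show "continuous_on UNIV (\<lambda>p::(real^'n) \<times> (real \<times> (real^'n)). exp (2 * phase (fst p \<bullet> (a *v fst p)) (fst p) (snd p)))"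
    unfolding phase_def by (intro continuous_intros)
qed

context
  fixes lam :: "(real^'n) measure" and a :: "real^'n^'n"
  assumes lam: "compactly_supported_prob lam"
begin

interpretation prob_space lam using lam by (simp add: compactly_supported_prob_def)

lemma lam_sets: "sets lam = sets borel" using lam by (simp add: compactly_supported_prob_def)

abbreviation EE where "EE \<zeta> x \<equiv> exp (2 * phase (\<zeta> \<bullet> (a *v \<zeta>)) \<zeta> x)"

lemma EE_measurable: "(\<lambda>\<zeta>. EE \<zeta> x) \<in> borel_measurable lam"
proof -
  have "(\<lambda>\<zeta>::real^'n. (\<zeta>, x)) \<in> borel_measurable borel"
    by (intro borel_measurable_continuous_onI continuous_intros)
  from measurable_compose[OF this phase_measurable[of a]]
  have "(\<lambda>\<zeta>. EE \<zeta> x) \<in> borel_measurable borel" by simp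
  then show ?thesis by (simp only: measurable_cong_sets[OF lam_sets refl])
qed

lemma EE_bounded:
  assumes "compact K"
  shows "\<exists>C. \<forall>x\<in>K. \<forall>\<zeta>\<in>msupp lam. EE \<zeta> x \<le> C"
proof -
  let ?f = "\<lambda>p::(real^'n) \<times> (real \<times> (real^'n)). exp (2 * phase (fst p \<bullet> (a *v fst p)) (fst p) (snd p))"
  have "continuous_on (msupp lam \<times> K) (\<lambda>p::(real^'n) \<times> (real \<times> (real^'n)). a *v fst p)"
    by (intro continuous_on_compose2[OF linear_continuous_on[OF matrix_vector_mul_bounded_linear[of a]]] continuous_intros) auto
  then have "continuous_on (msupp lam \<times> K) ?f" unfolding phase_def by (intro continuous_intros)
  moreover have "compact (msupp lam \<times> K)"
    using lam assms by (intro compact_Times) (auto simp: compactly_supported_prob_def)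
  ultimately have "bounded (?f ` (msupp lam \<times> K))" by (intro compact_imp_bounded compact_continuous_image)
  then obtain C where "\<forall>y\<in>?f ` (msupp lam \<times> K). norm y \<le> C" unfolding bounded_iff by blast
  then have "EE \<zeta> x \<le> C" if "x \<in> K" "\<zeta> \<in> msupp lam" for x \<zeta>
    using that by force
  then show ?thesis by blast
qed

lemma EE_integrable: "integrable lam (\<lambda>\<zeta>. EE \<zeta> x)"
proof -
  obtain C where C: "\<And>\<zeta>. \<zeta> \<in> msupp lam \<Longrightarrow> EE \<zeta> x \<le> C" using EE_bounded[of "{x}"] by auto
  show ?thesis
  proof (rule integrable_const_bound[where B=C])
    show "AE \<zeta> in lam. norm (EE \<zeta> x) \<le> C"
      using AE_msupp[OF lam_sets] by eventually_elim (use C in simp)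
  qed (rule EE_measurable)
qed

lemma W_wt_eq: "W_wt lam a x = (LINT \<zeta>|lam. EE \<zeta> x)"
  by (cases x) (simp add: W_wt_def phase_def)

lemma W_wt_nonneg: "0 \<le> W_wt lam a x"
  unfolding W_wt_eq by (rule Bochner_Integration.integral_nonneg) simp

lemma W_wt_bounded:
  assumes "compact K"
  shows "\<exists>C. \<forall>x\<in>K. W_wt lam a x \<le> C"
proof -
  obtain C where C: "\<And>x \<zeta>. x \<in> K \<Longrightarrow> \<zeta> \<in> msupp lam \<Longrightarrow> EE \<zeta> x \<le> C" using EE_bounded[OF assms] by blast
  have "W_wt lam a x \<le> C" if "x \<in> K" for x
  proof -
    have "(LINT \<zeta>|lam. EE \<zeta> x) \<le> (LINT \<zeta>|lam. C)"
    proof (rule integral_mono_AE[OF EE_integrable])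
      show "AE \<zeta> in lam. EE \<zeta> x \<le> C"
        using AE_msupp[OF lam_sets] by (rule eventually_mono) (rule C[OF that])
    qed simp
    then show ?thesis by (simp add: W_wt_eq prob_space)
  qed
  then show ?thesis by blast
qed

lemma EE_times_measurable:
  assumes g: "(\<lambda>x. indicator S x * g x) \<in> borel_measurable borel"
  shows "(\<lambda>(\<zeta>, x). ennreal (EE \<zeta> x * g x) * indicator S x) \<in> borel_measurable (lam \<Otimes>\<^sub>M lborel)"
proof -
  have "(\<lambda>p::(real^'n) \<times> (real \<times> (real^'n)). EE (fst p) (snd p) * (indicator S (snd p) * g (snd p))) \<in> borel_measurable borel"
  proof (rule borel_measurable_times[OF phase_measurable measurable_compose[OF _ g]])
    show "snd \<in> borel_measurable (borel :: ((real^'n) \<times> (real \<times> (real^'n))) measure)"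
      by (intro borel_measurable_continuous_onI continuous_intros)
  qed
  then have "(\<lambda>p::(real^'n) \<times> (real \<times> (real^'n)). ennreal (EE (fst p) (snd p) * (indicator S (snd p) * g (snd p)))) \<in> borel_measurable (borel \<Otimes>\<^sub>M borel)"
    unfolding borel_prod by simp
  moreover have "sets (lam \<Otimes>\<^sub>M (lborel :: (real \<times> (real^'n)) measure)) = sets (borel \<Otimes>\<^sub>M borel)"
    by (intro sets_pair_measure_cong lam_sets) simp
  ultimately have "(\<lambda>p::(real^'n) \<times> (real \<times> (real^'n)). ennreal (EE (fst p) (snd p) * (indicator S (snd p) * g (snd p)))) \<in> borel_measurable (lam \<Otimes>\<^sub>M lborel)"
    using measurable_cong_sets by blast
  moreover have "(\<lambda>p. ennreal (EE (fst p) (snd p) * (indicator S (snd p) * g (snd p))))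
      = (\<lambda>(\<zeta>, x). ennreal (EE \<zeta> x * g x) * indicator S x)"
    by (auto simp: fun_eq_iff indicator_def)
  ultimately show ?thesis by simp
qed

text \<open>Tonelli's theorem for the mixture. Measurability and sign of \<open>g\<close> are stated
  relative to \<open>S\<close>, because the representatives of the derivatives are arbitrary outside
  the slab.\<close>

lemma W_wt_mixture:
  assumes g: "(\<lambda>x. indicator S x * g x) \<in> borel_measurable borel" and pos: "\<And>x. x \<in> S \<Longrightarrow> 0 \<le> g x"
  shows "(\<integral>\<^sup>+x\<in>S. ennreal (W_wt lam a x * g x) \<partial>lborel)
      = (\<integral>\<^sup>+\<zeta>. (\<integral>\<^sup>+x\<in>S. ennreal (EE \<zeta> x * g x) \<partial>lborel) \<partial>lam)"
    and "(\<lambda>\<zeta>. \<integral>\<^sup>+x\<in>S. ennreal (EE \<zeta> x * g x) \<partial>lborel) \<in> borel_measurable lam"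
proof -
  have sf: "sigma_finite_measure lam" ..
  interpret pair_sigma_finite lam "lborel :: (real \<times> (real^'n)) measure"
    by (intro pair_sigma_finite.intro sf lborel.sigma_finite_measure_axioms)
  note m = EE_times_measurable[OF g]
  show "(\<lambda>\<zeta>. \<integral>\<^sup>+x\<in>S. ennreal (EE \<zeta> x * g x) \<partial>lborel) \<in> borel_measurable lam"
    using lborel.borel_measurable_nn_integral_fst[OF m] by simp
  have "(\<integral>\<^sup>+x\<in>S. ennreal (W_wt lam a x * g x) \<partial>lborel)
      = (\<integral>\<^sup>+x. (\<integral>\<^sup>+\<zeta>. ennreal (EE \<zeta> x * g x) * indicator S x \<partial>lam) \<partial>lborel)"
  proof (rule nn_integral_cong)
    fix x
    show "ennreal (W_wt lam a x * g x) * indicator S x = (\<integral>\<^sup>+\<zeta>. ennreal (EE \<zeta> x * g x) * indicator S x \<partial>lam)"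
    proof (cases "x \<in> S")
      case True
      have "ennreal (W_wt lam a x) = (\<integral>\<^sup>+\<zeta>. ennreal (EE \<zeta> x) \<partial>lam)"
        unfolding W_wt_eq by (rule nn_integral_eq_integral[symmetric, OF EE_integrable]) simp
      then show ?thesis using True pos[OF True] EE_measurable[of x]
        by (simp add: ennreal_mult W_wt_nonneg nn_integral_multc)
    qed simp
  qed
  also have "\<dots> = (\<integral>\<^sup>+\<zeta>. (\<integral>\<^sup>+x. ennreal (EE \<zeta> x * g x) * indicator S x \<partial>lborel) \<partial>lam)"
    by (rule Fubini'[OF m])
  finally show "(\<integral>\<^sup>+x\<in>S. ennreal (W_wt lam a x * g x) \<partial>lborel)
      = (\<integral>\<^sup>+\<zeta>. (\<integral>\<^sup>+x\<in>S. ennreal (EE \<zeta> x * g x) \<partial>lborel) \<partial>lam)" .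
qed

end

section \<open>The upper bound\<close>

lemma esqrt_le_mult:
  assumes "I \<le> ennreal (K\<^sup>2) * J" "K > 0"
  shows "esqrt I \<le> ennreal K * esqrt J"
proof (cases "J = \<top>")
  case True
  then show ?thesis using assms(2) by (simp add: esqrt_def ennreal_mult_top)
next
  case False
  then obtain j where j: "J = ennreal j" "j \<ge> 0" by (cases J) auto
  then have "I \<le> ennreal (K\<^sup>2 * j)" using assms by (simp add: ennreal_mult)
  also have "\<dots> = ennreal ((K * sqrt j)\<^sup>2)" using j by (simp add: power_mult_distrib)
  finally have "esqrt I \<le> ennreal (K * sqrt j)" using j assms by (subst esqrt_le_iff) auto
  then show ?thesis using j assms by (simp add: esqrt_def ennreal_mult)
qed

lemma esqrt_less_top_iff: "esqrt x < \<top> \<longleftrightarrow> x < \<top>"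
  by (auto simp: esqrt_def top.not_eq_extremum)

lemma ennreal_divide_le: "x \<le> ennreal K * y \<Longrightarrow> x / y \<le> ennreal K"
proof (cases "y = 0")
  case True
  assume "x \<le> ennreal K * y"
  then show ?thesis using True by simp
next
  case False
  assume "x \<le> ennreal K * y"
  then show ?thesis using False by (intro divide_le_posI_ennreal) (auto simp: zero_less_iff_neq_zero mult.commute)
qed

lemma ennreal_divide_leD:
  assumes "x / y \<le> ennreal K" "y < \<top>"
  shows "x \<le> ennreal K * y"
proof (cases "y = 0")
  case True
  then have "x = 0" using assms(1) by (metis ennreal_divide_zero ennreal_less_top not_le zero_less_iff_neq_zero)
  then show ?thesis by simp
next
  case False
  then have "x = (x / y) * y" using assms(2) by (simp add: ennreal_divide_times ennreal_times_divide)
  then show ?thesis using assms(1) by (metis mult_right_mono zero_le)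
qed

text \<open>A form without quotients or inverses of the statement that \<open>K\<close> dominates
  both the largest eigenvalue and every directional term; it is what the energy estimate consumes
  and what the wave packets produce.\<close>

definition freq_cond :: "(real^'n) measure \<Rightarrow> real^'n^'n \<Rightarrow> real^'n^'n \<Rightarrow> real^'n^'n \<Rightarrow> real \<Rightarrow> bool" where
  "freq_cond lam a A q K \<longleftrightarrow> (\<forall>x. x \<bullet> (q *v x) \<le> K * (x \<bullet> (A *v x))) \<and>
     (\<forall>\<zeta>\<in>msupp lam. \<zeta> \<bullet> (q *v \<zeta>) \<le> K * (\<zeta> \<bullet> ((a - A) *v \<zeta>)))"

lemma frequency_setup_time_factor:
  assumes "(0 \<le> \<alpha> \<and> 0 \<le> c) \<or> \<alpha> = 0" "c < B"
  shows "frequency_setup c B (time_factor \<alpha>) (\<lambda>s. if \<alpha> = 0 then 0 else \<alpha> * s powr (\<alpha> - 1))"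
proof
  show "c < B" by fact
  fix s assume s: "c < s"
  show "(time_factor \<alpha> has_real_derivative (if \<alpha> = 0 then 0 else \<alpha> * s powr (\<alpha> - 1))) (at s)"
  proof (cases "\<alpha> = 0")
    case True
    then have "time_factor \<alpha> = (\<lambda>_. 1)" by (auto simp: time_factor_def)
    then show ?thesis using True by simp
  next
    case False
    then have "time_factor \<alpha> = (\<lambda>s. s powr \<alpha>)" by (auto simp: time_factor_def)
    then show ?thesis using False assms s has_real_derivative_powr[of s \<alpha>] by auto
  qed
  show "0 < time_factor \<alpha> s" using assms s by (auto simp: time_factor_def)
  show "0 \<le> (if \<alpha> = 0 then 0 else \<alpha> * s powr (\<alpha> - 1))" using assms by auto
next
  show "continuous_on {c<..} (\<lambda>s. if \<alpha> = 0 then 0 else \<alpha> * s powr (\<alpha> - 1))"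
  proof (cases "\<alpha> = 0")
    case False
    then have "continuous_on {c<..} (\<lambda>s. \<alpha> * s powr (\<alpha> - 1))"
      using assms by (intro continuous_intros) auto
    then show ?thesis using False by simp
  qed simp
qed

lemma inorm_eq:
  "inorm \<alpha> c B F f = esqrt (\<integral>\<^sup>+x\<in>slab c B. ennreal (F x * (time_factor \<alpha> (fst x) * (norm (f x))\<^sup>2)) \<partial>lborel)"
  unfolding inorm_def wnorm_def
  by (simp add: case_prod_beta mult_ac)

lemma inorm_cong_AE:
  assumes "AE x in lborel. x \<in> slab c B \<longrightarrow> norm (f x) = norm (g x)"
  shows "inorm \<alpha> c B F f = inorm \<alpha> c B F g"
  unfolding inorm_eq
proof (rule arg_cong[where f=esqrt], rule nn_integral_cong_AE)
  show "AE x in lborel. ennreal (F x * (time_factor \<alpha> (fst x) * (norm (f x))\<^sup>2)) * indicator (slab c B) x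
      = ennreal (F x * (time_factor \<alpha> (fst x) * (norm (g x))\<^sup>2)) * indicator (slab c B) x"
    using assms by eventually_elim (auto simp: indicator_def)
qed

lemma weak_derivs_measurable:
  assumes "weak_derivs c B u us Du D2u"
  shows "(\<lambda>x. indicator (slab c B) x * u x) \<in> borel_measurable borel"
    "(\<lambda>x. indicator (slab c B) x * us x) \<in> borel_measurable borel"
    "(\<lambda>x. indicator (slab c B) x * Du x $ i) \<in> borel_measurable borel"
    "(\<lambda>x. indicator (slab c B) x * D2u x $ i $ j) \<in> borel_measurable borel"
  by (rule locally_integrable_measurable[OF open_slab];
      use assms in \<open>simp add: weak_derivs_def has_weak_deriv_def\<close>)+

lemma weak_derivs_unique:
  assumes 1: "weak_derivs c B u us Du D2u" and 2: "weak_derivs c B u us' Du' D2u'"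
  shows "AE x in lborel. x \<in> slab c B \<longrightarrow> us x = us' x \<and> Du x = Du' x \<and> D2u x = D2u' x"
proof -
  note uniq = has_weak_deriv_unique[OF open_slab]
  have s: "AE x in lborel. x \<in> slab c B \<longrightarrow> us x = us' x"
    by (rule uniq[OF Basis_space_time(1)]) (use 1 2 in \<open>auto simp: weak_derivs_def\<close>)
  have z: "AE x in lborel. x \<in> slab c B \<longrightarrow> Du x $ i = Du' x $ i" for i
    by (rule uniq[OF Basis_space_time(2)[of i]]) (use 1 2 in \<open>auto simp: weak_derivs_def\<close>)
  have zz: "AE x in lborel. x \<in> slab c B \<longrightarrow> D2u x $ i $ j = D2u' x $ i $ j" for i j
    by (rule uniq[OF Basis_space_time(2)[of j] _ _ z[of i]]) (use 1 2 in \<open>auto simp: weak_derivs_def\<close>)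
  have "AE x in lborel. \<forall>i. x \<in> slab c B \<longrightarrow> Du x $ i = Du' x $ i" using z by (subst AE_all_countable) blast
  moreover have "AE x in lborel. \<forall>i. \<forall>j. x \<in> slab c B \<longrightarrow> D2u x $ i $ j = D2u' x $ i $ j"
    using zz by (subst AE_all_countable, intro allI, subst AE_all_countable) blast
  ultimately show ?thesis using s by eventually_elim (auto simp: vec_eq_iff)
qed

lemma norm_matrix_nth_le: "\<bar>M $ i $ j\<bar> \<le> norm (M :: real^'n^'m)"
  using component_le_norm_cart[of "M $ i" j] Finite_Cartesian_Product.norm_nth_le[of M i] by linarith

lemma trace_slices:
  assumes "has_trace_at c B u Du (\<lambda>_. 0) (\<lambda>_. 0)"
  shows "\<exists>N\<in>null_sets lborel. \<forall>K. compact K \<longrightarrow>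
      ((\<lambda>s. wnorm K (\<lambda>_. 1) (\<lambda>z. u (s, z))) \<longlongrightarrow> 0) (at B within ({c<..<B} - N))"
proof -
  obtain N where N: "N \<in> null_sets lborel" "\<And>K. compact K \<Longrightarrow>
        ((\<lambda>s. wnorm K (\<lambda>_. 1) (\<lambda>z. u (s, z) - 0) + wnorm K (\<lambda>_. 1) (\<lambda>z. Du (s, z) - 0))
           \<longlongrightarrow> 0) (at B within ({c<..<B} - N))"
    using assms unfolding has_trace_at_def by blast
  have "((\<lambda>s. wnorm K (\<lambda>_. 1) (\<lambda>z. u (s, z))) \<longlongrightarrow> 0) (at B within ({c<..<B} - N))" if "compact K" for K
    by (rule tendsto_sandwich[OF _ _ tendsto_const N(2)[OF that]]) auto
  with N(1) show ?thesis by blast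
qed

text \<open>A finite norm for the mixed weight makes the norms for the single exponentials finite at
  almost every frequency, and almost every frequency lies in the support. The bound for one
  frequency then holds with the same K, and integration over the mixing measure gives it for the
  mixture.\<close>

lemma k_const_le:
  fixes a A q :: "real^'n^'n"
  assumes lam: "compactly_supported_prob lam" and A: "sym_posdef A" and q: "sym_posdef q"
    and K: "K > 0" and cond: "freq_cond lam a A q K"
    and \<alpha>: "(0 \<le> \<alpha> \<and> 0 \<le> c) \<or> \<alpha> = 0" and cB: "c < B"
  shows "k_const \<alpha> c B (W_wt lam a) A q \<le> ennreal K"
  unfolding k_const_def
proof (rule Sup_least)
  let ?F = "W_wt lam a"
  fix r assume "r \<in> {inorm \<alpha> c B ?F (H_op q D2u) / inorm \<alpha> c B ?F (P_op A us D2u) | u us Du D2u.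
            u \<in> W0_space \<alpha> c B ?F \<and> weak_derivs c B u us Du D2u}"
  then obtain u us Du D2u where r: "r = inorm \<alpha> c B ?F (H_op q D2u) / inorm \<alpha> c B ?F (P_op A us D2u)"
    and u: "u \<in> W0_space \<alpha> c B ?F" and wd: "weak_derivs c B u us Du D2u" by blast
  from u obtain us1 Du1 D2u1 where wd1: "weak_derivs c B u us1 Du1 D2u1"
    and f1: "inorm \<alpha> c B ?F u < \<top>" "inorm \<alpha> c B ?F us1 < \<top>" "inorm \<alpha> c B ?F Du1 < \<top>" "inorm \<alpha> c B ?F D2u1 < \<top>"
    unfolding W0_space_def W_space_def by blast
  from u obtain Du2 where "has_trace_at c B u Du2 (\<lambda>_. 0) (\<lambda>_. 0)" unfolding W0_space_def by blast
  note tr = trace_slices[OF this]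
  \<comment> \<open>\<open>k_const\<close> ranges over arbitrary representatives of the derivatives,
    while membership in the space supplies possibly different ones; uniqueness transfers the
    finiteness of the norms.\<close>
  have ae: "AE x in lborel. x \<in> slab c B \<longrightarrow> us x = us1 x \<and> Du x = Du1 x \<and> D2u x = D2u1 x"
    by (rule weak_derivs_unique[OF wd wd1])
  have f2: "inorm \<alpha> c B ?F us < \<top>" "inorm \<alpha> c B ?F Du < \<top>" "inorm \<alpha> c B ?F D2u < \<top>"
  proof -
    have "inorm \<alpha> c B ?F us = inorm \<alpha> c B ?F us1" "inorm \<alpha> c B ?F Du = inorm \<alpha> c B ?F Du1"
      "inorm \<alpha> c B ?F D2u = inorm \<alpha> c B ?F D2u1"
      by (rule inorm_cong_AE, use ae in \<open>auto elim: eventually_mono\<close>)+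
    with f1 show "inorm \<alpha> c B ?F us < \<top>" "inorm \<alpha> c B ?F Du < \<top>" "inorm \<alpha> c B ?F D2u < \<top>" by simp_all
  qed
  note meas = weak_derivs_measurable[OF wd]
  let ?S = "slab c B"
  let ?tf = "time_factor \<alpha>"
  define R where "R = mat_sqrt q"
  have R: "transpose R = R" "R ** R = q" using mat_sqrt[OF q] by (auto simp: R_def sym_posdef_def)
  have As: "transpose A = A" "0 \<le> x \<bullet> (A *v x)" for x
    using A by (auto simp: sym_posdef_def) (cases "x = 0"; force simp: less_imp_le)
  have qs: "transpose q = q" "0 \<le> x \<bullet> (q *v x)" for x
    using q by (auto simp: sym_posdef_def) (cases "x = 0"; force simp: less_imp_le)
  have tf0: "0 \<le> ?tf (fst x)" if "x \<in> ?S" for x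
    using frequency_setup.tf(3)[OF frequency_setup_time_factor[OF \<alpha> cB], of "fst x"] that by (auto simp: in_slab)
  have tfm: "(\<lambda>x::real \<times> (real^'n). indicator {c<..} (fst x) *\<^sub>R ?tf (fst x)) \<in> borel_measurable borel"
  proof (rule measurable_compose[of fst])
    show "fst \<in> borel_measurable (borel :: (real \<times> (real^'n)) measure)"
      by (intro borel_measurable_continuous_onI continuous_intros)
    show "(\<lambda>s. indicator {c<..} s *\<^sub>R ?tf s) \<in> borel_measurable borel"
      using borel_measurable_continuous_on_indicator[OF _ frequency_setup.tf_cont[OF frequency_setup_time_factor[OF \<alpha> cB]]] by simp
  qed
  have gm: "(\<lambda>x. indicator ?S x * (?tf (fst x) * (f x)\<^sup>2)) \<in> borel_measurable borel"
    if "(\<lambda>x. (indicator ?S x * f x)\<^sup>2) \<in> borel_measurable borel" for f :: "real \<times> (real^'n) \<Rightarrow> real"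
  proof -
    have "(\<lambda>x. (indicator {c<..} (fst x) *\<^sub>R ?tf (fst x)) * (indicator ?S x * f x)\<^sup>2) \<in> borel_measurable borel"
      by (rule borel_measurable_times[OF tfm that])
    moreover have "(\<lambda>x. (indicator {c<..} (fst x) *\<^sub>R ?tf (fst x)) * (indicator ?S x * f x)\<^sup>2)
        = (\<lambda>x. indicator ?S x * (?tf (fst x) * (f x)\<^sup>2))"
      by (auto simp: fun_eq_iff indicator_def in_slab)
    ultimately show ?thesis by simp
  qed
  have mu: "(\<lambda>x. (indicator ?S x * norm (u x))\<^sup>2) \<in> borel_measurable borel"
    using borel_measurable_power[OF meas(1), of 2] by (simp add: power_mult_distrib)
  have mus: "(\<lambda>x. (indicator ?S x * norm (us x))\<^sup>2) \<in> borel_measurable borel"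
    using borel_measurable_power[OF meas(2), of 2] by (simp add: power_mult_distrib)
  have mDu: "(\<lambda>x. (indicator ?S x * norm (Du x))\<^sup>2) \<in> borel_measurable borel"
  proof -
    have "(\<lambda>x. \<Sum>i\<in>UNIV. (indicator ?S x * Du x $ i)\<^sup>2) \<in> borel_measurable borel"
      by (intro borel_measurable_sum borel_measurable_power meas)
    moreover have "(\<Sum>i\<in>UNIV. (indicator ?S x * Du x $ i)\<^sup>2) = (indicator ?S x * norm (Du x))\<^sup>2" for x
      by (simp add: power_mult_distrib norm_vec_def L2_set_def sum_nonneg sum_distrib_left)
    ultimately show ?thesis by simp
  qed
  have mD2u: "(\<lambda>x. (indicator ?S x * norm (D2u x))\<^sup>2) \<in> borel_measurable borel"
  proof -
    have "(\<lambda>x. \<Sum>i\<in>UNIV. \<Sum>j\<in>UNIV. (indicator ?S x * D2u x $ i $ j)\<^sup>2) \<in> borel_measurable borel"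
      by (intro borel_measurable_sum borel_measurable_power meas)
    moreover have "(\<Sum>i\<in>UNIV. \<Sum>j\<in>UNIV. (indicator ?S x * D2u x $ i $ j)\<^sup>2) = (indicator ?S x * norm (D2u x))\<^sup>2" for x
      by (simp add: power_mult_distrib norm_matrix_power2 sum_distrib_left)
    ultimately show ?thesis by simp
  qed
  have mH: "(\<lambda>x. (indicator ?S x * norm (H_op q D2u x))\<^sup>2) \<in> borel_measurable borel"
  proof -
    have "(\<lambda>x. \<Sum>i\<in>UNIV. \<Sum>j\<in>UNIV. \<Sum>k\<in>UNIV. \<Sum>l\<in>UNIV. q $ i $ j * q $ k $ l *
        (indicator ?S x * D2u x $ i $ k) * (indicator ?S x * D2u x $ j $ l)) \<in> borel_measurable borel"
      by (intro borel_measurable_sum borel_measurable_times[OF borel_measurable_times[OF borel_measurable_const meas(4)] meas(4)])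
    moreover have "(\<Sum>i\<in>UNIV. \<Sum>j\<in>UNIV. \<Sum>k\<in>UNIV. \<Sum>l\<in>UNIV. q $ i $ j * q $ k $ l *
        (indicator ?S x * D2u x $ i $ k) * (indicator ?S x * D2u x $ j $ l)) = (indicator ?S x * norm (H_op q D2u x))\<^sup>2" for x
      unfolding power_mult_distrib H_op_def R_def[symmetric] norm_sandwich_power2[OF R(1)] R(2)
      by (auto simp: indicator_def)
    ultimately show ?thesis by simp
  qed
  have mP: "(\<lambda>x. (indicator ?S x * norm (P_op A us D2u x))\<^sup>2) \<in> borel_measurable borel"
  proof -
    have "(\<lambda>x. ((- 1) * (indicator ?S x * us x) - (\<Sum>i\<in>UNIV. \<Sum>j\<in>UNIV. A $ i $ j * (indicator ?S x * D2u x $ i $ j)))\<^sup>2) \<in> borel_measurable borel"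
      by (intro borel_measurable_power borel_measurable_diff borel_measurable_sum
          borel_measurable_times[OF borel_measurable_const meas(2)] borel_measurable_times[OF borel_measurable_const meas(4)])
    moreover have "((- 1) * (indicator ?S x * us x) - (\<Sum>i\<in>UNIV. \<Sum>j\<in>UNIV. A $ i $ j * (indicator ?S x * D2u x $ i $ j)))\<^sup>2
        = (indicator ?S x * norm (P_op A us D2u x))\<^sup>2" for x
      unfolding P_op_def frob_inner_eq_sum by (auto simp: indicator_def)
    ultimately show ?thesis by simp
  qed
  let ?G = "\<lambda>f x. ?tf (fst x) * (norm (f x))\<^sup>2"
  let ?J = "\<lambda>\<zeta> h. \<integral>\<^sup>+x\<in>?S. ennreal (exp (2 * phase (\<zeta> \<bullet> (a *v \<zeta>)) \<zeta> x) * h x) \<partial>lborel"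
  have tp: "0 \<le> ?tf (fst x) * (h x)\<^sup>2" if "x \<in> ?S" for x and h :: "real \<times> (real^'n) \<Rightarrow> real"
    using tf0[OF that] by simp
  have mix: "(\<integral>\<^sup>+x\<in>?S. ennreal (?F x * (?tf (fst x) * (h x)\<^sup>2)) \<partial>lborel)
      = (\<integral>\<^sup>+\<zeta>. ?J \<zeta> (\<lambda>x. ?tf (fst x) * (h x)\<^sup>2) \<partial>lam)"
    and mix_meas: "(\<lambda>\<zeta>. ?J \<zeta> (\<lambda>x. ?tf (fst x) * (h x)\<^sup>2)) \<in> borel_measurable lam"
    if "(\<lambda>x. (indicator ?S x * h x)\<^sup>2) \<in> borel_measurable borel" for h :: "real \<times> (real^'n) \<Rightarrow> real"
    by (rule W_wt_mixture[OF lam gm[OF that]], erule tp)+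
  \<comment> \<open>The mixture of the single-frequency integrals is finite, so each is finite off a
    null set of frequencies.\<close>
  have fin: "AE \<zeta> in lam. ?J \<zeta> (\<lambda>x. ?tf (fst x) * (h x)\<^sup>2) < \<top>"
    if "esqrt (\<integral>\<^sup>+x\<in>?S. ennreal (?F x * (?tf (fst x) * (h x)\<^sup>2)) \<partial>lborel) < \<top>"
      and m: "(\<lambda>x. (indicator ?S x * h x)\<^sup>2) \<in> borel_measurable borel"
    for h :: "real \<times> (real^'n) \<Rightarrow> real"
  proof -
    have "(\<integral>\<^sup>+\<zeta>. ?J \<zeta> (\<lambda>x. ?tf (fst x) * (h x)\<^sup>2) \<partial>lam) < \<top>"
      using that(1) unfolding esqrt_less_top_iff mix[OF m] .
    then have "AE \<zeta> in lam. ?J \<zeta> (\<lambda>x. ?tf (fst x) * (h x)\<^sup>2) \<noteq> \<infinity>"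
      by (intro nn_integral_PInf_AE mix_meas[OF m]) (simp add: less_top)
    then show ?thesis by (simp add: less_top)
  qed
  have key: "AE \<zeta> in lam. ?J \<zeta> (\<lambda>x. ?tf (fst x) * (norm (H_op q D2u x))\<^sup>2)
      \<le> ennreal (K\<^sup>2) * ?J \<zeta> (\<lambda>x. ?tf (fst x) * (norm (P_op A us D2u x))\<^sup>2)"
    using fin[OF f1(1)[unfolded inorm_eq] mu] fin[OF f2(1)[unfolded inorm_eq] mus]
      fin[OF f2(2)[unfolded inorm_eq] mDu] fin[OF f2(3)[unfolded inorm_eq] mD2u]
      AE_msupp[OF lam_sets[OF lam]]
  proof eventually_elim
    case (elim \<zeta>)
    interpret frequency_setup c B ?tf "\<lambda>s. if \<alpha> = 0 then 0 else \<alpha> * s powr (\<alpha> - 1)" "\<zeta> \<bullet> (a *v \<zeta>)" \<zeta>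
      by (rule frequency_setup_time_factor[OF \<alpha> cB])
    have le: "(\<integral>\<^sup>+x\<in>?S. ennreal (wt x * (g x)\<^sup>2) \<partial>lborel) < \<top>"
      if "?J \<zeta> (\<lambda>x. ?tf (fst x) * (h x)\<^sup>2) < \<top>" "\<And>x. \<bar>g x\<bar> \<le> h x"
      for g h :: "real \<times> (real^'n) \<Rightarrow> real"
    proof (rule le_less_trans[OF nn_integral_mono that(1)])
      fix x
      show "ennreal (wt x * (g x)\<^sup>2) * indicator ?S x
        \<le> ennreal (exp (2 * phase (\<zeta> \<bullet> (a *v \<zeta>)) \<zeta> x) * (?tf (fst x) * (h x)\<^sup>2)) * indicator ?S x"
      proof (cases "x \<in> ?S")
        case True
        have "\<bar>g x\<bar>\<^sup>2 \<le> (h x)\<^sup>2" using that(2)[of x] by (intro power_mono) auto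
        then have "(g x)\<^sup>2 \<le> (h x)\<^sup>2" by simp
        then have "wt x * (g x)\<^sup>2 \<le> wt x * (h x)\<^sup>2" using tf0[OF True] by (intro mult_left_mono) auto
        then show ?thesis using True by (simp add: mult_ac ennreal_leI)
      qed simp
    qed
    have b: "(\<integral>\<^sup>+x\<in>?S. ennreal (wt x * (norm (R ** D2u x ** R))\<^sup>2) \<partial>lborel)
        \<le> ennreal (K\<^sup>2) * (\<integral>\<^sup>+x\<in>?S. ennreal (wt x * (P_op A us D2u x)\<^sup>2) \<partial>lborel)"
    proof (rule frequency_bound[OF wd tr _ _ _ _ As qs R])
      show "fin_wt u" using le[OF elim(1), of u] meas(1) by (simp add: fin_wt_def)
      show "fin_wt us" using le[OF elim(2), of us] meas(2) by (simp add: fin_wt_def)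
      show "fin_wt (\<lambda>x. Du x $ i)" for i
        using le[OF elim(3), of "\<lambda>x. Du x $ i"] meas(3) component_le_norm_cart by (auto simp: fin_wt_def)
      show "fin_wt (\<lambda>x. D2u x $ i $ j)" for i j
        using le[OF elim(4), of "\<lambda>x. D2u x $ i $ j", OF norm_matrix_nth_le] meas(4) by (simp add: fin_wt_def)
      show "x \<bullet> (q *v x) \<le> K * (x \<bullet> (A *v x))" for x using cond by (simp add: freq_cond_def)
      have e: "\<zeta> \<bullet> (a *v \<zeta>) - \<zeta> \<bullet> (A *v \<zeta>) = \<zeta> \<bullet> ((a - A) *v \<zeta>)"
        by (simp add: matrix_vector_mult_diff_rdistrib inner_diff_right)
      show 1: "\<zeta> \<bullet> (q *v \<zeta>) \<le> K * (\<zeta> \<bullet> (a *v \<zeta>) - \<zeta> \<bullet> (A *v \<zeta>))"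
        unfolding e using cond elim(5) by (simp add: freq_cond_def)
      show "0 \<le> \<zeta> \<bullet> (a *v \<zeta>) - \<zeta> \<bullet> (A *v \<zeta>)"
      proof -
        have "0 \<le> K * (\<zeta> \<bullet> (a *v \<zeta>) - \<zeta> \<bullet> (A *v \<zeta>))" using qs(2)[of \<zeta>] 1 by linarith
        then show ?thesis using K by (simp add: zero_le_mult_iff)
      qed
    qed
    then show ?case unfolding H_op_def R_def[symmetric] by (simp add: mult_ac)
  qed
  have "(\<integral>\<^sup>+x\<in>?S. ennreal (?F x * (?tf (fst x) * (norm (H_op q D2u x))\<^sup>2)) \<partial>lborel)
      = (\<integral>\<^sup>+\<zeta>. ?J \<zeta> (\<lambda>x. ?tf (fst x) * (norm (H_op q D2u x))\<^sup>2) \<partial>lam)"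
    by (rule mix[OF mH])
  also have "\<dots> \<le> (\<integral>\<^sup>+\<zeta>. ennreal (K\<^sup>2) * ?J \<zeta> (\<lambda>x. ?tf (fst x) * (norm (P_op A us D2u x))\<^sup>2) \<partial>lam)"
    by (rule nn_integral_mono_AE[OF key])
  also have "\<dots> = ennreal (K\<^sup>2) * (\<integral>\<^sup>+\<zeta>. ?J \<zeta> (\<lambda>x. ?tf (fst x) * (norm (P_op A us D2u x))\<^sup>2) \<partial>lam)"
    by (rule nn_integral_cmult[OF mix_meas[OF mP]])
  also have "(\<integral>\<^sup>+\<zeta>. ?J \<zeta> (\<lambda>x. ?tf (fst x) * (norm (P_op A us D2u x))\<^sup>2) \<partial>lam)
      = (\<integral>\<^sup>+x\<in>?S. ennreal (?F x * (?tf (fst x) * (norm (P_op A us D2u x))\<^sup>2)) \<partial>lborel)"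
    by (rule mix[OF mP, symmetric])
  finally show "r \<le> ennreal K"
    unfolding r inorm_eq by (intro ennreal_divide_le esqrt_le_mult K)
qed

section \<open>Comparing the suprema over test functions with the interval constants\<close>

section \<open>Test functions belong to the interval spaces\<close>

lemma pd_off_compact:
  assumes "compact K" "\<And>x. x \<notin> K \<Longrightarrow> v x = 0" "x \<notin> K"
  shows "pd b v x = 0"
  by (rule pd_vanish[of "- K"]) (use assms compact_imp_closed in auto)

lemma compact_support_bounded:
  fixes f :: "'a::euclidean_space \<Rightarrow> 'b::real_normed_vector"
  assumes "continuous_on UNIV f" "compact K" "\<And>x. x \<notin> K \<Longrightarrow> f x = 0"
  obtains C where "C \<ge> 0" "\<And>x. norm (f x) \<le> C"
proof -
  have "bounded (f ` K)"
    using assms(1,2) by (intro compact_imp_bounded compact_continuous_image) (auto elim: continuous_on_subset)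
  then obtain C where C: "\<And>x. x \<in> K \<Longrightarrow> norm (f x) \<le> C" by (auto simp: bounded_iff)
  have "norm (f x) \<le> max C 0" for x using C[of x] assms(3)[of x] by (cases "x \<in> K") auto
  then show thesis using that[of "max C 0"] by simp
qed

lemma sandwich_bounded_linear:
  fixes R :: "real^'n^'n"
  shows "bounded_linear (\<lambda>M. R ** M ** R)"
proof -
  have "linear (\<lambda>M. R ** M ** R)"
    by (intro linearI)
       (simp_all add: vec_eq_iff matrix_mul_nth sum_distrib_left sum_distrib_right sum.distrib algebra_simps)
  then show ?thesis by (simp add: linear_conv_bounded_linear)
qed

lemmas continuous_on_sandwich = bounded_linear.continuous_on[OF sandwich_bounded_linear]

lemma hess_z_continuous: "smooth v \<Longrightarrow> continuous_on S (hess_z v)"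
  unfolding hess_z_def
  by (intro continuous_on_vec_lambda smooth_continuous smooth_pd Basis_space_time)

lemma P_op_continuous: "smooth v \<Longrightarrow> continuous_on S (P_op A (pd dir_s v) (hess_z v))"
  unfolding P_op_def frob_inner_eq_sum
  by (intro continuous_intros hess_z_continuous smooth_continuous smooth_pd Basis_space_time)

lemma H_op_continuous: "smooth v \<Longrightarrow> continuous_on S (H_op q (hess_z v))"
  unfolding H_op_def by (intro continuous_on_sandwich hess_z_continuous)

lemma operators_off_compact:
  assumes "compact K" "\<And>x. x \<notin> K \<Longrightarrow> v x = 0" "x \<notin> K"
  shows "hess_z v x = 0" "P_op A (pd dir_s v) (hess_z v) x = 0" "H_op q (hess_z v) x = 0"
proof -
  have p: "pd b v y = 0" if "y \<notin> K" for b y using pd_off_compact[OF assms(1,2) that] .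
  have pp: "pd b (pd b' v) y = 0" if "y \<notin> K" for b b' y by (rule pd_off_compact[OF assms(1) p that])
  show h: "hess_z v x = 0" by (simp add: hess_z_def pp[OF assms(3)] vec_eq_iff)
  show "P_op A (pd dir_s v) (hess_z v) x = 0" by (simp add: P_op_def frob_inner_eq_sum h p[OF assms(3)])
  show "H_op q (hess_z v) x = 0" by (simp add: H_op_def h)
qed

lemma inorm_finite:
  fixes f :: "real \<times> (real^'n) \<Rightarrow> 'b::real_normed_vector"
  assumes lam: "compactly_supported_prob lam" and \<alpha>: "(0 \<le> \<alpha> \<and> 0 \<le> c) \<or> \<alpha> = 0" and cB: "c < B"
    and K: "compact K" "K \<subseteq> slab c B" and f: "continuous_on UNIV f" "\<And>x. x \<notin> K \<Longrightarrow> f x = 0"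
  shows "inorm \<alpha> c B (W_wt lam a) f < \<top>"
proof -
  interpret frequency_setup c B "time_factor \<alpha>" "\<lambda>s. if \<alpha> = 0 then 0 else \<alpha> * s powr (\<alpha> - 1)" 0 "0::real^'n"
    by (rule frequency_setup_time_factor[OF \<alpha> cB])
  obtain C where C: "C \<ge> 0" "\<And>x. norm (f x) \<le> C" using compact_support_bounded[OF f(1) K(1) f(2)] by blast
  obtain C' where C': "\<And>x. x \<in> K \<Longrightarrow> W_wt lam a x \<le> C'" using W_wt_bounded[OF lam K(1), of a] by blast
  have tB: "0 \<le> time_factor \<alpha> B" using tf(3)[OF cB] by simp
  let ?M = "max C' 0 * (time_factor \<alpha> B * C\<^sup>2)"
  have "(\<integral>\<^sup>+x\<in>slab c B. ennreal (W_wt lam a x * (time_factor \<alpha> (fst x) * (norm (f x))\<^sup>2)) \<partial>lborel)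
      \<le> (\<integral>\<^sup>+x. ennreal ?M * indicator K x \<partial>lborel)"
  proof (rule nn_integral_mono)
    fix x
    show "ennreal (W_wt lam a x * (time_factor \<alpha> (fst x) * (norm (f x))\<^sup>2)) * indicator (slab c B) x \<le> ennreal ?M * indicator K x"
    proof (cases "x \<in> K")
      case True
      then have x: "c < fst x" "fst x < B" using K by (auto simp: in_slab)
      have "W_wt lam a x * (time_factor \<alpha> (fst x) * (norm (f x))\<^sup>2) \<le> ?M"
        using C'[OF True] C tf_mono[OF x(1), of B] x tf(3)[OF x(1)] W_wt_nonneg[OF lam, of a x] tB
        by (intro mult_mono power_mono mult_nonneg_nonneg) auto
      then show ?thesis using True by (auto simp: indicator_def intro: ennreal_leI)
    qed (simp add: f(2))
  qed
  also have "\<dots> = ennreal ?M * emeasure lborel K"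
    using K(1) by (subst nn_integral_cmult_indicator) (auto simp: borel_compact)
  also have "\<dots> < \<top>"
  proof -
    have "emeasure lborel K < \<infinity>" using K emeasure_bounded_finite compact_imp_bounded by blast
    then show ?thesis by (simp add: ennreal_mult_less_top)
  qed
  finally show ?thesis unfolding inorm_eq esqrt_less_top_iff .
qed

lemma test_function_weak_derivs:
  assumes v: "smooth v"
  shows "weak_derivs c B v (pd dir_s v) (\<lambda>x. \<chi> i. pd (dir_z i) v x) (hess_z v)"
proof -
  have "has_weak_deriv (slab c B) v b (pd b v)" if "b \<in> Basis" for b
    by (rule smooth_has_weak_deriv[OF v that])
  moreover have "has_weak_deriv (slab c B) (pd b v) b' (pd b' (pd b v))" if "b \<in> Basis" "b' \<in> Basis" for b b'
    by (rule smooth_has_weak_deriv[OF smooth_pd[OF v that(1)] that(2)])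
  ultimately show ?thesis unfolding weak_derivs_def hess_z_def by (simp add: Basis_space_time)
qed

text \<open>The compact support ends strictly before \<open>B\<close>, so the time slices near
  \<open>B\<close> vanish identically and the trace condition holds with an empty exceptional
  set.\<close>

lemma test_function_in_W0:
  assumes lam: "compactly_supported_prob lam" and \<alpha>: "(0 \<le> \<alpha> \<and> 0 \<le> c) \<or> \<alpha> = 0" and cB: "c < B"
    and v: "v \<in> Cc_infty (slab c B)"
  shows "v \<in> W0_space \<alpha> c B (W_wt lam a)"
proof -
  have sm: "smooth v" using Cc_inftyD(1)[OF v] .
  obtain K where K: "compact K" "K \<subseteq> slab c B" "\<And>x. x \<notin> K \<Longrightarrow> v x = 0" using Cc_inftyD(2)[OF v] by blast
  let ?Du = "\<lambda>x. \<chi> i. pd (dir_z i) v x"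
  note wd = test_function_weak_derivs[OF sm, of c B]
  have p0: "pd b v x = 0" if "x \<notin> K" for b x
    using K(3) that by (intro pd_off_compact[OF K(1)]) auto
  have Duc: "continuous_on UNIV ?Du"
    by (intro continuous_on_vec_lambda smooth_continuous smooth_pd[OF sm] Basis_space_time)
  have Du0: "?Du x = 0" if "x \<notin> K" for x using p0[OF that] by (simp add: vec_eq_iff)
  note fin = inorm_finite[OF lam \<alpha> cB K(1,2), of _ a]
  have W: "v \<in> W_space \<alpha> c B (W_wt lam a)"
    unfolding W_space_def
    using wd fin[OF smooth_continuous[OF sm] K(3)] fin[OF smooth_continuous[OF smooth_pd[OF sm Basis_space_time(1)]] p0]
      fin[OF Duc Du0] fin[OF hess_z_continuous[OF sm] operators_off_compact(1)[where v=v, OF K(1,3)]] by blast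
  have "has_trace_at c B v ?Du (\<lambda>_. 0) (\<lambda>_. 0)"
    unfolding has_trace_at_def
  proof (intro conjI allI impI bexI[of _ "{}"])
    fix i
    have "smooth (\<lambda>_::real^'a. 0)" using C_diff_const by blast
    moreover have "pd (axis i 1) (\<lambda>_::real^'a. 0) = (\<lambda>_. 0)"
      by (rule ext, rule pd_eqI) (rule has_derivative_const)
    ultimately show "has_weak_deriv UNIV (\<lambda>_::real^'a. 0) (axis i 1) (\<lambda>z. 0 $ i)"
      using smooth_has_weak_deriv[of "\<lambda>_::real^'a. 0" "axis i 1" UNIV] by (simp add: axis_in_Basis_iff)
  next
    fix K' :: "(real^'a) set" assume "compact K'"
    show "wnorm K' (\<lambda>_. 1) (\<lambda>_. 0::real) < \<top>" "wnorm K' (\<lambda>_. 1) (\<lambda>_. 0::real^'a) < \<top>"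
      by (simp_all add: wnorm_def esqrt_def)
    have "compact (fst ` K)" by (intro compact_continuous_image continuous_intros K)
    have "\<exists>b<B. \<forall>x\<in>K. fst x \<le> b"
    proof (cases "K = {}")
      case True
      then show ?thesis using cB by auto
    next
      case False
      have "continuous_on K fst" by (intro continuous_intros)
      then obtain x0 where "x0 \<in> K" "\<And>x. x \<in> K \<Longrightarrow> fst x \<le> fst x0"
        using continuous_attains_sup[of K fst] K False by blast
      then show ?thesis using K(2) by (intro exI[of _ "fst x0"]) (auto simp: in_slab)
    qed
    then obtain b where b: "b < B" "\<And>x. x \<in> K \<Longrightarrow> fst x \<le> b" by blast
    show "((\<lambda>s. wnorm K' (\<lambda>_. 1) (\<lambda>z. v (s, z) - 0) + wnorm K' (\<lambda>_. 1) (\<lambda>z. ?Du (s, z) - 0)) \<longlongrightarrow> 0)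
        (at B within {c<..<B} - {})"
    proof (rule tendsto_eventually)
      have "\<forall>\<^sub>F s in at B within {c<..<B} - {}. b < s"
        using b(1) by (auto simp: eventually_at dist_real_def intro!: exI[of _ "B - b"])
      then show "\<forall>\<^sub>F s in at B within {c<..<B} - {}.
          wnorm K' (\<lambda>_. 1) (\<lambda>z. v (s, z) - 0) + wnorm K' (\<lambda>_. 1) (\<lambda>z. ?Du (s, z) - 0) = 0"
      proof eventually_elim
        case (elim s)
        then have "(s, z) \<notin> K" for z using b(2)[of "(s, z)"] by auto
        then have z: "v (s, z) = 0" "?Du (s, z) = 0" for z using K(3) Du0 by auto
        show ?case unfolding z by (simp add: wnorm_def esqrt_def)
      qed
    qed
  qed auto
  then show ?thesis unfolding W0_space_def using W wd by blast
qed

lemma test_ratio_le_k_const: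
  assumes lam: "compactly_supported_prob lam" and \<alpha>: "(0 \<le> \<alpha> \<and> 0 \<le> c) \<or> \<alpha> = 0" and cB: "c < B"
    and v: "v \<in> Cc_infty (slab c B)"
  shows "inorm \<alpha> c B (W_wt lam a) (H_op q (hess_z v)) / inorm \<alpha> c B (W_wt lam a) (P_op A (pd dir_s v) (hess_z v))
    \<le> k_const \<alpha> c B (W_wt lam a) A q"
  unfolding k_const_def
  using test_function_in_W0[OF assms] test_function_weak_derivs[OF Cc_inftyD(1)[OF v], of c B]
  by (intro Sup_upper) blast

lemma wnorm_UNIV_eq_inorm:
  assumes "\<And>x. x \<notin> slab c B \<Longrightarrow> f x = 0"
  shows "wnorm UNIV F f = inorm 0 c B F f"
  unfolding inorm_eq wnorm_def
  by (rule arg_cong[where f=esqrt], rule nn_integral_cong) (use assms in \<open>auto simp: indicator_def time_factor_def\<close>)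

text \<open>Every test function lives in some bounded slab, and there the norms with \<alpha> = 0
  are the whole-space norms. The slab may contain negative times, which is where the interval
  constants with \<alpha> = 0 and arbitrary \<open>c\<close> are used.\<close>

lemma Q_const_le:
  assumes lam: "compactly_supported_prob lam" and k: "\<And>c B. c < B \<Longrightarrow> k_const 0 c B (W_wt lam a) A q \<le> K"
  shows "Q_const lam a A q \<le> K"
  unfolding Q_const_def Q_on_def
proof (rule SUP_least)
  fix v :: "real \<times> (real^'a) \<Rightarrow> real" assume v: "v \<in> Cc_infty UNIV"
  obtain L where L: "compact L" "\<And>x. x \<notin> L \<Longrightarrow> v x = 0" using Cc_inftyD(2)[OF v] by blast
  then obtain r where r: "\<And>x. x \<in> L \<Longrightarrow> norm x \<le> r" using compact_imp_bounded bounded_iff by metis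
  define B where "B = \<bar>r\<bar> + 1"
  have sub: "L \<subseteq> slab (- B) B"
  proof
    fix x assume "x \<in> L"
    then have "\<bar>fst x\<bar> < B" using r[of x] norm_fst_le[of "fst x" "snd x"] by (simp add: B_def)
    then show "x \<in> slab (- B) B" by (auto simp: in_slab)
  qed
  have B: "- B < B" by (simp add: B_def)
  have v': "v \<in> Cc_infty (slab (- B) B)" by (rule Cc_inftyI[OF Cc_inftyD(1)[OF v] L(1) sub L(2)])
  have o: "H_op q (hess_z v) x = 0" "P_op A (pd dir_s v) (hess_z v) x = 0" if "x \<notin> slab (- B) B" for x
    using operators_off_compact[where v=v, OF L] that sub by blast+
  show "wnorm UNIV (W_wt lam a) (H_op q (hess_z v)) / wnorm UNIV (W_wt lam a) (P_op A (pd dir_s v) (hess_z v)) \<le> K"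
    using order_trans[OF test_ratio_le_k_const[OF lam _ B v', of 0 a q A] k[OF B]]
    by (simp add: wnorm_UNIV_eq_inorm[where f="H_op q (hess_z v)", OF o(1)]
        wnorm_UNIV_eq_inorm[where f="P_op A (pd dir_s v) (hess_z v)", OF o(2)])
qed

section \<open>Lower bounds: concentration at one frequency and wave packets\<close>

section \<open>Concentration of the weight at a single frequency\<close>

lemma esqrt_mult_leD:
  assumes "esqrt I \<le> ennreal K * esqrt J" "J < \<top>" "K \<ge> 0"
  shows "I \<le> ennreal (K\<^sup>2) * J"
proof -
  obtain j where j: "J = ennreal j" "j \<ge> 0" using assms(2) by (cases J) auto
  have "esqrt I \<le> ennreal (K * sqrt j)" using assms j by (simp add: esqrt_def ennreal_mult)
  then have "I \<le> ennreal ((K * sqrt j)\<^sup>2)" using assms(3) j(2) by (subst (asm) esqrt_le_iff) auto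
  then show ?thesis using j by (simp add: power_mult_distrib ennreal_mult)
qed

text \<open>The energy seen by a single exponential, kept as a function of its frequency so that
  Laplace's method can be applied in that variable.\<close>

definition freq_energy :: "real^'n^'n \<Rightarrow> (real \<times> (real^'n) \<Rightarrow> real) \<Rightarrow> real^'n \<Rightarrow> real" where
  "freq_energy a g \<zeta> = (LINT x|lborel. exp (2 * phase (\<zeta> \<bullet> (a *v \<zeta>)) \<zeta> x) * g x)"

lemma phase_joint_continuous:
  "continuous_on S (\<lambda>p::(real^'n) \<times> (real \<times> (real^'n)). exp (2 * phase (fst p \<bullet> (a *v fst p)) (fst p) (snd p)))"
proof -
  have "continuous_on S (\<lambda>p::(real^'n) \<times> (real \<times> (real^'n)). a *v fst p)"
    by (intro continuous_on_compose2[OF linear_continuous_on[OF matrix_vector_mul_bounded_linear[of a]]] continuous_intros) auto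
  then show ?thesis unfolding phase_def by (intro continuous_intros)
qed

text \<open>Dominated convergence on the compact support; continuity in the frequency is what
  Laplace's method needs.\<close>

lemma freq_energy_continuous:
  fixes g :: "real \<times> (real^'n) \<Rightarrow> real"
  assumes g: "continuous_on UNIV g" and K: "compact K" "\<And>x. x \<notin> K \<Longrightarrow> g x = 0"
  shows "continuous_on UNIV (freq_energy a g)"
    and "integrable lborel (\<lambda>x. exp (2 * phase (\<zeta> \<bullet> (a *v \<zeta>)) \<zeta> x) * g x)"
proof -
  let ?e = "\<lambda>\<zeta> x. exp (2 * phase (\<zeta> \<bullet> (a *v \<zeta>)) \<zeta> x)"
  have ec: "continuous_on UNIV (\<lambda>x. ?e \<zeta> x)" for \<zeta>
    unfolding phase_def by (intro continuous_intros)
  have egc: "continuous_on UNIV (\<lambda>x. ?e \<zeta> x * g x)" for \<zeta> by (intro continuous_on_mult ec g)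
  have "integrable lborel (\<lambda>x. indicator K x *\<^sub>R (?e \<zeta> x * g x))" for \<zeta>
    by (intro borel_integrable_compact K continuous_on_subset[OF egc]) simp
  moreover have "(\<lambda>x. indicator K x *\<^sub>R (?e \<zeta> x * g x)) = (\<lambda>x. ?e \<zeta> x * g x)" for \<zeta>
    using K(2) by (auto simp: fun_eq_iff indicator_def)
  ultimately show int: "integrable lborel (\<lambda>x. ?e \<zeta> x * g x)" for \<zeta> by simp
  show "continuous_on UNIV (freq_energy a g)"
  proof (rule continuous_on_sequentiallyI)
    fix X :: "nat \<Rightarrow> real^'n" and \<zeta> assume X: "X \<longlonglongrightarrow> \<zeta>"
    obtain r where r: "\<And>n. norm (X n) \<le> r"
      using convergent_imp_bounded[OF X] by (auto simp: bounded_iff)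
    have "compact (cball (0::real^'n) r \<times> K)" by (rule compact_Times[OF compact_cball K(1)])
    then have "bounded ((\<lambda>p. exp (2 * phase (fst p \<bullet> (a *v fst p)) (fst p) (snd p))) ` (cball (0::real^'n) r \<times> K))"
      by (intro compact_imp_bounded compact_continuous_image phase_joint_continuous)
    then obtain C where Cb: "\<forall>y\<in>(\<lambda>p. exp (2 * phase (fst p \<bullet> (a *v fst p)) (fst p) (snd p))) ` (cball (0::real^'n) r \<times> K). norm y \<le> C"
      unfolding bounded_iff by blast
    have C: "exp (2 * phase (fst p \<bullet> (a *v fst p)) (fst p) (snd p)) \<le> C" if "p \<in> cball 0 r \<times> K" for p
      using bspec[OF Cb imageI[OF that]] by simp
    have gi: "integrable lborel g"
    proof -
      have "integrable lborel (\<lambda>x. indicator K x *\<^sub>R g x)"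
        by (intro borel_integrable_compact K continuous_on_subset[OF g]) simp
      moreover have "(\<lambda>x. indicator K x *\<^sub>R g x) = g" using K(2) by (auto simp: fun_eq_iff indicator_def)
      ultimately show ?thesis by simp
    qed
    show "(\<lambda>n. freq_energy a g (X n)) \<longlonglongrightarrow> freq_energy a g \<zeta>"
      unfolding freq_energy_def
    proof (rule integral_dominated_convergence[where w="\<lambda>x. C * \<bar>g x\<bar>"])
      show "integrable lborel (\<lambda>x. C * \<bar>g x\<bar>)" using gi by simp
      show "(\<lambda>x. ?e \<zeta> x * g x) \<in> borel_measurable lborel" "(\<lambda>x. ?e (X n) x * g x) \<in> borel_measurable lborel" for n
        using int by auto
      show "AE x in lborel. (\<lambda>n. ?e (X n) x * g x) \<longlonglongrightarrow> ?e \<zeta> x * g x"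
      proof (intro AE_I2 tendsto_mult tendsto_const)
        fix x :: "real \<times> (real^'n)"
        have "(\<lambda>n. (X n, x)) \<longlonglongrightarrow> (\<zeta>, x)" by (intro tendsto_intros X)
        from continuous_on_tendsto_compose[OF phase_joint_continuous[of UNIV a] this]
        show "(\<lambda>n. ?e (X n) x) \<longlonglongrightarrow> ?e \<zeta> x" by simp
      qed
      show "AE x in lborel. norm (?e (X n) x * g x) \<le> C * \<bar>g x\<bar>" for n
      proof (rule AE_I2)
        fix x show "norm (?e (X n) x * g x) \<le> C * \<bar>g x\<bar>"
        proof (cases "x \<in> K")
          case True
          then have "?e (X n) x \<le> C" using C[of "(X n, x)"] r[of n] by simp
          then show ?thesis by (simp add: abs_mult mult_right_mono)
        qed (simp add: K(2))
      qed
    qed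
  qed
qed

text \<open>As T grows, the factor exp(-2 T N) favours frequencies near the unique zero of
  \<open>N\<close>, which carries mass because it is in the support. The sign of the integrals for
  large T therefore forces the sign of \<open>h\<close> at that point.\<close>

lemma laplace_concentration:
  fixes lam :: "(real^'n) measure" and h N :: "real^'n \<Rightarrow> real"
  assumes lam: "compactly_supported_prob lam" and z: "\<zeta>0 \<in> msupp lam"
    and h: "continuous_on UNIV h" and N: "continuous_on UNIV N" "N \<zeta>0 = 0" "\<And>\<zeta>. \<zeta> \<noteq> \<zeta>0 \<Longrightarrow> N \<zeta> > 0"
    and pos: "\<And>T. T \<ge> T0 \<Longrightarrow> 0 \<le> (LINT \<zeta>|lam. exp (- (2 * T * N \<zeta>)) * h \<zeta>)"
  shows "0 \<le> h \<zeta>0"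
proof (rule ccontr)
  assume "\<not> 0 \<le> h \<zeta>0"
  define \<delta> where "\<delta> = - h \<zeta>0 / 2"
  have \<delta>: "\<delta> > 0" "h \<zeta>0 < - \<delta>" using \<open>\<not> 0 \<le> h \<zeta>0\<close> by (auto simp: \<delta>_def)
  interpret prob_space lam using lam by (simp add: compactly_supported_prob_def)
  have sl: "sets lam = sets borel" by (rule lam_sets[OF lam])
  have cS: "compact (msupp lam)" using lam by (simp add: compactly_supported_prob_def)
  have "open {\<zeta>. h \<zeta> < - \<delta>}" by (intro open_Collect_less h continuous_intros)
  then obtain r where r: "r > 0" "ball \<zeta>0 r \<subseteq> {\<zeta>. h \<zeta> < - \<delta>}"
    using \<delta>(2) open_contains_ball[of "{\<zeta>. h \<zeta> < - \<delta>}"] by auto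
  have "compact (msupp lam - ball \<zeta>0 r)" by (intro compact_diff cS open_ball)
  have "\<exists>m>0. \<forall>\<zeta>\<in>msupp lam - ball \<zeta>0 r. m \<le> N \<zeta>"
  proof (cases "msupp lam - ball \<zeta>0 r = {}")
    case True
    then show ?thesis by (intro exI[of _ 1]) auto
  next
    case False
    obtain \<zeta>1 where "\<zeta>1 \<in> msupp lam - ball \<zeta>0 r" "\<And>\<zeta>. \<zeta> \<in> msupp lam - ball \<zeta>0 r \<Longrightarrow> N \<zeta>1 \<le> N \<zeta>"
      using continuous_attains_inf[OF \<open>compact (msupp lam - ball \<zeta>0 r)\<close> False, of N] continuous_on_subset[OF N(1)] by auto
    moreover from this(1) have "\<zeta>1 \<noteq> \<zeta>0" using r(1) by auto
    ultimately show ?thesis using N(3)[of \<zeta>1] by (intro exI[of _ "N \<zeta>1"]) auto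
  qed
  then obtain m where m: "m > 0" "\<And>\<zeta>. \<zeta> \<in> msupp lam \<Longrightarrow> \<zeta> \<notin> ball \<zeta>0 r \<Longrightarrow> m \<le> N \<zeta>" by auto
  \<comment> \<open>On \<open>V\<close> the integrand is at most - \<delta> exp(- T m), off the ball
    it is at most C exp(- 2 T m), and in between it is negative. \<open>V\<close> has positive mass,
    so the first contribution wins for large T.\<close>
  define V where "V = ball \<zeta>0 r \<inter> {\<zeta>. N \<zeta> < m / 2}"
  have V: "open V" "\<zeta>0 \<in> V"
    unfolding V_def using r(1) N(2) m(1) by (auto intro!: open_Int open_Collect_less N continuous_intros)
  define p where "p = prob V"
  have p: "p > 0"
    using z V by (auto simp: msupp_def p_def emeasure_eq_measure)
  have "bounded (h ` msupp lam)" by (intro compact_imp_bounded compact_continuous_image continuous_on_subset[OF h] cS) simp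
  then obtain C0 where C0: "\<And>\<zeta>. \<zeta> \<in> msupp lam \<Longrightarrow> \<bar>h \<zeta>\<bar> \<le> C0" by (auto simp: bounded_iff)
  define C where "C = max C0 1"
  have C: "C > 0" "\<And>\<zeta>. \<zeta> \<in> msupp lam \<Longrightarrow> \<bar>h \<zeta>\<bar> \<le> C" using C0 by (auto simp: C_def le_max_iff_disj)
  have bm: "f \<in> borel_measurable lam" if "f \<in> borel_measurable borel" for f :: "real^'n \<Rightarrow> real"
    using that by (simp only: measurable_cong_sets[OF sl refl])
  have hm: "h \<in> borel_measurable borel" "N \<in> borel_measurable borel"
    using h N(1) by (auto intro: borel_measurable_continuous_onI)
  have Vs: "V \<in> sets lam" using V(1) sl by simp
  have key: "\<delta> * p * exp (T * m) \<le> C" if T: "T \<ge> T0" "T \<ge> 0" for T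
  proof -
    let ?f = "\<lambda>\<zeta>. exp (- (2 * T * N \<zeta>)) * h \<zeta>"
    let ?g = "\<lambda>\<zeta>. C * exp (- (2 * T * m)) - \<delta> * exp (- (T * m)) * indicator V \<zeta>"
    have N0: "N \<zeta> \<ge> 0" for \<zeta> using N(2) N(3)[of \<zeta>] by (cases "\<zeta> = \<zeta>0") auto
    have fi: "integrable lam ?f"
    proof (rule integrable_const_bound[where B=C])
      show "AE \<zeta> in lam. norm (?f \<zeta>) \<le> C"
        using AE_msupp[OF sl]
      proof eventually_elim
        case (elim \<zeta>)
        have "exp (- (2 * T * N \<zeta>)) \<le> 1" using T N0[of \<zeta>] by simp
        then have "exp (- (2 * T * N \<zeta>)) * \<bar>h \<zeta>\<bar> \<le> 1 * C" using C(2)[OF elim] by (intro mult_mono) auto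
        then show ?case by (simp add: abs_mult)
      qed
      show "?f \<in> borel_measurable lam" by (rule bm) (use hm in measurable)
    qed
    have gi: "integrable lam ?g" using Vs by (intro Bochner_Integration.integrable_diff integrable_mult_right) (auto simp: emeasure_eq_measure)
    have "(LINT \<zeta>|lam. ?f \<zeta>) \<le> (LINT \<zeta>|lam. ?g \<zeta>)"
    proof (rule integral_mono_AE[OF fi gi])
      show "AE \<zeta> in lam. ?f \<zeta> \<le> ?g \<zeta>"
        using AE_msupp[OF sl]
      proof eventually_elim
        case (elim \<zeta>)
        have e0: "0 \<le> C * exp (- (2 * T * m))" using C(1) by simp
        show ?case
        proof (cases "\<zeta> \<in> ball \<zeta>0 r")
          case True
          then have hl: "h \<zeta> < - \<delta>" using r(2) by auto
          show ?thesis
          proof (cases "\<zeta> \<in> V")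
            case True
            then have "N \<zeta> \<le> m / 2" by (simp add: V_def)
            then have "2 * (T * N \<zeta>) \<le> T * m" using mult_left_mono[of "N \<zeta>" "m / 2" T] T(2) by simp
            then have "exp (- (T * m)) \<le> exp (- (2 * T * N \<zeta>))" by simp
            then have "exp (- (T * m)) * \<delta> \<le> exp (- (2 * T * N \<zeta>)) * (- h \<zeta>)"
              using hl \<delta> by (intro mult_mono) auto
            then show ?thesis using True e0 by (simp add: mult.commute)
          next
            case False
            have "?f \<zeta> \<le> 0" using hl \<delta> by (intro mult_nonneg_nonpos) auto
            then show ?thesis using False e0 by simp
          qed
        next
          case False
          then have "m \<le> N \<zeta>" using m(2)[OF elim] by simp
          then have "exp (- (2 * T * N \<zeta>)) \<le> exp (- (2 * T * m))" using T(2) by (simp add: mult_left_mono)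
          then have "exp (- (2 * T * N \<zeta>)) * h \<zeta> \<le> exp (- (2 * T * m)) * C"
            using C(2)[OF elim] C(1) by (meson abs_ge_self abs_ge_zero exp_ge_zero mult_left_mono mult_mono order_trans)
          moreover have "\<zeta> \<notin> V" using False by (simp add: V_def)
          ultimately show ?thesis by (simp add: mult.commute)
        qed
      qed
    qed
    also have "\<dots> = C * exp (- (2 * T * m)) - \<delta> * exp (- (T * m)) * p"
      using Vs by (subst Bochner_Integration.integral_diff) (auto simp: prob_space p_def emeasure_eq_measure)
    finally have "\<delta> * exp (- (T * m)) * p \<le> C * exp (- (2 * T * m))" using pos[OF T(1)] by linarith
    moreover have "exp (- (2 * T * m)) = exp (- (T * m)) * exp (- (T * m))"
      by (simp add: exp_add[symmetric])
    ultimately have "(\<delta> * p) * exp (- (T * m)) \<le> (C * exp (- (T * m))) * exp (- (T * m))"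
      by (simp add: mult_ac)
    then have "\<delta> * p \<le> C * exp (- (T * m))" by (rule mult_right_le_imp_le) simp
    then have "\<delta> * p * exp (T * m) \<le> C * exp (- (T * m)) * exp (T * m)" by (rule mult_right_mono) simp
    also have "\<dots> = C" by (simp add: mult.assoc exp_add[symmetric])
    finally show ?thesis .
  qed
  \<comment> \<open>With this choice exp(T m) > T m \<ge> C / (\<delta> p), which contradicts
    \<open>key\<close>.\<close>
  define T where "T = max (max T0 0) (C / (\<delta> * p * m))"
  have "C / (\<delta> * p) \<le> T * m"
  proof -
    have "C / (\<delta> * p * m) \<le> T" by (simp add: T_def)
    then have "C / (\<delta> * p * m) * m \<le> T * m" using m(1) by (intro mult_right_mono) auto
    then show ?thesis using m(1) by simp
  qed
  also have "\<dots> < exp (T * m)" using exp_ge_add_one_self[of "T * m"] by linarith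
  finally have "C < \<delta> * p * exp (T * m)" using \<delta> p by (simp add: pos_divide_less_eq mult.commute)
  moreover have "T \<ge> T0" "T \<ge> 0" by (simp_all add: T_def)
  ultimately show False using key[of T] by simp
qed


text \<open>Completing the square: after the translation, the exponential of frequency \<zeta>
  acquires the factor exp(2 T \<zeta>0 . a \<zeta>0) exp(- 2 T N(\<zeta>)) with N(\<zeta>) =
  (\<zeta> - \<zeta>0) . a (\<zeta> - \<zeta>0). The first factor is common to both sides and
  cancels; the second is the concentrating factor of Laplace's method.\<close>

lemma Q_on_imp_frequency:
  fixes a A q :: "real^'n^'n"
  assumes lam: "compactly_supported_prob lam" and a: "sym_posdef a" and K: "K \<ge> 0"
    and Q: "Q_on ({..<B} \<times> UNIV) lam a A q \<le> ennreal K"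
    and z: "\<zeta>0 \<in> msupp lam" and v: "v \<in> Cc_infty UNIV"
  shows "freq_energy a (\<lambda>x. (norm (H_op q (hess_z v) x))\<^sup>2) \<zeta>0
    \<le> K\<^sup>2 * freq_energy a (\<lambda>x. (P_op A (pd dir_s v) (hess_z v) x)\<^sup>2) \<zeta>0"
proof -
  have sm: "smooth v" by (rule Cc_inftyD(1)[OF v])
  obtain L where L: "compact L" "\<And>x. x \<notin> L \<Longrightarrow> v x = 0" using Cc_inftyD(2)[OF v] by blast
  let ?H = "\<lambda>x. (norm (H_op q (hess_z v) x))\<^sup>2" and ?P = "\<lambda>x. (P_op A (pd dir_s v) (hess_z v) x)\<^sup>2"
  have H0: "?H x = 0" "?P x = 0" if "x \<notin> L" for x
    using operators_off_compact[where v=v, OF L that] by simp_all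
  have Hc: "continuous_on UNIV ?H" "continuous_on UNIV ?P"
    by (intro continuous_intros H_op_continuous P_op_continuous sm)+
  define N where "N \<zeta> = (\<zeta> - \<zeta>0) \<bullet> (a *v (\<zeta> - \<zeta>0))" for \<zeta>
  have asym: "transpose a = a" using a by (simp add: sym_posdef_def)
  have Nc: "continuous_on UNIV N"
    unfolding N_def
    by (intro continuous_on_inner continuous_on_compose2[OF linear_continuous_on[OF matrix_vector_mul_bounded_linear[of a]]] continuous_intros) auto
  have Npos: "N \<zeta> > 0" if "\<zeta> \<noteq> \<zeta>0" for \<zeta> using a that by (simp add: N_def sym_posdef_def)
  let ?h = "\<lambda>\<zeta>. K\<^sup>2 * freq_energy a ?P \<zeta> - freq_energy a ?H \<zeta>"
  note fH = freq_energy_continuous[where a=a, OF Hc(1) L(1) H0(1)] and fP = freq_energy_continuous[where a=a, OF Hc(2) L(1) H0(2)]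
  obtain r where r: "\<And>x. x \<in> L \<Longrightarrow> norm x \<le> r" using compact_imp_bounded[OF L(1)] bounded_iff by metis
  interpret prob_space lam using lam by (simp add: compactly_supported_prob_def)
  have sl: "sets lam = sets borel" by (rule lam_sets[OF lam])
  have bm: "f \<in> borel_measurable lam" if "f \<in> borel_measurable borel" for f :: "real^'n \<Rightarrow> real"
    using that by (simp only: measurable_cong_sets[OF sl refl])
  have "0 \<le> (LINT \<zeta>|lam. exp (- (2 * T * N \<zeta>)) * ?h \<zeta>)" if T: "T \<ge> max 0 (\<bar>r\<bar> + 1 - B)" for T
  proof -
    \<comment> \<open>The spatial shift 2 T a \<zeta>0 supplies the mixed term of the square. The
      lower bound on T puts the support of the translate before time B - 1.\<close>
    define p where "p = (T, (2 * T) *\<^sub>R (a *v \<zeta>0))"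
    define w where "w = (\<lambda>x. v (p + 1 *\<^sub>R x))"
    have wC: "w \<in> Cc_infty ({..<B} \<times> UNIV)"
      unfolding w_def
    proof (rule Cc_infty_affine[OF v, where L="{x. fst x \<le> \<bar>r\<bar> - T}"])
      fix x assume "v (p + 1 *\<^sub>R x) \<noteq> 0"
      then have "p + x \<in> L" using L(2)[of "p + x"] by auto
      then have "norm (p + x) \<le> r" by (rule r)
      moreover have "norm (fst (p + x)) \<le> norm (p + x)" by (metis norm_fst_le prod.collapse)
      ultimately have "\<bar>fst (p + x)\<bar> \<le> r" unfolding real_norm_def by linarith
      then show "x \<in> {x. fst x \<le> \<bar>r\<bar> - T}" by (simp add: p_def)
    next
      show "closed {x::real \<times> (real^'n). fst x \<le> \<bar>r\<bar> - T}" by (intro closed_Collect_le continuous_intros)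
    qed (use T in auto)
    have wsm: "smooth w" by (rule Cc_inftyD(1)[OF wC])
    have wp: "pd b w x = pd b v (p + x)" for b x
      unfolding w_def using pd_affine[OF smooth_differentiable[OF sm], of b p 1 x] by simp
    have wpp: "pd b' (pd b w) x = pd b' (pd b v) (p + x)" if "b \<in> Basis" for b b' x
    proof -
      have "pd b w = (\<lambda>x. pd b v (p + 1 *\<^sub>R x))" by (rule ext) (simp only: wp scaleR_one)
      then show ?thesis
        using pd_affine[OF smooth_differentiable[OF smooth_pd[OF sm that]], of b' p 1 x] by simp
    qed
    have wops: "H_op q (hess_z w) x = H_op q (hess_z v) (p + x)"
      "P_op A (pd dir_s w) (hess_z w) x = P_op A (pd dir_s v) (hess_z v) (p + x)" for x
      by (simp_all add: H_op_def P_op_def hess_z_def wp wpp Basis_space_time)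
    have LL: "compact ((\<lambda>x. x - p) ` L)" by (intro compact_continuous_image continuous_intros L)
    have w0: "w x = 0" if "x \<notin> (\<lambda>x. x - p) ` L" for x
    proof -
      have "x = (p + x) - p" by simp
      then have "p + x \<notin> L" using that by blast
      then show ?thesis using L(2) by (simp add: w_def)
    qed
    have ratio: "wnorm UNIV (W_wt lam a) (H_op q (hess_z w)) / wnorm UNIV (W_wt lam a) (P_op A (pd dir_s w) (hess_z w)) \<le> ennreal K"
    proof (rule order_trans[OF _ Q])
      show "wnorm UNIV (W_wt lam a) (H_op q (hess_z w)) / wnorm UNIV (W_wt lam a) (P_op A (pd dir_s w) (hess_z w))
          \<le> Q_on ({..<B} \<times> UNIV) lam a A q"
        unfolding Q_on_def by (rule SUP_upper[OF wC])
    qed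
    obtain c1 B1 where cB1: "c1 < B1" "(\<lambda>x. x - p) ` L \<subseteq> slab c1 B1"
    proof -
      obtain r1 where r1: "\<And>x. x \<in> (\<lambda>x. x - p) ` L \<Longrightarrow> norm x \<le> r1" using compact_imp_bounded[OF LL] bounded_iff by metis
      have "(\<lambda>x. x - p) ` L \<subseteq> slab (- (\<bar>r1\<bar> + 1)) (\<bar>r1\<bar> + 1)"
      proof
        fix x assume "x \<in> (\<lambda>x. x - p) ` L"
        from r1[OF this] have "\<bar>fst x\<bar> < \<bar>r1\<bar> + 1" using norm_fst_le[of "fst x" "snd x"] by simp
        then show "x \<in> slab (- (\<bar>r1\<bar> + 1)) (\<bar>r1\<bar> + 1)" by (auto simp: in_slab)
      qed
      then show thesis by (intro that[of "- (\<bar>r1\<bar> + 1)" "\<bar>r1\<bar> + 1"]) auto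
    qed
    have wz: "P_op A (pd dir_s w) (hess_z w) x = 0" if "x \<notin> (\<lambda>x. x - p) ` L" for x
      by (rule operators_off_compact(2)[OF LL w0 that])
    have finP: "wnorm UNIV (W_wt lam a) (P_op A (pd dir_s w) (hess_z w)) < \<top>"
    proof -
      have "inorm 0 c1 B1 (W_wt lam a) (P_op A (pd dir_s w) (hess_z w)) < \<top>"
        by (rule inorm_finite[OF lam _ cB1(1) LL cB1(2) P_op_continuous[OF wsm] wz]) simp
      then show ?thesis
        by (subst wnorm_UNIV_eq_inorm[of c1 B1]) (use wz cB1(2) in auto)
    qed
    let ?W = "W_wt lam a"
    have mixture: "(\<integral>\<^sup>+x. ennreal (?W x * g (p + x)) \<partial>lborel)
        = (\<integral>\<^sup>+\<zeta>. ennreal (exp (2 * T * (\<zeta>0 \<bullet> (a *v \<zeta>0))) * (exp (- (2 * T * N \<zeta>)) * freq_energy a g \<zeta>)) \<partial>lam)"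
      if g: "continuous_on UNIV g" "\<And>x. x \<notin> L \<Longrightarrow> g x = 0" "\<And>x. 0 \<le> g x" for g
    proof -
      have gm: "(\<lambda>x. indicator UNIV x * g (p + x)) \<in> borel_measurable borel"
        by (simp, intro borel_measurable_continuous_onI continuous_on_compose2[OF g(1)] continuous_intros) auto
      have "(\<integral>\<^sup>+x. ennreal (?W x * g (p + x)) \<partial>lborel)
          = (\<integral>\<^sup>+\<zeta>. (\<integral>\<^sup>+x. ennreal (exp (2 * phase (\<zeta> \<bullet> (a *v \<zeta>)) \<zeta> x) * g (p + x)) \<partial>lborel) \<partial>lam)"
        using W_wt_mixture(1)[OF lam gm, of a] g(3) by simp
      also have "\<dots> = (\<integral>\<^sup>+\<zeta>. ennreal (exp (2 * T * (\<zeta>0 \<bullet> (a *v \<zeta>0))) * (exp (- (2 * T * N \<zeta>)) * freq_energy a g \<zeta>)) \<partial>lam)"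
      proof (rule nn_integral_cong)
        fix \<zeta>
        let ?e = "\<lambda>x. exp (2 * phase (\<zeta> \<bullet> (a *v \<zeta>)) \<zeta> x)"
        let ?c = "exp (2 * T * (\<zeta>0 \<bullet> (a *v \<zeta>0))) * exp (- (2 * T * N \<zeta>))"
        have sw: "\<zeta>0 \<bullet> (a *v \<zeta>) = \<zeta> \<bullet> (a *v \<zeta>0)"
          using symmetric_inner_swap[OF asym, of \<zeta>0 \<zeta>] by (simp add: inner_commute)
        have ph: "phase (\<zeta> \<bullet> (a *v \<zeta>)) \<zeta> (y - p) = phase (\<zeta> \<bullet> (a *v \<zeta>)) \<zeta> y + (T * (\<zeta>0 \<bullet> (a *v \<zeta>0)) - T * N \<zeta>)" for y
          unfolding phase_def p_def N_def
          by (simp add: algebra_simps inner_diff_left inner_diff_right matrix_vector_mult_diff_distrib sw)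
        have e: "?e (y - p) = ?c * ?e y" for y
          unfolding ph exp_add[symmetric] by (rule arg_cong[where f=exp]) (simp add: algebra_simps)
        have em: "?e \<in> borel_measurable borel"
          unfolding phase_def by (intro borel_measurable_continuous_onI continuous_intros)
        have gm': "g \<in> borel_measurable borel" using g(1) by (rule borel_measurable_continuous_onI)
        have "(\<integral>\<^sup>+x. ennreal (?e x * g (p + x)) \<partial>lborel) = (\<integral>\<^sup>+x. ennreal (?e (x - p) * g x) \<partial>lborel)"
          using nn_integral_shift[of "\<lambda>x. ennreal (?e (x - p) * g x)" p] em gm' by (simp add: add.commute)
        also have "\<dots> = (\<integral>\<^sup>+x. ennreal ?c * ennreal (?e x * g x) \<partial>lborel)"
          unfolding e by (intro nn_integral_cong) (simp add: ennreal_mult g(3) mult.assoc)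
        also have "\<dots> = ennreal ?c * (\<integral>\<^sup>+x. ennreal (?e x * g x) \<partial>lborel)"
          using em gm' by (intro nn_integral_cmult) simp
        also have "(\<integral>\<^sup>+x. ennreal (?e x * g x) \<partial>lborel) = ennreal (freq_energy a g \<zeta>)"
          unfolding freq_energy_def
          by (rule nn_integral_eq_integral[OF freq_energy_continuous(2)[OF g(1) L(1) g(2)]]) (simp_all add: g(3))
        also have "ennreal ?c * \<dots> = ennreal (?c * freq_energy a g \<zeta>)"
          by (rule ennreal_mult'[symmetric]) simp
        finally show "(\<integral>\<^sup>+x. ennreal (?e x * g (p + x)) \<partial>lborel)
          = ennreal (exp (2 * T * (\<zeta>0 \<bullet> (a *v \<zeta>0))) * (exp (- (2 * T * N \<zeta>)) * freq_energy a g \<zeta>))"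
          by (simp add: mult.assoc)
      qed
      finally show ?thesis .
    qed
    define E where "E = exp (2 * T * (\<zeta>0 \<bullet> (a *v \<zeta>0)))"
    have E: "E > 0" by (simp add: E_def)
    have fen: "0 \<le> freq_energy a g \<zeta>" if "\<And>x. 0 \<le> g x" for g \<zeta>
      unfolding freq_energy_def by (intro Bochner_Integration.integral_nonneg mult_nonneg_nonneg that) simp
    have fint: "integrable lam (\<lambda>\<zeta>. E * (exp (- (2 * T * N \<zeta>)) * freq_energy a g \<zeta>))"
      if g: "continuous_on UNIV (freq_energy a g)" for g
    proof -
      have c: "continuous_on UNIV (\<lambda>\<zeta>. E * (exp (- (2 * T * N \<zeta>)) * freq_energy a g \<zeta>))"
        by (intro continuous_intros Nc g)
      have cS: "compact (msupp lam)" using lam by (simp add: compactly_supported_prob_def)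
      have "bounded ((\<lambda>\<zeta>. E * (exp (- (2 * T * N \<zeta>)) * freq_energy a g \<zeta>)) ` msupp lam)"
        by (intro compact_imp_bounded compact_continuous_image continuous_on_subset[OF c] cS) simp
      then obtain C where C: "\<And>\<zeta>. \<zeta> \<in> msupp lam \<Longrightarrow> norm (E * (exp (- (2 * T * N \<zeta>)) * freq_energy a g \<zeta>)) \<le> C"
        unfolding bounded_iff by blast
      show ?thesis
      proof (rule integrable_const_bound[where B=C])
        show "AE \<zeta> in lam. norm (E * (exp (- (2 * T * N \<zeta>)) * freq_energy a g \<zeta>)) \<le> C"
          using AE_msupp[OF sl] by (rule eventually_mono) (rule C)
        show "(\<lambda>\<zeta>. E * (exp (- (2 * T * N \<zeta>)) * freq_energy a g \<zeta>)) \<in> borel_measurable lam"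
          by (intro bm borel_measurable_continuous_onI c)
      qed
    qed
    have val: "(\<integral>\<^sup>+x. ennreal (?W x * g (p + x)) \<partial>lborel)
        = ennreal (LINT \<zeta>|lam. E * (exp (- (2 * T * N \<zeta>)) * freq_energy a g \<zeta>))"
      if g: "continuous_on UNIV g" "\<And>x. x \<notin> L \<Longrightarrow> g x = 0" "\<And>x. 0 \<le> g x" for g
    proof -
      have "(\<integral>\<^sup>+x. ennreal (?W x * g (p + x)) \<partial>lborel)
          = (\<integral>\<^sup>+\<zeta>. ennreal (E * (exp (- (2 * T * N \<zeta>)) * freq_energy a g \<zeta>)) \<partial>lam)"
        unfolding E_def by (rule mixture[OF g])
      also have "\<dots> = ennreal (LINT \<zeta>|lam. E * (exp (- (2 * T * N \<zeta>)) * freq_energy a g \<zeta>))"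
        by (rule nn_integral_eq_integral[OF fint[OF freq_energy_continuous(1)[OF g(1) L(1) g(2)]]])
           (use E fen[of g, OF g(3)] in simp_all)
      finally show ?thesis .
    qed
    have valH: "(\<integral>\<^sup>+x. ennreal (?W x * ?H (p + x)) \<partial>lborel)
        = ennreal (LINT \<zeta>|lam. E * (exp (- (2 * T * N \<zeta>)) * freq_energy a ?H \<zeta>))"
      by (rule val[OF Hc(1) H0(1) zero_le_power2])
    have valP: "(\<integral>\<^sup>+x. ennreal (?W x * ?P (p + x)) \<partial>lborel)
        = ennreal (LINT \<zeta>|lam. E * (exp (- (2 * T * N \<zeta>)) * freq_energy a ?P \<zeta>))"
      by (rule val[OF Hc(2) H0(2) zero_le_power2])
    have "(\<integral>\<^sup>+x. ennreal (?W x * ?H (p + x)) \<partial>lborel) \<le> ennreal (K\<^sup>2) * (\<integral>\<^sup>+x. ennreal (?W x * ?P (p + x)) \<partial>lborel)"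
    proof -
      have "wnorm UNIV ?W (H_op q (hess_z w)) \<le> ennreal K * wnorm UNIV ?W (P_op A (pd dir_s w) (hess_z w))"
        by (rule ennreal_divide_leD[OF ratio finP])
      from esqrt_mult_leD[OF this[unfolded wnorm_def] _ K] finP[unfolded wnorm_def esqrt_less_top_iff]
      show ?thesis by (simp add: wops)
    qed
    then have "ennreal (LINT \<zeta>|lam. E * (exp (- (2 * T * N \<zeta>)) * freq_energy a ?H \<zeta>))
        \<le> ennreal (K\<^sup>2) * ennreal (LINT \<zeta>|lam. E * (exp (- (2 * T * N \<zeta>)) * freq_energy a ?P \<zeta>))"
      by (simp only: valH valP)
    then have "ennreal (LINT \<zeta>|lam. E * (exp (- (2 * T * N \<zeta>)) * freq_energy a ?H \<zeta>))
        \<le> ennreal (K\<^sup>2 * (LINT \<zeta>|lam. E * (exp (- (2 * T * N \<zeta>)) * freq_energy a ?P \<zeta>)))"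
      by (simp add: ennreal_mult')
    then have "(LINT \<zeta>|lam. E * (exp (- (2 * T * N \<zeta>)) * freq_energy a ?H \<zeta>))
        \<le> K\<^sup>2 * (LINT \<zeta>|lam. E * (exp (- (2 * T * N \<zeta>)) * freq_energy a ?P \<zeta>))"
      using E fen by (subst (asm) ennreal_le_iff) (auto intro!: mult_nonneg_nonneg Bochner_Integration.integral_nonneg)
    moreover have "(LINT \<zeta>|lam. K\<^sup>2 * (E * (exp (- (2 * T * N \<zeta>)) * freq_energy a ?P \<zeta>)) - E * (exp (- (2 * T * N \<zeta>)) * freq_energy a ?H \<zeta>))
        = K\<^sup>2 * (LINT \<zeta>|lam. E * (exp (- (2 * T * N \<zeta>)) * freq_energy a ?P \<zeta>)) - (LINT \<zeta>|lam. E * (exp (- (2 * T * N \<zeta>)) * freq_energy a ?H \<zeta>))"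
    proof -
      have iP: "integrable lam (\<lambda>\<zeta>. K\<^sup>2 * (E * (exp (- (2 * T * N \<zeta>)) * freq_energy a ?P \<zeta>)))"
        by (rule integrable_mult_right[OF fint[OF fP(1)]])
      have iH: "integrable lam (\<lambda>\<zeta>. E * (exp (- (2 * T * N \<zeta>)) * freq_energy a ?H \<zeta>))"
        by (rule fint[OF fH(1)])
      show ?thesis
        by (rule trans[OF Bochner_Integration.integral_diff[OF iP iH]]) (simp only: integral_mult_right_zero)
    qed
    moreover have "K\<^sup>2 * (E * (exp (- (2 * T * N \<zeta>)) * freq_energy a ?P \<zeta>)) - E * (exp (- (2 * T * N \<zeta>)) * freq_energy a ?H \<zeta>)
        = E * (exp (- (2 * T * N \<zeta>)) * ?h \<zeta>)" for \<zeta> by (simp add: algebra_simps)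
    ultimately have "0 \<le> E * (LINT \<zeta>|lam. exp (- (2 * T * N \<zeta>)) * ?h \<zeta>)" by simp
    then show ?thesis using E by (simp add: zero_le_mult_iff)
  qed
  note pos = this
  have "0 \<le> ?h \<zeta>0"
  proof (rule laplace_concentration[where h="?h" and N=N, OF lam z _ Nc _ Npos pos])
    show "continuous_on UNIV ?h" by (intro continuous_on_diff continuous_on_mult continuous_on_const fH(1) fP(1))
    show "N \<zeta>0 = 0" by (simp add: N_def)
  qed
  then show ?thesis by simp
qed

section \<open>Wave packets\<close>

lemma matrix_sandwich_linear:
  fixes R X Y :: "real^'n^'n"
  shows "R ** (c *\<^sub>R X + d *\<^sub>R Y) ** R = c *\<^sub>R (R ** X ** R) + d *\<^sub>R (R ** Y ** R)"
  unfolding linear_add[OF bounded_linear.linear[OF sandwich_bounded_linear[of R]]]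
    linear_cmul[OF bounded_linear.linear[OF sandwich_bounded_linear[of R]]] ..

lemma frob_inner_linear: "frob_inner A (c *\<^sub>R X + d *\<^sub>R Y) = c * frob_inner A X + d * frob_inner A Y"
  unfolding frob_inner_eq_sum by (simp add: sum.distrib sum_distrib_left algebra_simps)

lemma pd_diff:
  assumes "f differentiable (at x)" "g differentiable (at x)"
  shows "pd b (\<lambda>x. f x - g x) x = pd b f x - pd b g x"
proof -
  have "((\<lambda>x. f x - g x) has_derivative
      (\<lambda>h. frechet_derivative f (at x) h - frechet_derivative g (at x) h)) (at x)"
    by (intro has_derivative_diff) (use assms frechet_derivative_works in auto)
  from pd_eqI[OF this] show ?thesis by (simp add: pd_def)
qed

lemma smooth_trig_ridge:
  fixes e :: "'a::euclidean_space"
  shows "smooth (\<lambda>x. cos (x \<bullet> e))" "smooth (\<lambda>x. sin (x \<bullet> e))"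
    "pd b (\<lambda>x. cos (x \<bullet> e)) x = - (b \<bullet> e) * sin (x \<bullet> e)"
    "pd b (\<lambda>x. sin (x \<bullet> e)) x = (b \<bullet> e) * cos (x \<bullet> e)"
proof -
  \<comment> \<open>The n-th derivative of cosine is cosine shifted by n pi/2, and likewise for
    sine; this gives the derivative sequences that \<open>C_diff_ridge\<close> expects.\<close>
  define Gc where "Gc n t = cos (t + real n * (pi / 2))" for n t
  define Gs where "Gs n t = sin (t + real n * (pi / 2))" for n t
  have shift: "t + real (Suc n) * (pi / 2) = (t + real n * (pi / 2)) + pi / 2" for t n
    by (simp add: algebra_simps)
  have c: "(Gc n has_real_derivative Gc (Suc n) t) (at t)" for n t
    unfolding Gc_def shift cos_add[of "t + real n * (pi / 2)"] by (auto intro!: derivative_eq_intros)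
  have s: "(Gs n has_real_derivative Gs (Suc n) t) (at t)" for n t
    unfolding Gs_def shift sin_add[of "t + real n * (pi / 2)"] by (auto intro!: derivative_eq_intros)
  have Gc0: "Gc 0 t = cos t" "Gc (Suc 0) t = - sin t" and Gs0: "Gs 0 t = sin t" "Gs (Suc 0) t = cos t" for t
    by (simp_all add: Gc_def Gs_def cos_add sin_add)
  show "smooth (\<lambda>x. cos (x \<bullet> e))" using C_diff_ridge[where G=Gc and n=0 and d=0 and e=e, OF c] by (simp add: Gc0)
  show "smooth (\<lambda>x. sin (x \<bullet> e))" using C_diff_ridge[where G=Gs and n=0 and d=0 and e=e, OF s] by (simp add: Gs0)
  show "pd b (\<lambda>x. cos (x \<bullet> e)) x = - (b \<bullet> e) * sin (x \<bullet> e)"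
    using pd_ridge[where G=Gc and n=0 and d=0 and e=e, OF c, of b x] by (simp add: Gc0)
  show "pd b (\<lambda>x. sin (x \<bullet> e)) x = (b \<bullet> e) * cos (x \<bullet> e)"
    using pd_ridge[where G=Gs and n=0 and d=0 and e=e, OF s, of b x] by (simp add: Gs0)
qed

text \<open>The waves are real and imaginary parts of exp(\<zeta> . z - k s + i (\<tau> s + \<xi> .
  z)); test functions being real, complex packets are handled as pairs. Their amplitude is the
  inverse square root of the exponential weight, so the weighted packets have constant
  modulus.\<close>

locale wave_packet =
  fixes k \<tau> :: real and \<zeta> \<xi> :: "real^'n"
begin

definition cos_wave :: "real \<times> (real^'n) \<Rightarrow> real" where
  "cos_wave x = exp (phase (- k) (- \<zeta>) x) * cos (x \<bullet> (\<tau>, \<xi>))"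

definition sin_wave :: "real \<times> (real^'n) \<Rightarrow> real" where
  "sin_wave x = exp (phase (- k) (- \<zeta>) x) * sin (x \<bullet> (\<tau>, \<xi>))"

lemma smooth_waves: "smooth cos_wave" "smooth sin_wave"
  unfolding cos_wave_def[abs_def] sin_wave_def[abs_def]
  using smooth_exp_phase(1)[of "- k" "- \<zeta>"] smooth_trig_ridge(1,2)[of "(\<tau>, \<xi>)"] by (auto intro!: C_diff_mult)

text \<open>\<open>al\<close> and \<open>be\<close> are the real and imaginary parts of the
  logarithmic derivative of the complex wave in direction b.\<close>

definition al :: "real \<times> (real^'n) \<Rightarrow> real" where "al b = b \<bullet> (- k, \<zeta>)"
definition be :: "real \<times> (real^'n) \<Rightarrow> real" where "be b = b \<bullet> (\<tau>, \<xi>)"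

lemma al_be: "al dir_s = - k" "al (dir_z i) = \<zeta> $ i" "be dir_s = \<tau>" "be (dir_z i) = \<xi> $ i"
  by (simp_all add: al_def be_def dir_s_def dir_z_def inner_prod_def inner_axis')

lemma pd_waves:
  assumes "b = dir_s \<or> b \<in> range dir_z"
  shows "pd b cos_wave x = al b * cos_wave x - be b * sin_wave x" "pd b sin_wave x = al b * sin_wave x + be b * cos_wave x"
proof -
  let ?E = "\<lambda>x. exp (phase (- k) (- \<zeta>) x)"
  have E: "pd b ?E x = al b * ?E x"
    using assms smooth_exp_phase(2)[of "- k" "- \<zeta>" x] smooth_exp_phase(3)[of _ "- k" "- \<zeta>" x] by (auto simp: al_be)
  note d = smooth_differentiable[OF smooth_exp_phase(1)[of "- k" "- \<zeta>"], of x]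
    smooth_differentiable[OF smooth_trig_ridge(1)[of "(\<tau>, \<xi>)"], of x]
    smooth_differentiable[OF smooth_trig_ridge(2)[of "(\<tau>, \<xi>)"], of x]
  show "pd b cos_wave x = al b * cos_wave x - be b * sin_wave x"
    unfolding cos_wave_def[abs_def] sin_wave_def pd_mult[OF d(1,2)] E smooth_trig_ridge(3) be_def by (simp add: algebra_simps)
  show "pd b sin_wave x = al b * sin_wave x + be b * cos_wave x"
    unfolding sin_wave_def[abs_def] cos_wave_def pd_mult[OF d(1,3)] E smooth_trig_ridge(4) be_def by (simp add: algebra_simps)
qed

text \<open>The two combinations are the real and imaginary parts of (f + i g) times the complex
  wave. This shape is preserved by differentiation, so it can be used twice to reach the
  Hessian.\<close>

lemma pd_wave_pair:
  assumes b: "b = dir_s \<or> b \<in> range dir_z" and f: "smooth f" and g: "smooth g"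
  shows "pd b (\<lambda>x. cos_wave x * f x - sin_wave x * g x) =
      (\<lambda>x. cos_wave x * (pd b f x + al b * f x - be b * g x) - sin_wave x * (pd b g x + al b * g x + be b * f x))"
    and "pd b (\<lambda>x. sin_wave x * f x + cos_wave x * g x) =
      (\<lambda>x. sin_wave x * (pd b f x + al b * f x - be b * g x) + cos_wave x * (pd b g x + al b * g x + be b * f x))"
proof -
  have sm: "smooth (\<lambda>x. cos_wave x * f x)" "smooth (\<lambda>x. sin_wave x * g x)" "smooth (\<lambda>x. sin_wave x * f x)" "smooth (\<lambda>x. cos_wave x * g x)"
    using C_diff_mult smooth_waves f g by blast+
  note d = smooth_differentiable
  show "pd b (\<lambda>x. cos_wave x * f x - sin_wave x * g x) =
      (\<lambda>x. cos_wave x * (pd b f x + al b * f x - be b * g x) - sin_wave x * (pd b g x + al b * g x + be b * f x))"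
    by (rule ext) (simp add: pd_diff d[OF sm(1)] d[OF sm(2)] pd_mult d[OF smooth_waves(1)] d[OF smooth_waves(2)] d[OF f] d[OF g]
        pd_waves[OF b] algebra_simps)
  show "pd b (\<lambda>x. sin_wave x * f x + cos_wave x * g x) =
      (\<lambda>x. sin_wave x * (pd b f x + al b * f x - be b * g x) + cos_wave x * (pd b g x + al b * g x + be b * f x))"
    by (rule ext) (simp add: pd_add d[OF sm(3)] d[OF sm(4)] pd_mult d[OF smooth_waves(1)] d[OF smooth_waves(2)] d[OF f] d[OF g]
        pd_waves[OF b] algebra_simps)
qed

text \<open>The packet \<open>\<eta> (cos_wave + i sin_wave)\<close> has Hessian \<open>(hess_re + i hess_im) (cos_wave + i sin_wave)\<close>.\<close>

definition hess_re :: "(real \<times> (real^'n) \<Rightarrow> real) \<Rightarrow> real \<times> (real^'n) \<Rightarrow> real^'n^'n" where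
  "hess_re \<eta> x = (\<chi> i j. (\<zeta> $ i * \<zeta> $ j - \<xi> $ i * \<xi> $ j) * \<eta> x
     + (\<zeta> $ i * pd (dir_z j) \<eta> x + \<zeta> $ j * pd (dir_z i) \<eta> x) + pd (dir_z j) (pd (dir_z i) \<eta>) x)"

definition hess_im :: "(real \<times> (real^'n) \<Rightarrow> real) \<Rightarrow> real \<times> (real^'n) \<Rightarrow> real^'n^'n" where
  "hess_im \<eta> x = (\<chi> i j. (\<zeta> $ i * \<xi> $ j + \<xi> $ i * \<zeta> $ j) * \<eta> x
     + (\<xi> $ i * pd (dir_z j) \<eta> x + \<xi> $ j * pd (dir_z i) \<eta> x))"

text \<open>Real and imaginary coefficients of the parabolic operator applied to the packet. The
  time frequency \<tau> enters only the imaginary part, which is why it can be chosen to cancel the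
  imaginary symbol.\<close>

definition op_re where "op_re A \<eta> x = k * \<eta> x - pd dir_s \<eta> x - frob_inner A (hess_re \<eta> x)"
definition op_im where "op_im A \<eta> x = - \<tau> * \<eta> x - frob_inner A (hess_im \<eta> x)"

lemma wave_square: "exp (2 * phase k \<zeta> x) * ((cos_wave x)\<^sup>2 + (sin_wave x)\<^sup>2) = 1"
proof -
  have "(cos_wave x)\<^sup>2 + (sin_wave x)\<^sup>2 = (exp (phase (- k) (- \<zeta>) x))\<^sup>2 * ((cos (x \<bullet> (\<tau>, \<xi>)))\<^sup>2 + (sin (x \<bullet> (\<tau>, \<xi>)))\<^sup>2)"
    by (simp only: cos_wave_def sin_wave_def power_mult_distrib distrib_left)
  also have "\<dots> = exp (2 * phase (- k) (- \<zeta>) x)" by (simp add: exp_double)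
  also have "phase (- k) (- \<zeta>) x = - phase k \<zeta> x" by (simp add: phase_def)
  finally show ?thesis by (simp add: exp_minus)
qed

text \<open>Passing from real and imaginary coefficients to the two real packets is a rotation
  scaled by the wave's modulus. Adding the energies of both packets removes the oscillation, and the
  weight removes the modulus.\<close>

lemma wave_energies:
  fixes A q :: "real^'n^'n"
  assumes \<eta>: "smooth \<eta>"
  defines "v1 \<equiv> \<lambda>x. cos_wave x * \<eta> x" and "v2 \<equiv> \<lambda>x. sin_wave x * \<eta> x"
  shows "exp (2 * phase k \<zeta> x) * ((norm (H_op q (hess_z v1) x))\<^sup>2 + (norm (H_op q (hess_z v2) x))\<^sup>2)
      = (norm (mat_sqrt q ** hess_re \<eta> x ** mat_sqrt q))\<^sup>2 + (norm (mat_sqrt q ** hess_im \<eta> x ** mat_sqrt q))\<^sup>2" (is ?H)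
    and "exp (2 * phase k \<zeta> x) * ((P_op A (pd dir_s v1) (hess_z v1) x)\<^sup>2 + (P_op A (pd dir_s v2) (hess_z v2) x)\<^sup>2)
      = (op_re A \<eta> x)\<^sup>2 + (op_im A \<eta> x)\<^sup>2" (is ?P)
proof -
  have z0: "smooth (\<lambda>_::real \<times> (real^'n). 0)" using C_diff_const by blast
  have pz: "pd b (\<lambda>_::real \<times> (real^'n). 0) x = 0" for b x by (rule pd_eqI) (rule has_derivative_const)
  have v1: "v1 = (\<lambda>x. cos_wave x * \<eta> x - sin_wave x * 0)" and v2: "v2 = (\<lambda>x. sin_wave x * \<eta> x + cos_wave x * 0)"
    by (simp_all add: v1_def v2_def)
  let ?f = "\<lambda>i x. pd (dir_z i) \<eta> x + \<zeta> $ i * \<eta> x" and ?g = "\<lambda>i x. \<xi> $ i * \<eta> x"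
  have fs: "smooth (?f i)" and gs: "smooth (?g i)" for i
    using \<eta> smooth_pd[OF \<eta> Basis_space_time(2)[of i]] by (auto intro!: C_diff_add C_diff_mult C_diff_const)
  have d1: "pd (dir_z i) v1 = (\<lambda>x. cos_wave x * ?f i x - sin_wave x * ?g i x)" "pd (dir_z i) v2 = (\<lambda>x. sin_wave x * ?f i x + cos_wave x * ?g i x)" for i
    unfolding v1 v2 using pd_wave_pair[OF _ \<eta> z0, of "dir_z i"] by (simp_all add: al_be pz)
  have s1: "pd dir_s v1 x = cos_wave x * (pd dir_s \<eta> x - k * \<eta> x) - sin_wave x * (\<tau> * \<eta> x)"
    "pd dir_s v2 x = sin_wave x * (pd dir_s \<eta> x - k * \<eta> x) + cos_wave x * (\<tau> * \<eta> x)" for x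
    unfolding v1 v2 using pd_wave_pair[OF _ \<eta> z0, of dir_s] by (simp_all add: al_be pz)
  have pf: "pd (dir_z j) (?f i) x = pd (dir_z j) (pd (dir_z i) \<eta>) x + \<zeta> $ i * pd (dir_z j) \<eta> x"
    "pd (dir_z j) (?g i) x = \<xi> $ i * pd (dir_z j) \<eta> x" for i j x
  proof -
    note d = smooth_differentiable[OF smooth_pd[OF \<eta> Basis_space_time(2)[of i]], of x] smooth_differentiable[OF \<eta>, of x]
    have d3: "(\<lambda>x. \<zeta> $ i * \<eta> x) differentiable (at x)" using d(2) by simp
    show "pd (dir_z j) (?f i) x = pd (dir_z j) (pd (dir_z i) \<eta>) x + \<zeta> $ i * pd (dir_z j) \<eta> x"
      unfolding pd_add[OF d(1) d3] pd_cmult[OF d(2)] ..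
    show "pd (dir_z j) (?g i) x = \<xi> $ i * pd (dir_z j) \<eta> x" by (rule pd_cmult[OF d(2)])
  qed
  have e: "pd (dir_z j) (pd (dir_z i) v1) x =
      cos_wave x * (pd (dir_z j) (?f i) x + al (dir_z j) * ?f i x - be (dir_z j) * ?g i x)
      - sin_wave x * (pd (dir_z j) (?g i) x + al (dir_z j) * ?g i x + be (dir_z j) * ?f i x)"
    "pd (dir_z j) (pd (dir_z i) v2) x =
      sin_wave x * (pd (dir_z j) (?f i) x + al (dir_z j) * ?f i x - be (dir_z j) * ?g i x)
      + cos_wave x * (pd (dir_z j) (?g i) x + al (dir_z j) * ?g i x + be (dir_z j) * ?f i x)" for i j
    unfolding d1 by (rule fun_cong[OF pd_wave_pair(1)[OF _ fs gs]] fun_cong[OF pd_wave_pair(2)[OF _ fs gs]], simp)+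
  have h1: "hess_z v1 x = cos_wave x *\<^sub>R hess_re \<eta> x + (- sin_wave x) *\<^sub>R hess_im \<eta> x"
    by (simp add: vec_eq_iff hess_z_def hess_re_def hess_im_def e pf al_be) (simp add: algebra_simps)
  have h2: "hess_z v2 x = sin_wave x *\<^sub>R hess_re \<eta> x + cos_wave x *\<^sub>R hess_im \<eta> x"
    by (simp add: vec_eq_iff hess_z_def hess_re_def hess_im_def e pf al_be) (simp add: algebra_simps)
  have rot: "(norm (c *\<^sub>R M + (- s) *\<^sub>R N))\<^sup>2 + (norm (s *\<^sub>R M + c *\<^sub>R N))\<^sup>2 = (c\<^sup>2 + s\<^sup>2) * ((norm M)\<^sup>2 + (norm N)\<^sup>2)"
    for c s and M N :: "real^'n^'n"
    unfolding power2_norm_eq_inner inner_add_left inner_add_right inner_scaleR_left inner_scaleR_right inner_commute[of N M]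
    by (simp only: power2_eq_square algebra_simps)
  show ?H
    unfolding H_op_def h1 h2 matrix_sandwich_linear rot
    using wave_square[of x] by (simp add: mult.assoc[symmetric])
  have P1: "P_op A (pd dir_s v1) (hess_z v1) x = cos_wave x * op_re A \<eta> x - sin_wave x * op_im A \<eta> x"
    "P_op A (pd dir_s v2) (hess_z v2) x = sin_wave x * op_re A \<eta> x + cos_wave x * op_im A \<eta> x"
    unfolding P_op_def h1 h2 frob_inner_linear s1 op_re_def op_im_def by (simp_all add: algebra_simps)
  have "(cos_wave x * op_re A \<eta> x - sin_wave x * op_im A \<eta> x)\<^sup>2 + (sin_wave x * op_re A \<eta> x + cos_wave x * op_im A \<eta> x)\<^sup>2
      = ((cos_wave x)\<^sup>2 + (sin_wave x)\<^sup>2) * ((op_re A \<eta> x)\<^sup>2 + (op_im A \<eta> x)\<^sup>2)"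
    by (simp add: power2_eq_square algebra_simps)
  then show ?P unfolding P1 using wave_square[of x] by (simp add: mult.assoc[symmetric])
qed

end

text \<open>The two matrices are the real and imaginary parts of w w^T with w = \<zeta> + i \<xi>.
  After the sandwich this is the rank-one matrix of R w, whose Frobenius norm is the squared
  Hermitian norm of R w.\<close>

lemma wave_symbol_norms:
  fixes R :: "real^'n^'n" and \<zeta> \<xi> :: "real^'n"
  assumes R: "transpose R = R" "R ** R = q"
  shows "(norm (R ** (\<chi> i j. \<zeta> $ i * \<zeta> $ j - \<xi> $ i * \<xi> $ j) ** R))\<^sup>2 + (norm (R ** (\<chi> i j. \<zeta> $ i * \<xi> $ j + \<xi> $ i * \<zeta> $ j) ** R))\<^sup>2
    = (\<zeta> \<bullet> (q *v \<zeta>) + \<xi> \<bullet> (q *v \<xi>))\<^sup>2"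
proof -
  define p where "p = R *v \<zeta>"
  define r where "r = R *v \<xi>"
  have Rn: "R $ k $ j = R $ j $ k" for j k
    using arg_cong[OF R(1), of "\<lambda>M. M $ k $ j"] by (simp add: transpose_def)
  have e: "(R ** (\<chi> i j. x $ i * y $ j) ** R) $ i $ j = (R *v x) $ i * (R *v y) $ j" for x y :: "real^'n" and i j
  proof -
    have "(R ** (\<chi> i j. x $ i * y $ j) ** R) $ i $ j = (\<Sum>k\<in>UNIV. (\<Sum>l\<in>UNIV. R $ i $ l * (x $ l * y $ k)) * R $ k $ j)"
      by (simp add: matrix_mul_nth)
    also have "\<dots> = (\<Sum>k\<in>UNIV. (R *v x) $ i * (R $ j $ k * y $ k))"
    proof (intro sum.cong refl)
      fix k
      have "(\<Sum>l\<in>UNIV. R $ i $ l * (x $ l * y $ k)) = (R *v x) $ i * y $ k"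
        by (simp add: matrix_vector_mult_def sum_distrib_right mult.assoc)
      then show "(\<Sum>l\<in>UNIV. R $ i $ l * (x $ l * y $ k)) * R $ k $ j = (R *v x) $ i * (R $ j $ k * y $ k)"
        by (simp add: Rn[of k j])
    qed
    also have "\<dots> = (R *v x) $ i * (R *v y) $ j" by (simp add: matrix_vector_mult_def sum_distrib_left)
    finally show ?thesis .
  qed
  have m1: "(\<chi> i j. \<zeta> $ i * \<zeta> $ j - \<xi> $ i * \<xi> $ j) = (1::real) *\<^sub>R (\<chi> i j. \<zeta> $ i * \<zeta> $ j) + (- 1::real) *\<^sub>R (\<chi> i j. \<xi> $ i * \<xi> $ j)"
    "(\<chi> i j. \<zeta> $ i * \<xi> $ j + \<xi> $ i * \<zeta> $ j) = (1::real) *\<^sub>R (\<chi> i j. \<zeta> $ i * \<xi> $ j) + (1::real) *\<^sub>R (\<chi> i j. \<xi> $ i * \<zeta> $ j)"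
    by (simp_all add: vec_eq_iff)
  have n: "(R ** (\<chi> i j. \<zeta> $ i * \<zeta> $ j - \<xi> $ i * \<xi> $ j) ** R) $ i $ j = p $ i * p $ j - r $ i * r $ j"
    "(R ** (\<chi> i j. \<zeta> $ i * \<xi> $ j + \<xi> $ i * \<zeta> $ j) ** R) $ i $ j = p $ i * r $ j + r $ i * p $ j" for i j
    unfolding m1 matrix_sandwich_linear p_def r_def by (simp_all add: e)
  have "(norm (R ** (\<chi> i j. \<zeta> $ i * \<zeta> $ j - \<xi> $ i * \<xi> $ j) ** R))\<^sup>2 + (norm (R ** (\<chi> i j. \<zeta> $ i * \<xi> $ j + \<xi> $ i * \<zeta> $ j) ** R))\<^sup>2
      = (\<Sum>i\<in>UNIV. \<Sum>j\<in>UNIV. ((p $ i)\<^sup>2 + (r $ i)\<^sup>2) * ((p $ j)\<^sup>2 + (r $ j)\<^sup>2))"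
    unfolding norm_matrix_power2 n sum.distrib[symmetric]
    by (intro sum.cong refl) (simp add: power2_eq_square algebra_simps)
  also have "\<dots> = (\<Sum>i\<in>UNIV. (p $ i)\<^sup>2 + (r $ i)\<^sup>2)\<^sup>2"
    by (simp only: power2_eq_square[of "sum _ _"] sum_product)
  also have "(\<Sum>i\<in>UNIV. (p $ i)\<^sup>2 + (r $ i)\<^sup>2) = p \<bullet> p + r \<bullet> r"
    by (simp add: inner_vec_def sum.distrib power2_eq_square)
  also have "p \<bullet> p + r \<bullet> r = \<zeta> \<bullet> (q *v \<zeta>) + \<xi> \<bullet> (q *v \<xi>)"
  proof -
    have "p \<bullet> p = \<zeta> \<bullet> (q *v \<zeta>)" "r \<bullet> r = \<xi> \<bullet> (q *v \<xi>)"
    unfolding p_def r_def R(2)[symmetric] matrix_vector_mul_assoc[symmetric]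
    by (simp_all add: symmetric_inner_swap[OF R(1)])
    then show ?thesis by simp
  qed
  finally show ?thesis .
qed

text \<open>Derivatives of the envelope carry small parameters, and at 0 only the symbol times the
  squared envelope remains. Separate parameters for space and time serve both uses: wide envelopes
  have es = ss, high frequencies have ss equal to the square of es.\<close>

lemma packet_limit:
  fixes w \<eta> \<eta>s :: "real \<times> (real^'n) \<Rightarrow> real" and R A m m' :: "real^'n^'n"
    and M1 M1' M2 :: "real \<times> (real^'n) \<Rightarrow> real^'n^'n" and k \<tau> L :: real
  assumes K: "compact K" and w: "w \<in> borel_measurable borel" "\<And>x. x \<in> K \<Longrightarrow> \<bar>w x\<bar> \<le> Cw"
    and cont: "continuous_on UNIV \<eta>" "continuous_on UNIV \<eta>s" "continuous_on UNIV M1" "continuous_on UNIV M1'" "continuous_on UNIV M2"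
    and off: "\<And>x. x \<notin> K \<Longrightarrow> \<eta> x = 0" "\<And>x. x \<notin> K \<Longrightarrow> \<eta>s x = 0" "\<And>x. x \<notin> K \<Longrightarrow> M1 x = 0" "\<And>x. x \<notin> K \<Longrightarrow> M1' x = 0" "\<And>x. x \<notin> K \<Longrightarrow> M2 x = 0"
  defines "X \<equiv> \<lambda>e x. \<eta> x *\<^sub>R m + e *\<^sub>R M1 x + e\<^sup>2 *\<^sub>R M2 x" and "Y \<equiv> \<lambda>e x. \<eta> x *\<^sub>R m' + e *\<^sub>R M1' x"
  defines "\<Psi> \<equiv> \<lambda>e s x. L * ((k * \<eta> x - s * \<eta>s x - frob_inner A (X e x))\<^sup>2 + (- \<tau> * \<eta> x - frob_inner A (Y e x))\<^sup>2)
      - ((norm (R ** X e x ** R))\<^sup>2 + (norm (R ** Y e x ** R))\<^sup>2)"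
  assumes es: "es \<longlonglongrightarrow> 0" "ss \<longlonglongrightarrow> (0::real)" and b: "\<And>n. \<bar>es n\<bar> \<le> 1" "\<And>n. \<bar>ss n\<bar> \<le> 1"
    and pos: "\<And>n. 0 \<le> (LINT x|lborel. w x * \<Psi> (es n) (ss n) x)"
    and wpos: "0 < (LINT x|lborel. w x * (\<eta> x)\<^sup>2)"
  shows "(norm (R ** m ** R))\<^sup>2 + (norm (R ** m' ** R))\<^sup>2 \<le> L * ((k - frob_inner A m)\<^sup>2 + (\<tau> + frob_inner A m')\<^sup>2)"
proof -
  have jc: "continuous_on UNIV (\<lambda>p::real \<times> real \<times> (real \<times> (real^'n)). \<Psi> (fst p) (fst (snd p)) (snd (snd p)))"
  proof -
    have c: "continuous_on UNIV (\<lambda>p::real \<times> real \<times> (real \<times> (real^'n)). f (snd (snd p)))" if "continuous_on UNIV f"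
      for f :: "real \<times> (real^'n) \<Rightarrow> 'z::topological_space"
      by (rule continuous_on_compose2[OF that]) (auto intro!: continuous_intros)
    have Xc: "continuous_on UNIV (\<lambda>p::real \<times> real \<times> (real \<times> (real^'n)). X (fst p) (snd (snd p)))"
      unfolding X_def by (intro continuous_intros c cont)
    have Yc: "continuous_on UNIV (\<lambda>p::real \<times> real \<times> (real \<times> (real^'n)). Y (fst p) (snd (snd p)))"
      unfolding Y_def by (intro continuous_intros c cont)
    show ?thesis unfolding \<Psi>_def frob_inner_eq_sum
      by (intro continuous_intros c cont Xc Yc continuous_on_sandwich)
  qed
  have "compact ({-1..1::real} \<times> {-1..1::real} \<times> K)" by (intro compact_Times compact_Icc K)
  then have "bounded ((\<lambda>p. \<Psi> (fst p) (fst (snd p)) (snd (snd p))) ` ({-1..1} \<times> {-1..1} \<times> K))"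
    by (intro compact_imp_bounded compact_continuous_image continuous_on_subset[OF jc]) auto
  then obtain C where Cb: "\<forall>y\<in>(\<lambda>p. \<Psi> (fst p) (fst (snd p)) (snd (snd p))) ` ({-1..1} \<times> {-1..1} \<times> K). norm y \<le> C"
    unfolding bounded_iff by blast
  have C: "\<bar>\<Psi> e s x\<bar> \<le> C" if "\<bar>e\<bar> \<le> 1" "\<bar>s\<bar> \<le> 1" "x \<in> K" for e s x
    using bspec[OF Cb imageI[of "(e, s, x)"]] that by (auto simp: abs_le_iff)
  have off\<Psi>: "\<Psi> e s x = 0" if "x \<notin> K" for e s x
    using off[OF that] by (simp add: \<Psi>_def X_def Y_def frob_inner_eq_sum)
  have \<Psi>c: "continuous_on UNIV (\<lambda>x. \<Psi> e s x)" for e s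
    using continuous_on_compose2[OF jc, of UNIV "\<lambda>x. (e, s, x)"] by (simp add: continuous_intros)
  have Kf: "emeasure lborel K < \<infinity>" using K emeasure_bounded_finite compact_imp_bounded by blast
  have "(\<lambda>n. LINT x|lborel. w x * \<Psi> (es n) (ss n) x) \<longlonglongrightarrow> (LINT x|lborel. w x * \<Psi> 0 0 x)"
  proof (rule integral_dominated_convergence[where w="\<lambda>x. (\<bar>Cw\<bar> * \<bar>C\<bar>) * indicator K x"])
    show "(\<lambda>x. w x * \<Psi> 0 0 x) \<in> borel_measurable lborel" "(\<lambda>x. w x * \<Psi> (es n) (ss n) x) \<in> borel_measurable lborel" for n
      using w(1) \<Psi>c borel_measurable_continuous_onI by (auto intro!: borel_measurable_times)
    show "integrable lborel (\<lambda>x. (\<bar>Cw\<bar> * \<bar>C\<bar>) * indicator K x)"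
      using Kf K by (intro integrable_mult_right integrable_real_indicator) (auto simp: borel_compact)
    show "AE x in lborel. (\<lambda>n. w x * \<Psi> (es n) (ss n) x) \<longlonglongrightarrow> w x * \<Psi> 0 0 x"
    proof (intro AE_I2 tendsto_mult tendsto_const)
      fix x :: "real \<times> (real^'n)"
      have "(\<lambda>n. (es n, ss n, x)) \<longlonglongrightarrow> (0, 0, x)" by (intro tendsto_intros es)
      from continuous_on_tendsto_compose[OF jc this]
      show "(\<lambda>n. \<Psi> (es n) (ss n) x) \<longlonglongrightarrow> \<Psi> 0 0 x" by simp
    qed
    show "AE x in lborel. norm (w x * \<Psi> (es n) (ss n) x) \<le> (\<bar>Cw\<bar> * \<bar>C\<bar>) * indicator K x" for n
    proof (rule AE_I2)
      fix x show "norm (w x * \<Psi> (es n) (ss n) x) \<le> (\<bar>Cw\<bar> * \<bar>C\<bar>) * indicator K x"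
      proof (cases "x \<in> K")
        case True
        have "\<bar>w x\<bar> \<le> \<bar>Cw\<bar>" using w(2)[OF True] by linarith
        moreover have "\<bar>\<Psi> (es n) (ss n) x\<bar> \<le> \<bar>C\<bar>" using C[OF b True, of n n] by linarith
        ultimately show ?thesis using True by (simp add: abs_mult mult_mono)
      qed (simp add: off\<Psi>)
    qed
  qed
  then have lim: "0 \<le> (LINT x|lborel. w x * \<Psi> 0 0 x)" using pos by (intro LIMSEQ_le_const) auto
  have "\<Psi> 0 0 x = (\<eta> x)\<^sup>2 * (L * ((k - frob_inner A m)\<^sup>2 + (\<tau> + frob_inner A m')\<^sup>2) - ((norm (R ** m ** R))\<^sup>2 + (norm (R ** m' ** R))\<^sup>2))" for x
  proof -
    have s: "R ** (c *\<^sub>R N) ** R = c *\<^sub>R (R ** N ** R)" "frob_inner A (c *\<^sub>R N) = c * frob_inner A N" for c and N :: "real^'n^'n"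
      using matrix_sandwich_linear[of R c N 0 0] frob_inner_linear[of A c N 0 0] by simp_all
    have X0: "X 0 x = \<eta> x *\<^sub>R m" "Y 0 x = \<eta> x *\<^sub>R m'" by (simp_all add: X_def Y_def)
    have n: "(norm (c *\<^sub>R N))\<^sup>2 = c\<^sup>2 * (norm N)\<^sup>2" for c and N :: "real^'n^'n" by (simp add: power_mult_distrib)
    have alg: "L * ((k * c - 0 * c' - c * f)\<^sup>2 + (- \<tau> * c - c * f')\<^sup>2) - (c\<^sup>2 * g + c\<^sup>2 * g')
        = c\<^sup>2 * (L * ((k - f)\<^sup>2 + (\<tau> + f')\<^sup>2) - (g + g'))" for c c' f f' g g'
      by (simp add: power2_eq_square algebra_simps)
    show ?thesis unfolding \<Psi>_def X0 s n by (rule alg)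
  qed
  then have "(LINT x|lborel. w x * \<Psi> 0 0 x) = (LINT x|lborel. (w x * (\<eta> x)\<^sup>2) * (L * ((k - frob_inner A m)\<^sup>2 + (\<tau> + frob_inner A m')\<^sup>2) - ((norm (R ** m ** R))\<^sup>2 + (norm (R ** m' ** R))\<^sup>2)))"
    by (simp only: mult.assoc)
  also have "\<dots> = (LINT x|lborel. w x * (\<eta> x)\<^sup>2) * (L * ((k - frob_inner A m)\<^sup>2 + (\<tau> + frob_inner A m')\<^sup>2) - ((norm (R ** m ** R))\<^sup>2 + (norm (R ** m' ** R))\<^sup>2))"
    by (rule integral_mult_left_zero)
  finally show ?thesis using wpos lim by (simp add: zero_le_mult_iff)
qed

lemma box_bump_square_integral_pos:
  fixes l u :: "'a::euclidean_space"
  assumes w: "w \<in> borel_measurable borel" "\<And>x. x \<in> box l u \<Longrightarrow> 0 < w x" "\<And>x. x \<in> box l u \<Longrightarrow> w x \<le> C" and ne: "box l u \<noteq> {}"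
  shows "0 < (LINT x|lborel. w x * (box_bump l u x)\<^sup>2)"
proof -
  have bm: "box_bump l u \<in> borel_measurable borel"
    using smooth_continuous smooth_box_bump borel_measurable_continuous_onI by blast
  have i: "integrable lborel (\<lambda>x. w x * (box_bump l u x)\<^sup>2)"
  proof (rule Bochner_Integration.integrable_bound)
    show "integrable lborel (\<lambda>x. C * indicator (box l u) x)"
      by (intro integrable_mult_right integrable_real_indicator) (auto simp: emeasure_lborel_box_finite[unfolded infinity_ennreal_def])
    show "(\<lambda>x. w x * (box_bump l u x)\<^sup>2) \<in> borel_measurable lborel" using w(1) bm by simp
    show "AE x in lborel. norm (w x * (box_bump l u x)\<^sup>2) \<le> norm (C * indicator (box l u) x)"
    proof (rule AE_I2)
      fix x show "norm (w x * (box_bump l u x)\<^sup>2) \<le> norm (C * indicator (box l u) x)"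
      proof (cases "x \<in> box l u")
        case True
        have "(box_bump l u x)\<^sup>2 \<le> 1" using box_bump_nonneg box_bump_le_1 by (intro power_le_one)
        then have "w x * (box_bump l u x)\<^sup>2 \<le> C * 1" using w(2,3)[OF True] by (intro mult_mono) auto
        then show ?thesis using True w(2,3)[OF True] by (simp add: abs_mult)
      qed (simp add: box_bump_eq_0)
    qed
  qed
  have nn: "0 \<le> w x * (box_bump l u x)\<^sup>2" for x
    using w(2)[of x] box_bump_eq_0[of x l u] by (cases "x \<in> box l u") auto
  have "(LINT x|lborel. w x * (box_bump l u x)\<^sup>2) \<noteq> 0"
  proof
    assume "(LINT x|lborel. w x * (box_bump l u x)\<^sup>2) = 0"
    then have "AE x in lborel. w x * (box_bump l u x)\<^sup>2 = 0"
      using integral_nonneg_eq_0_iff_AE[OF i] nn by simp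
    then have "AE x in lborel. x \<notin> box l u"
    proof eventually_elim
      case (elim x)
      show ?case
      proof
        assume x: "x \<in> box l u"
        then have "box_bump l u x > 0" by (simp add: box_bump_pos_iff)
        then show False using elim w(2)[OF x] by simp
      qed
    qed
    then have "emeasure lborel (box l u) = 0" by (subst (asm) AE_iff_measurable[OF _ refl]) auto
    then have "box l u \<in> null_sets lborel" by auto
    then show False
      using ne open_box negligible_iff_null_sets open_not_negligible null_sets_completionI by metis
  qed
  moreover have "0 \<le> (LINT x|lborel. w x * (box_bump l u x)\<^sup>2)" by (intro Bochner_Integration.integral_nonneg nn)
  ultimately show ?thesis by simp
qed

text \<open>Only the sign has to be transported, and the Jacobian is a positive factor.\<close>

lemma integral_scale_nonneg:
  fixes f :: "'a::euclidean_space \<Rightarrow> real"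
  assumes f: "f \<in> borel_measurable borel" and e: "e \<noteq> 0" and p: "0 \<le> (LINT x|lborel. f (e *\<^sub>R x))"
  shows "0 \<le> (LINT x|lborel. f x)"
proof -
  have "(LINT x|lborel. f x) = (LINT x|density (distr lborel borel (\<lambda>x. 0 + e *\<^sub>R x)) (\<lambda>_. ennreal (\<bar>e\<bar> ^ DIM('a))). f x)"
    using lborel_affine[OF e, of "0::'a"] by (simp add: ennreal_power)
  also have "\<dots> = (LINT x|distr lborel borel (\<lambda>x. 0 + e *\<^sub>R x). \<bar>e\<bar> ^ DIM('a) *\<^sub>R f x)"
    using f by (intro integral_density) auto
  also have "\<dots> = (LINT x|lborel. \<bar>e\<bar> ^ DIM('a) *\<^sub>R f (0 + e *\<^sub>R x))"
    using f by (intro integral_distr) auto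
  also have "\<dots> = \<bar>e\<bar> ^ DIM('a) * (LINT x|lborel. f (e *\<^sub>R x))" by simp
  finally show ?thesis using p by simp
qed

definition sym_grad :: "real^'n \<Rightarrow> (real \<times> (real^'n) \<Rightarrow> real) \<Rightarrow> real \<times> (real^'n) \<Rightarrow> real^'n^'n" where
  "sym_grad z \<eta> x = (\<chi> i j. z $ i * pd (dir_z j) \<eta> x + z $ j * pd (dir_z i) \<eta> x)"

lemma sym_grad_continuous: "smooth \<eta> \<Longrightarrow> continuous_on S (sym_grad z \<eta>)"
  unfolding sym_grad_def
  by (intro continuous_on_vec_lambda continuous_intros smooth_continuous smooth_pd Basis_space_time)

lemma sym_grad_off_compact:
  assumes "compact K" "\<And>x. x \<notin> K \<Longrightarrow> \<eta> x = 0" "x \<notin> K"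
  shows "sym_grad z \<eta> x = 0"
  using pd_off_compact[OF assms] by (simp add: sym_grad_def vec_eq_iff)

lemma sym_grad_scaleR: "sym_grad (c *\<^sub>R z) \<eta> x = c *\<^sub>R sym_grad z \<eta> x"
  by (simp add: sym_grad_def vec_eq_iff algebra_simps)

lemma dilation_derivs:
  assumes \<eta>: "smooth \<eta>"
  shows "smooth (\<lambda>x. \<eta> (e *\<^sub>R x))" "pd b (\<lambda>x. \<eta> (e *\<^sub>R x)) x = e * pd b \<eta> (e *\<^sub>R x)"
    "sym_grad z (\<lambda>x. \<eta> (e *\<^sub>R x)) x = e *\<^sub>R sym_grad z \<eta> (e *\<^sub>R x)"
    "hess_z (\<lambda>x. \<eta> (e *\<^sub>R x)) x = e\<^sup>2 *\<^sub>R hess_z \<eta> (e *\<^sub>R x)"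
proof -
  show "smooth (\<lambda>x. \<eta> (e *\<^sub>R x))" using C_diff_affine[where x=0 and r=e] \<eta> by fastforce
  have p: "pd b (\<lambda>x. f (e *\<^sub>R x)) x = e * pd b f (e *\<^sub>R x)" if "smooth f" for f b x
    using pd_affine[where x=0 and r=e and f=f and y=x and b=b] smooth_differentiable[OF that] by simp
  show p1: "pd b (\<lambda>x. \<eta> (e *\<^sub>R x)) x = e * pd b \<eta> (e *\<^sub>R x)" for b x by (rule p[OF \<eta>])
  show "sym_grad z (\<lambda>x. \<eta> (e *\<^sub>R x)) x = e *\<^sub>R sym_grad z \<eta> (e *\<^sub>R x)"
    by (simp add: sym_grad_def p1 vec_eq_iff algebra_simps)
  have "pd (dir_z j) (pd (dir_z i) (\<lambda>x. \<eta> (e *\<^sub>R x))) x = e\<^sup>2 * pd (dir_z j) (pd (dir_z i) \<eta>) (e *\<^sub>R x)" for i j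
  proof -
    have sm: "smooth (pd (dir_z i) \<eta>)" by (rule smooth_pd[OF \<eta> Basis_space_time(2)])
    have d: "smooth (\<lambda>x. pd (dir_z i) \<eta> (e *\<^sub>R x))" using C_diff_affine[where x=0 and r=e] sm by fastforce
    have "pd (dir_z i) (\<lambda>x. \<eta> (e *\<^sub>R x)) = (\<lambda>x. e * pd (dir_z i) \<eta> (e *\<^sub>R x))" using p1 by (rule ext)
    then show ?thesis by (simp add: pd_cmult[OF smooth_differentiable[OF d]] p[OF sm] power2_eq_square)
  qed
  then show "hess_z (\<lambda>x. \<eta> (e *\<^sub>R x)) x = e\<^sup>2 *\<^sub>R hess_z \<eta> (e *\<^sub>R x)" by (simp add: hess_z_def vec_eq_iff)
qed

lemma integrable_weight_compact:
  fixes g :: "'a::euclidean_space \<Rightarrow> real"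
  assumes w: "w \<in> borel_measurable borel" "\<And>x. x \<in> K \<Longrightarrow> \<bar>w x\<bar> \<le> C"
    and K: "compact K" and g: "continuous_on UNIV g" "\<And>x. x \<notin> K \<Longrightarrow> g x = 0"
  shows "integrable lborel (\<lambda>x. w x * g x)"
proof (rule Bochner_Integration.integrable_bound)
  have "integrable lborel (\<lambda>x. indicator K x *\<^sub>R (C * \<bar>g x\<bar>))"
    by (intro borel_integrable_compact K continuous_intros continuous_on_subset[OF g(1)]) auto
  then show "integrable lborel (\<lambda>x. indicator K x * (C * \<bar>g x\<bar>))" by simp
  have "g \<in> borel_measurable borel" using g(1) by (rule borel_measurable_continuous_onI)
  then show "(\<lambda>x. w x * g x) \<in> borel_measurable lborel" using w(1) by simp
  show "AE x in lborel. norm (w x * g x) \<le> norm (indicator K x * (C * \<bar>g x\<bar>))"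
  proof (rule AE_I2)
    fix x show "norm (w x * g x) \<le> norm (indicator K x * (C * \<bar>g x\<bar>))"
    proof (cases "x \<in> K")
      case True
      have "\<bar>w x\<bar> \<le> \<bar>C\<bar>" using w(2)[OF True] by linarith
      then show ?thesis using True by (simp add: abs_mult mult_right_mono)
    qed (simp add: g(2))
  qed
qed

context wave_packet
begin

lemma hess_re_im:
  "hess_re \<eta> x = \<eta> x *\<^sub>R (\<chi> i j. \<zeta> $ i * \<zeta> $ j - \<xi> $ i * \<xi> $ j) + sym_grad \<zeta> \<eta> x + hess_z \<eta> x"
  "hess_im \<eta> x = \<eta> x *\<^sub>R (\<chi> i j. \<zeta> $ i * \<xi> $ j + \<xi> $ i * \<zeta> $ j) + sym_grad \<xi> \<eta> x"
  by (simp_all add: hess_re_def hess_im_def sym_grad_def hess_z_def vec_eq_iff algebra_simps)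

text \<open>The assumed inequality is used for the cosine and the sine packet and the results are
  added. The extra weight \<open>w\<close> is kept apart from the exponential: it is 1 on the whole
  space, and it is the time weight of the slab in the flat case.\<close>

lemma wave_inequality:
  fixes A q :: "real^'n^'n"
  assumes w: "w \<in> borel_measurable borel" "\<And>x. x \<in> K \<Longrightarrow> \<bar>w x\<bar> \<le> C"
    and K: "compact K" and \<eta>: "smooth \<eta>" "\<And>x. x \<notin> K \<Longrightarrow> \<eta> x = 0"
    and le: "\<And>g. smooth g \<Longrightarrow>
      (LINT x|lborel. w x * (exp (2 * phase k \<zeta> x) * (norm (H_op q (hess_z (\<lambda>x. g x * \<eta> x)) x))\<^sup>2))
      \<le> L * (LINT x|lborel. w x * (exp (2 * phase k \<zeta> x) * (P_op A (pd dir_s (\<lambda>x. g x * \<eta> x)) (hess_z (\<lambda>x. g x * \<eta> x)) x)\<^sup>2))"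
  shows "0 \<le> (LINT x|lborel. w x * (L * ((op_re A \<eta> x)\<^sup>2 + (op_im A \<eta> x)\<^sup>2)
      - ((norm (mat_sqrt q ** hess_re \<eta> x ** mat_sqrt q))\<^sup>2 + (norm (mat_sqrt q ** hess_im \<eta> x ** mat_sqrt q))\<^sup>2)))"
proof -
  let ?E = "\<lambda>x. exp (2 * phase k \<zeta> x)"
  let ?H = "\<lambda>g x. w x * (?E x * (norm (H_op q (hess_z (\<lambda>x. g x * \<eta> x)) x))\<^sup>2)"
  let ?P = "\<lambda>g x. w x * (?E x * (P_op A (pd dir_s (\<lambda>x. g x * \<eta> x)) (hess_z (\<lambda>x. g x * \<eta> x)) x)\<^sup>2)"
  have iH: "integrable lborel (?H g)" and iP: "integrable lborel (?P g)" if g: "smooth g" for g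
  proof -
    have sm: "smooth (\<lambda>x. g x * \<eta> x)" using C_diff_mult g \<eta>(1) by blast
    have z: "g x * \<eta> x = 0" if "x \<notin> K" for x using \<eta>(2)[OF that] by simp
    note off = operators_off_compact[where v="\<lambda>x. g x * \<eta> x", OF K z]
    have ec: "continuous_on UNIV ?E" unfolding phase_def by (intro continuous_intros)
    show "integrable lborel (?H g)"
      by (rule integrable_weight_compact[OF w K])
        (auto intro!: continuous_intros ec H_op_continuous sm simp: off)
    show "integrable lborel (?P g)"
      by (rule integrable_weight_compact[OF w K])
        (auto intro!: continuous_intros ec P_op_continuous sm simp: off)
  qed
  note i = iH[OF smooth_waves(1)] iH[OF smooth_waves(2)] iP[OF smooth_waves(1)] iP[OF smooth_waves(2)]
  have "w x * (L * ((op_re A \<eta> x)\<^sup>2 + (op_im A \<eta> x)\<^sup>2)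
      - ((norm (mat_sqrt q ** hess_re \<eta> x ** mat_sqrt q))\<^sup>2 + (norm (mat_sqrt q ** hess_im \<eta> x ** mat_sqrt q))\<^sup>2))
    = L * (?P cos_wave x + ?P sin_wave x) - (?H cos_wave x + ?H sin_wave x)" for x
    unfolding wave_energies[OF \<eta>(1), symmetric] by (simp only: algebra_simps)
  then have "(LINT x|lborel. w x * (L * ((op_re A \<eta> x)\<^sup>2 + (op_im A \<eta> x)\<^sup>2)
      - ((norm (mat_sqrt q ** hess_re \<eta> x ** mat_sqrt q))\<^sup>2 + (norm (mat_sqrt q ** hess_im \<eta> x ** mat_sqrt q))\<^sup>2)))
    = (LINT x|lborel. L * (?P cos_wave x + ?P sin_wave x) - (?H cos_wave x + ?H sin_wave x))" by presburger
  also have "\<dots> = L * ((LINT x|lborel. ?P cos_wave x) + (LINT x|lborel. ?P sin_wave x)) - ((LINT x|lborel. ?H cos_wave x) + (LINT x|lborel. ?H sin_wave x))"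
    using i by simp
  also have "\<dots> \<ge> 0" using le[OF smooth_waves(1)] le[OF smooth_waves(2)] by (simp add: distrib_left)
  finally show ?thesis .
qed

end

lemma frob_inner_symbols:
  fixes A :: "real^'n^'n"
  assumes "transpose A = A"
  shows "frob_inner A (\<chi> i j. \<zeta> $ i * \<zeta> $ j - \<xi> $ i * \<xi> $ j) = \<zeta> \<bullet> (A *v \<zeta>) - \<xi> \<bullet> (A *v \<xi>)"
    and "frob_inner A (\<chi> i j. \<zeta> $ i * \<xi> $ j + \<xi> $ i * \<zeta> $ j) = 2 * (\<zeta> \<bullet> (A *v \<xi>))"
proof -
  have e: "x \<bullet> (A *v y) = (\<Sum>i\<in>UNIV. \<Sum>j\<in>UNIV. A $ i $ j * (x $ i * y $ j))" for x y
    by (simp add: inner_vec_def matrix_vector_mult_def sum_distrib_left mult_ac)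
  show "frob_inner A (\<chi> i j. \<zeta> $ i * \<zeta> $ j - \<xi> $ i * \<xi> $ j) = \<zeta> \<bullet> (A *v \<zeta>) - \<xi> \<bullet> (A *v \<xi>)"
    by (simp add: frob_inner_eq_sum e right_diff_distrib sum_subtractf)
  have "\<xi> \<bullet> (A *v \<zeta>) = \<zeta> \<bullet> (A *v \<xi>)" using symmetric_inner_swap[OF assms, of \<xi> \<zeta>] by (simp add: inner_commute)
  moreover have "frob_inner A (\<chi> i j. \<zeta> $ i * \<xi> $ j + \<xi> $ i * \<zeta> $ j) = \<zeta> \<bullet> (A *v \<xi>) + \<xi> \<bullet> (A *v \<zeta>)"
    by (simp add: frob_inner_eq_sum e distrib_left sum.distrib)
  ultimately show "frob_inner A (\<chi> i j. \<zeta> $ i * \<xi> $ j + \<xi> $ i * \<zeta> $ j) = 2 * (\<zeta> \<bullet> (A *v \<xi>))" by simp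
qed

lemma harmonic_null_sequences:
  "(\<lambda>n. 1 / real (Suc n)) \<longlonglongrightarrow> 0" "(\<lambda>n. (1 / real (Suc n))\<^sup>2) \<longlonglongrightarrow> 0"
  "\<bar>1 / real (Suc n)\<bar> \<le> 1" "\<bar>(1 / real (Suc n))\<^sup>2\<bar> \<le> 1"
proof -
  show l: "(\<lambda>n. 1 / real (Suc n)) \<longlonglongrightarrow> 0" by (rule LIMSEQ_Suc[OF lim_const_over_n])
  show "(\<lambda>n. (1 / real (Suc n))\<^sup>2) \<longlonglongrightarrow> 0" using tendsto_power[OF l, of 2] by simp
  show "\<bar>1 / real (Suc n)\<bar> \<le> 1" by simp
  show "\<bar>(1 / real (Suc n))\<^sup>2\<bar> \<le> 1" unfolding abs_power2 by (rule power_le_one) simp_all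
qed

text \<open>Testing with \<open>exp (\<zeta> \<sqdot> z - k s)\<close> times a plane wave of frequency \<open>\<xi>\<close> under a wide envelope
  bounds the symbol at the complex frequency \<open>\<zeta> + i \<xi>\<close>; the time frequency \<open>\<tau>\<close> cancels the imaginary part.\<close>

lemma frequency_symbol_bound:
  fixes a A q :: "real^'n^'n"
  assumes lam: "compactly_supported_prob lam" and a: "sym_posdef a" and A: "sym_posdef A" and q: "sym_posdef q"
    and K: "K \<ge> 0" and Q: "Q_on ({..<B} \<times> UNIV) lam a A q \<le> ennreal K" and z: "\<zeta> \<in> msupp lam"
  shows "(\<zeta> \<bullet> (q *v \<zeta>) + \<xi> \<bullet> (q *v \<xi>))\<^sup>2 \<le> K\<^sup>2 * (\<zeta> \<bullet> ((a - A) *v \<zeta>) + \<xi> \<bullet> (A *v \<xi>))\<^sup>2"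
proof -
  define k where "k = \<zeta> \<bullet> (a *v \<zeta>)"
  define \<tau> where "\<tau> = - 2 * (\<zeta> \<bullet> (A *v \<xi>))"
  interpret wave_packet k \<tau> \<zeta> \<xi> .
  define \<eta> :: "real \<times> (real^'n) \<Rightarrow> real" where "\<eta> = box_bump (- One) One"
  define K0 :: "(real \<times> (real^'n)) set" where "K0 = cbox (- One) One"
  have At: "transpose A = A" using A by (simp add: sym_posdef_def)
  have sm: "smooth \<eta>" unfolding \<eta>_def by (simp add: smooth_box_bump)
  have cK: "compact K0" unfolding K0_def by (rule compact_cbox)
  have off: "\<eta> x = 0" if "x \<notin> K0" for x
    unfolding \<eta>_def by (rule box_bump_eq_0) (use that box_subset_cbox K0_def in blast)
  let ?m = "\<chi> i j. \<zeta> $ i * \<zeta> $ j - \<xi> $ i * \<xi> $ j" and ?m' = "\<chi> i j. \<zeta> $ i * \<xi> $ j + \<xi> $ i * \<zeta> $ j"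
  let ?R = "mat_sqrt q"
  have R: "transpose ?R = ?R" "?R ** ?R = q" using mat_sqrt[OF q] by (auto simp: sym_posdef_def)
  let ?X = "\<lambda>e x. \<eta> x *\<^sub>R ?m + e *\<^sub>R sym_grad \<zeta> \<eta> x + e\<^sup>2 *\<^sub>R hess_z \<eta> x"
  let ?Y = "\<lambda>e x. \<eta> x *\<^sub>R ?m' + e *\<^sub>R sym_grad \<xi> \<eta> x"
  let ?\<Psi> = "\<lambda>e s x. K\<^sup>2 * ((k * \<eta> x - s * pd dir_s \<eta> x - frob_inner A (?X e x))\<^sup>2 + (- \<tau> * \<eta> x - frob_inner A (?Y e x))\<^sup>2)
      - ((norm (?R ** ?X e x ** ?R))\<^sup>2 + (norm (?R ** ?Y e x ** ?R))\<^sup>2)"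
  have cont: "continuous_on UNIV \<eta>" "continuous_on UNIV (pd dir_s \<eta>)" "continuous_on UNIV (hess_z \<eta>)" "continuous_on UNIV (sym_grad y \<eta>)" for y
    using smooth_continuous[OF sm] smooth_continuous[OF smooth_pd[OF sm Basis_space_time(1)]] hess_z_continuous[OF sm] sym_grad_continuous[OF sm]
    by blast+
  \<comment> \<open>The packet has envelope \<eta>(e x), so each derivative of the envelope costs a
    factor e; rescaling the integral returns to the fixed envelope \<eta>.\<close>
  have pos: "0 \<le> (LINT x|lborel. 1 * ?\<Psi> e e x)" if e: "e > 0" for e :: real
  proof -
    let ?\<eta> = "\<lambda>x::real \<times> (real^'n). \<eta> (e *\<^sub>R x)"
    let ?K = "(\<lambda>x. (1 / e) *\<^sub>R x) ` K0"
    have sme: "smooth ?\<eta>" by (rule dilation_derivs(1)[OF sm])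
    have Kc: "compact ?K" by (rule compact_scaling[OF cK])
    have offe: "?\<eta> x = 0" if "x \<notin> ?K" for x :: "real \<times> (real^'n)"
    proof (rule off, rule notI)
      assume "e *\<^sub>R x \<in> K0"
      then have "(1 / e) *\<^sub>R (e *\<^sub>R x) \<in> ?K" by blast
      then show False using that e by simp
    qed
    have "0 \<le> (LINT x|lborel. 1 * (K\<^sup>2 * ((op_re A ?\<eta> x)\<^sup>2 + (op_im A ?\<eta> x)\<^sup>2)
        - ((norm (?R ** hess_re ?\<eta> x ** ?R))\<^sup>2 + (norm (?R ** hess_im ?\<eta> x ** ?R))\<^sup>2)))"
    proof (rule wave_inequality[where K="?K" and C=1])
      fix g :: "real \<times> (real^'n) \<Rightarrow> real" assume "smooth g"
      then have v: "(\<lambda>x. g x * ?\<eta> x) \<in> Cc_infty UNIV"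
        by (intro Cc_infty_mult Cc_inftyI[OF sme Kc]) (auto simp: offe)
      show "(LINT x|lborel. 1 * (exp (2 * phase k \<zeta> x) * (norm (H_op q (hess_z (\<lambda>x. g x * ?\<eta> x)) x))\<^sup>2))
        \<le> K\<^sup>2 * (LINT x|lborel. 1 * (exp (2 * phase k \<zeta> x) * (P_op A (pd dir_s (\<lambda>x. g x * ?\<eta> x)) (hess_z (\<lambda>x. g x * ?\<eta> x)) x)\<^sup>2))"
        using Q_on_imp_frequency[OF lam a K Q z v] by (simp add: freq_energy_def k_def)
    qed (use Kc sme offe in auto)
    also have "(\<lambda>x. 1 * (K\<^sup>2 * ((op_re A ?\<eta> x)\<^sup>2 + (op_im A ?\<eta> x)\<^sup>2)
        - ((norm (?R ** hess_re ?\<eta> x ** ?R))\<^sup>2 + (norm (?R ** hess_im ?\<eta> x ** ?R))\<^sup>2))) = (\<lambda>x. ?\<Psi> e e (e *\<^sub>R x))"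
      unfolding op_re_def op_im_def hess_re_im dilation_derivs[OF sm] by simp
    finally have "0 \<le> (LINT x|lborel. ?\<Psi> e e (e *\<^sub>R x))" .
    moreover have "(\<lambda>x. ?\<Psi> e e x) \<in> borel_measurable borel"
      unfolding frob_inner_eq_sum
      by (intro borel_measurable_continuous_onI continuous_intros continuous_on_sandwich cont)
    ultimately have "0 \<le> (LINT x|lborel. ?\<Psi> e e x)" using e by (intro integral_scale_nonneg[of "?\<Psi> e e" e]) auto
    then show ?thesis by simp
  qed
  have wpos: "0 < (LINT x|lborel. 1 * (\<eta> x)\<^sup>2)"
    unfolding \<eta>_def by (rule box_bump_square_integral_pos[where C=1]) (auto simp: box_ne_empty)
  have "(norm (?R ** ?m ** ?R))\<^sup>2 + (norm (?R ** ?m' ** ?R))\<^sup>2 \<le> K\<^sup>2 * ((k - frob_inner A ?m)\<^sup>2 + (\<tau> + frob_inner A ?m')\<^sup>2)"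
  proof (rule packet_limit[where w="\<lambda>_. 1" and \<eta>=\<eta> and \<eta>s="pd dir_s \<eta>" and ?M1.0="sym_grad \<zeta> \<eta>" and M1'="sym_grad \<xi> \<eta>" and ?M2.0="hess_z \<eta>"
      and es="\<lambda>n. 1 / real (Suc n)" and ss="\<lambda>n. 1 / real (Suc n)" and K=K0 and Cw=1, OF cK _ _ cont(1,2) cont(4) cont(4) cont(3)])
    show "0 \<le> (LINT x|lborel. 1 * ?\<Psi> (1 / real (Suc n)) (1 / real (Suc n)) x)" for n by (rule pos) simp
  qed (use off wpos harmonic_null_sequences pd_off_compact[OF cK off] sym_grad_off_compact[OF cK off] operators_off_compact(1)[where v=\<eta>, OF cK off] in auto)
  then show ?thesis
    unfolding wave_symbol_norms[OF R] frob_inner_symbols[OF At]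
    by (simp add: k_def \<tau>_def matrix_vector_mult_diff_rdistrib inner_diff_right algebra_simps)
qed

section \<open>The flat case on a bounded time interval\<close>

section \<open>Lower bound in the flat case\<close>

lemma W_wt_dirac0: "W_wt dirac0 a x = 1"
proof (cases x)
  case (Pair s z)
  have "continuous_on UNIV (\<lambda>\<zeta>. exp (2 * (s * (\<zeta> \<bullet> (a *v \<zeta>)) - \<zeta> \<bullet> z)))"
    by (intro continuous_intros)
  then have "(\<lambda>\<zeta>. exp (2 * (s * (\<zeta> \<bullet> (a *v \<zeta>)) - \<zeta> \<bullet> z))) \<in> borel_measurable borel"
    by (rule borel_measurable_continuous_onI)
  then show ?thesis using Pair by (simp add: W_wt_def integral_return)
qed

lemma dirac0_compact: "msupp (dirac0 :: (real^'n) measure) = {0}" "compactly_supported_prob (dirac0 :: (real^'n) measure)"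
proof -
  have "x \<in> msupp dirac0 \<longleftrightarrow> x = 0" for x :: "real^'n"
  proof
    assume x: "x \<in> msupp dirac0"
    show "x = 0"
    proof (rule ccontr)
      assume "x \<noteq> 0"
      then have "emeasure dirac0 (- {0 :: real^'n}) > 0"
        using x unfolding msupp_def by (auto simp del: emeasure_return)
      then show False by simp
    qed
  qed (auto simp: msupp_def)
  then show m: "msupp (dirac0 :: (real^'n) measure) = {0}" by blast
  show "compactly_supported_prob (dirac0 :: (real^'n) measure)"
    unfolding compactly_supported_prob_def m by (simp add: prob_space_return)
qed

text \<open>A bounded slab has no room for wide envelopes. The envelope is therefore fixed and the
  spatial frequency sent to infinity; since no exponential is present, the symbols are homogeneous
  of degree 2 and dominate all derivatives of the envelope, whatever the time weight is.\<close>

lemma flat_symbol_bound: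
  fixes a A q :: "real^'n^'n"
  assumes A: "sym_posdef A" and q: "sym_posdef q" and K: "K \<ge> 0"
    and \<alpha>: "(0 \<le> \<alpha> \<and> 0 \<le> c) \<or> \<alpha> = 0" and cB: "c < B"
    and k: "k_const \<alpha> c B (W_wt dirac0 a) A q \<le> ennreal K"
  shows "(\<xi> \<bullet> (q *v \<xi>))\<^sup>2 \<le> K\<^sup>2 * (\<xi> \<bullet> (A *v \<xi>))\<^sup>2"
proof -
  \<comment> \<open>The middle third of the time interval: the closed box lies in the open slab,
    away from its ends, and the time weight is positive on it.\<close>
  define l :: "real \<times> (real^'n)" where "l = ((2 * c + B) / 3, - One)"
  define u :: "real \<times> (real^'n)" where "u = ((c + 2 * B) / 3, One)"
  define \<eta> where "\<eta> = box_bump l u"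
  define w where "w x = indicator (slab c B) x * time_factor \<alpha> (fst x)" for x :: "real \<times> (real^'n)"
  have At: "transpose A = A" using A by (simp add: sym_posdef_def)
  have sub: "cbox l u \<subseteq> slab c B"
    using cB by (auto simp: l_def u_def cbox_Pair_eq in_slab)
  have sm: "smooth \<eta>" unfolding \<eta>_def by (simp add: smooth_box_bump)
  have off: "\<eta> x = 0" if "x \<notin> cbox l u" for x
    unfolding \<eta>_def by (rule box_bump_eq_0) (use that box_subset_cbox in blast)
  have tf: "0 < time_factor \<alpha> s" "time_factor \<alpha> s \<le> max 1 (B powr \<alpha>)" if "c < s" "s < B" for s
    using \<alpha> that powr_mono2[of \<alpha> s B] by (auto simp: time_factor_def)
  have w0: "0 \<le> w x" for x using tf[of "fst x"] by (auto simp: w_def indicator_def in_slab less_imp_le)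
  have w1: "0 < w x" "w x \<le> max 1 (B powr \<alpha>)" if "x \<in> cbox l u" for x
  proof -
    have "x \<in> slab c B" using that sub by blast
    then show "0 < w x" "w x \<le> max 1 (B powr \<alpha>)" using tf[of "fst x"] by (auto simp: w_def in_slab)
  qed
  have slab_m: "slab c B \<in> sets borel" using open_slab by (rule borel_open)
  have wm: "w \<in> borel_measurable borel"
  proof -
    have "time_factor \<alpha> \<in> borel_measurable borel" unfolding time_factor_def[abs_def] by measurable
    moreover have "fst \<in> borel_measurable (borel :: (real \<times> (real^'n)) measure)"
      by (intro borel_measurable_continuous_onI continuous_intros)
    ultimately have "(\<lambda>x::real \<times> (real^'n). time_factor \<alpha> (fst x)) \<in> borel_measurable borel"
      by (rule measurable_compose[rotated])
    then show ?thesis unfolding w_def[abs_def] using slab_m by (intro borel_measurable_times borel_measurable_indicator)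
  qed
  have wb: "\<bar>w x\<bar> \<le> max 1 (B powr \<alpha>)" if "x \<in> cbox l u" for x using w1[OF that] by simp
  have le: "(LINT x|lborel. w x * (norm (H_op q (hess_z v) x))\<^sup>2) \<le> K\<^sup>2 * (LINT x|lborel. w x * (P_op A (pd dir_s v) (hess_z v) x)\<^sup>2)"
    if v: "smooth v" "\<And>x. x \<notin> cbox l u \<Longrightarrow> v x = 0" for v
  proof -
    have vC: "v \<in> Cc_infty (slab c B)" by (rule Cc_inftyI[OF v(1) compact_cbox sub v(2)])
    have voff: "P_op A (pd dir_s v) (hess_z v) x = 0" "H_op q (hess_z v) x = 0" if "x \<notin> cbox l u" for x
      by (rule operators_off_compact[where v=v, OF compact_cbox[of l u] v(2) that], assumption)+
    have i: "integrable lborel (\<lambda>x. w x * (norm (H_op q (hess_z v) x))\<^sup>2)"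
      by (rule integrable_weight_compact[OF wm wb compact_cbox[of l u]])
        (assumption, intro continuous_intros H_op_continuous v(1), simp add: voff)
    have i': "integrable lborel (\<lambda>x. w x * (P_op A (pd dir_s v) (hess_z v) x)\<^sup>2)"
      by (rule integrable_weight_compact[OF wm wb compact_cbox[of l u]])
        (assumption, intro continuous_intros P_op_continuous v(1), simp add: voff)
    have e: "(\<integral>\<^sup>+x\<in>slab c B. ennreal (W_wt dirac0 a x * (time_factor \<alpha> (fst x) * g x)) \<partial>lborel) = ennreal (LINT x|lborel. w x * g x)"
      if "integrable lborel (\<lambda>x. w x * g x)" "\<And>x. 0 \<le> g x" for g
    proof -
      have "(\<integral>\<^sup>+x\<in>slab c B. ennreal (W_wt dirac0 a x * (time_factor \<alpha> (fst x) * g x)) \<partial>lborel) = (\<integral>\<^sup>+x. ennreal (w x * g x) \<partial>lborel)"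
        by (rule nn_integral_cong) (simp add: W_wt_dirac0 w_def indicator_def)
      also have "\<dots> = ennreal (LINT x|lborel. w x * g x)"
        by (rule nn_integral_eq_integral) (use that w0 in auto)
      finally show ?thesis .
    qed
    have fin: "inorm \<alpha> c B (W_wt dirac0 a) (P_op A (pd dir_s v) (hess_z v)) < \<top>"
      by (rule inorm_finite[OF dirac0_compact(2) \<alpha> cB compact_cbox sub P_op_continuous[OF v(1)] voff(1)])
    have "inorm \<alpha> c B (W_wt dirac0 a) (H_op q (hess_z v)) \<le> ennreal K * inorm \<alpha> c B (W_wt dirac0 a) (P_op A (pd dir_s v) (hess_z v))"
      using order_trans[OF test_ratio_le_k_const[OF dirac0_compact(2) \<alpha> cB vC] k] fin by (rule ennreal_divide_leD)
    then have "ennreal (LINT x|lborel. w x * (norm (H_op q (hess_z v) x))\<^sup>2) \<le> ennreal (K\<^sup>2) * ennreal (LINT x|lborel. w x * (P_op A (pd dir_s v) (hess_z v) x)\<^sup>2)"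
      unfolding inorm_eq real_norm_def power2_abs e[OF i zero_le_power2] e[OF i' zero_le_power2] by (rule esqrt_mult_leD) (use K in auto)
    moreover have "0 \<le> (LINT x|lborel. w x * (P_op A (pd dir_s v) (hess_z v) x)\<^sup>2)"
      by (intro Bochner_Integration.integral_nonneg mult_nonneg_nonneg w0 zero_le_power2)
    ultimately show ?thesis by (simp flip: ennreal_mult)
  qed
  let ?m = "\<chi> i j. 0 $ i * 0 $ j - \<xi> $ i * \<xi> $ j" and ?m' = "\<chi> i j. 0 $ i * \<xi> $ j + \<xi> $ i * 0 $ j"
  let ?R = "mat_sqrt q"
  have R: "transpose ?R = ?R" "?R ** ?R = q" using mat_sqrt[OF q] by (auto simp: sym_posdef_def)
  let ?X = "\<lambda>e x. \<eta> x *\<^sub>R ?m + e *\<^sub>R 0 + e\<^sup>2 *\<^sub>R hess_z \<eta> x"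
  let ?Y = "\<lambda>e x. \<eta> x *\<^sub>R ?m' + e *\<^sub>R sym_grad \<xi> \<eta> x"
  let ?\<Psi> = "\<lambda>e s x. K\<^sup>2 * ((0 * \<eta> x - s * pd dir_s \<eta> x - frob_inner A (?X e x))\<^sup>2 + (- 0 * \<eta> x - frob_inner A (?Y e x))\<^sup>2)
      - ((norm (?R ** ?X e x ** ?R))\<^sup>2 + (norm (?R ** ?Y e x ** ?R))\<^sup>2)"
  have cont: "continuous_on UNIV \<eta>" "continuous_on UNIV (pd dir_s \<eta>)" "continuous_on UNIV (hess_z \<eta>)" "continuous_on UNIV (sym_grad y \<eta>)" for y
    using smooth_continuous[OF sm] smooth_continuous[OF smooth_pd[OF sm Basis_space_time(1)]] hess_z_continuous[OF sm] sym_grad_continuous[OF sm]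
    by blast+
  have pos: "0 \<le> (LINT x|lborel. w x * ?\<Psi> e (e\<^sup>2) x)" if e: "e > 0" for e :: real
  proof -
    \<comment> \<open>With frequency \<mu> \<xi> the symbols grow like \<mu>^2. Dividing the squared
      quantities by \<mu>^4 leaves a factor e on the gradient of the envelope and e^2 on its Hessian
      and time derivative.\<close>
    define \<mu> where "\<mu> = 1 / e"
    interpret wave_packet 0 0 0 "\<mu> *\<^sub>R \<xi>" .
    have "0 \<le> (LINT x|lborel. w x * (K\<^sup>2 * ((op_re A \<eta> x)\<^sup>2 + (op_im A \<eta> x)\<^sup>2)
        - ((norm (?R ** hess_re \<eta> x ** ?R))\<^sup>2 + (norm (?R ** hess_im \<eta> x ** ?R))\<^sup>2)))"
    proof (rule wave_inequality[where K="cbox l u", OF wm wb compact_cbox[of l u] sm off])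
      fix g :: "real \<times> (real^'n) \<Rightarrow> real" assume g: "smooth g"
      have "smooth (\<lambda>x. g x * \<eta> x)" using C_diff_mult g sm by blast
      from le[OF this] off
      show "(LINT x|lborel. w x * (exp (2 * phase 0 0 x) * (norm (H_op q (hess_z (\<lambda>x. g x * \<eta> x)) x))\<^sup>2))
        \<le> K\<^sup>2 * (LINT x|lborel. w x * (exp (2 * phase 0 0 x) * (P_op A (pd dir_s (\<lambda>x. g x * \<eta> x)) (hess_z (\<lambda>x. g x * \<eta> x)) x)\<^sup>2))"
        by (simp add: phase_def)
    qed
    also have "(\<lambda>x. w x * (K\<^sup>2 * ((op_re A \<eta> x)\<^sup>2 + (op_im A \<eta> x)\<^sup>2)
        - ((norm (?R ** hess_re \<eta> x ** ?R))\<^sup>2 + (norm (?R ** hess_im \<eta> x ** ?R))\<^sup>2)) ) = (\<lambda>x. \<mu>^4 * (w x * ?\<Psi> e (e\<^sup>2) x))"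
    proof (rule ext)
      fix x
      have \<mu>e: "\<mu> * e = 1" "\<mu>\<^sup>2 * e\<^sup>2 = 1" using e by (simp_all add: \<mu>_def power_mult_distrib[symmetric])
      have sg: "sym_grad 0 \<eta> x = 0" using sym_grad_scaleR[of 0 0 \<eta> x] by simp
      have "\<mu>\<^sup>2 *\<^sub>R ?X e x = \<mu>\<^sup>2 *\<^sub>R \<eta> x *\<^sub>R ?m + (\<mu>\<^sup>2 * e\<^sup>2) *\<^sub>R hess_z \<eta> x" by (simp add: scaleR_add_right)
      also have "\<dots> = hess_re \<eta> x" unfolding \<mu>e hess_re_im sg by (simp add: vec_eq_iff power2_eq_square)
      finally have X: "hess_re \<eta> x = \<mu>\<^sup>2 *\<^sub>R ?X e x" ..
      have "\<mu>\<^sup>2 *\<^sub>R ?Y e x = \<mu>\<^sup>2 *\<^sub>R \<eta> x *\<^sub>R ?m' + (\<mu> * (\<mu> * e)) *\<^sub>R sym_grad \<xi> \<eta> x" by (simp add: scaleR_add_right power2_eq_square mult.assoc)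
      also have "\<dots> = hess_im \<eta> x" unfolding \<mu>e hess_re_im sym_grad_scaleR by (simp add: vec_eq_iff)
      finally have Y: "hess_im \<eta> x = \<mu>\<^sup>2 *\<^sub>R ?Y e x" ..
      have s: "?R ** (c *\<^sub>R N) ** ?R = c *\<^sub>R (?R ** N ** ?R)" "frob_inner A (c *\<^sub>R N) = c * frob_inner A N" for c and N :: "real^'n^'n"
        using matrix_sandwich_linear[of ?R c N 0 0] frob_inner_linear[of A c N 0 0] by simp_all
      have n: "(norm (c *\<^sub>R N))\<^sup>2 = c\<^sup>2 * (norm N)\<^sup>2" for c and N :: "real^'n^'n" by (simp add: power_mult_distrib)
      have p: "op_re A \<eta> x = \<mu>\<^sup>2 * (0 * \<eta> x - e\<^sup>2 * pd dir_s \<eta> x - frob_inner A (?X e x))"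
        "op_im A \<eta> x = \<mu>\<^sup>2 * (- 0 * \<eta> x - frob_inner A (?Y e x))"
        unfolding op_re_def op_im_def X Y s right_diff_distrib mult.assoc[symmetric] \<mu>e by simp_all
      have alg: "w x * (L * ((M\<^sup>2 * f)\<^sup>2 + (M\<^sup>2 * g)\<^sup>2) - ((M\<^sup>2)\<^sup>2 * n1 + (M\<^sup>2)\<^sup>2 * n2)) = M^4 * (w x * (L * (f\<^sup>2 + g\<^sup>2) - (n1 + n2)))" for L M f g n1 n2
        by (simp add: algebra_simps power_mult_distrib flip: power_mult)
      show "w x * (K\<^sup>2 * ((op_re A \<eta> x)\<^sup>2 + (op_im A \<eta> x)\<^sup>2)
        - ((norm (?R ** hess_re \<eta> x ** ?R))\<^sup>2 + (norm (?R ** hess_im \<eta> x ** ?R))\<^sup>2)) = \<mu>^4 * (w x * ?\<Psi> e (e\<^sup>2) x)"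
        unfolding p unfolding X Y s n by (rule alg)
    qed
    also have "(LINT x|lborel. \<mu>^4 * (w x * ?\<Psi> e (e\<^sup>2) x)) = \<mu>^4 * (LINT x|lborel. w x * ?\<Psi> e (e\<^sup>2) x)"
      by (rule integral_mult_right_zero)
    finally show ?thesis using e by (simp add: \<mu>_def zero_le_mult_iff)
  qed
  have wpos: "0 < (LINT x|lborel. w x * (\<eta> x)\<^sup>2)"
    unfolding \<eta>_def
  proof (rule box_bump_square_integral_pos[OF wm])
    show "box l u \<noteq> {}" using cB by (auto simp: box_ne_empty Basis_prod_def l_def u_def)
  qed (use w1 box_subset_cbox in blast)+
  have "(norm (?R ** ?m ** ?R))\<^sup>2 + (norm (?R ** ?m' ** ?R))\<^sup>2 \<le> K\<^sup>2 * ((0 - frob_inner A ?m)\<^sup>2 + (0 + frob_inner A ?m')\<^sup>2)"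
  proof (rule packet_limit[where w=w and \<eta>=\<eta> and \<eta>s="pd dir_s \<eta>" and ?M1.0="\<lambda>_. 0" and M1'="sym_grad \<xi> \<eta>" and ?M2.0="hess_z \<eta>"
      and es="\<lambda>n. 1 / real (Suc n)" and ss="\<lambda>n. (1 / real (Suc n))\<^sup>2" and K="cbox l u", OF compact_cbox[of l u] wm wb cont(1,2) continuous_on_const cont(4) cont(3)])
    show "0 \<le> (LINT x|lborel. w x * ?\<Psi> (1 / real (Suc n)) ((1 / real (Suc n))\<^sup>2) x)" for n by (rule pos) simp
  qed (use off wpos harmonic_null_sequences pd_off_compact[OF compact_cbox[of l u] off] sym_grad_off_compact[OF compact_cbox[of l u] off] operators_off_compact(1)[where v=\<eta>, OF compact_cbox[of l u] off] in auto)
  then show ?thesis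
    unfolding wave_symbol_norms[OF R] frob_inner_symbols[OF At] by simp
qed

section \<open>From symbol bounds to the constants\<close>

section \<open>The frequency condition\<close>

text \<open>Taking \<xi> = t x and dividing by t^2 makes the constants \<open>b\<close> and \<kappa>
  disappear as t tends to infinity. Both are free parameters, so the flat case fits with both equal
  to 0.\<close>

lemma symbol_bound_imp_form_bound:
  fixes A q :: "real^'n^'n"
  assumes A: "sym_posdef A" and K: "K \<ge> 0"
    and le: "\<And>\<xi>. (b + \<xi> \<bullet> (q *v \<xi>))\<^sup>2 \<le> K\<^sup>2 * (\<kappa> + \<xi> \<bullet> (A *v \<xi>))\<^sup>2"
  shows "x \<bullet> (q *v x) \<le> K * (x \<bullet> (A *v x))"
proof -
  define e where "e n = (1 / real (Suc n))\<^sup>2" for n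
  have e0: "e \<longlonglongrightarrow> 0" unfolding e_def[abs_def] by (rule harmonic_null_sequences(2))
  have bd: "e n * b + x \<bullet> (q *v x) \<le> K * \<bar>e n * \<kappa> + x \<bullet> (A *v x)\<bar>" for n
  proof -
    define t where "t = real (Suc n)"
    have t: "t > 0" "e n * t\<^sup>2 = 1" by (simp_all add: t_def e_def power_mult_distrib[symmetric])
    have en: "e n \<ge> 0" by (simp add: e_def)
    have "(b + t\<^sup>2 * (x \<bullet> (q *v x)))\<^sup>2 \<le> (K * (\<kappa> + t\<^sup>2 * (x \<bullet> (A *v x))))\<^sup>2"
      using le[of "t *\<^sub>R x"] by (simp add: matrix_vector_mult_scaleR power_mult_distrib power2_eq_square mult_ac)
    then have "\<bar>b + t\<^sup>2 * (x \<bullet> (q *v x))\<bar> \<le> \<bar>K * (\<kappa> + t\<^sup>2 * (x \<bullet> (A *v x)))\<bar>" by (simp only: abs_le_square_iff)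
    then have "b + t\<^sup>2 * (x \<bullet> (q *v x)) \<le> K * \<bar>\<kappa> + t\<^sup>2 * (x \<bullet> (A *v x))\<bar>" using K by (simp add: abs_mult)
    from mult_left_mono[OF this en]
    have "e n * b + (e n * t\<^sup>2) * (x \<bullet> (q *v x)) \<le> K * \<bar>e n * (\<kappa> + t\<^sup>2 * (x \<bullet> (A *v x)))\<bar>"
      unfolding abs_mult abs_of_nonneg[OF en] by (simp only: distrib_left mult_ac)
    also have "e n * (\<kappa> + t\<^sup>2 * (x \<bullet> (A *v x))) = e n * \<kappa> + (e n * t\<^sup>2) * (x \<bullet> (A *v x))" by (simp add: algebra_simps)
    finally show ?thesis unfolding t(2) by simp
  qed
  have "(\<lambda>n. e n * b + x \<bullet> (q *v x)) \<longlonglongrightarrow> 0 * b + x \<bullet> (q *v x)"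
    by (intro tendsto_intros e0)
  moreover have "(\<lambda>n. K * \<bar>e n * \<kappa> + x \<bullet> (A *v x)\<bar>) \<longlonglongrightarrow> K * \<bar>0 * \<kappa> + x \<bullet> (A *v x)\<bar>"
    by (intro tendsto_intros e0)
  ultimately have "0 * b + x \<bullet> (q *v x) \<le> K * \<bar>0 * \<kappa> + x \<bullet> (A *v x)\<bar>"
    by (rule LIMSEQ_le) (use bd in auto)
  moreover have "0 \<le> x \<bullet> (A *v x)" using A by (cases "x = 0") (auto simp: sym_posdef_def less_imp_le)
  ultimately show ?thesis by simp
qed

text \<open>Positivity of \<kappa> is the point: for \<kappa> \<le> 0 a multiple of \<zeta> makes
  the right side vanish while the left side is positive. Once \<kappa> > 0, the case \<xi> = 0 can
  be freed of its squares.\<close>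

lemma symbol_bound_imp_frequency_bound:
  fixes A q :: "real^'n^'n"
  assumes A: "sym_posdef A" and q: "sym_posdef q" and K: "K \<ge> 0"
    and le: "\<And>\<xi>. (\<zeta> \<bullet> (q *v \<zeta>) + \<xi> \<bullet> (q *v \<xi>))\<^sup>2 \<le> K\<^sup>2 * (\<zeta> \<bullet> ((a - A) *v \<zeta>) + \<xi> \<bullet> (A *v \<xi>))\<^sup>2"
  shows "\<zeta> \<bullet> (q *v \<zeta>) \<le> K * (\<zeta> \<bullet> ((a - A) *v \<zeta>))"
proof (cases "\<zeta> = 0")
  case False
  define b where "b = \<zeta> \<bullet> (q *v \<zeta>)"
  define \<kappa> where "\<kappa> = \<zeta> \<bullet> ((a - A) *v \<zeta>)"
  have b: "b > 0" and P: "\<zeta> \<bullet> (A *v \<zeta>) > 0" using A q False by (auto simp: sym_posdef_def b_def)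
  have "\<kappa> > 0"
  proof (rule ccontr)
    assume "\<not> \<kappa> > 0"
    \<comment> \<open>Solves \<kappa> + s^2 (\<zeta> . A \<zeta>) = 0; the radicand is nonnegative
      because \<kappa> \<le> 0.\<close>
    define s where "s = sqrt (- \<kappa> / (\<zeta> \<bullet> (A *v \<zeta>)))"
    have s2: "s\<^sup>2 * (\<zeta> \<bullet> (A *v \<zeta>)) = - \<kappa>" using \<open>\<not> \<kappa> > 0\<close> P unfolding s_def by (subst real_sqrt_pow2) (auto intro!: divide_nonpos_pos)
    have "(b + s\<^sup>2 * b)\<^sup>2 \<le> K\<^sup>2 * (\<kappa> + s\<^sup>2 * (\<zeta> \<bullet> (A *v \<zeta>)))\<^sup>2"
      using le[of "s *\<^sub>R \<zeta>"] by (simp add: matrix_vector_mult_scaleR b_def \<kappa>_def power2_eq_square mult_ac)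
    then have "(b + s\<^sup>2 * b)\<^sup>2 \<le> 0" by (simp add: s2)
    moreover have "b + s\<^sup>2 * b > 0" using b by (intro add_pos_nonneg mult_nonneg_nonneg) auto
    ultimately show False by (metis less_irrefl power2_less_eq_zero_iff)
  qed
  then have "0 \<le> K * \<kappa>" using K by simp
  moreover have "b\<^sup>2 \<le> (K * \<kappa>)\<^sup>2"
    using le[of 0] unfolding power_mult_distrib b_def \<kappa>_def inner_zero_left add_0_right .
  ultimately have "b \<le> K * \<kappa>" by (rule power2_le_imp_le[rotated])
  then show ?thesis by (simp add: b_def \<kappa>_def)
qed simp

text \<open>Extends \<open>freq_cond\<close> to all of [0, \<infinity>]. The infinite value always
  qualifies, so the equivalences with "constant \<le> y" also cover infinite constants.\<close>

definition freq_bound :: "(real^'n) measure \<Rightarrow> real^'n^'n \<Rightarrow> real^'n^'n \<Rightarrow> real^'n^'n \<Rightarrow> ennreal \<Rightarrow> bool" where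
  "freq_bound lam a A q y \<longleftrightarrow> y = \<top> \<or> (\<exists>K>0. y = ennreal K \<and> freq_cond lam a A q K)"

text \<open>One nonzero vector suffices, and it exists because the index type is nonempty. This is
  what rules out the bound 0 in the equivalences below.\<close>

lemma form_bound_pos:
  fixes A q :: "real^'n^'n"
  assumes A: "sym_posdef A" and q: "sym_posdef q" and le: "\<And>x. x \<bullet> (q *v x) \<le> K * (x \<bullet> (A *v x))"
  shows "K > 0"
proof -
  define x :: "real^'n" where "x = axis undefined 1"
  have "x \<noteq> 0" by (simp add: x_def axis_eq_0_iff)
  then have "0 < x \<bullet> (q *v x)" "0 < x \<bullet> (A *v x)" using A q by (auto simp: sym_posdef_def)
  then show ?thesis using le[of x] by (smt (verit) zero_less_mult_iff)
qed

lemma freq_bound_ennreal: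
  assumes "sym_posdef A" "sym_posdef q" "freq_cond lam a A q K"
  shows "freq_bound lam a A q (ennreal K)"
  using form_bound_pos[OF assms(1,2), of K] assms(3) by (auto simp: freq_bound_def freq_cond_def)

lemma k_const_le_freq_bound:
  fixes a A q :: "real^'n^'n"
  assumes "compactly_supported_prob lam" "sym_posdef A" "sym_posdef q" "freq_bound lam a A q y"
    "(0 \<le> \<alpha> \<and> 0 \<le> c) \<or> \<alpha> = 0" "c < B"
  shows "k_const \<alpha> c B (W_wt lam a) A q \<le> y"
  using assms(4) k_const_le[OF assms(1-3) _ _ assms(5,6)] by (auto simp: freq_bound_def)

lemma Q_on_le_Q_const: "Q_on U lam a A q \<le> Q_const lam a A q"
  unfolding Q_const_def Q_on_def by (rule SUP_subset_mono) (auto intro: Cc_infty_mono)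

text \<open>A cycle of implications: a bound for tests before time \<open>B\<close> gives the
  condition through wave packets, the condition bounds the interval constants and hence the supremum
  over all tests, and this supremum dominates the one over earlier tests. The support is nonempty,
  so at least one frequency is available for q \<le> K A.\<close>

lemma Q_le_iff_freq_bound:
  fixes a A q :: "real^'n^'n"
  assumes lam: "compactly_supported_prob lam" and a: "sym_posdef a" and A: "sym_posdef A" and q: "sym_posdef q"
  shows "Q_const lam a A q \<le> y \<longleftrightarrow> freq_bound lam a A q y"
    and "Q_on ({..<B} \<times> UNIV) lam a A q \<le> y \<longleftrightarrow> freq_bound lam a A q y"
proof -
  have *: "freq_bound lam a A q y" if Q: "Q_on ({..<B} \<times> UNIV) lam a A q \<le> y" for B
  proof (cases y)
    case (real K)
    note sb = frequency_symbol_bound[OF lam a A q real(1) Q[unfolded real(2)]]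
    obtain \<zeta>0 where z0: "\<zeta>0 \<in> msupp lam"
    proof -
      interpret prob_space lam using lam by (simp add: compactly_supported_prob_def)
      have "AE \<zeta> in lam. \<zeta> \<in> msupp lam" using lam by (intro AE_msupp) (simp add: compactly_supported_prob_def)
      then have "msupp lam \<noteq> {}" by auto
      then show ?thesis using that by blast
    qed
    have "freq_cond lam a A q K"
      unfolding freq_cond_def
      using symbol_bound_imp_form_bound[OF A real(1) sb[OF z0]] symbol_bound_imp_frequency_bound[OF A q real(1) sb] by blast
    then show ?thesis using freq_bound_ennreal[OF A q] real(2) by blast
  next
    case top
    then show ?thesis by (simp add: freq_bound_def)
  qed
  have **: "Q_const lam a A q \<le> y" if "freq_bound lam a A q y"
    by (rule Q_const_le[OF lam k_const_le_freq_bound[OF lam A q that]]) simp_all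
  show "Q_const lam a A q \<le> y \<longleftrightarrow> freq_bound lam a A q y"
    "Q_on ({..<B} \<times> UNIV) lam a A q \<le> y \<longleftrightarrow> freq_bound lam a A q y"
    using * ** order_trans[OF Q_on_le_Q_const] by blast+
qed

text \<open>The support is {0}, where the frequency clause reads 0 \<le> 0, so only the eigenvalue
  clause remains. The second equivalence gives equality of all interval constants, because its right
  side does not depend on \<alpha>, \<open>c\<close> or \<open>B\<close>.\<close>

lemma flat_freq_bound_iff:
  fixes a A q :: "real^'n^'n"
  assumes A: "sym_posdef A" and q: "sym_posdef q"
  shows "freq_bound dirac0 a A q y \<longleftrightarrow>
      ennreal (lambda_max (matrix_inv (mat_sqrt A) ** q ** matrix_inv (mat_sqrt A))) \<le> y"
    and "(0 \<le> \<alpha> \<and> 0 \<le> c) \<or> \<alpha> = 0 \<Longrightarrow> c < B \<Longrightarrow>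
      k_const \<alpha> c B (W_wt dirac0 a) A q \<le> y \<longleftrightarrow> freq_bound dirac0 a A q y"
proof -
  have fc: "freq_cond dirac0 a A q K \<longleftrightarrow> (\<forall>x. x \<bullet> (q *v x) \<le> K * (x \<bullet> (A *v x)))" for K
    by (simp add: freq_cond_def dirac0_compact)
  let ?L = "lambda_max (matrix_inv (mat_sqrt A) ** q ** matrix_inv (mat_sqrt A))"
  show "freq_bound dirac0 a A q y \<longleftrightarrow> ennreal ?L \<le> y"
  proof (cases y)
    case (real K)
    have "freq_bound dirac0 a A q y \<longleftrightarrow> ?L \<le> K"
      unfolding lambda_max_le_iff[OF A q] freq_bound_def fc real(2)
      using form_bound_pos[OF A q, of K] real(1) by (auto simp: ennreal_eq_0_iff)
    then show ?thesis using real by (simp add: ennreal_le_iff)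
  qed (simp add: freq_bound_def)
  assume \<alpha>: "(0 \<le> \<alpha> \<and> 0 \<le> c) \<or> \<alpha> = 0" "c < B"
  show "k_const \<alpha> c B (W_wt dirac0 a) A q \<le> y \<longleftrightarrow> freq_bound dirac0 a A q y"
  proof
    assume k: "k_const \<alpha> c B (W_wt dirac0 a) A q \<le> y"
    show "freq_bound dirac0 a A q y"
    proof (cases y)
      case (real K)
      have "\<forall>x. x \<bullet> (q *v x) \<le> K * (x \<bullet> (A *v x))"
        using symbol_bound_imp_form_bound[OF A real(1), of 0 q 0] flat_symbol_bound[OF A q real(1) \<alpha> k[unfolded real(2)]] by simp
      then show ?thesis using freq_bound_ennreal[OF A q] fc real(2) by blast
    qed (simp add: freq_bound_def)
  qed (rule k_const_le_freq_bound[OF dirac0_compact(2) A q _ \<alpha>])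
qed

text \<open>Away from 0 the form of \<open>q\<close> is positive, so the frequency clause can be
  divided into the form of \<open>Phi\<close>; a nonpositive ratio satisfies neither side for finite
  K, which matches the value \<infinity>.\<close>

lemma heat_freq_bound_iff:
  fixes a A q :: "real^'n^'n"
  assumes A: "sym_posdef A" and q: "sym_posdef q" and 0: "0 \<notin> msupp lam"
  shows "freq_bound lam a A q y \<longleftrightarrow>
      max (ennreal (lambda_max (matrix_inv (mat_sqrt A) ** q ** matrix_inv (mat_sqrt A))))
        (SUP \<zeta>\<in>msupp lam. Phi (dir_ratio a A q \<zeta>)) \<le> y"
proof (cases y)
  case (real K)
  have Phi: "Phi (dir_ratio a A q \<zeta>) \<le> ennreal K \<longleftrightarrow> \<zeta> \<bullet> (q *v \<zeta>) \<le> K * (\<zeta> \<bullet> ((a - A) *v \<zeta>))"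
    if "K > 0" "\<zeta> \<in> msupp lam" for \<zeta>
  proof -
    have b: "0 < \<zeta> \<bullet> (q *v \<zeta>)" using that 0 q unfolding sym_posdef_def by metis
    show ?thesis
    proof (cases "0 < \<zeta> \<bullet> ((a - A) *v \<zeta>)")
      case True
      then show ?thesis using b real(1) by (simp add: Phi_def dir_ratio_def ennreal_le_iff pos_divide_le_eq)
    next
      case False
      then have "K * (\<zeta> \<bullet> ((a - A) *v \<zeta>)) \<le> 0" using that(1) by (simp add: mult_nonneg_nonpos)
      then show ?thesis using False b by (simp add: Phi_def dir_ratio_def zero_less_divide_iff top_unique)
    qed
  qed
  have L: "ennreal (lambda_max (matrix_inv (mat_sqrt A) ** q ** matrix_inv (mat_sqrt A))) \<le> ennreal K
      \<longleftrightarrow> (\<forall>x. x \<bullet> (q *v x) \<le> K * (x \<bullet> (A *v x)))"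
    unfolding lambda_max_le_iff[OF A q, symmetric] using real(1) by (simp add: ennreal_le_iff)
  have "freq_bound lam a A q y \<longleftrightarrow> K > 0 \<and> freq_cond lam a A q K"
    unfolding freq_bound_def real(2) using real(1) by (auto simp: ennreal_eq_0_iff)
  also have "\<dots> \<longleftrightarrow> (\<forall>x. x \<bullet> (q *v x) \<le> K * (x \<bullet> (A *v x))) \<and> (\<forall>\<zeta>\<in>msupp lam. Phi (dir_ratio a A q \<zeta>) \<le> ennreal K)"
    unfolding freq_cond_def using form_bound_pos[OF A q, of K] Phi by blast
  finally show ?thesis unfolding real(2) max.bounded_iff SUP_le_iff L by simp
qed (simp add: freq_bound_def)

theorem proposition2p11:
  fixes a A q :: "real^'n^'n"
  assumes "sym_posdef a" and "sym_posdef A" and "sym_posdef q"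
  shows
    "Q_const dirac0 a A q =
       ennreal (lambda_max (matrix_inv (mat_sqrt A) ** q ** matrix_inv (mat_sqrt A))) \<and>
     (\<forall>lam. heat_phase lam \<longrightarrow>
       Q_const lam a A q =
         max (ennreal (lambda_max (matrix_inv (mat_sqrt A) ** q ** matrix_inv (mat_sqrt A))))
             (SUP \<zeta>\<in>msupp lam. Phi (dir_ratio a A q \<zeta>))) \<and>
     (\<forall>lam. flat_measure lam \<or> heat_phase lam \<longrightarrow>
       (\<forall>\<alpha> c B. 0 \<le> \<alpha> \<and> 0 \<le> c \<and> c < B \<longrightarrow>
          k_const \<alpha> c B (W_wt lam a) A q \<le> Q_const lam a A q) \<and>
       (\<forall>c B. c < B \<longrightarrow> k_const 0 c B (W_wt lam a) A q \<le> Q_const lam a A q)) \<and>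
     (\<forall>\<alpha> c B. 0 \<le> \<alpha> \<and> 0 \<le> c \<and> c < B \<longrightarrow>
        k_const \<alpha> c B (W_wt dirac0 a) A q = Q_const dirac0 a A q) \<and>
     (\<forall>c B. c < B \<longrightarrow> k_const 0 c B (W_wt dirac0 a) A q = Q_const dirac0 a A q) \<and>
     (\<forall>lam. flat_measure lam \<or> heat_phase lam \<longrightarrow>
       (\<forall>B. Q_const lam a A q = Q_on ({..<B} \<times> UNIV) lam a A q))"
proof -
  let ?L = "ennreal (lambda_max (matrix_inv (mat_sqrt A) ** q ** matrix_inv (mat_sqrt A)))"
  \<comment> \<open>Elements of [0, \<infinity>] with the same upper bounds coincide; every claimed
    equality is reduced in this way to a condition that both sides share.\<close>
  have eqI: "x = x'" if "\<And>y. x \<le> y \<longleftrightarrow> x' \<le> y" for x x' :: ennreal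
    using that by (meson order.antisym order_refl)
  have cpt: "compactly_supported_prob lam" if "flat_measure lam \<or> heat_phase lam" for lam :: "(real^'n) measure"
    using that dirac0_compact(2) by (auto simp: flat_measure_def heat_phase_def)
  have k: "k_const \<alpha> c B (W_wt lam a) A q \<le> Q_const lam a A q"
    if "flat_measure lam \<or> heat_phase lam" "(0 \<le> \<alpha> \<and> 0 \<le> c) \<or> \<alpha> = 0" "c < B" for lam \<alpha> c B
    using k_const_le_freq_bound[OF cpt[OF that(1)] assms(2,3) _ that(2,3)]
      Q_le_iff_freq_bound(1)[OF cpt[OF that(1)] assms] by blast
  have "Q_const dirac0 a A q = ?L"
    by (rule eqI) (simp only: Q_le_iff_freq_bound(1)[OF dirac0_compact(2) assms] flat_freq_bound_iff(1)[OF assms(2,3)])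
  moreover have "Q_const lam a A q = max ?L (SUP \<zeta>\<in>msupp lam. Phi (dir_ratio a A q \<zeta>))" if "heat_phase lam" for lam
  proof -
    have "0 \<notin> msupp lam" using that unfolding heat_phase_def by fastforce
    from heat_freq_bound_iff[OF assms(2,3) this] show ?thesis
      by (intro eqI) (simp only: Q_le_iff_freq_bound(1)[OF cpt[OF disjI2[OF that]] assms])
  qed
  moreover have "k_const \<alpha> c B (W_wt dirac0 a) A q = Q_const dirac0 a A q"
    if "(0 \<le> \<alpha> \<and> 0 \<le> c) \<or> \<alpha> = 0" "c < B" for \<alpha> c B
    by (rule eqI) (simp only: Q_le_iff_freq_bound(1)[OF dirac0_compact(2) assms] flat_freq_bound_iff(2)[OF assms(2,3) that])
  moreover have "Q_const lam a A q = Q_on ({..<B} \<times> UNIV) lam a A q" if "flat_measure lam \<or> heat_phase lam" for lam B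
    by (rule eqI) (simp only: Q_le_iff_freq_bound[OF cpt[OF that] assms])
  ultimately show ?thesis using k by simp
qed


end
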